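(* Let $\mathfrak{D}$ be a proper $\sigma$-polyhedral divisor over a regular curve $C$ over a field $\mathbf{k}$, with $\sigma$ nonzero, and let $A=A[C,\mathfrak{D}]$. If $e\in\operatorname{Rt}\sigma$ is a Demazure root of $\sigma$ with distinguished ray $\rho$ and $\varphi\in\Phi_e=H^0(C,\mathcal{O}_C(\mathfrak{D}(e)))$ is a section, then $\partial_{e,\varphi}$ is a homogeneous vertical LFIHD on $A$. Conversely, every homogeneous vertical LFIHD on $A$ is of the form $\partial_{e,\varphi}$, where $e\in\operatorname{Rt}\sigma$ and $\varphi\in\Phi_e$.
   Context: Notation. $\mathbf{k}$ is a field, $N\simeq\mathbb{Z}^n$ a lattice, $M$ its dual lattice, $\langle m,v\rangle$ the pairing, $M_{\mathbb{R}},N_{\mathbb{R}},M_{\mathbb{Q}},N_{\mathbb{Q}}$ the associated vector spaces, $\sigma\subseteq N_{\mathbb{R}}$ a strongly convex rational cone, $\sigma^\vee$ its dual, $\sigma^\vee_M=\sigma^\vee\cap M$, $\sigma(1)$ its set of extremal rays (identified with their primitive vectors). $e\in M$ is a Demazure root ($e\in\operatorname{Rt}\sigma$) if there is $\rho\in\sigma(1)$ (the distinguished ray) with $\langle e,\rho\rangle=-1$ and $\langle e,\rho'\rangle\ge0$ for all $\rho'\in\sigma(1)\setminus\{\rho\}$. Polyhedral divisors. $C$ is a regular curve over $\mathbf{k}$ with $\mathbf{k}$ algebraically closed in $K_0:=\mathbf{k}(C)$; points are closed points, $\kappa_z$ is the residue field of $z$. $\operatorname{Pol}_\sigma(N_{\mathbb{R}})$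 is the set of polyhedra $Q+\sigma$ with $Q$ a polytope with vertices in $N_{\mathbb{Q}}$. A $\sigma$-polyhedral divisor is a formal sum $\mathfrak{D}=\sum_{z\in C}\Delta_z\cdot z$ with $\Delta_z\in\operatorname{Pol}_\sigma(N_{\mathbb{R}})$ and $\Delta_z=\sigma$ for all but finitely many $z$. With $\Delta_z(0)$ the set of vertices, $h_z(m)=\min_{v\in\Delta_z(0)}\langle m,v\rangle$ for $m\in M_{\mathbb{R}}$, and the evaluation is the $\mathbb{Q}$-divisor $\mathfrak{D}(m)=\sum_z h_z(m)\cdot z$. $\deg\mathfrak{D}=\sum_z[\kappa_z:\mathbf{k}]\Delta_z$, and $\deg\sum a_z z=\sum[\kappa_z:\mathbf{k}]a_z$. $\mathfrak{D}$ is proper if either $C$ is affine, or $C$ is projective, $\deg\mathfrak{D}\subsetneq\sigma$, and for every $m\in\sigma^\vee_M$ with $\deg\mathfrak{D}(m)=0$ a nonzero integral multiple of $\mathfrak{D}(m)$ is principal. For a $\mathbb{Q}$-divisor $D$, $H^0(C,\mathcal{O}_C(D))=\{f\in\mathbf{k}(C)^*:\operatorname{div}f+D\ge0\}\cup\{0\}$. Then $A[C,\mathfrak{D}]=\bigoplus_{m\in\sigma^\vee_M}A_m\chi^m\subseteq K_0[M]$ with $A_m=H^0(C,\mathcal{O}_C(\mathfrak{D}(m)))$. LFIHDs. An LFIHD on a $\mathbf{k}$-algebra $A$ is a sequence $\partial=\{\partial^{(i)}\}_{i\ge0}$ of $\mathbf{k}$-linear operators with (1) $\partial^{(0)}=\mathrm{id}$;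 (2) $\partial^{(i)}(fg)=\sum_{j=0}^i\partial^{(j)}(f)\partial^{(i-j)}(g)$; (3) for each $f$, $\partial^{(i)}(f)=0$ for all large $i$; (4) $\partial^{(i)}\circ\partial^{(j)}=\binom{i+j}{i}\partial^{(i+j)}$. It is homogeneous if there is $e\in M$ with $\partial^{(i)}(A_m\chi^m)\subseteq A_{m+ie}\chi^{m+ie}$ for all $i\ge0$, $m\in M$ ($A_m=0$ for $m\notin\sigma^\vee_M$). It extends uniquely to a sequence $\bar\partial$ on $\operatorname{Frac}A$ satisfying (1),(2),(4); a homogeneous LFIHD is vertical if $\bar\partial^{(i)}(K_0)=\{0\}$ for all $i>0$. Definition of $\partial_{e,\varphi}$. For $e\in\operatorname{Rt}\sigma$ with distinguished ray $\rho$, $\partial_e$ is the LFIHD of the $K_0$-algebra $K_0[\sigma^\vee_M]$ given by the $K_0$-linear maps $\partial_e^{(i)}(\chi^m)=\binom{\langle m,\rho\rangle}{i}\chi^{m+ie}$ (with $\binom{r_1}{r_2}=0$ if $0\le r_1<r_2$). For $\varphi\in\Phi_e$, $\partial_{e,\varphi}=\{\varphi^i\partial_e^{(i)}|_A\}_{i\ge0}$ (with $\varphi^0=1$). *)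

theory Defs
  imports
    "HOL-Analysis.Analysis"
    "HOL-Algebra.Algebra"
    "HOL-Algebra.Algebraic_Closure_Type"
    "HOL-Library.Poly_Mapping"
    "HOL-Library.Set_Algebras"
    "HOL-Computational_Algebra.Fraction_Field"
begin

section \<open>Regular curves\<close>

text \<open>
  An integral separated scheme of finite type over a field \<open>k\<close> with function field \<open>K\<^sub>0\<close> is
  represented, in the style of Zariski's models, by the set of the local rings of its closed points,
  all of them subrings of \<open>K\<^sub>0\<close>.  Throughout, \<open>K\<^sub>0\<close> is the type \<^typ>\<open>'K::field\<close>, the ground field is a
  subfield \<open>k\<close> of it, and a closed point \<open>z\<close> \<^emph>\<open>is\<close> its local ring \<open>z \<subseteq> K\<^sub>0\<close>.
\<close>

abbreviation subring_rec :: "'K::field set \<Rightarrow> 'K ring"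
  where "subring_rec R \<equiv> ring_of_type_algebra\<lparr>carrier := R\<rparr>"

definition alg_closed_in_type :: "'K::field set \<Rightarrow> bool"
  where "alg_closed_in_type k \<longleftrightarrow>
    (\<forall>x. \<not> ring.transcendental (ring_of_type_algebra :: 'K ring) k x \<longrightarrow> x \<in> k)"

definition generated_algebra :: "'K::field set \<Rightarrow> 'K set \<Rightarrow> 'K set"
  where "generated_algebra k S = generate_ring ring_of_type_algebra (k \<union> S)"

definition localization_at :: "'K::field set \<Rightarrow> 'K set \<Rightarrow> 'K set"
  where "localization_at R \<mm> = {a / b | a b. a \<in> R \<and> b \<in> R - \<mm>}"

text \<open>The closed points of \<open>Spec R\<close>, for a domain \<open>R \<subseteq> K\<^sub>0\<close>.\<close>

definition closed_points :: "'K::field set \<Rightarrow> 'K set set"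
  where "closed_points R = {localization_at R \<mm> | \<mm>. maximalideal \<mm> (subring_rec R)}"

text \<open>
  Coordinate rings of integral affine curves over \<open>k\<close> with function field \<open>K\<^sub>0\<close>: finitely generated
  \<open>k\<close>-algebras with fraction field \<open>K\<^sub>0\<close> and of Krull dimension one (the last two conditions).
\<close>

definition affine_curve_ring :: "'K::field set \<Rightarrow> 'K set \<Rightarrow> bool"
  where "affine_curve_ring k R \<longleftrightarrow>
    (\<exists>S. finite S \<and> R = generated_algebra k S) \<and>
    {a / b | a b. a \<in> R \<and> b \<in> R - {0}} = UNIV \<and>
    \<not> Ring.field (subring_rec R) \<and>
    (\<forall>P. primeideal P (subring_rec R) \<and> P \<noteq> {0} \<longrightarrow> maximalideal P (subring_rec R))"

definition max_ideal_at :: "'K::field set \<Rightarrow> 'K set"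
  where "max_ideal_at z = z - Units (subring_rec z)"

text \<open>
  A one-dimensional noetherian local domain is regular iff its maximal ideal is generated by
  \<open>dim = 1\<close> element.  Separatedness need not be imposed: it says that no
  two distinct local rings of \<open>C\<close> are dominated by a common valuation ring of \<open>K\<^sub>0\<close>, and the local
  rings here, being discrete valuation rings, are dominated only by themselves.
\<close>

definition regular_curve :: "'K::field set \<Rightarrow> 'K set set \<Rightarrow> bool"
  where "regular_curve k C \<longleftrightarrow>
    subfield k ring_of_type_algebra \<and>
    (\<exists>\<R>. finite \<R> \<and> \<R> \<noteq> {} \<and> (\<forall>R\<in>\<R>. affine_curve_ring k R) \<and> C = (\<Union>R\<in>\<R>. closed_points R)) \<and>
    (\<forall>z\<in>C. principalideal (max_ideal_at z) (subring_rec z))"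

definition affine_curve :: "'K::field set \<Rightarrow> 'K set set \<Rightarrow> bool"
  where "affine_curve k C \<longleftrightarrow> (\<exists>R. affine_curve_ring k R \<and> C = closed_points R)"

text \<open>
  \<open>C\<close> is projective if it is the closed image of the point with homogeneous coordinates
  \<open>x \<in> E\<close> in projective space; its standard affine charts are \<open>Spec k[y / x. y \<in> E]\<close>.
  (Zero and repeated coordinates may be dropped, so a finite set \<open>E\<close> of nonzero elements suffices.)
\<close>

definition projective_curve :: "'K::field set \<Rightarrow> 'K set set \<Rightarrow> bool"
  where "projective_curve k C \<longleftrightarrow>
    (\<exists>E. finite E \<and> E \<noteq> {} \<and> 0 \<notin> E \<and>
      C = (\<Union>x\<in>E. closed_points (generated_algebra k {y / x | y. y \<in> E})))"

text \<open>The order of \<open>f \<noteq> 0\<close> at \<open>z\<close>: \<open>f = u t\<^sup>n\<close> with \<open>t\<close> a uniformizer and \<open>u\<close> a unit of the local ring.\<close>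

definition ord_at :: "'K::field set \<Rightarrow> 'K \<Rightarrow> int"
  where "ord_at z f = (THE n. \<exists>t\<in>z. \<exists>u\<in>Units (subring_rec z).
    max_ideal_at z = PIdl\<^bsub>subring_rec z\<^esub> t \<and> f = u * t powi n)"

abbreviation residue_field :: "'K::field set \<Rightarrow> 'K set ring"
  where "residue_field z \<equiv> subring_rec z Quot max_ideal_at z"

definition residue_degree :: "'K::field set \<Rightarrow> 'K set \<Rightarrow> nat"
  where "residue_degree k z =
    ring.dim (residue_field z) ((\<lambda>c. max_ideal_at z +>\<^bsub>subring_rec z\<^esub> c) ` k)
      (carrier (residue_field z))"


section \<open>\<open>\<rat>\<close>-divisors\<close>

text \<open>
  A \<open>\<rat>\<close>-divisor is given by its coefficient function; only the values at points of \<open>C\<close> matter.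
  Coefficients are typed as reals; the divisors below all have rational coefficients.
\<close>

definition divisor_degree :: "'K::field set \<Rightarrow> 'K set set \<Rightarrow> ('K set \<Rightarrow> real) \<Rightarrow> real"
  where "divisor_degree k C D =
    (\<Sum>z\<in>{z\<in>C. D z \<noteq> 0}. real (residue_degree k z) * D z)"

definition principal_divisor :: "'K::field set set \<Rightarrow> ('K set \<Rightarrow> real) \<Rightarrow> bool"
  where "principal_divisor C D \<longleftrightarrow> (\<exists>f. f \<noteq> 0 \<and> (\<forall>z\<in>C. D z = of_int (ord_at z f)))"

definition H0 :: "'K::field set set \<Rightarrow> ('K set \<Rightarrow> real) \<Rightarrow> 'K set"
  where "H0 C D = {f. f \<noteq> 0 \<and> (\<forall>z\<in>C. of_int (ord_at z f) + D z \<ge> 0)} \<union> {0}"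


section \<open>Lattices and cones\<close>

text \<open>
  \<open>N\<close> is \<^typ>\<open>int ^ 'n\<close>, and its dual \<open>M\<close> is the free abelian group \<^typ>\<open>'n \<Rightarrow>\<^sub>0 int\<close> on the dual basis.
  This choice makes \<open>K\<^sub>0[M]\<close> the library's group algebra \<^typ>\<open>('n \<Rightarrow>\<^sub>0 int) \<Rightarrow>\<^sub>0 'K\<close>, with
  \<open>c \<chi>\<^sup>m = Poly_Mapping.single m c\<close>.  The linear order on the index type \<open>'n\<close> is used only for the
  library's proof that \<open>K\<^sub>0[M]\<close> is an integral domain.  The multiple \<open>i e\<close> is \<^term>\<open>frag_cmul i e\<close>.
\<close>

type_synonym 'n dual_lattice = "'n \<Rightarrow>\<^sub>0 int"
type_synonym ('n, 'K) group_algebra = "('n \<Rightarrow>\<^sub>0 int) \<Rightarrow>\<^sub>0 'K"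

definition pairing :: "'n::finite dual_lattice \<Rightarrow> 'a::ring_1 ^ 'n \<Rightarrow> 'a"
  where "pairing m v = (\<Sum>i\<in>UNIV. of_int (Poly_Mapping.lookup m i) * v $ i)"

definition lattice_vec :: "int ^ 'n::finite \<Rightarrow> real ^ 'n"
  where "lattice_vec v = (\<chi> i. of_int (v $ i))"

definition rational_vec :: "real ^ 'n::finite \<Rightarrow> bool"
  where "rational_vec v \<longleftrightarrow> (\<forall>i. v $ i \<in> \<rat>)"

definition strongly_convex_rational_cone :: "(real ^ 'n::finite) set \<Rightarrow> bool"
  where "strongly_convex_rational_cone \<sigma> \<longleftrightarrow>
    (\<exists>S. finite S \<and> \<sigma> = convex_cone hull (lattice_vec ` S)) \<and>
    (\<forall>v. v \<in> \<sigma> \<and> - v \<in> \<sigma> \<longrightarrow> v = 0)"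

text \<open>\<open>\<sigma>\<^sup>\<or> \<inter> M\<close>\<close>

definition dual_cone_lattice :: "(real ^ 'n::finite) set \<Rightarrow> 'n dual_lattice set"
  where "dual_cone_lattice \<sigma> = {m. \<forall>v\<in>\<sigma>. pairing m v \<ge> 0}"

definition primitive :: "int ^ 'n::finite \<Rightarrow> bool"
  where "primitive v \<longleftrightarrow> (\<forall>d w. v = d *s w \<longrightarrow> is_unit d)"

definition extremal_rays :: "(real ^ 'n::finite) set \<Rightarrow> (int ^ 'n) set"
  where "extremal_rays \<sigma> = {\<rho>. primitive \<rho> \<and> {t *\<^sub>R lattice_vec \<rho> | t. t \<ge> 0} face_of \<sigma>}"

text \<open>\<open>e\<close> is a Demazure root of \<open>\<sigma>\<close> with distinguished ray \<open>\<rho>\<close>.\<close>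

definition demazure_root :: "(real ^ 'n::finite) set \<Rightarrow> 'n dual_lattice \<Rightarrow> int ^ 'n \<Rightarrow> bool"
  where "demazure_root \<sigma> e \<rho> \<longleftrightarrow>
    \<rho> \<in> extremal_rays \<sigma> \<and> pairing e \<rho> = -1 \<and>
    (\<forall>\<rho>'\<in>extremal_rays \<sigma> - {\<rho>}. pairing e \<rho>' \<ge> 0)"


section \<open>Polyhedral divisors\<close>

text \<open>The sum \<open>Q + \<sigma>\<close> of sets is the Minkowski sum, as is the sum in \<open>pdiv_degree\<close>.\<close>

definition Pol :: "(real ^ 'n::finite) set \<Rightarrow> (real ^ 'n) set set"
  where "Pol \<sigma> = {Q + \<sigma> | Q. polytope Q \<and> Q \<noteq> {} \<and> (\<forall>v. v extreme_point_of Q \<longrightarrow> rational_vec v)}"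

definition polyhedral_divisor ::
    "'K::field set set \<Rightarrow> (real ^ 'n::finite) set \<Rightarrow> ('K set \<Rightarrow> (real ^ 'n) set) \<Rightarrow> bool"
  where "polyhedral_divisor C \<sigma> \<DD> \<longleftrightarrow> (\<forall>z\<in>C. \<DD> z \<in> Pol \<sigma>) \<and> finite {z\<in>C. \<DD> z \<noteq> \<sigma>}"

definition pdiv_eval ::
    "('K::field set \<Rightarrow> (real ^ 'n::finite) set) \<Rightarrow> 'n dual_lattice \<Rightarrow> 'K set \<Rightarrow> real"
  where "pdiv_eval \<DD> m z = Min (pairing m ` {v. v extreme_point_of \<DD> z})"

text \<open>
  All but finitely many summands of the degree equal a positive multiple of \<open>\<sigma>\<close>, that is \<open>\<sigma>\<close>
  itself, and \<open>\<sigma> + \<sigma> = \<sigma>\<close>; these summands are collected in the single summand \<open>\<sigma>\<close>.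
\<close>

definition pdiv_degree ::
    "'K::field set \<Rightarrow> 'K set set \<Rightarrow> (real ^ 'n::finite) set \<Rightarrow> ('K set \<Rightarrow> (real ^ 'n) set) \<Rightarrow> (real ^ 'n) set"
  where "pdiv_degree k C \<sigma> \<DD> =
    \<sigma> + (\<Sum>z\<in>{z\<in>C. \<DD> z \<noteq> \<sigma>}. (\<lambda>v. real (residue_degree k z) *\<^sub>R v) ` \<DD> z)"

definition proper_pdiv ::
    "'K::field set \<Rightarrow> 'K set set \<Rightarrow> (real ^ 'n::finite) set \<Rightarrow> ('K set \<Rightarrow> (real ^ 'n) set) \<Rightarrow> bool"
  where "proper_pdiv k C \<sigma> \<DD> \<longleftrightarrow>
    affine_curve k C \<or>
    (projective_curve k C \<and> pdiv_degree k C \<sigma> \<DD> \<subset> \<sigma> \<and>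
     (\<forall>m\<in>dual_cone_lattice \<sigma>. divisor_degree k C (pdiv_eval \<DD> m) = 0 \<longrightarrow>
        (\<exists>r::int. r \<noteq> 0 \<and> principal_divisor C (\<lambda>z. of_int r * pdiv_eval \<DD> m z))))"

text \<open>The graded pieces \<open>A\<^sub>m\<close> and the algebra \<open>A[C,\<DD>] \<subseteq> K\<^sub>0[M]\<close>.\<close>

definition pdiv_piece ::
    "'K::field set set \<Rightarrow> (real ^ 'n::finite) set \<Rightarrow> ('K set \<Rightarrow> (real ^ 'n) set) \<Rightarrow> 'n dual_lattice \<Rightarrow> 'K set"
  where "pdiv_piece C \<sigma> \<DD> m = (if m \<in> dual_cone_lattice \<sigma> then H0 C (pdiv_eval \<DD> m) else {0})"

definition pdiv_algebra ::
    "'K::field set set \<Rightarrow> (real ^ 'n::finite) set \<Rightarrow> ('K set \<Rightarrow> (real ^ 'n) set) \<Rightarrow> ('n, 'K) group_algebra set"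
  where "pdiv_algebra C \<sigma> \<DD> = {a. \<forall>m. Poly_Mapping.lookup a m \<in> pdiv_piece C \<sigma> \<DD> m}"


section \<open>Locally finite iterative higher derivations\<close>

text \<open>
  Operators on a subalgebra \<open>B\<close> of an ambient ring are total functions on the ambient ring, of which
  only the restriction to \<open>B\<close> matters; \<open>S\<close> is the image of the ground field in the ambient ring.
\<close>

definition iterative_hd :: "'r::comm_ring_1 set \<Rightarrow> 'r set \<Rightarrow> (nat \<Rightarrow> 'r \<Rightarrow> 'r) \<Rightarrow> bool"
  where "iterative_hd S B \<delta> \<longleftrightarrow>
    (\<forall>i. \<forall>f\<in>B. \<delta> i f \<in> B) \<and>
    (\<forall>i. \<forall>f\<in>B. \<forall>g\<in>B. \<delta> i (f + g) = \<delta> i f + \<delta> i g) \<and>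
    (\<forall>i. \<forall>s\<in>S. \<forall>f\<in>B. \<delta> i (s * f) = s * \<delta> i f) \<and>
    (\<forall>f\<in>B. \<delta> 0 f = f) \<and>
    (\<forall>i. \<forall>f\<in>B. \<forall>g\<in>B. \<delta> i (f * g) = (\<Sum>j\<le>i. \<delta> j f * \<delta> (i - j) g)) \<and>
    (\<forall>i j. \<forall>f\<in>B. \<delta> i (\<delta> j f) = of_nat ((i + j) choose i) * \<delta> (i + j) f)"

definition lfihd :: "'r::comm_ring_1 set \<Rightarrow> 'r set \<Rightarrow> (nat \<Rightarrow> 'r \<Rightarrow> 'r) \<Rightarrow> bool"
  where "lfihd S B \<delta> \<longleftrightarrow>
    iterative_hd S B \<delta> \<and> (\<forall>f\<in>B. \<exists>n. \<forall>i\<ge>n. \<delta> i f = 0)"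

text \<open>Homogeneity with respect to the grading with pieces \<open>G m \<cdot> \<chi>\<^sup>m\<close>.\<close>

definition homogeneous_hd ::
    "('n::finite dual_lattice \<Rightarrow> 'K::field set) \<Rightarrow>
     (nat \<Rightarrow> ('n, 'K) group_algebra \<Rightarrow> ('n, 'K) group_algebra) \<Rightarrow> bool"
  where "homogeneous_hd G \<delta> \<longleftrightarrow>
    (\<exists>e. \<forall>i m. \<delta> i ` (Poly_Mapping.single m ` G m) \<subseteq>
       Poly_Mapping.single (m + frag_cmul (int i) e) ` G (m + frag_cmul (int i) e))"

definition const :: "'K::field \<Rightarrow> ('n, 'K) group_algebra"
  where "const c = Poly_Mapping.single 0 c"

definition frac_embed :: "'r::idom \<Rightarrow> 'r fract"
  where "frac_embed a = Fract a 1"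

definition fraction_subfield :: "'r::idom set \<Rightarrow> 'r fract set"
  where "fraction_subfield B = {Fract a b | a b. a \<in> B \<and> b \<in> B \<and> b \<noteq> 0}"

text \<open>
  The existential quantifier refers to \<^emph>\<open>the\<close> extension of \<open>\<delta>\<close> to \<open>Frac A\<close>: as a map on \<open>Frac A\<close> the
  extension is unique.
\<close>

definition vertical_hd ::
    "'K::field set \<Rightarrow> ('n::{finite,linorder}, 'K) group_algebra set \<Rightarrow>
     (nat \<Rightarrow> ('n, 'K) group_algebra \<Rightarrow> ('n, 'K) group_algebra) \<Rightarrow> bool"
  where "vertical_hd k A \<delta> \<longleftrightarrow>
    (\<exists>\<delta>'. iterative_hd ((frac_embed \<circ> const) ` k) (fraction_subfield A) \<delta>' \<and>
          (\<forall>i. \<forall>a\<in>A. \<delta>' i (frac_embed a) = frac_embed (\<delta> i a)) \<and>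
          (\<forall>i>0. \<forall>c. \<delta>' i (frac_embed (const c)) = 0))"

text \<open>
  The \<open>K\<^sub>0\<close>-linear operators \<open>\<partial>\<^sub>e\<^sup>(\<^sup>i\<^sup>)\<close> with \<open>\<chi>\<^sup>m \<mapsto> (\<langle>m,\<rho>\<rangle> choose i) \<chi>\<^sup>m\<^sup>+\<^sup>i\<^sup>e\<close>, meant for arguments in
  \<open>K\<^sub>0[\<sigma>\<^sup>\<or> \<inter> M]\<close>, where \<open>\<langle>m,\<rho>\<rangle> \<ge> 0\<close>; \<open>\<rho>\<close> is the distinguished ray of \<open>e\<close>.
\<close>

definition root_hd ::
    "'n::finite dual_lattice \<Rightarrow> int ^ 'n \<Rightarrow> nat \<Rightarrow> ('n, 'K::field) group_algebra \<Rightarrow> ('n, 'K) group_algebra"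
  where "root_hd e \<rho> i a =
    (\<Sum>m\<in>Poly_Mapping.keys a. Poly_Mapping.single (m + frag_cmul (int i) e)
       (of_nat (nat (pairing m \<rho>) choose i) * Poly_Mapping.lookup a m))"

definition root_section_hd ::
    "'n::finite dual_lattice \<Rightarrow> int ^ 'n \<Rightarrow> 'K::field \<Rightarrow> nat \<Rightarrow>
     ('n, 'K) group_algebra \<Rightarrow> ('n, 'K) group_algebra"
  where "root_section_hd e \<rho> \<phi> i a = const (\<phi> ^ i) * root_hd e \<rho> i a"

end

theory Submission
  imports Defs "HOL-Computational_Algebra.Formal_Power_Series"
begin

hide_const (open) up_ring.coeff up_ring.monom Polynomials.degree Polynomials.lead_coeff module.smult

(*PART P1*)
definition is_subring :: "'a::field set \<Rightarrow> bool" where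
  "is_subring B \<longleftrightarrow> 0 \<in> B \<and> 1 \<in> B \<and> (\<forall>x\<in>B. \<forall>y\<in>B. x + y \<in> B \<and> x * y \<in> B) \<and> (\<forall>x\<in>B. - x \<in> B)"

definition is_subfield :: "'a::field set \<Rightarrow> bool" where
  "is_subfield F \<longleftrightarrow> is_subring F \<and> (\<forall>x\<in>F. inverse x \<in> F)"

definition submodule_over :: "'a::field set \<Rightarrow> 'a set \<Rightarrow> bool" where
  "submodule_over k U \<longleftrightarrow> 0 \<in> U \<and> (\<forall>x\<in>U. \<forall>y\<in>U. x + y \<in> U) \<and> (\<forall>c\<in>k. \<forall>x\<in>U. c * x \<in> U)"

definition codim_le :: "'a::field set \<Rightarrow> 'a set \<Rightarrow> 'a set \<Rightarrow> nat \<Rightarrow> bool" where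
  "codim_le k V U d \<longleftrightarrow> (\<forall>f :: nat \<Rightarrow> 'a. (\<forall>i\<le>d. f i \<in> V) \<longrightarrow>
     (\<exists>c. (\<forall>i\<le>d. c i \<in> k) \<and> (\<exists>i\<le>d. c i \<noteq> 0) \<and> (\<Sum>i\<le>d. c i * f i) \<in> U))"

definition indep_mod :: "'a::field set \<Rightarrow> 'a set \<Rightarrow> ('i \<Rightarrow> 'a) \<Rightarrow> 'i set \<Rightarrow> bool" where
  "indep_mod k U f I \<longleftrightarrow> (\<forall>c. (\<forall>i\<in>I. c i \<in> k) \<and> (\<Sum>i\<in>I. c i * f i) \<in> U \<longrightarrow> (\<forall>i\<in>I. c i = 0))"

definition codim_ge :: "'a::field set \<Rightarrow> 'a set \<Rightarrow> 'a set \<Rightarrow> nat \<Rightarrow> bool" where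
  "codim_ge k V U n \<longleftrightarrow> (\<exists>f :: nat \<Rightarrow> 'a. (\<forall>i<n. f i \<in> V) \<and> indep_mod k U f {..<n})"

lemma is_subringD:
  assumes "is_subring B"
  shows "0 \<in> B" "1 \<in> B" "\<And>x y. x \<in> B \<Longrightarrow> y \<in> B \<Longrightarrow> x + y \<in> B"
    "\<And>x y. x \<in> B \<Longrightarrow> y \<in> B \<Longrightarrow> x * y \<in> B" "\<And>x. x \<in> B \<Longrightarrow> - x \<in> B"
    "\<And>x y. x \<in> B \<Longrightarrow> y \<in> B \<Longrightarrow> x - y \<in> B" "\<And>x n. x \<in> B \<Longrightarrow> x ^ n \<in> B"
    "\<And>f I. (\<And>i. i \<in> I \<Longrightarrow> f i \<in> B) \<Longrightarrow> sum f I \<in> B"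
    "\<And>f I. (\<And>i. i \<in> I \<Longrightarrow> f i \<in> B) \<Longrightarrow> prod f I \<in> B"
    "\<And>n. of_nat n \<in> B"
proof -
  show 0: "0 \<in> B" "1 \<in> B" and add: "\<And>x y. x \<in> B \<Longrightarrow> y \<in> B \<Longrightarrow> x + y \<in> B"
    and mult: "\<And>x y. x \<in> B \<Longrightarrow> y \<in> B \<Longrightarrow> x * y \<in> B" and um: "\<And>x. x \<in> B \<Longrightarrow> - x \<in> B"
    using assms by (auto simp: is_subring_def)
  show "\<And>x y. x \<in> B \<Longrightarrow> y \<in> B \<Longrightarrow> x - y \<in> B"
    using add um by (metis diff_conv_add_uminus)
  show "x ^ n \<in> B" if "x \<in> B" for x n
    by (induction n) (auto simp: 0 mult that)
  show "sum f I \<in> B" if "\<And>i. i \<in> I \<Longrightarrow> f i \<in> B" for f and I :: "'b set"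
    using that by (induction I rule: infinite_finite_induct) (auto simp: 0 add)
  show "prod f I \<in> B" if "\<And>i. i \<in> I \<Longrightarrow> f i \<in> B" for f and I :: "'c set"
    using that by (induction I rule: infinite_finite_induct) (auto simp: 0 mult)
  show "of_nat n \<in> B" for n by (induction n) (auto simp: 0 add)
qed

lemma is_subfieldD:
  assumes "is_subfield F"
  shows "is_subring F" "\<And>x. x \<in> F \<Longrightarrow> inverse x \<in> F" "\<And>x y. x \<in> F \<Longrightarrow> y \<in> F \<Longrightarrow> x / y \<in> F"
  using assms is_subringD(4)[of F] by (auto simp: is_subfield_def divide_inverse)

lemma submodule_overD:
  assumes "submodule_over k U"
  shows "0 \<in> U" "\<And>x y. x \<in> U \<Longrightarrow> y \<in> U \<Longrightarrow> x + y \<in> U" "\<And>c x. c \<in> k \<Longrightarrow> x \<in> U \<Longrightarrow> c * x \<in> U"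
    "\<And>f c I. (\<And>i. i \<in> I \<Longrightarrow> c i \<in> k \<and> f i \<in> U) \<Longrightarrow> (\<Sum>i\<in>I. c i * f i) \<in> U"
proof -
  show 0: "0 \<in> U" and add: "\<And>x y. x \<in> U \<Longrightarrow> y \<in> U \<Longrightarrow> x + y \<in> U"
    and sc: "\<And>c x. c \<in> k \<Longrightarrow> x \<in> U \<Longrightarrow> c * x \<in> U"
    using assms by (auto simp: submodule_over_def)
  show "(\<Sum>i\<in>I. c i * f i) \<in> U" if "\<And>i. i \<in> I \<Longrightarrow> c i \<in> k \<and> f i \<in> U" for f c and I :: "'c set"
    using that by (induction I rule: infinite_finite_induct) (auto simp: 0 add sc)
qed

lemma codim_leD:
  assumes le: "codim_le k V U d" and k0: "0 \<in> k" and J: "finite J" "d < card J"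
    and f: "\<And>j. j \<in> J \<Longrightarrow> f j \<in> V"
  shows "\<exists>c. (\<forall>j\<in>J. c j \<in> k) \<and> (\<exists>j\<in>J. c j \<noteq> 0) \<and> (\<Sum>j\<in>J. c j * f j) \<in> U"
proof -
  obtain J' where J': "J' \<subseteq> J" "card J' = Suc d"
    using obtain_subset_with_card_n[of "Suc d" J] J by (metis Suc_leI)
  have finJ': "finite J'" using J' J finite_subset by blast
  obtain h where h: "bij_betw h {..d} J'"
    using finite_same_card_bij[of "{..d}" J'] finJ' J'(2) by auto
  have "\<forall>i\<le>d. (f \<circ> h) i \<in> V" using f J' h by (auto simp: bij_betw_def)
  then obtain c where c: "\<forall>i\<le>d. c i \<in> k" "\<exists>i\<le>d. c i \<noteq> 0" "(\<Sum>i\<le>d. c i * (f \<circ> h) i) \<in> U"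
    using le unfolding codim_le_def by blast
  define g where "g = the_inv_into {..d} h"
  have gh: "g (h i) = i" if "i \<le> d" for i
    using h that unfolding g_def by (simp add: bij_betw_def the_inv_into_f_f)
  have hm: "h i \<in> J'" if "i \<le> d" for i using h that by (auto simp: bij_betw_def)
  have gm: "g j \<le> d" if "j \<in> J'" for j
    using h that gh by (metis atMost_iff bij_betw_imp_surj_on imageE)
  define e where "e j = (if j \<in> J' then c (g j) else 0)" for j
  have "(\<Sum>j\<in>J. e j * f j) = (\<Sum>j\<in>J'. e j * f j)"
    using J' J by (intro sum.mono_neutral_right) (auto simp: e_def)
  also have "\<dots> = (\<Sum>i\<le>d. e (h i) * f (h i))"
    using sum.reindex_bij_betw[OF h, of "\<lambda>j. e j * f j"] by simp
  also have "\<dots> = (\<Sum>i\<le>d. c i * (f \<circ> h) i)"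
    by (intro sum.cong) (auto simp: e_def gh hm)
  finally have "(\<Sum>j\<in>J. e j * f j) \<in> U" using c(3) by simp
  moreover have "\<forall>j\<in>J. e j \<in> k" using c(1) gm k0 by (auto simp: e_def)
  moreover have "\<exists>j\<in>J. e j \<noteq> 0"
  proof -
    obtain i where "i \<le> d" "c i \<noteq> 0" using c(2) by blast
    then show ?thesis using hm gh J'(1) by (intro bexI[of _ "h i"]) (auto simp: e_def)
  qed
  ultimately show ?thesis by blast
qed

text \<open>Gaussian elimination, one equation at a time.\<close>

lemma homogeneous_system_nontrivial:
  fixes a :: "'i \<Rightarrow> 'j \<Rightarrow> 'a::field"
  assumes k: "is_subfield k" and "finite I" "finite J" "card I < card J"
    and "\<And>i j. i \<in> I \<Longrightarrow> j \<in> J \<Longrightarrow> a i j \<in> k"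
  shows "\<exists>c. (\<forall>j\<in>J. c j \<in> k) \<and> (\<exists>j\<in>J. c j \<noteq> 0) \<and> (\<forall>i\<in>I. (\<Sum>j\<in>J. a i j * c j) = 0)"
  using assms(2-)
proof (induction I arbitrary: J a rule: finite_induct)
  case empty
  then obtain j where "j \<in> J" by fastforce
  then show ?case using k
    by (intro exI[of _ "\<lambda>_. 1"]) (auto simp: is_subfield_def is_subring_def)
next
  case (insert i0 I)
  note kD = is_subfieldD(3)[OF k] is_subringD[OF is_subfieldD(1)[OF k]]
  show ?case
  proof (cases "\<forall>j\<in>J. a i0 j = 0")
    case True
    obtain c where "\<forall>j\<in>J. c j \<in> k" "\<exists>j\<in>J. c j \<noteq> 0" "\<forall>i\<in>I. (\<Sum>j\<in>J. a i j * c j) = 0"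
      using insert.IH[of J a] insert.prems insert.hyps by auto
    then show ?thesis using True by (intro exI[of _ c]) auto
  next
    case False
    then obtain p where p: "p \<in> J" "a i0 p \<noteq> 0" by blast
    let ?J = "J - {p}"
    define a' where "a' i j = a i j - a i p * (a i0 j / a i0 p)" for i j
    have card: "card I < card ?J" using insert.prems insert.hyps p by simp
    have "a' i j \<in> k" if "i \<in> I" "j \<in> ?J" for i j
      using that insert.prems(3) p unfolding a'_def by (intro kD) auto
    then obtain c where c: "\<forall>j\<in>?J. c j \<in> k" "\<exists>j\<in>?J. c j \<noteq> 0" "\<forall>i\<in>I. (\<Sum>j\<in>?J. a' i j * c j) = 0"
      using insert.IH[of ?J a'] card insert.prems(1) by auto
    define s where "s = (\<Sum>j\<in>?J. a i0 j / a i0 p * c j)"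
    define c' where "c' = c(p := - s)"
    have sk: "s \<in> k" unfolding s_def using c(1) insert.prems(3) p by (intro kD) auto
    have split: "(\<Sum>j\<in>J. a i j * c' j) = (\<Sum>j\<in>?J. a i j * c j) - a i p * s" for i
    proof -
      have "(\<Sum>j\<in>J. a i j * c' j) = a i p * c' p + (\<Sum>j\<in>?J. a i j * c' j)"
        using p insert.prems(1) by (simp add: sum.remove)
      also have "(\<Sum>j\<in>?J. a i j * c' j) = (\<Sum>j\<in>?J. a i j * c j)"
        by (intro sum.cong) (auto simp: c'_def)
      finally show ?thesis by (simp add: c'_def)
    qed
    have "(\<Sum>j\<in>J. a i j * c' j) = 0" if "i \<in> insert i0 I" for i
    proof (cases "i = i0")
      case True
      have "a i0 p * s = (\<Sum>j\<in>?J. a i0 j * c j)"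
        unfolding s_def sum_distrib_left using p by (intro sum.cong) auto
      then show ?thesis using split True by simp
    next
      case False
      have "(\<Sum>j\<in>?J. a i j * c j) - a i p * s = (\<Sum>j\<in>?J. a' i j * c j)"
        unfolding s_def sum_distrib_left a'_def sum_subtractf[symmetric]
        by (intro sum.cong) (auto simp: algebra_simps)
      then show ?thesis using split False that c(3) by auto
    qed
    moreover have "\<forall>j\<in>J. c' j \<in> k" using c(1) sk kD(6) by (auto simp: c'_def)
    moreover have "\<exists>j\<in>J. c' j \<noteq> 0" using c(2) by (auto simp: c'_def)
    ultimately show ?thesis by (intro exI[of _ c']) blast
  qed
qed

lemma codim_le_spanned:
  assumes k: "is_subfield k" and U: "submodule_over k U"
    and span: "\<And>v. v \<in> V \<Longrightarrow> \<exists>c. (\<forall>i<d. c i \<in> k) \<and> v - (\<Sum>i<d. c i * b i) \<in> U"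
  shows "codim_le k V U d"
  unfolding codim_le_def
proof (intro allI impI)
  fix f :: "nat \<Rightarrow> 'a" assume f: "\<forall>i\<le>d. f i \<in> V"
  have "\<forall>i\<in>{..d}. \<exists>c. (\<forall>j<d. c j \<in> k) \<and> f i - (\<Sum>j<d. c j * b j) \<in> U" using span f by auto
  then obtain a where a: "\<And>i. i \<le> d \<Longrightarrow> (\<forall>j<d. a i j \<in> k) \<and> f i - (\<Sum>j<d. a i j * b j) \<in> U"
    by (subst (asm) bchoice_iff) auto
  have "\<exists>c. (\<forall>j\<in>{..d}. c j \<in> k) \<and> (\<exists>j\<in>{..d}. c j \<noteq> 0) \<and>
      (\<forall>i\<in>{..<d}. (\<Sum>j\<in>{..d}. a j i * c j) = 0)"
    using a by (intro homogeneous_system_nontrivial[OF k]) auto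
  then obtain c where c: "\<forall>i\<le>d. c i \<in> k" "\<exists>i\<le>d. c i \<noteq> 0" "\<And>j. j < d \<Longrightarrow> (\<Sum>i\<le>d. a i j * c i) = 0"
    by auto
  have "(\<Sum>i\<le>d. c i * (\<Sum>j<d. a i j * b j)) = (\<Sum>j<d. \<Sum>i\<le>d. c i * (a i j * b j))"
    unfolding sum_distrib_left by (rule sum.swap)
  also have "\<dots> = (\<Sum>j<d. (\<Sum>i\<le>d. a i j * c i) * b j)"
    unfolding sum_distrib_right by (intro sum.cong refl) (auto simp: algebra_simps)
  also have "\<dots> = 0" using c(3) by simp
  finally have "(\<Sum>i\<le>d. c i * f i) = (\<Sum>i\<le>d. c i * (f i - (\<Sum>j<d. a i j * b j)))"
    by (simp add: right_diff_distrib sum_subtractf)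
  also have "\<dots> \<in> U" using c(1) a by (intro submodule_overD(4)[OF U]) auto
  finally show "\<exists>c. (\<forall>i\<le>d. c i \<in> k) \<and> (\<exists>i\<le>d. c i \<noteq> 0) \<and> (\<Sum>i\<le>d. c i * f i) \<in> U"
    using c by blast
qed

lemma codim_le_restrict:
  assumes "codim_le k V U d" "V' \<subseteq> V" "submodule_over k V'" "V' \<inter> U \<subseteq> U'"
  shows "codim_le k V' U' d"
  unfolding codim_le_def
proof (intro allI impI)
  fix f :: "nat \<Rightarrow> 'a" assume f: "\<forall>i\<le>d. f i \<in> V'"
  then obtain c where c: "\<forall>i\<le>d. c i \<in> k" "\<exists>i\<le>d. c i \<noteq> 0" "(\<Sum>i\<le>d. c i * f i) \<in> U"
    using assms(1,2) unfolding codim_le_def by blast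
  have "(\<Sum>i\<le>d. c i * f i) \<in> V'" using c(1) f by (intro submodule_overD(4)[OF assms(3)]) auto
  then show "\<exists>c. (\<forall>i\<le>d. c i \<in> k) \<and> (\<exists>i\<le>d. c i \<noteq> 0) \<and> (\<Sum>i\<le>d. c i * f i) \<in> U'"
    using c assms(4) by blast
qed

text \<open>A maximal subfamily that is independent modulo \<open>U\<close> has at most \<open>a\<close> members, and
  subtracting combinations of it moves the remaining ones into \<open>U\<close>.\<close>

lemma codim_le_trans:
  assumes k: "is_subfield k" and U: "submodule_over k U"
    and VU: "codim_le k V U a" and UW: "codim_le k U W b"
  shows "codim_le k V W (a + b)"
  unfolding codim_le_def
proof (intro allI impI)
  fix f :: "nat \<Rightarrow> 'a" assume f: "\<forall>i\<le>a + b. f i \<in> V"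
  note kD = is_subfieldD(2,3)[OF k] is_subringD[OF is_subfieldD(1)[OF k]]
  let ?N = "{..a + b}"
  let ?ind = "\<lambda>I. I \<subseteq> ?N \<and> indep_mod k U f I"
  have "?ind {}" by (auto simp: indep_mod_def)
  moreover have "\<forall>I. ?ind I \<longrightarrow> card I < a + b + 2"
  proof (intro allI impI)
    fix I assume "?ind I"
    then have "card I \<le> card ?N" by (intro card_mono) auto
    then show "card I < a + b + 2" by simp
  qed
  ultimately obtain I where I: "?ind I" and Imax: "\<And>I'. ?ind I' \<Longrightarrow> card I' \<le> card I"
    using ex_has_greatest_nat[of ?ind "{}" card "a + b + 2"] by blast
  have finI: "finite I" using I finite_subset by blast
  have cardI: "card I \<le> a"
  proof (rule ccontr)
    assume "\<not> card I \<le> a"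
    then have "\<exists>c. (\<forall>j\<in>I. c j \<in> k) \<and> (\<exists>j\<in>I. c j \<noteq> 0) \<and> (\<Sum>j\<in>I. c j * f j) \<in> U"
      using I f finI kD(3) by (intro codim_leD[OF VU]) auto
    then show False using I unfolding indep_mod_def by blast
  qed
  let ?J = "?N - I"
  have cardJ: "b < card ?J" using cardI I finI by (simp add: card_Diff_subset)
  have "\<exists>e. (\<forall>i\<in>I. e i \<in> k) \<and> f j + (\<Sum>i\<in>I. e i * f i) \<in> U" if j: "j \<in> ?J" for j
  proof -
    have "\<not> ?ind (insert j I)"
      using Imax[of "insert j I"] j finI by auto
    then obtain c where c: "\<forall>i\<in>insert j I. c i \<in> k" "(\<Sum>i\<in>insert j I. c i * f i) \<in> U"
      and nz: "\<exists>i\<in>insert j I. c i \<noteq> 0"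
      using I j unfolding indep_mod_def by auto
    have cj: "c j \<noteq> 0"
    proof
      assume "c j = 0"
      then have "(\<Sum>i\<in>I. c i * f i) \<in> U" using c(2) finI j by simp
      then show False using I c(1) nz \<open>c j = 0\<close> unfolding indep_mod_def by auto
    qed
    have "inverse (c j) * (\<Sum>i\<in>insert j I. c i * f i) \<in> U"
      using c by (intro submodule_overD(3)[OF U] kD(1)) auto
    moreover have "inverse (c j) * (\<Sum>i\<in>insert j I. c i * f i) = f j + (\<Sum>i\<in>I. c i / c j * f i)"
      using finI j cj by (simp add: sum_distrib_left field_simps)
    ultimately show ?thesis using c(1) by (intro exI[of _ "\<lambda>i. c i / c j"]) (auto intro: kD(2))
  qed
  then obtain e where e: "\<And>j. j \<in> ?J \<Longrightarrow> (\<forall>i\<in>I. e j i \<in> k) \<and> f j + (\<Sum>i\<in>I. e j i * f i) \<in> U"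
    by metis
  obtain c where c: "\<forall>j\<in>?J. c j \<in> k" "\<exists>j\<in>?J. c j \<noteq> 0"
      "(\<Sum>j\<in>?J. c j * (f j + (\<Sum>i\<in>I. e j i * f i))) \<in> W"
    using codim_leD[OF UW kD(3) _ cardJ, of "\<lambda>j. f j + (\<Sum>i\<in>I. e j i * f i)"] e by auto
  define c' where "c' i = (if i \<in> I then \<Sum>j\<in>?J. c j * e j i else c i)" for i
  have "(\<Sum>i\<le>a + b. c' i * f i) = (\<Sum>i\<in>?J. c' i * f i) + (\<Sum>i\<in>I. c' i * f i)"
    using I by (intro sum.subset_diff) auto
  also have "(\<Sum>i\<in>?J. c' i * f i) = (\<Sum>i\<in>?J. c i * f i)"
    by (intro sum.cong) (auto simp: c'_def)
  also have "(\<Sum>i\<in>I. c' i * f i) = (\<Sum>i\<in>I. \<Sum>j\<in>?J. c j * e j i * f i)"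
    by (intro sum.cong refl) (auto simp: c'_def sum_distrib_right)
  also have "\<dots> = (\<Sum>j\<in>?J. c j * (\<Sum>i\<in>I. e j i * f i))"
    by (subst sum.swap) (simp add: sum_distrib_left mult.assoc)
  also have "(\<Sum>i\<in>?J. c i * f i) + (\<Sum>j\<in>?J. c j * (\<Sum>i\<in>I. e j i * f i)) =
      (\<Sum>j\<in>?J. c j * (f j + (\<Sum>i\<in>I. e j i * f i)))"
    by (simp add: sum.distrib algebra_simps)
  finally have "(\<Sum>i\<le>a + b. c' i * f i) \<in> W" using c(3) by simp
  moreover have "c' i \<in> k" if "i \<le> a + b" for i
  proof (cases "i \<in> I")
    case True
    have "(\<Sum>j\<in>?J. c j * e j i) \<in> k" using c(1) e True by (intro kD(10) kD(6)) auto
    then show ?thesis using True by (simp add: c'_def)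
  qed (use c(1) that in \<open>auto simp: c'_def\<close>)
  moreover have "\<exists>i\<le>a + b. c' i \<noteq> 0" using c(2) by (auto simp: c'_def)
  ultimately show "\<exists>c. (\<forall>i\<le>a + b. c i \<in> k) \<and> (\<exists>i\<le>a + b. c i \<noteq> 0) \<and> (\<Sum>i\<le>a + b. c i * f i) \<in> W"
    by blast
qed

lemma codim_ge_iff_not_codim_le: "codim_ge k V U (Suc d) \<longleftrightarrow> \<not> codim_le k V U d"
proof -
  have "codim_ge k V U (Suc d) \<longleftrightarrow>
      (\<exists>f :: nat \<Rightarrow> 'a. (\<forall>i\<le>d. f i \<in> V) \<and> (\<forall>c. (\<forall>i\<le>d. c i \<in> k) \<and> (\<Sum>i\<le>d. c i * f i) \<in> U \<longrightarrow> (\<forall>i\<le>d. c i = 0)))"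
    unfolding codim_ge_def indep_mod_def lessThan_Suc_atMost by (simp only: less_Suc_eq_le Ball_def atMost_iff)
  then show ?thesis unfolding codim_le_def by blast
qed

lemma codim_ge_le:
  assumes "codim_ge k V U n" "codim_le k V U d" "0 \<in> k"
  shows "n \<le> d"
proof (rule ccontr)
  assume "\<not> n \<le> d"
  obtain f :: "nat \<Rightarrow> 'a" where f: "\<forall>i<n. f i \<in> V" "indep_mod k U f {..<n}"
    using assms(1) unfolding codim_ge_def by blast
  have "\<exists>c. (\<forall>j\<in>{..<n}. c j \<in> k) \<and> (\<exists>j\<in>{..<n}. c j \<noteq> 0) \<and> (\<Sum>j\<in>{..<n}. c j * f j) \<in> U"
    using f(1) \<open>\<not> n \<le> d\<close> by (intro codim_leD[OF assms(2,3)]) auto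
  then show False using f(2) unfolding indep_mod_def by blast
qed

lemma codim_ge_add:
  assumes k: "0 \<in> k" and U: "submodule_over k U"
    and VU: "codim_ge k V U a" and UW: "codim_ge k U W b" and sub: "W \<subseteq> U" "U \<subseteq> V"
    and neg: "-1 \<in> k"
  shows "codim_ge k V W (a + b)"
proof -
  obtain f g :: "nat \<Rightarrow> 'a" where f: "\<forall>i<a. f i \<in> V" "indep_mod k U f {..<a}"
    and g: "\<forall>i<b. g i \<in> U" "indep_mod k W g {..<b}"
    using VU UW unfolding codim_ge_def by blast
  define h where "h i = (if i < a then f i else g (i - a))" for i
  have "indep_mod k W h {..<a + b}"
    unfolding indep_mod_def
  proof (intro allI impI)
    fix c assume c: "(\<forall>i\<in>{..<a + b}. c i \<in> k) \<and> (\<Sum>i<a + b. c i * h i) \<in> W"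
    have split: "(\<Sum>i<a + b. c i * h i) = (\<Sum>i<a. c i * f i) + (\<Sum>i<b. c (a + i) * g i)"
    proof -
      have "(\<Sum>i<a + b. c i * h i) = (\<Sum>i<a. c i * h i) + (\<Sum>i=a..<a+b. c i * h i)"
        by (simp add: lessThan_atLeast0 sum.atLeastLessThan_concat)
      also have "(\<Sum>i=a..<a+b. c i * h i) = (\<Sum>i<b. c (a + i) * h (a + i))"
        using sum.shift_bounds_nat_ivl[of "\<lambda>i. c i * h i" 0 a b]
        by (simp add: lessThan_atLeast0 add.commute)
      finally show ?thesis by (simp add: h_def)
    qed
    have gU: "(\<Sum>i<b. c (a + i) * g i) \<in> U"
      using c g by (intro submodule_overD(4)[OF U]) auto
    have "(\<Sum>i<a. c i * f i) = (\<Sum>i<a + b. c i * h i) + (-1) * (\<Sum>i<b. c (a + i) * g i)"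
      using split by simp
    also have "\<dots> \<in> U" using c sub gU neg submodule_overD(2,3)[OF U] by blast
    finally have f0: "\<forall>i\<in>{..<a}. c i = 0" using f(2) c unfolding indep_mod_def by auto
    then have "(\<Sum>i<b. c (a + i) * g i) \<in> W" using split c by simp
    then have "\<forall>i\<in>{..<b}. c (a + i) = 0"
      using g(2)[unfolded indep_mod_def, rule_format, of "\<lambda>i. c (a + i)"] c by auto
    then show "\<forall>i\<in>{..<a + b}. c i = 0" using f0
      by (metis add_diff_inverse_nat lessThan_iff nat_add_left_cancel_less)
  qed
  moreover have "\<forall>i<a + b. h i \<in> V" using f g sub by (auto simp: h_def)
  ultimately show ?thesis unfolding codim_ge_def by blast
qed

(*PART P2a*)
definition poly_over :: "'a::field set \<Rightarrow> 'a poly \<Rightarrow> bool" where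
  "poly_over B p \<longleftrightarrow> (\<forall>i. coeff p i \<in> B)"

definition adjoin :: "'a::field set \<Rightarrow> 'a \<Rightarrow> 'a set" where
  "adjoin B x = {poly p x | p. poly_over B p}"

definition transc_over :: "'a::field set \<Rightarrow> 'a \<Rightarrow> bool" where
  "transc_over B x \<longleftrightarrow> (\<forall>p. poly_over B p \<and> poly p x = 0 \<longrightarrow> p = 0)"

definition ring_hom_on :: "'a::field set \<Rightarrow> ('a \<Rightarrow> 'b::field) \<Rightarrow> bool" where
  "ring_hom_on B h \<longleftrightarrow> h 1 = 1 \<and> (\<forall>x\<in>B. \<forall>y\<in>B. h (x + y) = h x + h y \<and> h (x * y) = h x * h y)"

lemma poly_over_ring:
  assumes "is_subring B"
  shows "poly_over B 0" "poly_over B 1" "\<And>p q. poly_over B p \<Longrightarrow> poly_over B q \<Longrightarrow> poly_over B (p + q)"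
    "\<And>p q. poly_over B p \<Longrightarrow> poly_over B q \<Longrightarrow> poly_over B (p * q)"
    "\<And>p q. poly_over B p \<Longrightarrow> poly_over B q \<Longrightarrow> poly_over B (p - q)"
    "\<And>p. poly_over B p \<Longrightarrow> poly_over B (- p)"
    "\<And>p c. c \<in> B \<Longrightarrow> poly_over B p \<Longrightarrow> poly_over B (smult c p)"
    "\<And>c n. c \<in> B \<Longrightarrow> poly_over B (monom c n)"
    "\<And>c p. c \<in> B \<Longrightarrow> poly_over B p \<Longrightarrow> poly_over B (pCons c p)"
    "\<And>p n. poly_over B p \<Longrightarrow> poly_over B (p ^ n)"
    "\<And>f I. (\<And>i. i \<in> I \<Longrightarrow> poly_over B (f i)) \<Longrightarrow> poly_over B (sum f I)"
proof -
  note B = is_subringD[OF assms]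
  show "poly_over B 0" by (simp add: poly_over_def B)
  show one: "poly_over B 1" by (auto simp: poly_over_def B coeff_1)
  show "poly_over B (p + q)" if "poly_over B p" "poly_over B q" for p q
    using that by (simp add: poly_over_def B)
  show mult: "poly_over B (p * q)" if "poly_over B p" "poly_over B q" for p q
    using that by (auto simp: poly_over_def coeff_mult intro!: B(8) B(4))
  show "poly_over B (p - q)" if "poly_over B p" "poly_over B q" for p q
    using that by (simp add: poly_over_def B)
  show "poly_over B (- p)" if "poly_over B p" for p using that by (simp add: poly_over_def B)
  show "poly_over B (smult c p)" if "c \<in> B" "poly_over B p" for c p using that by (simp add: poly_over_def B)
  show "poly_over B (monom c n)" if "c \<in> B" for c n using that by (simp add: poly_over_def B)
  show "poly_over B (pCons c p)" if "c \<in> B" "poly_over B p" for c p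
    using that by (auto simp: poly_over_def coeff_pCons split: nat.splits)
  show "poly_over B (p ^ n)" if "poly_over B p" for p n by (induction n) (auto simp: that one mult)
  show "poly_over B (sum f I)" if "\<And>i. i \<in> I \<Longrightarrow> poly_over B (f i)" for f and I :: "'b set"
    using that by (auto simp: poly_over_def coeff_sum intro!: B(8))
qed

lemma poly_in_subring:
  assumes "is_subring B" "poly_over B p" "x \<in> B"
  shows "poly p x \<in> B"
  unfolding poly_altdef using assms by (intro is_subringD(8)[OF assms(1)] is_subringD(4,7)) (auto simp: poly_over_def)

lemma is_subring_adjoin:
  assumes B: "is_subring B"
  shows "is_subring (adjoin B x)"
  unfolding is_subring_def
proof (intro conjI ballI)
  note P = poly_over_ring[OF B]
  show "0 \<in> adjoin B x" unfolding adjoin_def using P(1) by (intro CollectI exI[of _ 0]) simp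
  show "1 \<in> adjoin B x" unfolding adjoin_def using P(2) by (intro CollectI exI[of _ 1]) simp
  fix u assume "u \<in> adjoin B x"
  then obtain p where p: "u = poly p x" "poly_over B p" unfolding adjoin_def by blast
  show "- u \<in> adjoin B x" unfolding adjoin_def using P(6) p by (intro CollectI exI[of _ "- p"]) simp
  fix v assume "v \<in> adjoin B x"
  then obtain q where q: "v = poly q x" "poly_over B q" unfolding adjoin_def by blast
  show "u + v \<in> adjoin B x" unfolding adjoin_def using P(3) p q by (intro CollectI exI[of _ "p + q"]) simp
  show "u * v \<in> adjoin B x" unfolding adjoin_def using P(4) p q by (intro CollectI exI[of _ "p * q"]) simp
qed

lemma adjoin_incl:
  assumes "is_subring B"
  shows "B \<subseteq> adjoin B x" "x \<in> adjoin B x"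
proof -
  note P = poly_over_ring[OF assms] and B = is_subringD[OF assms]
  show "B \<subseteq> adjoin B x"
  proof
    fix b assume "b \<in> B"
    then show "b \<in> adjoin B x" unfolding adjoin_def using P(1,9) by (intro CollectI exI[of _ "[:b:]"]) simp
  qed
  show "x \<in> adjoin B x" unfolding adjoin_def using P(1,9) B(1,2) by (intro CollectI exI[of _ "[:0, 1:]"]) simp
qed

lemma adjoin_least:
  assumes "is_subring E" "B \<subseteq> E" "x \<in> E"
  shows "adjoin B x \<subseteq> E"
  using assms poly_in_subring[OF assms(1) _ assms(3)] by (auto simp: adjoin_def poly_over_def)

fun adjoins :: "'a::field set \<Rightarrow> 'a list \<Rightarrow> 'a set" where
  "adjoins B [] = B"
| "adjoins B (x # xs) = adjoins (adjoin B x) xs"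

lemma is_subring_adjoins: "is_subring B \<Longrightarrow> is_subring (adjoins B xs)"
  by (induction B xs rule: adjoins.induct) (auto simp: is_subring_adjoin)

lemma adjoins_incl: "is_subring B \<Longrightarrow> B \<subseteq> adjoins B xs \<and> set xs \<subseteq> adjoins B xs"
proof (induction B xs rule: adjoins.induct)
  case (2 B x xs)
  then show ?case using adjoin_incl[of B x] is_subring_adjoin[of B x] by auto
qed auto

lemma adjoins_least: "is_subring E \<Longrightarrow> B \<subseteq> E \<Longrightarrow> set xs \<subseteq> E \<Longrightarrow> adjoins B xs \<subseteq> E"
  by (induction B xs rule: adjoins.induct) (auto dest: adjoin_least)

lemma ring_hom_onD:
  assumes "ring_hom_on B h" "is_subring B"
  shows "h 1 = 1" "h 0 = 0" "\<And>x y. x \<in> B \<Longrightarrow> y \<in> B \<Longrightarrow> h (x + y) = h x + h y"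
    "\<And>x y. x \<in> B \<Longrightarrow> y \<in> B \<Longrightarrow> h (x * y) = h x * h y"
    "\<And>x. x \<in> B \<Longrightarrow> h (- x) = - h x"
    "\<And>x n. x \<in> B \<Longrightarrow> h (x ^ n) = h x ^ n"
    "\<And>f I. (\<And>i. i \<in> I \<Longrightarrow> f i \<in> B) \<Longrightarrow> h (sum f I) = (\<Sum>i\<in>I. h (f i))"
proof -
  note B = is_subringD[OF assms(2)]
  show h1: "h 1 = 1" and add: "\<And>x y. x \<in> B \<Longrightarrow> y \<in> B \<Longrightarrow> h (x + y) = h x + h y"
    and mult: "\<And>x y. x \<in> B \<Longrightarrow> y \<in> B \<Longrightarrow> h (x * y) = h x * h y"
    using assms(1) by (auto simp: ring_hom_on_def)
  show h0: "h 0 = 0" using add[of 0 0] B(1) by (metis add_cancel_right_right add_0)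
  show "h (- x) = - h x" if "x \<in> B" for x using add[of x "- x"] that B(5) h0
    by (simp add: add_eq_0_iff2)
  show "h (x ^ n) = h x ^ n" if "x \<in> B" for x n
    by (induction n) (auto simp: h1 mult that B(7))
  show "h (sum f I) = (\<Sum>i\<in>I. h (f i))" if "\<And>i. i \<in> I \<Longrightarrow> f i \<in> B" for f and I :: "'c set"
    using that by (induction I rule: infinite_finite_induct) (auto simp: h0 add B(8))
qed

lemma is_subring_image:
  assumes "ring_hom_on B h" "is_subring B"
  shows "is_subring (h ` B)"
  unfolding is_subring_def
proof (intro conjI ballI)
  note H = ring_hom_onD[OF assms] and B = is_subringD[OF assms(2)]
  show "0 \<in> h ` B" "1 \<in> h ` B" using H(1,2) B(1,2) by force+
  fix a assume "a \<in> h ` B" then obtain a' where a: "a = h a'" "a' \<in> B" by blast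
  show "- a \<in> h ` B" using a H(5) B(5) by (metis imageI)
  fix b assume "b \<in> h ` B" then obtain b' where b: "b = h b'" "b' \<in> B" by blast
  show "a + b \<in> h ` B" "a * b \<in> h ` B" using a b H(3,4) B(3,4) by (metis imageI)+
qed

lemma map_poly_hom_on:
  assumes h: "ring_hom_on B h" and B: "is_subring B"
  shows "\<And>p q. poly_over B p \<Longrightarrow> poly_over B q \<Longrightarrow> map_poly h (p + q) = map_poly h p + map_poly h q"
    "\<And>p q. poly_over B p \<Longrightarrow> poly_over B q \<Longrightarrow> map_poly h (p * q) = map_poly h p * map_poly h q"
    "\<And>p c. c \<in> B \<Longrightarrow> poly_over B p \<Longrightarrow> map_poly h (smult c p) = smult (h c) (map_poly h p)"
    "\<And>p. poly_over B p \<Longrightarrow> map_poly h (- p) = - map_poly h p"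
proof -
  note H = ring_hom_onD[OF h B] and BD = is_subringD[OF B]
  show "map_poly h (p + q) = map_poly h p + map_poly h q" if "poly_over B p" "poly_over B q" for p q
    using that by (intro poly_eqI) (auto simp: coeff_map_poly H poly_over_def)
  show "map_poly h (p * q) = map_poly h p * map_poly h q" if "poly_over B p" "poly_over B q" for p q
    using that by (intro poly_eqI) (auto simp: coeff_map_poly H coeff_mult poly_over_def BD)
  show "map_poly h (smult c p) = smult (h c) (map_poly h p)" if "c \<in> B" "poly_over B p" for c p
    using that by (intro poly_eqI) (auto simp: coeff_map_poly H poly_over_def)
  show "map_poly h (- p) = - map_poly h p" if "poly_over B p" for p
    using that by (intro poly_eqI) (auto simp: coeff_map_poly H poly_over_def)
qed

lemma hom_on_poly:
  assumes h: "ring_hom_on B h" and B: "is_subring B" and p: "poly_over B p" "x \<in> B"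
  shows "h (poly p x) = poly (map_poly h p) (h x)"
  using p(1)
proof (induction p)
  case 0
  then show ?case by (simp add: ring_hom_onD(2)[OF h B])
next
  case (pCons a p)
  have a: "a \<in> B" and p': "poly_over B p"
    using pCons.prems unfolding poly_over_def by (metis coeff_pCons_0, metis coeff_pCons_Suc)
  have "x * poly p x \<in> B" using poly_in_subring[OF B p' p(2)] p(2) is_subringD(4)[OF B] by blast
  then show ?case using pCons.IH[OF p'] ring_hom_onD[OF h B] a p(2) poly_in_subring[OF B p' p(2)]
    by (simp add: map_poly_pCons)
qed

lemma pseudo_division_over:
  assumes B: "is_subring B" and r: "poly_over B r" "r \<noteq> 0"
  shows "poly_over B p \<Longrightarrow> \<exists>N q s. poly_over B q \<and> poly_over B s \<and>
    smult (lead_coeff r ^ N) p = q * r + s \<and> (s = 0 \<or> degree s < degree r)"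
proof (induction "degree p" arbitrary: p rule: less_induct)
  case less
  note P = poly_over_ring[OF B]
  have lc: "lead_coeff r \<in> B" using r(1) by (simp add: poly_over_def)
  show ?case
  proof (cases "p = 0 \<or> degree p < degree r")
    case True
    then show ?thesis using less.prems P(1) by (intro exI[of _ 0] exI[of _ p]) auto
  next
    case False
    then have p0: "p \<noteq> 0" and deg: "degree r \<le> degree p" by auto
    define m where "m = monom (lead_coeff p) (degree p - degree r)"
    have mB: "poly_over B m" unfolding m_def using less.prems by (intro P(8)) (simp add: poly_over_def)
    define p1 where "p1 = smult (lead_coeff r) p - m * r"
    have p1B: "poly_over B p1" using less.prems mB r lc by (auto simp: p1_def intro!: P)
    have degm: "degree (m * r) = degree p"
      using p0 r(2) deg by (simp add: m_def degree_mult_eq degree_monom_eq)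
    have lcm: "coeff (m * r) (degree p) = lead_coeff r * lead_coeff p"
      using degm p0 r(2) by (metis lead_coeff_mult lead_coeff_monom m_def mult.commute)
    have "p1 = 0 \<or> degree p1 < degree p"
    proof (cases "p1 = 0")
      case False
      have "degree p1 \<le> degree p" unfolding p1_def
        using degm by (intro degree_diff_le) auto
      moreover have "coeff p1 (degree p) = 0" using lcm by (simp add: p1_def)
      ultimately show ?thesis using False by (metis le_neq_implies_less leading_coeff_0_iff)
    qed auto
    then have "\<exists>N q s. poly_over B q \<and> poly_over B s \<and>
      smult (lead_coeff r ^ N) p1 = q * r + s \<and> (s = 0 \<or> degree s < degree r)"
    proof
      assume "p1 = 0" then show ?thesis using P(1) by (intro exI[of _ 0]) auto
    qed (use less.hyps p1B in blast)
    then obtain N q s where qs: "poly_over B q" "poly_over B s"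
      "smult (lead_coeff r ^ N) p1 = q * r + s" "s = 0 \<or> degree s < degree r" by blast
    have "smult (lead_coeff r ^ Suc N) p = smult (lead_coeff r ^ N) p1 + smult (lead_coeff r ^ N) m * r"
      by (simp add: p1_def smult_diff_right mult.commute)
    also have "\<dots> = (q + smult (lead_coeff r ^ N) m) * r + s" using qs(3) by (simp add: algebra_simps)
    finally have "smult (lead_coeff r ^ Suc N) p = (q + smult (lead_coeff r ^ N) m) * r + s" .
    moreover have "poly_over B (q + smult (lead_coeff r ^ N) m)"
      using qs mB lc is_subringD(7)[OF B] by (auto intro!: P)
    ultimately show ?thesis using qs by blast
  qed
qed

(*PART P2b*)
text \<open>Evaluation at \<open>\<xi>\<close> is the only possible value of an extension of \<open>h\<close> that sends \<open>x\<close> to \<open>\<xi>\<close>.\<close>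

lemma hom_extends_to_adjoin:
  fixes h :: "'a::field \<Rightarrow> 'b::field"
  assumes B: "is_subring B" and h: "ring_hom_on B h"
    and rel: "\<And>p. poly_over B p \<Longrightarrow> poly p x = 0 \<Longrightarrow> poly (map_poly h p) \<xi> = 0"
  obtains h' where "ring_hom_on (adjoin B x) h'" "\<And>b. b \<in> B \<Longrightarrow> h' b = h b"
    "\<And>p. poly_over B p \<Longrightarrow> h' (poly p x) = poly (map_poly h p) \<xi>"
proof -
  note P = poly_over_ring[OF B] and H = ring_hom_onD[OF h B] and M = map_poly_hom_on[OF h B]
  define h' where "h' y = poly (map_poly h (SOME p. poly_over B p \<and> poly p x = y)) \<xi>" for y
  have ev: "h' (poly p x) = poly (map_poly h p) \<xi>" if p: "poly_over B p" for p
  proof -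
    let ?q = "SOME q. poly_over B q \<and> poly q x = poly p x"
    have q: "poly_over B ?q \<and> poly ?q x = poly p x" using p by (intro someI[of "\<lambda>q. poly_over B q \<and> poly q x = poly p x" p]) simp
    have "poly (map_poly h (?q + - p)) \<xi> = 0" using q p P(6)[of p] by (intro rel P(3)) auto
    moreover have "map_poly h (?q + - p) = map_poly h ?q - map_poly h p"
      using M(1)[OF conjunct1[OF q] P(6)[OF p]] M(4)[OF p] by simp
    ultimately show ?thesis unfolding h'_def by simp
  qed
  show ?thesis
  proof
    show "h' (poly p x) = poly (map_poly h p) \<xi>" if "poly_over B p" for p using ev[OF that] .
    show hb: "h' b = h b" if "b \<in> B" for b
      using ev[of "[:b:]"] P(9)[OF that P(1)] H(2) by (simp add: map_poly_pCons)
    show "ring_hom_on (adjoin B x) h'"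
      unfolding ring_hom_on_def
    proof (intro conjI ballI)
      show "h' 1 = 1" using hb[of 1] H(1) is_subringD(2)[OF B] by simp
      fix u v assume "u \<in> adjoin B x" "v \<in> adjoin B x"
      then obtain p q where pq: "u = poly p x" "poly_over B p" "v = poly q x" "poly_over B q"
        unfolding adjoin_def by blast
      show "h' (u + v) = h' u + h' v" using ev[of "p + q"] ev[of p] ev[of q] M(1) P(3) pq by simp
      show "h' (u * v) = h' u * h' v" using ev[of "p * q"] ev[of p] ev[of q] M(2) P(4) pq by simp
    qed
  qed
qed

lemma exists_nonroot:
  fixes P :: "'b::alg_closed_field poly"
  assumes "P \<noteq> 0"
  obtains \<xi> where "\<xi> * poly P \<xi> = -1"
proof -
  have "degree (pCons 1 P) > 0" using assms by simp
  then obtain \<xi> where "poly (pCons 1 P) \<xi> = 0" using alg_closed_imp_poly_has_root by blast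
  then have "\<xi> * poly P \<xi> = -1" by (simp add: add_eq_0_iff)
  then show ?thesis using that by blast
qed

text \<open>If \<open>x\<close> is algebraic over \<open>B\<close>, a nonzero \<open>v \<in> B[x]\<close> divides a nonzero constant in
  \<open>B[x]\<close>: a nonzero element of least degree in the ideal of \<open>B[X]\<close> generated by a minimal
  polynomial of \<open>x\<close> and a polynomial representing \<open>v\<close> is a constant.\<close>

lemma algebraic_divides_constant:
  assumes B: "is_subring B" and g: "poly_over B g" "g \<noteq> 0" "poly g x = 0"
    and gmin: "\<And>p. poly_over B p \<Longrightarrow> poly p x = 0 \<Longrightarrow> p \<noteq> 0 \<Longrightarrow> degree g \<le> degree p"
    and v: "v \<in> adjoin B x" "v \<noteq> 0"
  obtains c w where "c \<in> B" "c \<noteq> 0" "w \<in> adjoin B x" "c = w * v"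
proof -
  note P = poly_over_ring[OF B]
  obtain p where p: "v = poly p x" "poly_over B p" using v unfolding adjoin_def by blast
  let ?I = "\<lambda>r. \<exists>\<alpha> \<beta>. poly_over B \<alpha> \<and> poly_over B \<beta> \<and> r = \<alpha> * p + \<beta> * g"
  have I_lin: "?I (smult a r1 - q * r2)" if r12: "?I r1" "?I r2" "a \<in> B" "poly_over B q" for r1 r2 a q
  proof -
    obtain \<alpha> \<beta> \<alpha>' \<beta>' where *: "poly_over B \<alpha>" "poly_over B \<beta>" "r1 = \<alpha> * p + \<beta> * g"
      "poly_over B \<alpha>'" "poly_over B \<beta>'" "r2 = \<alpha>' * p + \<beta>' * g" using r12(1,2) by blast
    have "smult a r1 - q * r2 = (smult a \<alpha> - q * \<alpha>') * p + (smult a \<beta> - q * \<beta>') * g"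
      using * by (simp add: algebra_simps smult_add_right)
    moreover have "poly_over B (smult a \<alpha> - q * \<alpha>')" "poly_over B (smult a \<beta> - q * \<beta>')"
      using * r12(3,4) by (auto intro: P(4,5,7))
    ultimately show ?thesis by blast
  qed
  have Ig: "?I g" using P(1,2) by (intro exI[of _ 0] exI[of _ 1]) auto
  have Ip: "?I p" using P(1,2) by (intro exI[of _ 1] exI[of _ 0]) auto
  obtain r where r: "?I r" "r \<noteq> 0" and rmin: "\<And>s. ?I s \<Longrightarrow> s \<noteq> 0 \<Longrightarrow> degree r \<le> degree s"
    using ex_has_least_nat[of "\<lambda>r. ?I r \<and> r \<noteq> 0" g degree] Ig g(2) by blast
  have rB: "poly_over B r" using r(1) p(2) g(1) by (auto intro!: P)
  have lcB: "lead_coeff r ^ N \<in> B" for N using rB is_subringD(7)[OF B] by (simp add: poly_over_def)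
  have divides: "\<exists>N q. poly_over B q \<and> smult (lead_coeff r ^ N) s = q * r" if s: "?I s" for s
  proof -
    have "poly_over B s" using s p(2) g(1) by (auto intro!: P)
    from pseudo_division_over[OF B rB r(2) this]
    obtain N q s' where q: "poly_over B q" "smult (lead_coeff r ^ N) s = q * r + s'"
      "s' = 0 \<or> degree s' < degree r" by blast
    have "s' = smult (lead_coeff r ^ N) s - q * r" using q(2) by simp
    then have "?I s'" using I_lin[OF s r(1) lcB q(1)] by simp
    then have "s' = 0" using rmin q(3) by fastforce
    then show ?thesis using q by auto
  qed
  obtain N q where q: "poly_over B q" "smult (lead_coeff r ^ N) p = q * r" using divides[OF Ip] by blast
  have "poly q x * poly r x = lead_coeff r ^ N * v"
    using arg_cong[OF q(2), of "\<lambda>p. poly p x"] p(1) by simp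
  then have rx: "poly r x \<noteq> 0" using v(2) r(2) by auto
  obtain M q' where q': "poly_over B q'" "smult (lead_coeff r ^ M) g = q' * r" using divides[OF Ig] by blast
  have "poly q' x * poly r x = 0" using arg_cong[OF q'(2), of "\<lambda>p. poly p x"] g(3) by simp
  then have q'x: "poly q' x = 0" using rx by simp
  have q'0: "q' \<noteq> 0" using q'(2) g(2) r(2) by auto
  have "degree g = degree q' + degree r"
    using arg_cong[OF q'(2), of degree] r(2) q'0 by (simp add: degree_mult_eq)
  moreover have "degree g \<le> degree q'" using gmin q'x q'0 q'(1) by blast
  ultimately have "degree r = 0" by simp
  then obtain c where c: "r = [:c:]" by (meson degree_eq_zeroE)
  obtain \<alpha> \<beta> where ab: "poly_over B \<alpha>" "r = \<alpha> * p + \<beta> * g" using r(1) by blast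
  show ?thesis
  proof
    show "c \<in> B" using rB c unfolding poly_over_def by (metis coeff_pCons_0)
    show "c \<noteq> 0" using r(2) c by simp
    show "poly \<alpha> x \<in> adjoin B x" using ab(1) unfolding adjoin_def by blast
    show "c = poly \<alpha> x * v" using arg_cong[OF ab(2), of "\<lambda>p. poly p x"] c p(1) g(3) by simp
  qed
qed

lemma hom_extension_one_generator:
  fixes B :: "'a::field set"
  assumes B: "is_subring B" and v: "v \<in> adjoin B x" "v \<noteq> 0"
  obtains u where "u \<in> B" "u \<noteq> 0"
    "\<And>h :: 'a \<Rightarrow> 'b::alg_closed_field. ring_hom_on B h \<Longrightarrow> h u \<noteq> 0 \<Longrightarrow>
       \<exists>h'. ring_hom_on (adjoin B x) h' \<and> (\<forall>b\<in>B. h' b = h b) \<and> h' v \<noteq> 0"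
proof (cases "transc_over B x")
  case True
  obtain p where p: "v = poly p x" "poly_over B p" using v unfolding adjoin_def by blast
  have "p \<noteq> 0" using v(2) p(1) by auto
  show ?thesis
  proof (rule that)
    show "lead_coeff p \<in> B" using p(2) by (simp add: poly_over_def)
    show "lead_coeff p \<noteq> 0" using \<open>p \<noteq> 0\<close> by simp
    fix h :: "'a \<Rightarrow> 'b::alg_closed_field" assume h: "ring_hom_on B h" "h (lead_coeff p) \<noteq> 0"
    have "map_poly h p \<noteq> 0" using h(2) ring_hom_onD(2)[OF h(1) B]
      by (metis coeff_0 coeff_map_poly)
    then obtain \<xi> where xi: "\<xi> * poly (map_poly h p) \<xi> = -1" by (rule exists_nonroot)
    have "poly (map_poly h q) \<xi> = 0" if "poly_over B q" "poly q x = 0" for q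
      using True that unfolding transc_over_def by fastforce
    then obtain h' where "ring_hom_on (adjoin B x) h'" "\<And>b. b \<in> B \<Longrightarrow> h' b = h b"
      "\<And>p. poly_over B p \<Longrightarrow> h' (poly p x) = poly (map_poly h p) \<xi>"
      by (rule hom_extends_to_adjoin[OF B h(1)]) auto
    moreover from this p xi have "h' v \<noteq> 0" by auto
    ultimately show "\<exists>h'. ring_hom_on (adjoin B x) h' \<and> (\<forall>b\<in>B. h' b = h b) \<and> h' v \<noteq> 0" by blast
  qed
next
  case False
  note P = poly_over_ring[OF B]
  let ?Q = "\<lambda>g. poly_over B g \<and> poly g x = 0 \<and> g \<noteq> 0"
  obtain g0 where "?Q g0" using False unfolding transc_over_def by blast
  then obtain g where g: "?Q g" and gmin: "\<And>p. ?Q p \<Longrightarrow> degree g \<le> degree p"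
    using ex_has_least_nat[of ?Q g0 degree] by blast
  have degg: "degree g > 0"
  proof (rule ccontr)
    assume "\<not> degree g > 0"
    then obtain c where "g = [:c:]" using degree_eq_zeroE by blast
    then show False using g by simp
  qed
  obtain c w where c: "c \<in> B" "c \<noteq> 0" "w \<in> adjoin B x" "c = w * v"
    using algebraic_divides_constant[OF B _ _ _ _ v, of g] g gmin by blast
  show ?thesis
  proof (rule that)
    have lcB: "lead_coeff g \<in> B" using g by (simp add: poly_over_def)
    show "lead_coeff g * c \<in> B" using lcB c is_subringD(4)[OF B] by blast
    show "lead_coeff g * c \<noteq> 0" using g c by simp
    fix h :: "'a \<Rightarrow> 'b::alg_closed_field" assume h: "ring_hom_on B h" "h (lead_coeff g * c) \<noteq> 0"
    note H = ring_hom_onD[OF h(1) B] and M = map_poly_hom_on[OF h(1) B]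
    have hlc: "h (lead_coeff g) \<noteq> 0" "h c \<noteq> 0" using h(2) H(4)[OF lcB c(1)] by auto
    have "degree (map_poly h g) = degree g"
      using hlc(1) by (intro map_poly_degree_eq)
    then obtain \<xi> where xi: "poly (map_poly h g) \<xi> = 0"
      using alg_closed_imp_poly_has_root[of "map_poly h g"] degg by auto
    have "poly (map_poly h q) \<xi> = 0" if q: "poly_over B q" "poly q x = 0" for q
    proof -
      from pseudo_division_over[OF B _ _ q(1), of g] g
      obtain N q' s where s: "poly_over B q'" "poly_over B s"
        "smult (lead_coeff g ^ N) q = q' * g + s" "s = 0 \<or> degree s < degree g" by blast
      have "poly s x = 0" using arg_cong[OF s(3), of "\<lambda>p. poly p x"] g q(2) by simp
      then have "s = 0" using gmin[of s] s(2,4) by fastforce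
      then have "smult (h (lead_coeff g ^ N)) (map_poly h q) = map_poly h q' * map_poly h g"
        using s(1,3) M(2,3) g q(1) lcB is_subringD(7)[OF B] by (metis add.right_neutral)
      then have "h (lead_coeff g ^ N) * poly (map_poly h q) \<xi> = 0"
        using xi by (metis mult_zero_right poly_mult poly_smult)
      then show ?thesis using H(6)[OF lcB] hlc by simp
    qed
    then obtain h' where h': "ring_hom_on (adjoin B x) h'" "\<And>b. b \<in> B \<Longrightarrow> h' b = h b"
      by (rule hom_extends_to_adjoin[OF B h(1)]) auto
    have "h' c = h' w * h' v" using ring_hom_onD(4)[OF h'(1) is_subring_adjoin[OF B]] c v by simp
    then have "h' v \<noteq> 0" using h'(2)[OF c(1)] hlc by auto
    then show "\<exists>h'. ring_hom_on (adjoin B x) h' \<and> (\<forall>b\<in>B. h' b = h b) \<and> h' v \<noteq> 0"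
      using h' by blast
  qed
qed

lemma hom_extension:
  fixes B :: "'a::field set"
  assumes "is_subring B" "v \<in> adjoins B xs" "v \<noteq> 0"
  shows "\<exists>u\<in>B. u \<noteq> 0 \<and> (\<forall>h :: 'a \<Rightarrow> 'b::alg_closed_field. ring_hom_on B h \<and> h u \<noteq> 0 \<longrightarrow>
       (\<exists>h'. ring_hom_on (adjoins B xs) h' \<and> (\<forall>b\<in>B. h' b = h b) \<and> h' v \<noteq> 0))"
  using assms
proof (induction B xs arbitrary: v rule: adjoins.induct)
  case (1 B)
  then show ?case by auto
next
  case (2 B x xs)
  from 2(1)[OF is_subring_adjoin[OF 2(2)] 2(3)[simplified] 2(4)]
  obtain w where w: "w \<in> adjoin B x" "w \<noteq> 0"
    "\<forall>h :: 'a \<Rightarrow> 'b. ring_hom_on (adjoin B x) h \<and> h w \<noteq> 0 \<longrightarrow>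
       (\<exists>h'. ring_hom_on (adjoins (adjoin B x) xs) h' \<and> (\<forall>b\<in>adjoin B x. h' b = h b) \<and> h' v \<noteq> 0)"
    by blast
  obtain u where u: "u \<in> B" "u \<noteq> 0"
    "\<And>h :: 'a \<Rightarrow> 'b. ring_hom_on B h \<Longrightarrow> h u \<noteq> 0 \<Longrightarrow>
       \<exists>h'. ring_hom_on (adjoin B x) h' \<and> (\<forall>b\<in>B. h' b = h b) \<and> h' w \<noteq> 0"
    using hom_extension_one_generator[OF 2(2) w(1,2)] by blast
  have incl: "B \<subseteq> adjoin B x" using adjoin_incl[OF 2(2)] by blast
  have "\<exists>h'. ring_hom_on (adjoins B (x # xs)) h' \<and> (\<forall>b\<in>B. h' b = h b) \<and> h' v \<noteq> 0"
    if h: "ring_hom_on B h" "h u \<noteq> 0" for h :: "'a \<Rightarrow> 'b"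
  proof -
    obtain h1 where h1: "ring_hom_on (adjoin B x) h1" "\<forall>b\<in>B. h1 b = h b" "h1 w \<noteq> 0"
      using u(3)[OF h] by blast
    obtain h2 where "ring_hom_on (adjoins (adjoin B x) xs) h2" "\<forall>b\<in>adjoin B x. h2 b = h1 b" "h2 v \<noteq> 0"
      using w(3) h1 by blast
    then show ?thesis using h1 incl by (intro exI[of _ h2]) auto
  qed
  then show ?case using u(1,2) by blast
qed

text \<open>An injective homomorphism on \<open>B\<close> extends to a homomorphism with nonzero kernel as soon as
  one of the generators is transcendental over \<open>B\<close>: that generator may be sent to a root of
  \<open>1 + X U(X)\<close>, where \<open>U\<close> is the obstruction to extending further.\<close>

lemma hom_extension_with_kernel:
  fixes h :: "'a::field \<Rightarrow> 'b::alg_closed_field"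
  assumes B: "is_subring B" and x: "transc_over B x" and h: "ring_hom_on B h"
    and inj: "\<And>b. b \<in> B \<Longrightarrow> h b = 0 \<Longrightarrow> b = 0"
  obtains h' w where "ring_hom_on (adjoins (adjoin B x) xs) h'" "\<And>b. b \<in> B \<Longrightarrow> h' b = h b"
    "w \<in> adjoins (adjoin B x) xs" "w \<noteq> 0" "h' w = 0"
proof -
  note P = poly_over_ring[OF B] and H = ring_hom_onD[OF h B] and M = map_poly_hom_on[OF h B]
  have Bx: "is_subring (adjoin B x)" using is_subring_adjoin[OF B] .
  have "1 \<in> adjoins (adjoin B x) xs" using is_subringD(2)[OF is_subring_adjoins[OF Bx]] .
  from hom_extension[where 'b='b, OF Bx this]
  obtain u where u: "u \<in> adjoin B x" "u \<noteq> 0"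
    "\<forall>h :: 'a \<Rightarrow> 'b. ring_hom_on (adjoin B x) h \<and> h u \<noteq> 0 \<longrightarrow>
       (\<exists>h'. ring_hom_on (adjoins (adjoin B x) xs) h' \<and> (\<forall>b\<in>adjoin B x. h' b = h b) \<and> h' 1 \<noteq> 0)"
    by fastforce
  obtain U where U: "u = poly U x" "poly_over B U" using u(1) unfolding adjoin_def by blast
  have "U \<noteq> 0" using u(2) U(1) by auto
  then have "map_poly h U \<noteq> 0"
    using inj U(2) H(2) unfolding poly_over_def by (metis coeff_0 coeff_map_poly leading_coeff_0_iff)
  then obtain \<xi> where xi: "\<xi> * poly (map_poly h U) \<xi> = -1" by (rule exists_nonroot)
  have "poly (map_poly h q) \<xi> = 0" if "poly_over B q" "poly q x = 0" for q
    using x that unfolding transc_over_def by fastforce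
  then obtain h1 where h1: "ring_hom_on (adjoin B x) h1" "\<And>b. b \<in> B \<Longrightarrow> h1 b = h b"
    "\<And>p. poly_over B p \<Longrightarrow> h1 (poly p x) = poly (map_poly h p) \<xi>"
    by (rule hom_extends_to_adjoin[OF B h]) auto
  have "h1 u \<noteq> 0" using h1(3)[OF U(2)] U(1) xi by auto
  then obtain h' where h': "ring_hom_on (adjoins (adjoin B x) xs) h'" "\<And>b. b \<in> adjoin B x \<Longrightarrow> h' b = h1 b"
    using u(3) h1(1) by blast
  have pB: "poly_over B (pCons 1 U)" using P(9)[OF is_subringD(2)[OF B] U(2)] .
  show ?thesis
  proof
    show "ring_hom_on (adjoins (adjoin B x) xs) h'" using h'(1) .
    show "h' b = h b" if "b \<in> B" for b using h'(2) h1(2) adjoin_incl(1)[OF B, of x] that by auto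
    have mem: "poly (pCons 1 U) x \<in> adjoin B x" using pB unfolding adjoin_def by blast
    then show "poly (pCons 1 U) x \<in> adjoins (adjoin B x) xs" using adjoins_incl[OF Bx] by blast
    show "poly (pCons 1 U) x \<noteq> 0" using x pB unfolding transc_over_def by (metis pCons_eq_0_iff zero_neq_one)
    show "h' (poly (pCons 1 U) x) = 0"
      using h'(2)[OF mem] h1(3)[OF pB] xi H by (simp add: map_poly_pCons del: poly_pCons) simp
  qed
qed

text \<open>Two-dimensional rings have nonmaximal nonzero primes: a homomorphism that keeps \<open>t\<close>
  but kills something has a field as its image, and this image has a further proper specialisation
  that moves \<open>t\<close>.\<close>

lemma dim_one_algebraic:
  fixes k :: "'a::field set"
  assumes k: "is_subfield k" and R: "R = adjoins k xs"
    and dim: "\<And>(h :: 'a \<Rightarrow> 'a alg_closure) w y. ring_hom_on R h \<Longrightarrow> w \<in> R \<Longrightarrow> w \<noteq> 0 \<Longrightarrow> h w = 0 \<Longrightarrow> y \<in> R \<Longrightarrow>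
       h y \<noteq> 0 \<Longrightarrow> \<exists>z\<in>R. h y * h z = 1"
    and t: "t \<in> R" "transc_over k t" and y: "y \<in> R"
  shows "\<not> transc_over (adjoin k t) y"
proof
  assume tr: "transc_over (adjoin k t) y"
  have k': "is_subring k" using is_subfieldD(1)[OF k] .
  let ?B = "adjoin k t"
  have B: "is_subring ?B" using is_subring_adjoin[OF k'] .
  have By: "is_subring (adjoin ?B y)" using is_subring_adjoin[OF B] .
  have Rr: "is_subring R" using is_subring_adjoins[OF k'] R by simp
  have kR: "k \<subseteq> R" "set xs \<subseteq> R" using adjoins_incl[OF k'] R by auto
  have R2: "adjoins (adjoin ?B y) xs = R"
  proof
    show "adjoins (adjoin ?B y) xs \<subseteq> R"
      using kR t y by (intro adjoins_least adjoin_least Rr) auto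
    show "R \<subseteq> adjoins (adjoin ?B y) xs"
      unfolding R using adjoins_incl[OF By, of xs] adjoin_incl[OF B, of y] adjoin_incl[OF k', of t]
      by (intro adjoins_least is_subring_adjoins By) auto
  qed
  have "ring_hom_on ?B (to_ac :: 'a \<Rightarrow> 'a alg_closure)" by (simp add: ring_hom_on_def)
  from hom_extension_with_kernel[OF B tr this, where xs = xs]
  obtain h w where h: "ring_hom_on R h" "\<And>b. b \<in> ?B \<Longrightarrow> h b = to_ac b" "w \<in> R" "w \<noteq> 0" "h w = 0"
    unfolding R2 by (metis to_ac_eq_0_iff)
  note H = ring_hom_onD[OF h(1) Rr]
  let ?k = "h ` k"
  have hk: "h c = to_ac c" if "c \<in> k" for c using h(2) adjoin_incl(1)[OF k'] that by auto
  have ht: "h t = to_ac t" using h(2) adjoin_incl(2)[OF k'] by auto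
  have kk: "is_subring ?k"
  proof (rule is_subring_image[OF _ k'])
    show "ring_hom_on k h" using h(1) kR(1) unfolding ring_hom_on_def by (meson subsetD)
  qed
  have ktr: "transc_over ?k (h t)"
    unfolding transc_over_def
  proof (intro allI impI)
    fix P assume P: "poly_over ?k P \<and> poly P (h t) = 0"
    define p where "p = map_poly of_ac P"
    have cp: "to_ac (coeff p i) = coeff P i" "coeff p i \<in> k" for i
    proof -
      have "coeff P i \<in> h ` k" using P unfolding poly_over_def by blast
      then obtain c where "c \<in> k" "coeff P i = h c" by (rule imageE)
      then have c: "c \<in> k" "coeff P i = to_ac c" using hk by auto
      then show "to_ac (coeff p i) = coeff P i" "coeff p i \<in> k"
        by (auto simp: p_def coeff_map_poly)
    qed
    have "P = map_poly to_ac p" using cp by (intro poly_eqI) (auto simp: coeff_map_poly)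
    moreover have "h (poly p t) = poly (map_poly h p) (h t)"
      using cp kR t by (intro hom_on_poly[OF h(1) Rr]) (auto simp: poly_over_def)
    moreover have "map_poly h p = map_poly to_ac p"
      using cp hk by (intro poly_eqI) (auto simp: coeff_map_poly H)
    moreover have "h (poly p t) = to_ac (poly p t)" using cp h(2) unfolding adjoin_def poly_over_def by blast
    ultimately have "poly p t = 0" using P by (metis to_ac_eq_0_iff)
    then have "p = 0" using t(2) cp unfolding transc_over_def poly_over_def by blast
    then show "P = 0" using cp(1) by (intro poly_eqI) (metis coeff_0 to_ac_0)
  qed
  let ?R1 = "adjoins (adjoin ?k (h t)) (map h xs)"
  have B1: "is_subring (adjoin ?k (h t))" using is_subring_adjoin[OF kk] .
  have R1r: "is_subring ?R1" using is_subring_adjoins[OF B1] .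
  have hR: "is_subring (h ` R)" using is_subring_image[OF h(1) Rr] .
  have sub1: "?R1 \<subseteq> h ` R" using kR t by (intro adjoins_least adjoin_least hR) auto
  have sub2: "h a \<in> ?R1" if "a \<in> R" for a
  proof -
    have "is_subring {a \<in> R. h a \<in> ?R1}"
      using is_subringD[OF Rr] is_subringD[OF R1r] H unfolding is_subring_def by auto
    moreover have "?k \<subseteq> ?R1" "set (map h xs) \<subseteq> ?R1"
      using adjoins_incl[OF B1, of "map h xs"] adjoin_incl[OF kk, of "h t"] by blast+
    ultimately have "R \<subseteq> {a \<in> R. h a \<in> ?R1}"
      using kR by (subst R, intro adjoins_least) auto
    then show ?thesis using that by blast
  qed
  have id: "ring_hom_on ?k (\<lambda>x. x)" by (simp add: ring_hom_on_def)
  obtain g :: "'a alg_closure \<Rightarrow> 'a alg_closure" and w'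
    where g: "ring_hom_on ?R1 g" "w' \<in> ?R1" "w' \<noteq> 0" "g w' = 0"
    by (rule hom_extension_with_kernel[OF kk ktr id, where xs = "map h xs"]) auto
  note G = ring_hom_onD[OF g(1) R1r]
  obtain a where a: "w' = h a" "a \<in> R" using g(2) sub1 by blast
  obtain b where b: "b \<in> R" "h a * h b = 1" using dim[OF h(1,3,4,5) a(2)] a g(3) by auto
  have "g 1 = g w' * g (h b)" using G(4)[OF g(2) sub2[OF b(1)]] b a by simp
  then show False using g(4) G(1) by simp
qed

(*PART P3a*)
definition is_ideal :: "'a::field set \<Rightarrow> 'a set \<Rightarrow> bool" where
  "is_ideal R I \<longleftrightarrow> I \<subseteq> R \<and> 0 \<in> I \<and> (\<forall>x\<in>I. \<forall>y\<in>I. x + y \<in> I) \<and> (\<forall>r\<in>R. \<forall>x\<in>I. r * x \<in> I)"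

lemma rota_simps [simp]:
  "carrier (ring_of_type_algebra :: 'a::field ring) = UNIV"
  "x \<otimes>\<^bsub>ring_of_type_algebra\<^esub> y = x * (y :: 'a)"
  "\<one>\<^bsub>ring_of_type_algebra\<^esub> = (1 :: 'a)"
  "\<zero>\<^bsub>ring_of_type_algebra\<^esub> = (0 :: 'a)"
  "x \<oplus>\<^bsub>ring_of_type_algebra\<^esub> y = x + (y :: 'a)"
  by (auto simp: ring_of_type_algebra_def)

lemma a_inv_rota [simp]: "a_inv (ring_of_type_algebra :: 'a::field ring) x = - x"
  using abelian_group.minus_equality[OF ring.is_abelian_group[OF ring_from_type_algebra], of "- x" x] by simp

lemma subring_iff_is_subring: "subring B (ring_of_type_algebra :: 'a::field ring) \<longleftrightarrow> is_subring B"
proof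
  assume "subring B (ring_of_type_algebra :: 'a ring)"
  from subringE[OF this] show "is_subring B" by (auto simp: is_subring_def)
next
  assume "is_subring B"
  then show "subring B (ring_of_type_algebra :: 'a ring)"
    by (intro ring.subringI[OF ring_from_type_algebra]) (auto simp: is_subring_def)
qed

lemma m_inv_rota: "x \<noteq> 0 \<Longrightarrow> m_inv (ring_of_type_algebra :: 'a::field ring) x = inverse x"
  by (rule comm_monoid.comm_inv_char[OF cring.axioms(2)[OF cring_from_type_algebra]]) auto

lemma subfield_iff_is_subfield: "subfield F (ring_of_type_algebra :: 'a::field ring) \<longleftrightarrow> is_subfield F"
proof
  assume F: "subfield F (ring_of_type_algebra :: 'a ring)"
  have "inverse x \<in> F" if "x \<in> F" for x
    using ring.subfield_m_inv(1)[OF ring_from_type_algebra F, of x] that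
    by (cases "x = 0") (auto simp: m_inv_rota)
  then show "is_subfield F"
    using subfieldE(1)[OF F] by (auto simp: is_subfield_def subring_iff_is_subring)
next
  assume F: "is_subfield F"
  show "subfield F (ring_of_type_algebra :: 'a ring)"
  proof (rule Subrings.field.subfieldI'[OF field_from_type_algebra])
    show "subring F (ring_of_type_algebra :: 'a ring)"
      using is_subfieldD(1)[OF F] by (simp add: subring_iff_is_subring)
    show "m_inv (ring_of_type_algebra :: 'a ring) x \<in> F" if "x \<in> F - {\<zero>\<^bsub>ring_of_type_algebra\<^esub>}" for x
      using that is_subfieldD(2)[OF F] by (simp add: m_inv_rota)
  qed
qed

lemma cring_subring_rec:
  assumes "is_subring R"
  shows "cring (subring_rec R)"
  using cring.subcringI'[OF cring_from_type_algebra] ring.subcring_iff[OF ring_from_type_algebra]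
    assms subring_iff_is_subring by (metis rota_simps(1) subset_UNIV)

lemma ideal_iff_is_ideal:
  assumes R: "is_subring R"
  shows "ideal I (subring_rec R) \<longleftrightarrow> is_ideal R I"
proof
  assume I: "ideal I (subring_rec R)"
  interpret ideal I "subring_rec R" by fact
  show "is_ideal R I"
    using a_subset I_l_closed additive_subgroup.zero_closed[OF ideal.axioms(1)[OF I]]
      additive_subgroup.a_closed[OF ideal.axioms(1)[OF I]]
    unfolding is_ideal_def by auto
next
  assume I: "is_ideal R I"
  note R' = is_subringD[OF R]
  have ring: "ring (subring_rec R)" using cring_subring_rec[OF R] cring.axioms(1) by blast
  have neg: "- x \<in> I" if "x \<in> I" for x
  proof -
    have "(-1) * x \<in> I" using I that R'(2,5) unfolding is_ideal_def by blast
    then show ?thesis by simp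
  qed
  have ainv: "a_inv (subring_rec R) x = - x" if "x \<in> R" for x
    using ring.ring_simprules(18)[OF ring] that
    by (intro abelian_group.minus_equality[OF ring.is_abelian_group[OF ring]]) (auto simp: R')
  show "ideal I (subring_rec R)"
  proof (rule idealI[OF ring])
    show "subgroup I (add_monoid (subring_rec R))"
    proof (rule group.subgroupI[OF abelian_group.a_group[OF ring.is_abelian_group[OF ring]]])
      fix x assume x: "x \<in> I"
      then have "m_inv (add_monoid (subring_rec R)) x = a_inv (subring_rec R) x" by (simp add: a_inv_def)
      then show "m_inv (add_monoid (subring_rec R)) x \<in> I"
        using ainv neg x I unfolding is_ideal_def by auto
    qed (use I in \<open>auto simp: is_ideal_def\<close>)
  next
    fix a x assume "a \<in> I" "x \<in> carrier (subring_rec R)"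
    then have "x * a \<in> I" using I unfolding is_ideal_def by auto
    then show "x \<otimes>\<^bsub>subring_rec R\<^esub> a \<in> I" "a \<otimes>\<^bsub>subring_rec R\<^esub> x \<in> I" by (simp_all add: mult.commute)
  qed
qed

lemma primeideal_iff:
  assumes R: "is_subring R"
  shows "primeideal P (subring_rec R) \<longleftrightarrow>
    is_ideal R P \<and> P \<noteq> R \<and> (\<forall>a\<in>R. \<forall>b\<in>R. a * b \<in> P \<longrightarrow> a \<in> P \<or> b \<in> P)"
proof
  assume "primeideal P (subring_rec R)"
  then interpret primeideal P "subring_rec R" .
  show "is_ideal R P \<and> P \<noteq> R \<and> (\<forall>a\<in>R. \<forall>b\<in>R. a * b \<in> P \<longrightarrow> a \<in> P \<or> b \<in> P)"
    using ideal_iff_is_ideal[OF R] is_ideal I_notcarr I_prime by auto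
next
  assume "is_ideal R P \<and> P \<noteq> R \<and> (\<forall>a\<in>R. \<forall>b\<in>R. a * b \<in> P \<longrightarrow> a \<in> P \<or> b \<in> P)"
  then show "primeideal P (subring_rec R)"
    using ideal_iff_is_ideal[OF R] cring_subring_rec[OF R] by (intro primeidealI) auto
qed

lemma maximalideal_iff:
  assumes R: "is_subring R"
  shows "maximalideal P (subring_rec R) \<longleftrightarrow>
    is_ideal R P \<and> P \<noteq> R \<and> (\<forall>J. is_ideal R J \<and> P \<subseteq> J \<longrightarrow> J = P \<or> J = R)"
proof
  assume "maximalideal P (subring_rec R)"
  then interpret maximalideal P "subring_rec R" .
  show "is_ideal R P \<and> P \<noteq> R \<and> (\<forall>J. is_ideal R J \<and> P \<subseteq> J \<longrightarrow> J = P \<or> J = R)"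
    using ideal_iff_is_ideal[OF R] is_ideal I_notcarr I_maximal unfolding is_ideal_def by auto
next
  assume "is_ideal R P \<and> P \<noteq> R \<and> (\<forall>J. is_ideal R J \<and> P \<subseteq> J \<longrightarrow> J = P \<or> J = R)"
  then show "maximalideal P (subring_rec R)"
    using ideal_iff_is_ideal[OF R] by (intro maximalidealI) auto
qed

lemma maximal_is_prime:
  assumes R: "is_subring R" and m: "maximalideal m (subring_rec R)"
  shows "is_ideal R m" "1 \<notin> m" "\<And>a b. a \<in> R \<Longrightarrow> b \<in> R \<Longrightarrow> a * b \<in> m \<Longrightarrow> a \<in> m \<or> b \<in> m"
    "\<And>a. a \<in> R \<Longrightarrow> a \<notin> m \<Longrightarrow> \<exists>b\<in>R. 1 - b * a \<in> m"
proof -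
  show I: "is_ideal R m" using m maximalideal_iff[OF R] by blast
  have "m \<noteq> R" using m maximalideal_iff[OF R] by blast
  then show one: "1 \<notin> m" using I unfolding is_ideal_def by (metis mult.right_neutral subset_antisym subsetI)
  have "primeideal m (subring_rec R)"
    using cring.maximalideal_prime[OF cring_subring_rec[OF R] m] .
  then show "\<And>a b. a \<in> R \<Longrightarrow> b \<in> R \<Longrightarrow> a * b \<in> m \<Longrightarrow> a \<in> m \<or> b \<in> m"
    using primeideal_iff[OF R] by blast
  fix a assume a: "a \<in> R" "a \<notin> m"
  define J where "J = {x + b * a | x b. x \<in> m \<and> b \<in> R}"
  note RD = is_subringD[OF R]
  have "is_ideal R J"
    unfolding is_ideal_def
  proof (intro conjI ballI)
    show "J \<subseteq> R" using I a RD by (auto simp: J_def is_ideal_def)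
    show "0 \<in> J" unfolding J_def using I RD(1) by (intro CollectI exI[of _ 0]) (auto simp: is_ideal_def)
    fix u assume "u \<in> J" then obtain x b where u: "u = x + b * a" "x \<in> m" "b \<in> R" by (auto simp: J_def)
    {
      fix v assume "v \<in> J" then obtain y c where v: "v = y + c * a" "y \<in> m" "c \<in> R" by (auto simp: J_def)
      have "u + v = (x + y) + (b + c) * a" using u v by (simp add: algebra_simps)
      moreover have "x + y \<in> m" "b + c \<in> R" using I u v RD by (auto simp: is_ideal_def)
      ultimately show "u + v \<in> J" unfolding J_def by blast
    }
    fix r assume r: "r \<in> R"
    have "r * u = r * x + (r * b) * a" using u by (simp add: algebra_simps)
    moreover have "r * x \<in> m" "r * b \<in> R" using I u r RD by (auto simp: is_ideal_def)
    ultimately show "r * u \<in> J" unfolding J_def by blast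
  qed
  moreover have "m \<subseteq> J"
  proof
    fix x assume "x \<in> m" then show "x \<in> J"
      unfolding J_def using RD(1) by (intro CollectI exI[of _ x] exI[of _ 0]) simp
  qed
  moreover have "a \<in> J" unfolding J_def using I RD(2)
    by (intro CollectI exI[of _ 0] exI[of _ 1]) (simp add: is_ideal_def)
  ultimately have "J = R" using m maximalideal_iff[OF R] a(2) by blast
  then have "1 \<in> J" using RD(2) by simp
  then obtain x b where "1 = x + b * a" "x \<in> m" "b \<in> R" unfolding J_def by blast
  then show "\<exists>b\<in>R. 1 - b * a \<in> m" by (metis add_diff_cancel_right')
qed

lemma Units_subring_rec:
  assumes "is_subring R"
  shows "Units (subring_rec R) = {x \<in> R. x \<noteq> 0 \<and> inverse x \<in> R}"
proof -
  have "y = inverse x" if "x * y = 1" for x y :: 'a using that by (simp add: inverse_unique)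
  then show ?thesis
    by (auto simp: Units_def mult.commute intro!: bexI[of _ "inverse _"])
qed

lemma PIdl_subring_rec: "PIdl\<^bsub>subring_rec R\<^esub> t = {x * t | x. x \<in> R}"
  by (auto simp: cgenideal_def)

text \<open>\<open>z\<close> is a discrete valuation ring of the ambient field, with normalised valuation \<open>ord_at z\<close>.\<close>

definition discrete_place :: "'K::field set \<Rightarrow> bool" where
  "discrete_place z \<longleftrightarrow> is_subring z \<and>
     (\<forall>x y. x \<noteq> 0 \<and> y \<noteq> 0 \<longrightarrow> ord_at z (x * y) = ord_at z x + ord_at z y) \<and>
     (\<forall>x y. x \<noteq> 0 \<and> y \<noteq> 0 \<and> x + y \<noteq> 0 \<longrightarrow> ord_at z (x + y) \<ge> min (ord_at z x) (ord_at z y)) \<and>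
     (\<exists>t. t \<noteq> 0 \<and> ord_at z t = 1) \<and>
     z = {x. x = 0 \<or> ord_at z x \<ge> 0} \<and> max_ideal_at z = {x. x = 0 \<or> ord_at z x \<ge> 1}"

lemma unit_times_power:
  fixes x :: "'a::field"
  assumes x: "x \<in> z" and fin: "\<exists>n. x \<notin> {y * t ^ n | y. y \<in> z}"
  shows "\<exists>y\<in>z. y \<notin> {x * t | x. x \<in> z} \<and> (\<exists>m. x = y * t ^ m)"
proof -
  define n where "n = (LEAST n. x \<notin> {y * t ^ n | y. y \<in> z})"
  have n: "x \<notin> {y * t ^ n | y. y \<in> z}" unfolding n_def using LeastI_ex[OF fin] .
  have "n \<noteq> 0"
  proof
    assume "n = 0"
    then have "x = x * t ^ n" by simp
    then show False using n x by blast
  qed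
  then obtain m where m: "n = Suc m" using not0_implies_Suc by blast
  have "m < n" using m by simp
  then have "x \<in> {y * t ^ m | y. y \<in> z}" unfolding n_def using not_less_Least by blast
  then obtain y where y: "x = y * t ^ m" "y \<in> z" by blast
  have "y \<notin> {x * t | x. x \<in> z}"
  proof
    assume "y \<in> {x * t | x. x \<in> z}"
    then obtain w where "y = w * t" "w \<in> z" by blast
    then have "x = w * t ^ n" using y m by simp
    then show False using n \<open>w \<in> z\<close> by blast
  qed
  then show ?thesis using y by blast
qed

lemma discrete_place_from_uniformizer:
  assumes z: "is_subring z" and t: "t \<in> z" "t \<noteq> 0" and M: "max_ideal_at z = {x * t | x. x \<in> z}"
    and fin: "\<And>x. x \<in> z \<Longrightarrow> x \<noteq> 0 \<Longrightarrow> \<exists>n. x \<notin> {y * t ^ n | y. y \<in> z}"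
    and frac: "\<And>x. \<exists>a\<in>z. \<exists>b\<in>z. b \<noteq> 0 \<and> x = a / b"
  shows "discrete_place z"
proof -
  note Z = is_subringD[OF z]
  let ?U = "{x \<in> z. x \<noteq> 0 \<and> inverse x \<in> z}"
  have Mz: "max_ideal_at z = z - ?U" unfolding max_ideal_at_def Units_subring_rec[OF z] ..
  have Umult: "u * v \<in> ?U" if "u \<in> ?U" "v \<in> ?U" for u v using that Z by auto
  have Uinv: "inverse u \<in> ?U" if "u \<in> ?U" for u using that by auto
  have Upow: "u powi n \<in> ?U" if "u \<in> ?U" for u n
  proof (cases "n \<ge> 0")
    case True then show ?thesis using that Z(7) by (auto simp: power_int_def power_inverse[symmetric])
  next
    case False then show ?thesis using that Z(7) by (auto simp: power_int_def power_inverse[symmetric])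
  qed
  have tU: "t \<notin> ?U"
    using M Mz Z(2) t by (metis (mono_tags, lifting) DiffD2 mem_Collect_eq mult_1)
  have decomp_z: "\<exists>u\<in>?U. \<exists>n. x = u * t ^ n" if x: "x \<in> z" "x \<noteq> 0" for x
  proof -
    obtain y m where y: "y \<in> z" "y \<notin> {x * t | x. x \<in> z}" "x = y * t ^ m"
      using unit_times_power[OF x(1)] fin[OF x] by blast
    then have "y \<in> ?U" using y M Mz by blast
    then show ?thesis using y by blast
  qed
  have decomp: "\<exists>u\<in>?U. \<exists>n::int. x = u * t powi n" if x: "x \<noteq> 0" for x
  proof -
    obtain a b where ab: "a \<in> z" "b \<in> z" "b \<noteq> 0" "x = a / b" using frac by blast
    have "a \<noteq> 0" using ab x by auto
    obtain u n where u: "u \<in> ?U" "a = u * t ^ n" using decomp_z[OF ab(1) \<open>a \<noteq> 0\<close>] by blast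
    obtain v m where v: "v \<in> ?U" "b = v * t ^ m" using decomp_z[OF ab(2,3)] by blast
    have "x = (u * inverse v) * t powi (int n - int m)"
      using ab u v t by (simp add: power_int_diff field_simps)
    then show ?thesis using Umult[OF u(1) Uinv[OF v(1)]] by blast
  qed
  have tpow: "t powi n \<in> max_ideal_at z" if n: "n > 0" for n :: int
  proof -
    obtain m where "n = int (Suc m)" using n by (metis Suc_pred nat_0_le zero_less_nat_eq order_less_imp_le)
    then have "t powi n = t ^ m * t" by (simp add: power_int_def nat_add_distrib mult.commute)
    then show ?thesis using M Z(7)[OF t(1), of m] by blast
  qed
  have no_unit: "n = 0" if "t powi n \<in> ?U" for n :: int
  proof (rule ccontr)
    assume "n \<noteq> 0"
    then consider "n > 0" | "- n > 0" by linarith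
    then show False
    proof cases
      case 1 then show ?thesis using tpow that Mz by blast
    next
      case 2
      have "t powi (- n) \<in> ?U" using Uinv[OF that] by (simp add: power_int_minus)
      then show ?thesis using tpow[OF 2] Mz by blast
    qed
  qed
  have ord: "ord_at z (u * t powi n) = n" if u: "u \<in> ?U" for u n
    unfolding ord_at_def
  proof (rule the_equality)
    show "\<exists>s\<in>z. \<exists>v\<in>Units (subring_rec z). max_ideal_at z = PIdl\<^bsub>subring_rec z\<^esub> s \<and> u * t powi n = v * s powi n"
      unfolding Units_subring_rec[OF z] PIdl_subring_rec using u t(1) M by blast
  next
    fix m assume "\<exists>s\<in>z. \<exists>v\<in>Units (subring_rec z). max_ideal_at z = PIdl\<^bsub>subring_rec z\<^esub> s \<and> u * t powi n = v * s powi m"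
    then obtain s v where s: "s \<in> z" "v \<in> ?U" "max_ideal_at z = {x * s | x. x \<in> z}" "u * t powi n = v * s powi m"
      unfolding Units_subring_rec[OF z] PIdl_subring_rec by blast
    have "s \<in> max_ideal_at z" using s(3) Z(2) by (metis (mono_tags, lifting) mem_Collect_eq mult_1)
    then obtain w where w: "s = w * t" "w \<in> z" using M by blast
    have "t \<in> max_ideal_at z" using M Z(2) by (metis (mono_tags, lifting) mem_Collect_eq mult_1)
    then obtain w' where w': "t = w' * s" "w' \<in> z" using s(3) by blast
    have ww: "w' * w = 1" using w w' t(2) by (metis mult.assoc mult_cancel_right1)
    then have "inverse w = w'" by (metis inverse_unique mult.commute)
    then have wU: "w \<in> ?U" using w(2) w'(2) ww by auto
    have "u * t powi n = v * w powi m * t powi m" using s(4) w(1) by (simp add: power_int_mult_distrib)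
    then have "t powi (n - m) = v * w powi m * inverse u"
      using u t(2) by (simp add: power_int_diff field_simps)
    moreover have "v * w powi m * inverse u \<in> ?U" using Umult[OF Umult[OF s(2) Upow[OF wU]] Uinv[OF u]] .
    ultimately have "n - m = 0" using no_unit by metis
    then show "m = n" by simp
  qed
  have zmem: "x \<in> z \<longleftrightarrow> ord_at z x \<ge> 0" if x: "x \<noteq> 0" for x
  proof
    assume "x \<in> z"
    then obtain u n where u: "u \<in> ?U" "x = u * t ^ n" using decomp_z x by blast
    then show "ord_at z x \<ge> 0" using ord[OF u(1), of "int n"] by simp
  next
    assume o: "ord_at z x \<ge> 0"
    obtain u n where u: "u \<in> ?U" "x = u * t powi n" using decomp[OF x] by blast
    then have "n \<ge> 0" using ord o by simp
    then show "x \<in> z" using u Z t by (auto simp: power_int_def)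
  qed
  have mmem: "x \<in> max_ideal_at z \<longleftrightarrow> ord_at z x \<ge> 1" if x: "x \<noteq> 0" for x
  proof
    assume "x \<in> max_ideal_at z"
    then obtain y where y: "x = y * t" "y \<in> z" using M by blast
    then have "y \<noteq> 0" using x by auto
    then obtain u n where u: "u \<in> ?U" "y = u * t ^ n" using decomp_z y by blast
    then have "x = u * t powi (int n + 1)" using y t by (simp add: power_int_add)
    then show "ord_at z x \<ge> 1" using ord[OF u(1)] by simp
  next
    assume o: "ord_at z x \<ge> 1"
    obtain u n where u: "u \<in> ?U" "x = u * t powi n" using decomp[OF x] by blast
    then have n: "n \<ge> 1" using ord o by simp
    then obtain y where y: "t powi n = y * t" "y \<in> z" using tpow[of n] M by auto
    then show "x \<in> max_ideal_at z" using u y M Z(4) by (metis (mono_tags, lifting) mem_Collect_eq mult.assoc)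
  qed
  have 0: "0 \<in> max_ideal_at z" using M Z(1) by (metis (mono_tags, lifting) mem_Collect_eq mult_zero_left)
  have mult: "ord_at z (x * y) = ord_at z x + ord_at z y" if xy: "x \<noteq> 0" "y \<noteq> 0" for x y
  proof -
    obtain u n where u: "u \<in> ?U" "x = u * t powi n" using decomp[OF xy(1)] by blast
    obtain v m where v: "v \<in> ?U" "y = v * t powi m" using decomp[OF xy(2)] by blast
    have "x * y = (u * v) * t powi (n + m)" using u v t by (simp add: power_int_add)
    then have "ord_at z (x * y) = n + m" using ord[OF Umult[OF u(1) v(1)]] by metis
    then show ?thesis using ord[OF u(1), of n] ord[OF v(1), of m] u(2) v(2) by metis
  qed
  have add1: "ord_at z (x + y) \<ge> ord_at z x" if xy: "x \<noteq> 0" "y \<noteq> 0" "x + y \<noteq> 0" "ord_at z x \<le> ord_at z y" for x y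
  proof -
    have "y = x * (y / x)" using xy by simp
    then have "ord_at z y = ord_at z x + ord_at z (y / x)" using mult[of x "y / x"] xy by simp
    then have "y / x \<in> z" using zmem xy by simp
    then have "1 + y / x \<in> z" using Z by blast
    moreover have "1 + y / x \<noteq> 0" using xy by (simp add: field_simps)
    ultimately have "ord_at z (1 + y / x) \<ge> 0" using zmem by blast
    moreover have "x + y = x * (1 + y / x)" using xy by (simp add: field_simps)
    ultimately show ?thesis using mult[of x "1 + y / x"] xy \<open>1 + y / x \<noteq> 0\<close> by simp
  qed
  have add: "ord_at z (x + y) \<ge> min (ord_at z x) (ord_at z y)" if xy: "x \<noteq> 0" "y \<noteq> 0" "x + y \<noteq> 0" for x y
    using add1[of x y] add1[of y x] xy by (cases "ord_at z x \<le> ord_at z y") (auto simp: add.commute)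
  have "1 \<in> ?U" using Z by simp
  then have "ord_at z t = 1" using ord[of 1 1] by simp
  then have unif: "\<exists>t. t \<noteq> 0 \<and> ord_at z t = 1" using t(2) by blast
  have zeq: "z = {x. x = 0 \<or> ord_at z x \<ge> 0}"
  proof (rule Set.set_eqI)
    show "x \<in> z \<longleftrightarrow> x \<in> {x. x = 0 \<or> ord_at z x \<ge> 0}" for x
      using zmem[of x] Z(1) by (cases "x = 0") auto
  qed
  have Meq: "max_ideal_at z = {x. x = 0 \<or> ord_at z x \<ge> 1}"
  proof (rule Set.set_eqI)
    show "x \<in> max_ideal_at z \<longleftrightarrow> x \<in> {x. x = 0 \<or> ord_at z x \<ge> 1}" for x
      using mmem[of x] 0 by (cases "x = 0") auto
  qed
  show ?thesis unfolding discrete_place_def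
    by (intro conjI z zeq Meq unif allI impI) (use mult add in simp_all)
qed

(*PART P3b*)
lemma generated_algebra_eq_adjoins:
  assumes k: "is_subring k"
  shows "generated_algebra k (set xs) = adjoins k xs"
proof
  let ?R = "ring_of_type_algebra :: 'a ring"
  have r: "ring ?R" using ring_from_type_algebra .
  have sub: "is_subring (generated_algebra k (set xs))"
    unfolding generated_algebra_def using ring.generate_ring_is_subring[OF r] subring_iff_is_subring by auto
  have incl: "k \<union> set xs \<subseteq> generated_algebra k (set xs)"
    unfolding generated_algebra_def using ring.generate_ringE(2)[OF r, of "k \<union> set xs"] by auto
  show "generated_algebra k (set xs) \<subseteq> adjoins k xs"
    unfolding generated_algebra_def
    using is_subring_adjoins[OF k, of xs] adjoins_incl[OF k, of xs]
    by (intro ring.generate_ring_min_subring1[OF r]) (auto simp: subring_iff_is_subring)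
  show "adjoins k xs \<subseteq> generated_algebra k (set xs)" using incl by (intro adjoins_least sub) auto
qed

lemma affine_curve_ringD:
  assumes k: "is_subfield k" and R: "affine_curve_ring k R"
  shows "\<exists>xs. R = adjoins k xs" "is_subring R" "k \<subseteq> R"
    "\<And>x. \<exists>a\<in>R. \<exists>b\<in>R. b \<noteq> 0 \<and> x = a / b"
    "\<And>P. is_ideal R P \<Longrightarrow> P \<noteq> R \<Longrightarrow> (\<And>a b. a \<in> R \<Longrightarrow> b \<in> R \<Longrightarrow> a * b \<in> P \<Longrightarrow> a \<in> P \<or> b \<in> P) \<Longrightarrow>
       P \<noteq> {0} \<Longrightarrow> maximalideal P (subring_rec R)"
    "\<not> maximalideal {0} (subring_rec R)"
proof -
  have k': "is_subring k" using is_subfieldD(1)[OF k] .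
  note Rd = R[unfolded affine_curve_ring_def]
  note R1 = conjunct1[OF Rd] and f = conjunct1[OF conjunct2[OF Rd]]
    and R3 = conjunct1[OF conjunct2[OF conjunct2[OF Rd]]] and R4 = conjunct2[OF conjunct2[OF conjunct2[OF Rd]]]
  obtain S where S: "finite S" "R = generated_algebra k S" using R1 by (elim exE conjE)
  obtain xs where "set xs = S" using finite_list[OF S(1)] by blast
  then have xs: "R = adjoins k xs" using S generated_algebra_eq_adjoins[OF k'] by blast
  then show "\<exists>xs. R = adjoins k xs" by blast
  show sub: "is_subring R" using xs is_subring_adjoins[OF k'] by blast
  show "k \<subseteq> R" using xs adjoins_incl[OF k'] by blast
  show "\<exists>a\<in>R. \<exists>b\<in>R. b \<noteq> 0 \<and> x = a / b" for x
  proof -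
    have "x \<in> {a / b | a b. a \<in> R \<and> b \<in> R - {0}}" unfolding f ..
    then show ?thesis by blast
  qed
  show "maximalideal P (subring_rec R)" if "is_ideal R P" "P \<noteq> R"
    "\<And>a b. a \<in> R \<Longrightarrow> b \<in> R \<Longrightarrow> a * b \<in> P \<Longrightarrow> a \<in> P \<or> b \<in> P" "P \<noteq> {0}" for P
  proof -
    have "primeideal P (subring_rec R)" using that(1,2,3) by (subst primeideal_iff[OF sub]) simp
    then show ?thesis using R4 that(4) by simp
  qed
  show "\<not> maximalideal {0} (subring_rec R)"
    using R3 cring.zeromaximalideal_fieldI[OF cring_subring_rec[OF sub]] by auto
qed

lemma localization_props:
  assumes R: "is_subring R" and m: "maximalideal m (subring_rec R)"
    and z: "z = localization_at R m"
  shows "is_subring z" "R \<subseteq> z" "max_ideal_at z = {a / b | a b. a \<in> m \<and> b \<in> R - m}"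
    "R \<inter> max_ideal_at z = m"
proof -
  note RD = is_subringD[OF R] and mD = maximal_is_prime[OF R m]
  have mI: "m \<subseteq> R" "0 \<in> m" "\<And>x y. x \<in> m \<Longrightarrow> y \<in> m \<Longrightarrow> x + y \<in> m" "\<And>r x. r \<in> R \<Longrightarrow> x \<in> m \<Longrightarrow> r * x \<in> m"
    using mD(1) unfolding is_ideal_def by auto
  have memI: "a / b \<in> z" if "a \<in> R" "b \<in> R" "b \<notin> m" for a b
    unfolding z localization_at_def using that by blast
  have memE: "\<exists>a b. a \<in> R \<and> b \<in> R \<and> b \<notin> m \<and> b \<noteq> 0 \<and> x = a / b" if "x \<in> z" for x
    using that mI(2) unfolding z localization_at_def by blast
  have dm: "b * d \<notin> m" if "b \<in> R" "d \<in> R" "b \<notin> m" "d \<notin> m" for b d using mD(3) that by blast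
  show Rz: "R \<subseteq> z"
  proof
    fix x assume "x \<in> R" then show "x \<in> z" using memI[of x 1] RD(2) mD(2) by simp
  qed
  show sub: "is_subring z"
    unfolding is_subring_def
  proof (intro conjI ballI)
    show "0 \<in> z" "1 \<in> z" using Rz RD by auto
    fix x assume "x \<in> z"
    then obtain a b where x: "a \<in> R" "b \<in> R" "b \<notin> m" "b \<noteq> 0" "x = a / b" using memE by blast
    show "- x \<in> z" using memI[of "- a" b] x RD by simp
    fix y assume "y \<in> z"
    then obtain c d where y: "c \<in> R" "d \<in> R" "d \<notin> m" "d \<noteq> 0" "y = c / d" using memE by blast
    have "x + y = (a * d + c * b) / (b * d)" using x y by (simp add: field_simps)
    moreover have "a * d + c * b \<in> R" "b * d \<in> R" using x y RD by auto
    ultimately show "x + y \<in> z" using memI dm[OF x(2) y(2) x(3) y(3)] by simp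
    have "x * y = (a * c) / (b * d)" using x y by simp
    moreover have "a * c \<in> R" "b * d \<in> R" using x y RD by auto
    ultimately show "x * y \<in> z" using memI dm[OF x(2) y(2) x(3) y(3)] by simp
  qed
  show M: "max_ideal_at z = {a / b | a b. a \<in> m \<and> b \<in> R - m}"
  proof (intro Set.set_eqI iffI)
    fix x assume "x \<in> max_ideal_at z"
    then have x: "x \<in> z" "\<not> (x \<noteq> 0 \<and> inverse x \<in> z)"
      unfolding max_ideal_at_def Units_subring_rec[OF sub] by auto
    obtain a b where ab: "a \<in> R" "b \<in> R" "b \<notin> m" "b \<noteq> 0" "x = a / b" using memE[OF x(1)] by metis
    have "a \<in> m"
    proof (rule ccontr)
      assume "a \<notin> m"
      then have "b / a \<in> z" "a \<noteq> 0" using memI ab mI(2) by auto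
      then show False using x(2) ab by simp
    qed
    then show "x \<in> {a / b | a b. a \<in> m \<and> b \<in> R - m}" using ab by blast
  next
    fix x assume "x \<in> {a / b | a b. a \<in> m \<and> b \<in> R - m}"
    then obtain a b where ab: "a \<in> m" "b \<in> R" "b \<notin> m" "x = a / b" by blast
    have "x \<in> z" using memI ab mI by auto
    moreover have "\<not> (x \<noteq> 0 \<and> inverse x \<in> z)"
    proof
      assume h: "x \<noteq> 0 \<and> inverse x \<in> z"
      then obtain c d where cd: "c \<in> R" "d \<in> R" "d \<notin> m" "d \<noteq> 0" "inverse x = c / d" using memE[OF conjunct2[OF h]] by metis
      have "b * d = c * a" using h ab cd by (auto simp: field_simps)
      then show False using dm[OF ab(2) cd(2) ab(3) cd(3)] mI(4)[OF cd(1) ab(1)] by simp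
    qed
    ultimately show "x \<in> max_ideal_at z" unfolding max_ideal_at_def Units_subring_rec[OF sub] by blast
  qed
  show "R \<inter> max_ideal_at z = m"
  proof
    show "m \<subseteq> R \<inter> max_ideal_at z"
    proof
      fix x assume "x \<in> m"
      then have "x = x / 1 \<and> x \<in> m \<and> 1 \<in> R - m" using RD mD by simp
      then have "x \<in> max_ideal_at z" unfolding M by blast
      then show "x \<in> R \<inter> max_ideal_at z" using \<open>x \<in> m\<close> mI(1) by blast
    qed
    show "R \<inter> max_ideal_at z \<subseteq> m"
    proof
      fix x assume "x \<in> R \<inter> max_ideal_at z"
      then obtain a b where ab: "x \<in> R" "a \<in> m" "b \<in> R" "b \<notin> m" "x = a / b" unfolding M by blast
      have "b \<noteq> 0" using ab mI(2) by auto
      then have "x * b \<in> m" using ab by simp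
      then show "x \<in> m" using mD(3) ab by blast
    qed
  qed
qed

text \<open>The intersection of the powers of a principal maximal ideal is a prime ideal; in dimension one
  it vanishes, so that no noetherian hypothesis enters.\<close>

lemma closed_point_discrete_place:
  assumes k: "is_subfield k" and R: "affine_curve_ring k R" and m: "maximalideal m (subring_rec R)"
    and z: "z = localization_at R m" and princ: "principalideal (max_ideal_at z) (subring_rec z)"
  shows "discrete_place z"
proof -
  note RR = affine_curve_ringD[OF k R]
  note L = localization_props[OF RR(2) m z] and RD = is_subringD[OF RR(2)]
  note mD = maximal_is_prime[OF RR(2) m]
  note Z = is_subringD[OF L(1)]
  note cr = cring_subring_rec[OF L(1)]
  obtain t where t: "t \<in> z" "max_ideal_at z = genideal (subring_rec z) {t}"
    using principalideal.generate[OF princ] by auto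
  have M: "max_ideal_at z = {x * t | x. x \<in> z}"
    using t cring.cgenideal_eq_genideal[OF cr, of t] PIdl_subring_rec[of z t] by simp
  have "m \<noteq> {0}" using m RR(6) by metis
  moreover have "0 \<in> m" using mD(1) unfolding is_ideal_def by blast
  ultimately obtain a where "a \<in> m" "a \<noteq> 0" by blast
  then have "a \<in> max_ideal_at z" using L(4) by blast
  then have t0: "t \<noteq> 0" using M \<open>a \<noteq> 0\<close> by auto
  have tnu: "1 \<notin> {x * t | x. x \<in> z}"
  proof
    assume "1 \<in> {x * t | x. x \<in> z}"
    then have "1 \<in> R \<inter> max_ideal_at z" using M RD by auto
    then show False using L(4) mD(2) by simp
  qed
  have Mmult: "x * y \<notin> {x * t | x. x \<in> z}" if "x \<in> z" "y \<in> z" "x \<notin> {x * t | x. x \<in> z}" "y \<notin> {x * t | x. x \<in> z}" for x y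
  proof -
    have U: "x \<noteq> 0 \<and> inverse x \<in> z" if "x \<in> z" "x \<notin> {x * t | x. x \<in> z}" for x
      using that M unfolding max_ideal_at_def Units_subring_rec[OF L(1)] by blast
    have "x * y \<in> Units (subring_rec z)"
      unfolding Units_subring_rec[OF L(1)] using U[OF that(1,3)] U[OF that(2,4)] that Z(4) by auto
    then show ?thesis using M unfolding max_ideal_at_def by blast
  qed
  define I where "I n = {y * t ^ n | y. y \<in> z}" for n
  have I_ideal: "is_ideal z (I n)" for n
    unfolding is_ideal_def
  proof (intro conjI ballI)
    show "I n \<subseteq> z" unfolding I_def using Z t by auto
    show "0 \<in> I n" unfolding I_def using Z(1) by (intro CollectI exI[of _ 0]) simp
    fix x assume "x \<in> I n" then obtain a where a: "x = a * t ^ n" "a \<in> z" unfolding I_def by blast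
    {
      fix y assume "y \<in> I n" then obtain b where b: "y = b * t ^ n" "b \<in> z" unfolding I_def by blast
      have "x + y = (a + b) * t ^ n" "a + b \<in> z" using a b Z by (auto simp: algebra_simps)
      then show "x + y \<in> I n" unfolding I_def by blast
    }
    fix r assume "r \<in> z"
    then have "r * x = (r * a) * t ^ n" "r * a \<in> z" using a Z by auto
    then show "r * x \<in> I n" unfolding I_def by blast
  qed
  have IP: "0 \<in> I n" "\<And>x y. x \<in> I n \<Longrightarrow> y \<in> I n \<Longrightarrow> x + y \<in> I n"
    "\<And>r x. r \<in> z \<Longrightarrow> x \<in> I n \<Longrightarrow> r * x \<in> I n" for n
    using I_ideal[of n] unfolding is_ideal_def by auto
  have fin: "\<exists>n. x \<notin> I n" if x: "x \<in> z" "x \<noteq> 0" for x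
  proof (rule ccontr)
    assume "\<not> (\<exists>n. x \<notin> I n)"
    then have xP: "\<And>n. x \<in> I n" by blast
    define Q where "Q = {a \<in> R. \<forall>n. a \<in> I n}"
    have Qi: "is_ideal R Q"
      using RD subsetD[OF L(2)] by (auto simp: Q_def is_ideal_def IP)
    have "I 1 = max_ideal_at z" unfolding I_def M by simp
    then have Qm: "Q \<subseteq> m" using L(4) unfolding Q_def by blast
    then have "Q \<noteq> R" using mD(2) RD(2) by blast
    obtain a b where ab: "a \<in> R" "b \<in> R" "b \<notin> m" "x = a / b"
      using x(1) unfolding z localization_at_def by (elim CollectE exE conjE DiffE) metis
    have b0: "b \<noteq> 0" using ab(3) \<open>0 \<in> m\<close> by blast
    have "a = b * x" using ab b0 by simp
    then have "a \<in> Q" using xP IP(3)[of b x] ab(1,2) L(2) by (auto simp: Q_def)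
    moreover have "a \<noteq> 0" using ab x b0 by auto
    ultimately have "Q \<noteq> {0}" by blast
    have prime: "a \<in> Q \<or> b \<in> Q" if "a \<in> R" "b \<in> R" "a * b \<in> Q" for a b
    proof (rule ccontr)
      assume n: "\<not> (a \<in> Q \<or> b \<in> Q)"
      have "a \<in> z" "b \<in> z" using that L(2) by auto
      have na: "\<exists>n. a \<notin> {y * t ^ n | y. y \<in> z}" and nb: "\<exists>n. b \<notin> {y * t ^ n | y. y \<in> z}"
        using n that(1,2) unfolding Q_def I_def by simp_all
      obtain u i where u: "u \<in> z" "u \<notin> {x * t | x. x \<in> z}" "a = u * t ^ i"
        using unit_times_power[OF \<open>a \<in> z\<close> na] by blast
      obtain v j where v: "v \<in> z" "v \<notin> {x * t | x. x \<in> z}" "b = v * t ^ j"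
        using unit_times_power[OF \<open>b \<in> z\<close> nb] by blast
      have "a * b \<in> I (Suc (i + j))" using that(3) unfolding Q_def by blast
      then obtain y where y: "a * b = y * t ^ Suc (i + j)" "y \<in> z" unfolding I_def by blast
      have "(u * v) * t ^ (i + j) = (y * t) * t ^ (i + j)" using y u v by (simp add: power_add algebra_simps)
      then have "u * v = y * t" using t0 by simp
      then show False using Mmult[OF u(1) v(1) u(2) v(2)] y(2) by blast
    qed
    have "maximalideal Q (subring_rec R)"
      using RR(5)[OF Qi \<open>Q \<noteq> R\<close> prime \<open>Q \<noteq> {0}\<close>] by blast
    then have "Q = m" using Qm mD(1) m maximalideal_iff[OF RR(2)] by metis
    have "t \<in> max_ideal_at z" using M Z(2) by (metis (mono_tags, lifting) mem_Collect_eq mult_1)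
    then obtain c d where cd: "c \<in> m" "d \<in> R" "d \<notin> m" "t = c / d" unfolding L(3) by blast
    have "c \<in> I 2" using cd(1) \<open>Q = m\<close> unfolding Q_def by blast
    then obtain y where y: "c = y * t ^ 2" "y \<in> z" unfolding I_def by blast
    have d0: "d \<noteq> 0" using cd(3) \<open>0 \<in> m\<close> by blast
    have "1 / d \<in> z" using cd RD z unfolding localization_at_def by blast
    then have "y * (1 / d) \<in> z" using y Z by blast
    moreover have "1 = (y * (1 / d)) * t"
    proof -
      have "d * t = c" using cd(4) d0 by simp
      then have "d * t = (y * t) * t" unfolding y(1) by (simp only: power2_eq_square mult.assoc)
      then have "d = y * t" using t0 by simp
      then show ?thesis using d0 by simp
    qed
    ultimately show False using tnu by blast
  qed
  have frac: "\<exists>a\<in>z. \<exists>b\<in>z. b \<noteq> 0 \<and> x = a / b" for x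
  proof -
    obtain a b where "a \<in> R" "b \<in> R" "b \<noteq> 0" "x = a / b" using RR(4)[of x] by blast
    then show ?thesis using L(2) by blast
  qed
  show ?thesis
    using discrete_place_from_uniformizer[OF L(1) t(1) t0 M _ frac] fin unfolding I_def by blast
qed

(*PART P3c*)
abbreviation rota :: "'a::field ring" where "rota \<equiv> ring_of_type_algebra"

lemma eval_rota: "ring.eval rota p x = poly (Poly (rev p)) x"
proof (induction p)
  case Nil
  then show ?case by (simp add: ring.eval.simps[OF ring_from_type_algebra])
next
  case (Cons a p)
  have pow: "x [^]\<^bsub>rota\<^esub> n = x ^ n" for n :: nat
    by (induction n) (simp_all add: mult.commute)
  show ?case
    by (simp add: ring.eval.simps[OF ring_from_type_algebra] Cons Poly_append pow poly_monom mult.commute add.commute)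
qed

lemma transc_over_iff_transcendental:
  assumes F: "is_subring F"
  shows "transc_over F x \<longleftrightarrow> ring.transcendental rota F x"
proof
  assume tr: "transc_over F x"
  show "ring.transcendental rota F x"
  proof (rule ccontr)
    assume "\<not> ring.transcendental rota F x"
    then have alg: "(ring.algebraic rota over F) x" unfolding over_def .
    have dom: "domain rota" using field_from_type_algebra Ring.field.axioms(1) by blast
    obtain p where p: "p \<in> carrier (F[X]\<^bsub>rota\<^esub>)" "p \<noteq> []" "ring.eval rota p x = 0"
      using domain.algebraicE[OF dom _ _ alg] F subring_iff_is_subring by auto
    have pl: "set p \<subseteq> F" "hd p \<noteq> 0" using p(1,2) by (auto simp: univ_poly_def polynomial_def)
    have "poly_over F (Poly (rev p))"
      unfolding poly_over_def coeff_Poly_eq nth_default_def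
      using is_subringD(1)[OF F] by (auto simp: rev_nth intro!: subsetD[OF pl(1)] nth_mem)
    then have "Poly (rev p) = 0" using tr p(3) unfolding transc_over_def eval_rota by blast
    then have "coeff (Poly (rev p)) (length p - 1) = 0" by simp
    then show False using pl(2) p(2) by (simp add: nth_default_def rev_nth hd_conv_nth)
  qed
next
  assume tr: "ring.transcendental rota F x"
  show "transc_over F x"
    unfolding transc_over_def
  proof (intro allI impI)
    fix p assume p: "poly_over F p \<and> poly p x = 0"
    show "p = 0"
    proof (rule ccontr)
      assume p0: "p \<noteq> 0"
      let ?l = "rev (coeffs p)"
      have "set ?l \<subseteq> F" using p unfolding poly_over_def by (auto simp: coeffs_def)
      moreover have "hd ?l \<noteq> 0" using p0 by (simp add: hd_rev last_coeffs_eq_coeff_degree)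
      ultimately have c: "?l \<in> carrier (F[X]\<^bsub>rota\<^esub>)" by (auto simp: univ_poly_def polynomial_def)
      have n: "[] \<in> carrier (F[X]\<^bsub>rota\<^esub>)" by (auto simp: univ_poly_def polynomial_def)
      have "ring.eval rota ?l x = ring.eval rota [] x"
        unfolding eval_rota using p by simp
      then have "?l = []" using tr c n unfolding ring.transcendental_def[OF ring_from_type_algebra] inj_on_def by blast
      then show False using p0 by simp
    qed
  qed
qed

definition fractions :: "'a::field set \<Rightarrow> 'a set" where
  "fractions B = {a / b | a b. a \<in> B \<and> b \<in> B \<and> b \<noteq> 0}"

lemma fractions_subfield:
  assumes B: "is_subring B"
  shows "is_subfield (fractions B)" "B \<subseteq> fractions B"
proof -
  note BD = is_subringD[OF B]
  have I: "a / b \<in> fractions B" if "a \<in> B" "b \<in> B" "b \<noteq> 0" for a b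
    using that unfolding fractions_def by blast
  show sub: "B \<subseteq> fractions B" using I[OF _ BD(2)] by force
  show "is_subfield (fractions B)"
    unfolding is_subfield_def is_subring_def
  proof (intro conjI ballI)
    show "0 \<in> fractions B" "1 \<in> fractions B" using sub BD by auto
    fix x assume "x \<in> fractions B"
    then obtain a b where x: "a \<in> B" "b \<in> B" "b \<noteq> 0" "x = a / b" unfolding fractions_def by blast
    show "- x \<in> fractions B" using I[of "- a" b] x BD by simp
    show "inverse x \<in> fractions B"
    proof (cases "a = 0")
      case True then show ?thesis using x sub BD by auto
    next
      case False then show ?thesis using I[of b a] x by simp
    qed
    fix y assume "y \<in> fractions B"
    then obtain c d where y: "c \<in> B" "d \<in> B" "d \<noteq> 0" "y = c / d" unfolding fractions_def by blast
    have "x + y = (a * d + c * b) / (b * d)" using x y by (simp add: field_simps)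
    then show "x + y \<in> fractions B" using I[of "a * d + c * b" "b * d"] x y BD by simp
    have "x * y = (a * c) / (b * d)" using x y by simp
    then show "x * y \<in> fractions B" using I[of "a * c" "b * d"] x y BD by simp
  qed
qed

lemma codim_le_fractions:
  assumes B: "is_subring B" and le: "codim_le (fractions B) V {0} n"
  shows "codim_le B V {0} n"
  unfolding codim_le_def
proof (intro allI impI)
  note BD = is_subringD[OF B]
  fix f :: "nat \<Rightarrow> 'a" assume "\<forall>i\<le>n. f i \<in> V"
  then obtain c where c: "\<forall>i\<le>n. c i \<in> fractions B" "\<exists>i\<le>n. c i \<noteq> 0" "(\<Sum>i\<le>n. c i * f i) = 0"
    using le unfolding codim_le_def by blast
  have "\<forall>i\<in>{..n}. \<exists>ab. fst ab \<in> B \<and> snd ab \<in> B \<and> snd ab \<noteq> 0 \<and> c i = fst ab / snd ab"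
    using c(1) unfolding fractions_def by fastforce
  then obtain ab where ab: "\<And>i. i \<le> n \<Longrightarrow> fst (ab i) \<in> B \<and> snd (ab i) \<in> B \<and> snd (ab i) \<noteq> 0 \<and> c i = fst (ab i) / snd (ab i)"
    by (subst (asm) bchoice_iff) auto
  define d where "d = (\<Prod>i\<le>n. snd (ab i))"
  have d0: "d \<noteq> 0" using ab by (auto simp: d_def)
  have dc: "d * c i \<in> B" if i: "i \<le> n" for i
  proof -
    have "d = snd (ab i) * (\<Prod>j\<in>{..n} - {i}. snd (ab j))"
      unfolding d_def using i by (simp add: prod.remove)
    then have "d * c i = fst (ab i) * (\<Prod>j\<in>{..n} - {i}. snd (ab j))" using ab[OF i] by simp
    also have "\<dots> \<in> B" using ab i by (intro BD(4) BD(9)) auto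
    finally show ?thesis .
  qed
  have "(\<Sum>i\<le>n. d * c i * f i) = d * (\<Sum>i\<le>n. c i * f i)" by (simp add: sum_distrib_left mult.assoc)
  then show "\<exists>c. (\<forall>i\<le>n. c i \<in> B) \<and> (\<exists>i\<le>n. c i \<noteq> 0) \<and> (\<Sum>i\<le>n. c i * f i) \<in> {0}"
    using c dc d0 by (intro exI[of _ "\<lambda>i. d * c i"]) auto
qed

lemma combine_rota: "length Ks = length Us \<Longrightarrow> ring.combine rota Ks Us = (\<Sum>i<length Us. Ks ! i * Us ! i)"
proof (induction Ks Us rule: list_induct2)
  case Nil then show ?case by (simp add: ring.combine.simps[OF ring_from_type_algebra])
next
  case (Cons x xs y ys)
  then show ?case by (simp add: ring.combine.simps[OF ring_from_type_algebra] sum.lessThan_Suc_shift del: sum.lessThan_Suc)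
qed

lemma codim_le_finite_dimension:
  assumes F: "is_subfield F" and fd: "ring.finite_dimension rota F UNIV"
  shows "\<exists>n. codim_le F UNIV {0} n"
proof -
  have sf: "subfield F rota" using F subfield_iff_is_subfield by blast
  obtain n where "ring.dimension rota n F UNIV"
    using fd ring.finite_dimension_def[OF ring_from_type_algebra] by blast
  from ring.exists_base[OF ring_from_type_algebra sf this]
  obtain Vs where Vs: "length Vs = n" "ring.Span rota F Vs = UNIV" by blast
  have "codim_le F UNIV {0} n"
  proof (rule codim_le_spanned[OF F])
    show "submodule_over F {0}" by (simp add: submodule_over_def)
    fix v :: 'a
    have "v \<in> ring.Span rota F Vs" using Vs by simp
    then obtain Ks where Ks: "set Ks \<subseteq> F" "length Ks = length Vs" "v = ring.combine rota Ks Vs"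
      using ring.Span_mem_iff_length_version[OF ring_from_type_algebra sf, of Vs v] by auto
    then have "v = (\<Sum>i<n. Ks ! i * Vs ! i)" using combine_rota[OF Ks(2)] Vs by simp
    then show "\<exists>c. (\<forall>i<n. c i \<in> F) \<and> v - (\<Sum>i<n. c i * Vs ! i) \<in> {0}"
      using Ks Vs by (intro exI[of _ "\<lambda>i. Ks ! i"]) auto
  qed
  then show ?thesis by blast
qed

lemma finite_over_fractions_of_algebraic_generators:
  assumes B: "is_subring B" and k: "is_subring k" "k \<subseteq> B" and alg: "\<And>y. y \<in> set xs \<Longrightarrow> \<not> transc_over B y"
    and frac: "\<And>x. \<exists>a\<in>adjoins k xs. \<exists>b\<in>adjoins k xs. b \<noteq> 0 \<and> x = a / b"
  shows "ring.finite_dimension rota (fractions B) UNIV"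
proof -
  note F = fractions_subfield[OF B]
  have sf: "subfield (fractions B) rota" using F(1) subfield_iff_is_subfield by blast
  have dom: "domain rota" using field_from_type_algebra Ring.field.axioms(1) by blast
  have alg': "(ring.algebraic rota over fractions B) y" if "y \<in> set xs" for y
  proof -
    have "\<not> transc_over (fractions B) y"
      using alg[OF that] F(2) unfolding transc_over_def poly_over_def by blast
    then show ?thesis using transc_over_iff_transcendental[OF is_subfieldD(1)[OF F(1)]] by (simp add: over_def)
  qed
  let ?E = "ring.finite_extension rota (fractions B) xs"
  have fd: "ring.finite_dimension rota (fractions B) ?E"
    using domain.finite_extension_finite_dimension(1)[OF dom sf _ alg'] by simp
  have "subfield ?E rota"
    using domain.finite_extension_is_subfield[OF dom sf _ alg'] by simp
  then have E: "is_subfield ?E" using subfield_iff_is_subfield by blast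
  have "set xs \<subseteq> ?E" using domain.finite_extension_mem[OF dom subfieldE(1)[OF sf]] by simp
  moreover have "fractions B \<subseteq> ?E" using ring.finite_extension_incl[OF ring_from_type_algebra, of "fractions B" xs] by simp
  ultimately have "adjoins k xs \<subseteq> ?E" using F(2) k by (intro adjoins_least is_subfieldD(1)[OF E]) auto
  then have "?E = UNIV" using frac is_subfieldD(3)[OF E] by (metis UNIV_eq_I subsetD)
  then show ?thesis using fd by simp
qed

lemma transc_exchange:
  assumes k: "is_subfield k" and t: "transc_over k t" and le: "codim_le (adjoin k t0) UNIV {0} n"
  shows "\<not> transc_over (adjoin k t) t0"
proof
  assume tr: "transc_over (adjoin k t) t0"
  have k': "is_subring k" using is_subfieldD(1)[OF k] .
  note B = is_subring_adjoin[OF k', of t]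
  obtain c where c: "\<forall>i\<le>n. c i \<in> adjoin k t0" "\<exists>i\<le>n. c i \<noteq> 0" "(\<Sum>i\<le>n. c i * t ^ i) = 0"
    using le unfolding codim_le_def by (metis UNIV_I singletonD)
  have "\<forall>i\<in>{..n}. \<exists>p. poly_over k p \<and> c i = poly p t0" using c(1) unfolding adjoin_def by blast
  then obtain p where p: "\<And>i. i \<le> n \<Longrightarrow> poly_over k (p i) \<and> c i = poly (p i) t0"
    by (subst (asm) bchoice_iff) auto
  define Q where "Q = (\<Sum>i\<le>n. smult (t ^ i) (p i))"
  have "poly Q t0 = (\<Sum>i\<le>n. c i * t ^ i)" using p by (simp add: Q_def poly_sum mult.commute)
  moreover have "poly_over (adjoin k t) Q"
    unfolding Q_def
  proof (intro poly_over_ring[OF B])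
    fix i assume "i \<in> {..n}"
    then show "t ^ i \<in> adjoin k t" "poly_over (adjoin k t) (p i)"
      using p[of i] adjoin_incl[OF k', of t] is_subringD(7)[OF B] unfolding poly_over_def by auto
  qed
  ultimately have "Q = 0" using tr c(3) unfolding transc_over_def by simp
  have "p i = 0" if i: "i \<le> n" for i
  proof (rule poly_eqI)
    fix j
    define q where "q = (\<Sum>i\<le>n. monom (coeff (p i) j) i)"
    have "poly q t = coeff Q j"
      by (simp add: q_def Q_def poly_sum coeff_sum poly_monom mult.commute)
    moreover have "poly_over k q"
      unfolding q_def using p by (intro poly_over_ring(8,11)[OF k']) (auto simp: poly_over_def)
    ultimately have "q = 0" using t \<open>Q = 0\<close> unfolding transc_over_def by simp
    moreover have "coeff q i = coeff (p i) j" unfolding q_def coeff_sum using i by (simp add: sum.delta)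
    ultimately show "coeff (p i) j = coeff 0 j" by simp
  qed
  then show False using c(2) p by fastforce
qed

text \<open>A field that is finite over \<open>k(t\<^sub>0)\<close> is finite over \<open>k(t)\<close> for every other
  transcendental \<open>t\<close>.\<close>

lemma finite_over_other_transcendental:
  assumes k: "is_subfield k" and t: "transc_over k t"
    and fd: "ring.finite_dimension rota (fractions (adjoin k t0)) UNIV"
  shows "\<exists>n. codim_le (adjoin k t) UNIV {0} n"
proof -
  have r: "ring rota" using ring_from_type_algebra .
  have dom: "domain rota" using field_from_type_algebra Ring.field.axioms(1) by blast
  have k': "is_subring k" using is_subfieldD(1)[OF k] .
  note B0 = is_subring_adjoin[OF k', of t0] and B = is_subring_adjoin[OF k', of t]
  note F0 = fractions_subfield[OF B0] and F = fractions_subfield[OF B]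
  have sf: "subfield (fractions (adjoin k t)) rota" and sf0: "subfield (fractions (adjoin k t0)) rota"
    using F(1) F0(1) subfield_iff_is_subfield by blast+
  obtain n where "codim_le (adjoin k t0) UNIV {0} n"
    using codim_le_fractions[OF B0] codim_le_finite_dimension[OF F0(1) fd] by blast
  then have "\<not> transc_over (adjoin k t) t0" using transc_exchange[OF k t] by blast
  then have "\<not> transc_over (fractions (adjoin k t)) t0"
    using F(2) unfolding transc_over_def poly_over_def by blast
  then have alg: "(ring.algebraic rota over fractions (adjoin k t)) t0"
    using transc_over_iff_transcendental[OF is_subfieldD(1)[OF F(1)]] by (simp add: over_def)
  let ?F' = "ring.finite_extension rota (fractions (adjoin k t)) [t0]"
  have fd': "ring.finite_dimension rota (fractions (adjoin k t)) ?F'"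
    using domain.finite_extension_finite_dimension(1)[OF dom sf, of "[t0]"] alg by auto
  have sf': "subfield ?F' rota"
    using domain.finite_extension_is_subfield[OF dom sf, of "[t0]"] alg by auto
  then have F': "is_subfield ?F'" using subfield_iff_is_subfield by blast
  have t0: "t0 \<in> ?F'" using domain.finite_extension_mem[OF dom subfieldE(1)[OF sf], of "[t0]"] by simp
  have "fractions (adjoin k t) \<subseteq> ?F'"
    using ring.finite_extension_incl[OF r, of "fractions (adjoin k t)" "[t0]"] by simp
  then have "k \<subseteq> ?F'" using F(2) adjoin_incl(1)[OF k', of t] by blast
  then have "adjoin k t0 \<subseteq> ?F'" using t0 by (intro adjoin_least is_subfieldD(1)[OF F'])
  then have F0F': "fractions (adjoin k t0) \<subseteq> ?F'"
    unfolding fractions_def[of "adjoin k t0"] using is_subfieldD(3)[OF F'] by auto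
  obtain m where "ring.dimension rota m (fractions (adjoin k t0)) UNIV"
    using fd ring.finite_dimension_def[OF r] by blast
  from ring.exists_base[OF r sf0 this]
  obtain Vs where Vs: "ring.Span rota (fractions (adjoin k t0)) Vs = UNIV" by blast
  have "v \<in> ring.Span rota ?F' Vs" for v
  proof -
    have "v \<in> ring.Span rota (fractions (adjoin k t0)) Vs" using Vs by simp
    then obtain Ks where Ks: "set Ks \<subseteq> fractions (adjoin k t0)" "v = ring.combine rota Ks Vs"
      using ring.Span_eq_combine_set[OF r sf0, of Vs] by auto
    have "set Ks \<subseteq> ?F'" using Ks(1) F0F' by (rule subset_trans)
    moreover have "set Vs \<subseteq> carrier rota" by simp
    ultimately show ?thesis using ring.Span_eq_combine_set[OF r sf'] Ks(2) by blast
  qed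
  then have "ring.Span rota ?F' Vs = UNIV" by blast
  then have "ring.finite_dimension rota ?F' UNIV"
    using ring.Span_finite_dimension[OF r sf', of Vs] by simp
  then have "ring.finite_dimension rota (fractions (adjoin k t)) UNIV"
    using ring.telescopic_base_dim(1)[OF r sf sf' fd'] by blast
  then show ?thesis using codim_le_fractions[OF B] codim_le_finite_dimension[OF F(1)] by blast
qed

(*PART P3d*)
text \<open>What the theory of divisors below uses of a regular curve: its closed points are discrete
  valuation rings containing \<open>k\<close>, and the function field has transcendence degree one over \<open>k\<close>,
  in which \<open>k\<close> is algebraically closed.\<close>

locale places =
  fixes k :: "'K::field set" and C :: "'K set set"
  assumes k: "is_subfield k"
    and place: "\<And>z. z \<in> C \<Longrightarrow> discrete_place z"
    and k_place: "\<And>z. z \<in> C \<Longrightarrow> k \<subseteq> z"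
    and transc: "\<And>t. t \<notin> k \<Longrightarrow> transc_over k t"
    and finite_over: "\<And>t. t \<notin> k \<Longrightarrow> \<exists>n. codim_le (adjoin k t) UNIV {0} n"
    and k_not_UNIV: "k \<noteq> UNIV"

lemma kernel_maximal:
  assumes k: "is_subfield k" and R: "affine_curve_ring k R"
    and h: "ring_hom_on R h" and w: "w \<in> R" "w \<noteq> 0" "h w = 0" and y: "y \<in> R" "h y \<noteq> 0"
  shows "\<exists>z\<in>R. h y * h z = 1"
proof -
  note RR = affine_curve_ringD[OF k R] and RD = is_subringD[OF affine_curve_ringD(2)[OF k R]]
  note H = ring_hom_onD[OF h RR(2)]
  define P where "P = {x \<in> R. h x = 0}"
  have "is_ideal R P" using RD H by (auto simp: P_def is_ideal_def)
  moreover have "P \<noteq> R" using y by (auto simp: P_def)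
  moreover have "a \<in> P \<or> b \<in> P" if "a \<in> R" "b \<in> R" "a * b \<in> P" for a b
    using that H by (auto simp: P_def)
  moreover have "P \<noteq> {0}" using w by (auto simp: P_def)
  ultimately have "maximalideal P (subring_rec R)" using RR(5) by blast
  from maximal_is_prime(4)[OF RR(2) this y(1)] obtain b where b: "b \<in> R" "1 - b * y \<in> P"
    using y by (auto simp: P_def)
  have "h (1 - b * y) + h (b * y) = h 1"
    using H(3)[of "1 - b * y" "b * y"] b y RD by simp
  then have "h b * h y = 1" using b y H RD by (simp add: P_def)
  then show ?thesis using b by (intro bexI[of _ b]) (simp add: mult.commute)
qed

lemma regular_curve_places:
  assumes C: "regular_curve k C" and ac: "alg_closed_in_type k"
  shows "places k C"
proof -
  have k: "is_subfield k" using C subfield_iff_is_subfield unfolding regular_curve_def by blast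
  have k': "is_subring k" using is_subfieldD(1)[OF k] .
  have tr: "transc_over k t" if "t \<notin> k" for t
    using ac that transc_over_iff_transcendental[OF k'] unfolding alg_closed_in_type_def by blast
  obtain \<R> where \<R>: "\<R> \<noteq> {}" "\<forall>R\<in>\<R>. affine_curve_ring k R" "C = (\<Union>R\<in>\<R>. closed_points R)"
    using C unfolding regular_curve_def by (elim conjE exE)
  have pl: "discrete_place z \<and> k \<subseteq> z" if z: "z \<in> C" for z
  proof -
    obtain R where R: "R \<in> \<R>" "z \<in> closed_points R" using z \<R>(3) by blast
    then obtain m where m: "z = localization_at R m" "maximalideal m (subring_rec R)"
      unfolding closed_points_def by blast
    have Rc: "affine_curve_ring k R" using R \<R> by blast
    have "principalideal (max_ideal_at z) (subring_rec z)"
      using C z unfolding regular_curve_def by blast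
    then show ?thesis
      using closed_point_discrete_place[OF k Rc m(2,1)] localization_props(2)[OF _ m(2,1)]
        affine_curve_ringD(2,3)[OF k Rc] by blast
  qed
  obtain R where R: "affine_curve_ring k R" using \<R> by blast
  note RR = affine_curve_ringD[OF k R]
  obtain xs where xs: "R = adjoins k xs" using RR(1) by blast
  have "\<not> R \<subseteq> k"
  proof
    assume "R \<subseteq> k"
    then have "R = k" using RR(3) by blast
    have "maximalideal {0} (subring_rec R)"
      unfolding maximalideal_iff[OF RR(2)]
    proof (intro conjI allI impI)
      show "is_ideal R {0}" using is_subringD(1)[OF RR(2)] by (auto simp: is_ideal_def)
      show "{0} \<noteq> R" using is_subringD(2)[OF RR(2)] by auto
      fix J assume J: "is_ideal R J \<and> {0} \<subseteq> J"
      show "J = {0} \<or> J = R"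
      proof (cases "J = {0}")
        case False
        then obtain x where x: "x \<in> J" "x \<noteq> 0" using J by blast
        have "x \<in> R" using x J unfolding is_ideal_def by blast
        then have "inverse x \<in> R" using \<open>R = k\<close> is_subfieldD(2)[OF k] by blast
        have "y \<in> J" if "y \<in> R" for y
        proof -
          have "(y * inverse x) * x \<in> J"
            using J x that \<open>inverse x \<in> R\<close> is_subringD(4)[OF RR(2)] unfolding is_ideal_def by blast
          then show ?thesis using x by (simp add: mult.assoc)
        qed
        then show ?thesis using J unfolding is_ideal_def by blast
      qed simp
    qed
    then show False using RR(6) by blast
  qed
  then obtain t0 where t0: "t0 \<in> R" "t0 \<notin> k" by blast
  have alg: "\<not> transc_over (adjoin k t0) y" if "y \<in> R" for y
    by (rule dim_one_algebraic[OF k xs _ t0(1) tr[OF t0(2)] that]) (rule kernel_maximal[OF k R]; assumption)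
  have setxs: "set xs \<subseteq> R" using adjoins_incl[OF k'] xs by blast
  have fr: "\<And>x. \<exists>a\<in>adjoins k xs. \<exists>b\<in>adjoins k xs. b \<noteq> 0 \<and> x = a / b" using RR(4) xs by simp
  have fd: "ring.finite_dimension rota (fractions (adjoin k t0)) UNIV"
    using finite_over_fractions_of_algebraic_generators[OF is_subring_adjoin[OF k'] k' adjoin_incl(1)[OF k'], of xs t0]
      alg setxs fr by blast
  show ?thesis
  proof
    show "is_subfield k" using k .
    show "discrete_place z" "k \<subseteq> z" if "z \<in> C" for z using pl that by auto
    show "transc_over k t" "\<exists>n. codim_le (adjoin k t) UNIV {0} n" if "t \<notin> k" for t
      using tr[OF that] finite_over_other_transcendental[OF k tr[OF that] fd] by auto
    show "k \<noteq> UNIV" using t0 by blast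
  qed
qed

(*PART P4a*)
definition vge :: "'K::field set \<Rightarrow> int \<Rightarrow> 'K \<Rightarrow> bool" where
  "vge z n x \<longleftrightarrow> x = 0 \<or> ord_at z x \<ge> n"

lemma discrete_placeD:
  assumes "discrete_place z"
  shows "is_subring z" "\<And>x y. x \<noteq> 0 \<Longrightarrow> y \<noteq> 0 \<Longrightarrow> ord_at z (x * y) = ord_at z x + ord_at z y"
    "\<And>x y. x \<noteq> 0 \<Longrightarrow> y \<noteq> 0 \<Longrightarrow> x + y \<noteq> 0 \<Longrightarrow> ord_at z (x + y) \<ge> min (ord_at z x) (ord_at z y)"
    "\<exists>t. t \<noteq> 0 \<and> ord_at z t = 1"
    "\<And>x. x \<in> z \<longleftrightarrow> vge z 0 x" "\<And>x. x \<in> max_ideal_at z \<longleftrightarrow> vge z 1 x"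
proof -
  note d1 = assms[unfolded discrete_place_def]
  note d2 = conjunct2[OF d1] note d3 = conjunct2[OF d2] note d4 = conjunct2[OF d3] note d5 = conjunct2[OF d4]
  show "is_subring z" using conjunct1[OF d1] .
  show "ord_at z (x * y) = ord_at z x + ord_at z y" if "x \<noteq> 0" "y \<noteq> 0" for x y
    using conjunct1[OF d2] that by simp
  show "ord_at z (x + y) \<ge> min (ord_at z x) (ord_at z y)" if "x \<noteq> 0" "y \<noteq> 0" "x + y \<noteq> 0" for x y
    using conjunct1[OF d3] that by simp
  show "\<exists>t. t \<noteq> 0 \<and> ord_at z t = 1" using conjunct1[OF d4] .
  show "x \<in> z \<longleftrightarrow> vge z 0 x" for x
    using arg_cong[OF conjunct1[OF d5], of "\<lambda>A. x \<in> A"] unfolding vge_def mem_Collect_eq .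
  show "x \<in> max_ideal_at z \<longleftrightarrow> vge z 1 x" for x
    using arg_cong[OF conjunct2[OF d5], of "\<lambda>A. x \<in> A"] unfolding vge_def mem_Collect_eq .
qed

lemma ord_simps:
  assumes z: "discrete_place z"
  shows "ord_at z 1 = 0" "ord_at z (- 1) = 0" "\<And>x. x \<noteq> 0 \<Longrightarrow> ord_at z (- x) = ord_at z x"
    "\<And>x. x \<noteq> 0 \<Longrightarrow> ord_at z (inverse x) = - ord_at z x"
    "\<And>x y. x \<noteq> 0 \<Longrightarrow> y \<noteq> 0 \<Longrightarrow> ord_at z (x / y) = ord_at z x - ord_at z y"
    "\<And>x n. x \<noteq> 0 \<Longrightarrow> ord_at z (x ^ n) = int n * ord_at z x"
    "\<And>x n. x \<noteq> 0 \<Longrightarrow> ord_at z (x powi n) = n * ord_at z x"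
proof -
  note m = discrete_placeD(2)[OF z]
  show one: "ord_at z 1 = 0" using m[of 1 1] by simp
  show neg: "ord_at z (- 1) = 0" using m[of "- 1" "- 1"] one by simp
  show "ord_at z (- x) = ord_at z x" if "x \<noteq> 0" for x using m[of "- 1" x] that neg by simp
  show inv: "ord_at z (inverse x) = - ord_at z x" if "x \<noteq> 0" for x
    using m[of x "inverse x"] that one by simp
  show "ord_at z (x / y) = ord_at z x - ord_at z y" if "x \<noteq> 0" "y \<noteq> 0" for x y
    using m[of x "inverse y"] inv that by (simp add: divide_inverse)
  show pow: "ord_at z (x ^ n) = int n * ord_at z x" if "x \<noteq> 0" for x n
    by (induction n) (simp_all add: one m that algebra_simps)
  show "ord_at z (x powi n) = n * ord_at z x" if "x \<noteq> 0" for x n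
    using that pow[of x] pow[of "inverse x"] inv[of x] by (simp add: power_int_def)
qed

lemma vge_simps:
  assumes z: "discrete_place z"
  shows "vge z n 0" "\<And>x y. vge z n x \<Longrightarrow> vge z n y \<Longrightarrow> vge z n (x + y)"
    "\<And>x y. vge z n x \<Longrightarrow> vge z m y \<Longrightarrow> vge z (n + m) (x * y)"
    "\<And>x. vge z n x \<Longrightarrow> vge z n (- x)"
    "\<And>x y. vge z n x \<Longrightarrow> vge z n y \<Longrightarrow> vge z n (x - y)"
    "\<And>x. vge z n x \<Longrightarrow> l \<le> n \<Longrightarrow> vge z l x"
proof -
  note m = discrete_placeD[OF z]
  show "vge z n 0" by (simp add: vge_def)
  show add: "vge z n (x + y)" if "vge z n x" "vge z n y" for x y
    using that m(3)[of x y] by (fastforce simp: vge_def)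
  show "vge z (n + m) (x * y)" if "vge z n x" "vge z m y" for x y
    using that m(2)[of x y] by (auto simp: vge_def)
  show neg: "vge z n (- x)" if "vge z n x" for x
    using that ord_simps(3)[OF z, of x] by (auto simp: vge_def)
  show "vge z n (x - y)" if "vge z n x" "vge z n y" for x y
    using add[OF that(1) neg[OF that(2)]] by simp
  show "vge z l x" if "vge z n x" "l \<le> n" for x using that by (auto simp: vge_def)
qed

lemma ord_add_eq:
  assumes z: "discrete_place z" and "x \<noteq> 0" "y \<noteq> 0" "ord_at z x < ord_at z y"
  shows "x + y \<noteq> 0 \<and> ord_at z (x + y) = ord_at z x"
proof -
  have n0: "x + y \<noteq> 0"
  proof
    assume "x + y = 0"
    then have "y = - x" by (simp add: add_eq_0_iff)
    then show False using assms ord_simps(3)[OF z, of x] by simp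
  qed
  have "vge z (ord_at z x) (x + y)" using assms by (intro vge_simps(2)[OF z]) (auto simp: vge_def)
  then have "ord_at z (x + y) \<ge> ord_at z x" using n0 by (simp add: vge_def)
  moreover have "\<not> ord_at z (x + y) > ord_at z x"
  proof
    assume g: "ord_at z (x + y) > ord_at z x"
    have "vge z (ord_at z x + 1) ((x + y) - y)"
      using g assms by (intro vge_simps(5)[OF z]) (auto simp: vge_def)
    then show False using assms(2) by (simp add: vge_def)
  qed
  ultimately show ?thesis using n0 by simp
qed

lemma distinct_places_separated:
  assumes z: "discrete_place z" and l: "discrete_place l" and "z \<noteq> l"
  obtains a where "a \<noteq> 0" "ord_at z a > 0" "ord_at l a < 0"
proof -
  have incomparable: "\<not> z \<subseteq> l" if z: "discrete_place z" and l: "discrete_place l" and ne: "z \<noteq> l"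
    for z l :: "'a set"
  proof
    assume sub: "z \<subseteq> l"
    then obtain x where x: "x \<in> l" "x \<notin> z" using ne by blast
    then have x0: "x \<noteq> 0" "ord_at z x < 0" using discrete_placeD(5)[OF z] by (auto simp: vge_def)
    obtain s where s: "s \<noteq> 0" "ord_at l s = 1" using discrete_placeD(4)[OF l] by blast
    define y where "y = inverse s"
    have y0: "y \<noteq> 0" "ord_at l y = - 1" using s ord_simps(4)[OF l] by (auto simp: y_def)
    define n where "n = nat \<bar>ord_at z y\<bar>"
    have "ord_at z (y / x ^ n) = ord_at z y - int n * ord_at z x"
      using x0 y0 ord_simps[OF z] by simp
    also have "\<dots> \<ge> 0"
    proof -
      have "int n * 1 \<le> int n * (- ord_at z x)" using x0 by (intro mult_left_mono) auto
      then show ?thesis by (simp add: n_def)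
    qed
    finally have "y / x ^ n \<in> z" using discrete_placeD(5)[OF z] by (simp add: vge_def)
    then have "y / x ^ n \<in> l" using sub by blast
    then have "(y / x ^ n) * x ^ n \<in> l"
      using is_subringD(4,7)[OF discrete_placeD(1)[OF l]] x by blast
    then have "y \<in> l" using x0 by simp
    then show False using y0 discrete_placeD(5)[OF l] by (simp add: vge_def)
  qed
  obtain a where a: "a \<in> z" "a \<notin> l" using incomparable[OF z l] assms(3) by blast
  obtain b where b: "b \<in> l" "b \<notin> z" using incomparable[OF l z] assms(3) by blast
  have ab: "a \<noteq> 0" "b \<noteq> 0" "ord_at z a \<ge> 0" "ord_at l a < 0" "ord_at l b \<ge> 0" "ord_at z b < 0"
    using a b discrete_placeD(5)[OF z] discrete_placeD(5)[OF l] by (auto simp: vge_def)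
  show ?thesis
    by (rule that[of "a / b"]) (use ab ord_simps(5)[OF z, of a b] ord_simps(5)[OF l, of a b] in auto)
qed

lemma zero_and_poles:
  assumes "finite Z" "discrete_place z" "\<And>l. l \<in> Z \<Longrightarrow> discrete_place l" "z \<notin> Z"
  shows "\<exists>a. a \<noteq> 0 \<and> ord_at z a > 0 \<and> (\<forall>l\<in>Z. ord_at l a < 0)"
  using assms
proof (induction Z rule: finite_induct)
  case empty
  then show ?case using discrete_placeD(4)[of z] by fastforce
next
  case (insert l Z)
  note z = \<open>discrete_place z\<close>
  have l: "discrete_place l" using insert by blast
  have "\<exists>a. a \<noteq> 0 \<and> ord_at z a > 0 \<and> (\<forall>l\<in>Z. ord_at l a < 0)"
    by (rule insert.IH) (use insert.prems in auto)
  then obtain a where a: "a \<noteq> 0" "ord_at z a > 0" "\<forall>l\<in>Z. ord_at l a < 0" by (elim exE conjE)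
  show ?case
  proof (cases "ord_at l a < 0")
    case True
    then show ?thesis using a by blast
  next
    case False
    obtain b where b: "b \<noteq> 0" "ord_at z b > 0" "ord_at l b < 0"
      using distinct_places_separated[OF z l] insert by auto
    define r where "r = Suc (\<Sum>y\<in>Z. nat \<bar>ord_at y a\<bar>)"
    have rbig: "\<bar>ord_at y a\<bar> < int r" if "y \<in> Z" for y
    proof -
      have "nat \<bar>ord_at y a\<bar> \<le> (\<Sum>y\<in>Z. nat \<bar>ord_at y a\<bar>)"
        using insert.hyps that by (intro member_le_sum) auto
      then have "nat \<bar>ord_at y a\<bar> < r" unfolding r_def by linarith
      then show ?thesis by linarith
    qed
    have r0: "int r > 0" unfolding r_def of_nat_0_less_iff by (rule zero_less_Suc)
    define c where "c = a + b ^ r"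
    have bz: "ord_at z (b ^ r) > 0" using b ord_simps(6)[OF z] r0 by simp
    have neg: "c \<noteq> 0 \<and> ord_at y c < 0" if y: "y \<in> insert l Z" for y
    proof -
      have py: "discrete_place y" using insert.prems y by blast
      have oy: "ord_at y (b ^ r) = int r * ord_at y b" using ord_simps(6)[OF py] b by simp
      have ne: "ord_at y (b ^ r) \<noteq> ord_at y a \<and> (ord_at y a < 0 \<or> ord_at y (b ^ r) < 0)"
      proof (cases "y = l")
        case True
        have "int r * ord_at l b < 0" using r0 b by (simp add: mult_pos_neg)
        then show ?thesis using True False oy by auto
      next
        case False
        then have "ord_at y a < 0" using a y by blast
        moreover have "int r * ord_at y b \<noteq> ord_at y a"
        proof (cases "ord_at y b = 0")
          case False
          then have "int r * 1 \<le> int r * \<bar>ord_at y b\<bar>" by (intro mult_left_mono) auto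
          then have "int r \<le> \<bar>int r * ord_at y b\<bar>" by (simp add: abs_mult)
          then show ?thesis using rbig[of y] y \<open>y \<noteq> l\<close> by auto
        qed (use \<open>ord_at y a < 0\<close> in simp)
        ultimately show ?thesis using oy by simp
      qed
      then consider "ord_at y (b ^ r) < ord_at y a" | "ord_at y a < ord_at y (b ^ r)" by linarith
      then show ?thesis
      proof cases
        case 1
        then show ?thesis using ord_add_eq[OF py _ _ 1] a b ne by (auto simp: c_def add.commute)
      next
        case 2
        then show ?thesis using ord_add_eq[OF py _ _ 2] a b ne by (auto simp: c_def)
      qed
    qed
    have c0: "c \<noteq> 0" using neg by blast
    have "vge z 1 c" unfolding c_def using a bz by (intro vge_simps(2)[OF z]) (auto simp: vge_def)
    then have "ord_at z c > 0" using c0 by (simp add: vge_def)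
    then show ?thesis using c0 neg by (intro exI[of _ c]) auto
  qed
qed

text \<open>Weak approximation: prescribe \<open>y\<close> to high order at \<open>z\<close> and \<open>0\<close> at finitely many other
  places.  If \<open>a\<close> has a zero at \<open>z\<close> and poles elsewhere, \<open>1 / (1 + a\<^sup>n)\<close> is close to \<open>1\<close>
  at \<open>z\<close> and to \<open>0\<close> elsewhere.\<close>

lemma weak_approximation:
  assumes Z: "finite Z" and z: "discrete_place z" and pl: "\<And>l. l \<in> Z \<Longrightarrow> discrete_place l" and "z \<notin> Z"
  obtains x where "vge z N (x - y)" "\<And>l. l \<in> Z \<Longrightarrow> vge l N x"
proof -
  obtain a where a: "a \<noteq> 0" "ord_at z a > 0" "\<forall>l\<in>Z. ord_at l a < 0"
    using zero_and_poles[OF Z z pl \<open>z \<notin> Z\<close>] by blast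
  define M where "M = Suc (nat \<bar>N\<bar> + nat \<bar>ord_at z y\<bar> + (\<Sum>l\<in>Z. nat \<bar>ord_at l y\<bar>))"
  have "nat \<bar>N\<bar> + nat \<bar>ord_at z y\<bar> < M" unfolding M_def by linarith
  then have Mz: "int M \<ge> N - ord_at z y" "M > 0" by linarith+
  have Ml: "int M \<ge> N - ord_at l y" if "l \<in> Z" for l
  proof -
    have "nat \<bar>ord_at l y\<bar> \<le> (\<Sum>l\<in>Z. nat \<bar>ord_at l y\<bar>)"
      using Z that by (intro member_le_sum) auto
    then have "nat \<bar>N\<bar> + nat \<bar>ord_at l y\<bar> < M" unfolding M_def by linarith
    then show ?thesis by linarith
  qed
  define h where "h = 1 / (1 + a ^ M)"
  have oz: "ord_at z (a ^ M) \<ge> int M"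
  proof -
    have "int M * 1 \<le> int M * ord_at z a" using a by (intro mult_left_mono) auto
    then show ?thesis using ord_simps(6)[OF z a(1)] by simp
  qed
  have n0: "1 + a ^ M \<noteq> 0 \<and> ord_at z (1 + a ^ M) = ord_at z 1"
    using oz Mz a by (intro ord_add_eq[OF z]) (auto simp: ord_simps[OF z])
  have h0: "h \<noteq> 0" using n0 by (simp add: h_def)
  have "h - 1 = - (a ^ M / (1 + a ^ M))" using n0 by (simp add: h_def field_simps)
  moreover have "ord_at z (a ^ M / (1 + a ^ M)) = ord_at z (a ^ M)"
    using n0 a ord_simps[OF z] by simp
  ultimately have hz: "vge z (int M) (h - 1)"
    using oz by (metis vge_simps(4)[OF z] vge_def)
  have hl: "vge l (int M) h" if l: "l \<in> Z" for l
  proof -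
    have pl': "discrete_place l" using pl l .
    have "int M * 1 \<le> int M * (- ord_at l a)" using a l by (intro mult_left_mono) auto
    then have ol: "ord_at l (a ^ M) \<le> - int M" using ord_simps(6)[OF pl' a(1)] by simp
    then have "ord_at l (a ^ M) < ord_at l 1" using Mz ord_simps(1)[OF pl'] by simp
    from ord_add_eq[OF pl' _ _ this] a have "ord_at l (1 + a ^ M) = ord_at l (a ^ M)"
      by (simp add: add.commute)
    then show ?thesis using ol n0 ord_simps(1)[OF pl'] ord_simps(5)[OF pl', of 1 "1 + a ^ M"] by (simp add: h_def vge_def)
  qed
  show ?thesis
  proof
    have "vge z (int M + ord_at z y) ((h - 1) * y)"
      using hz by (rule vge_simps(3)[OF z]) (simp add: vge_def)
    then have "vge z N ((h - 1) * y)" by (rule vge_simps(6)[OF z]) (use Mz in linarith)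
    then show "vge z N (h * y - y)" by (simp add: algebra_simps)
    fix l assume l: "l \<in> Z"
    have "vge l (int M + ord_at l y) (h * y)"
      using hl[OF l] by (rule vge_simps(3)[OF pl[OF l]]) (simp add: vge_def)
    then show "vge l N (h * y)" by (rule vge_simps(6)[OF pl[OF l]]) (use Ml[OF l] in linarith)
  qed
qed

(*PART P4b*)
context places
begin

lemma subring_k: "is_subring k" using is_subfieldD(1)[OF k] .

lemma ord_const: assumes "z \<in> C" "c \<in> k" "c \<noteq> 0" shows "ord_at z c = 0"
proof -
  note pl = place[OF assms(1)]
  have "c \<in> z" "inverse c \<in> z" using k_place[OF assms(1)] assms(2) is_subfieldD(2)[OF k] by blast+
  then show ?thesis
    using discrete_placeD(5)[OF pl] ord_simps(4)[OF pl assms(3)] assms(3) by (simp add: vge_def)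
qed

lemma vge_scale: "z \<in> C \<Longrightarrow> c \<in> k \<Longrightarrow> vge z n x \<Longrightarrow> vge z n (c * x)"
  using ord_const[of z c] discrete_placeD(2)[OF place, of z c x] by (auto simp: vge_def)

definition sections :: "'K set set \<Rightarrow> ('K set \<Rightarrow> int) \<Rightarrow> 'K set" where
  "sections Z D = {x. \<forall>z\<in>Z. vge z (- D z) x}"

lemma submodule_sections: "Z \<subseteq> C \<Longrightarrow> submodule_over k (sections Z D)"
  unfolding submodule_over_def sections_def
  using vge_simps(1,2)[OF place] vge_scale by (auto simp: subset_iff)

lemma submodule_zero: "submodule_over k {0}" by (simp add: submodule_over_def)

text \<open>Families independent modulo \<open>t\<close> are independent over \<open>k[t]\<close>: reduce a relation
  modulo \<open>t\<close> and divide by \<open>t\<close>.\<close>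

lemma indep_mod_lift:
  fixes f :: "nat \<Rightarrow> 'K"
  assumes S: "is_subring S" and kt: "k \<subseteq> S" "t \<in> S" and t: "t \<notin> k"
    and f: "\<And>i. i < n \<Longrightarrow> f i \<in> S" and ind: "indep_mod k U f {..<n}"
    and U: "\<And>x. x \<in> S \<Longrightarrow> t * x \<in> U"
  shows "indep_mod (adjoin k t) {0} f {..<n}"
proof -
  have t0: "t \<noteq> 0" using t is_subringD(1)[OF subring_k] by blast
  have main: "\<forall>i<n. p i = 0"
    if "\<And>i. i < n \<Longrightarrow> poly_over k (p i)" "\<And>i. i < n \<Longrightarrow> degree (p i) < d" "(\<Sum>i<n. poly (p i) t * f i) = 0"
    for p :: "nat \<Rightarrow> 'K poly" and d
    using that
  proof (induction d arbitrary: p)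
    case 0
    then have "n = 0" by blast
    then show ?case by simp
  next
    case (Suc d)
    define a where "a i = coeff (p i) 0" for i
    define q where "q i = poly_shift 1 (p i)" for i
    have pq: "p i = pCons (a i) (q i)" for i
      by (rule poly_eqI) (auto simp: a_def q_def coeff_pCons coeff_poly_shift split: nat.split)
    have ak: "a i \<in> k" if "i < n" for i using Suc.prems(1)[OF that] by (simp add: a_def poly_over_def)
    have qk: "poly_over k (q i)" if "i < n" for i
      using Suc.prems(1)[OF that] by (simp add: q_def poly_over_def coeff_poly_shift)
    have "poly (p i) t * f i = a i * f i + t * (poly (q i) t * f i)" for i
      by (simp add: pq algebra_simps)
    then have eq: "(\<Sum>i<n. a i * f i) + t * (\<Sum>i<n. poly (q i) t * f i) = 0"
      using Suc.prems(3) by (simp add: sum.distrib sum_distrib_left)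
    have "poly (q i) t * f i \<in> S" if "i < n" for i
    proof -
      have "poly_over S (q i)" using qk[OF that] kt(1) by (auto simp: poly_over_def)
      then show ?thesis using poly_in_subring[OF S _ kt(2)] f[OF that] is_subringD(4)[OF S] by blast
    qed
    then have "- (\<Sum>i<n. poly (q i) t * f i) \<in> S" by (intro is_subringD(5,8)[OF S]) auto
    then have "t * - (\<Sum>i<n. poly (q i) t * f i) \<in> U" by (rule U)
    moreover have "(\<Sum>i<n. a i * f i) = t * - (\<Sum>i<n. poly (q i) t * f i)"
      using eq by (simp add: eq_neg_iff_add_eq_0)
    ultimately have "(\<Sum>i<n. a i * f i) \<in> U" by simp
    then have a0: "\<forall>i<n. a i = 0" using ind ak unfolding indep_mod_def by auto
    then have "t * (\<Sum>i<n. poly (q i) t * f i) = 0" using eq by simp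
    then have q0: "(\<Sum>i<n. poly (q i) t * f i) = 0" using t0 by simp
    show ?case
    proof (cases "d = 0")
      case True
      show ?thesis
      proof (intro allI impI)
        fix i assume i: "i < n"
        then have "degree (p i) = 0" using Suc.prems(2) True by fastforce
        then have "q i = 0" using pq[of i] by (metis degree_pCons_eq nat.distinct(1))
        then show "p i = 0" using pq[of i] a0 i by simp
      qed
    next
      case False
      have "degree (q i) < d" if "i < n" for i
      proof (cases "q i = 0")
        case False
        then have "degree (p i) = Suc (degree (q i))" using pq[of i] by (simp add: degree_pCons_eq)
        then show ?thesis using Suc.prems(2)[OF that] by simp
      qed (use \<open>d \<noteq> 0\<close> in simp)
      then have "\<forall>i<n. q i = 0" using Suc.IH[OF qk _ q0] by blast
      then show ?thesis using pq a0 by auto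
    qed
  qed
  show ?thesis
    unfolding indep_mod_def
  proof (intro allI impI)
    fix c assume c: "(\<forall>i\<in>{..<n}. c i \<in> adjoin k t) \<and> (\<Sum>i<n. c i * f i) \<in> {0}"
    then have "\<forall>i\<in>{..<n}. \<exists>p. poly_over k p \<and> c i = poly p t" unfolding adjoin_def by blast
    then obtain p where p: "\<And>i. i < n \<Longrightarrow> poly_over k (p i) \<and> c i = poly (p i) t"
      by (subst (asm) bchoice_iff) auto
    have "degree (p i) < Suc (\<Sum>i<n. degree (p i))" if "i < n" for i
      using member_le_sum[of i "{..<n}" "\<lambda>i. degree (p i)"] that by simp
    then have "\<forall>i<n. p i = 0" using p c by (intro main) auto
    then show "\<forall>i\<in>{..<n}. c i = 0" using p by auto
  qed
qed

lemma uniformizer: assumes "z \<in> C" obtains t where "t \<noteq> 0" "ord_at z t = 1" "t \<notin> k"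
  using discrete_placeD(4)[OF place[OF assms]] ord_const[OF assms] by force

lemma residue_bounded:
  assumes "z \<in> C" shows "\<exists>n. codim_le k z (max_ideal_at z) n"
proof -
  note pl = place[OF assms]
  obtain t where t: "t \<noteq> 0" "ord_at z t = 1" "t \<notin> k" using uniformizer[OF assms] .
  obtain n where n: "codim_le (adjoin k t) UNIV {0} n" using finite_over[OF t(3)] by blast
  have S: "is_subring z" using discrete_placeD(1)[OF pl] .
  have tz: "t \<in> z" using t discrete_placeD(5)[OF pl] by (simp add: vge_def)
  have U: "t * x \<in> max_ideal_at z" if "x \<in> z" for x
    using that t discrete_placeD[OF pl] by (auto simp: vge_def)
  have "codim_le k z (max_ideal_at z) n"
  proof (rule ccontr)
    assume "\<not> ?thesis"
    then obtain f where f: "\<forall>i<Suc n. f i \<in> z" "indep_mod k (max_ideal_at z) f {..<Suc n}"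
      using codim_ge_iff_not_codim_le unfolding codim_ge_def by blast
    have "indep_mod (adjoin k t) {0} f {..<Suc n}"
      using f(1) by (intro indep_mod_lift[OF S k_place[OF assms] tz t(3) _ f(2) U]) auto
    then have "codim_ge (adjoin k t) UNIV {0} (Suc n)" unfolding codim_ge_def by blast
    then show False using n codim_ge_iff_not_codim_le by blast
  qed
  then show ?thesis by blast
qed

end

lemma combine_subring_rec:
  assumes "is_subring z"
  shows "ring.combine (subring_rec z) Ks Us = (\<Sum>i<min (length Ks) (length Us). Ks ! i * Us ! i)"
proof (induction Ks arbitrary: Us)
  case Nil
  show ?case using ring.combine.simps(2)[OF cring.axioms(1)[OF cring_subring_rec[OF assms]]] by simp
next
  case (Cons x xs)
  note c = ring.combine.simps[OF cring.axioms(1)[OF cring_subring_rec[OF assms]]]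
  show ?case
    by (cases Us) (auto simp: c Cons sum.lessThan_Suc_shift simp del: sum.lessThan_Suc)
qed

(*PART P4c*)
lemma exists_maximal_indep_family:
  fixes V :: "'a::field set"
  assumes k: "is_subfield k" and U: "submodule_over k U" and bnd: "codim_le k V U n"
  obtains d :: nat and f :: "nat \<Rightarrow> 'a" where "\<And>i. i < d \<Longrightarrow> f i \<in> V" "indep_mod k U f {..<d}"
    "\<And>v. v \<in> V \<Longrightarrow> \<exists>c. (\<forall>i<d. c i \<in> k) \<and> v - (\<Sum>i<d. c i * f i) \<in> U"
proof -
  note kD = is_subfieldD(2,3)[OF k] is_subringD[OF is_subfieldD(1)[OF k]]
  have "codim_ge k V U 0" by (auto simp: codim_ge_def indep_mod_def)
  moreover have "\<forall>d. codim_ge k V U d \<longrightarrow> d < Suc n" using codim_ge_le[OF _ bnd kD(3)] by (auto simp: less_Suc_eq_le)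
  ultimately obtain d where d: "codim_ge k V U d" and dmax: "\<And>d'. codim_ge k V U d' \<Longrightarrow> d' \<le> d"
    using ex_has_greatest_nat[of "codim_ge k V U" 0 "\<lambda>d. d" "Suc n"] by blast
  obtain f :: "nat \<Rightarrow> 'a" where f: "\<forall>i<d. f i \<in> V" "indep_mod k U f {..<d}" using d unfolding codim_ge_def by blast
  show ?thesis
  proof (rule that)
    show "f i \<in> V" if "i < d" for i using f that by blast
    show "indep_mod k U f {..<d}" using f by blast
    fix v assume v: "v \<in> V"
    define g where "g = f(d := v)"
    have "\<not> codim_ge k V U (Suc d)" using dmax by fastforce
    moreover have "\<forall>i<Suc d. g i \<in> V" using f v by (auto simp: g_def less_Suc_eq)
    ultimately have "\<not> indep_mod k U g {..<Suc d}" unfolding codim_ge_def by blast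
    then obtain c where c: "\<forall>i\<in>{..<Suc d}. c i \<in> k" "(\<Sum>i<Suc d. c i * g i) \<in> U" "\<exists>i\<in>{..<Suc d}. c i \<noteq> 0"
      unfolding indep_mod_def by blast
    have s: "(\<Sum>i<Suc d. c i * g i) = (\<Sum>i<d. c i * f i) + c d * v"
      unfolding g_def by simp
    have cd: "c d \<noteq> 0"
    proof
      assume "c d = 0"
      then have "(\<Sum>i<d. c i * f i) \<in> U" using c(2) s by simp
      then have "\<forall>i\<in>{..<d}. c i = 0" using f(2) c(1) unfolding indep_mod_def by auto
      then show False using c(3) \<open>c d = 0\<close> by (auto simp: less_Suc_eq)
    qed
    have "inverse (c d) * ((\<Sum>i<d. c i * f i) + c d * v) \<in> U"
      using c s kD by (intro submodule_overD(3)[OF U]) auto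
    moreover have "inverse (c d) * ((\<Sum>i<d. c i * f i) + c d * v) = v - (\<Sum>i<d. (- (c i / c d)) * f i)"
      using cd by (simp add: sum_negf distrib_left sum_distrib_left field_simps)
    ultimately show "\<exists>c. (\<forall>i<d. c i \<in> k) \<and> v - (\<Sum>i<d. c i * f i) \<in> U"
      using c(1) kD(2,7) by (intro exI[of _ "\<lambda>i. - (c i / c d)"]) simp
  qed
qed

context places
begin

lemma maximalideal_max_ideal_at:
  assumes "z \<in> C" shows "maximalideal (max_ideal_at z) (subring_rec z)"
proof -
  note pl = place[OF assms] note P = discrete_placeD[OF pl] and O = ord_simps[OF pl]
  have idl: "is_ideal z (max_ideal_at z)"
    unfolding is_ideal_def subset_iff Ball_def P(5,6)
    using vge_simps[OF pl] by (metis add.left_neutral zero_le_one)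
  have "max_ideal_at z \<noteq> z"
  proof -
    have "1 \<in> z" "1 \<notin> max_ideal_at z" unfolding P(5,6) vge_def using O(1) by auto
    then show ?thesis by blast
  qed
  moreover have "J = max_ideal_at z \<or> J = z" if J: "is_ideal z J" "max_ideal_at z \<subseteq> J" for J
  proof (cases "J \<subseteq> max_ideal_at z")
    case False
    then obtain x where x: "x \<in> J" "x \<notin> max_ideal_at z" by blast
    have "x \<in> z" using J(1) x unfolding is_ideal_def by blast
    then have "x \<noteq> 0" "ord_at z x = 0" using x(2) unfolding P(5,6) by (auto simp: vge_def)
    then have "inverse x \<in> z" unfolding P(5) using O(4) by (simp add: vge_def)
    have "y \<in> J" if "y \<in> z" for y
    proof -
      have "(y * inverse x) * x \<in> J"
        using J(1) x(1) is_subringD(4)[OF P(1) that \<open>inverse x \<in> z\<close>] unfolding is_ideal_def by blast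
      then show ?thesis using \<open>x \<noteq> 0\<close> by (simp add: mult.assoc)
    qed
    then show ?thesis using J unfolding is_ideal_def by blast
  qed (use J in blast)
  ultimately show ?thesis unfolding maximalideal_iff[OF P(1)] using idl by blast
qed

lemma submodule_max_ideal_at: "z \<in> C \<Longrightarrow> submodule_over k (max_ideal_at z)"
  unfolding submodule_over_def discrete_placeD(6)[OF place]
  using vge_simps(1,2)[OF place] vge_scale by (auto simp: discrete_placeD(6)[OF place])

lemma residue_degree_codim:
  assumes zC: "z \<in> C"
  shows "codim_le k z (max_ideal_at z) (residue_degree k z)"
    "codim_ge k z (max_ideal_at z) (residue_degree k z)" "residue_degree k z > 0"
proof -
  note pl = place[OF zC] note P = discrete_placeD[OF pl]
  let ?M = "max_ideal_at z" and ?R = "subring_rec z"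
  note subM = submodule_max_ideal_at[OF zC]
  have cr: "cring ?R" using cring_subring_rec[OF P(1)] .
  have max: "maximalideal ?M ?R" using maximalideal_max_ideal_at[OF zC] .
  have idl: "ideal ?M ?R" using maximalideal.axioms(1)[OF max] .
  let ?Q = "?R Quot ?M" and ?h = "\<lambda>c. ?M +>\<^bsub>?R\<^esub> c"
  have Qf: "Ring.field ?Q" using maximalideal.quotient_is_field[OF max cr] .
  have Qr: "ring ?Q" using ideal.quotient_is_ring[OF idl] .
  have hom: "ring_hom_ring ?R ?Q ?h" using ideal.rcos_ring_hom_ring[OF idl] .
  interpret hom: ring_hom_ring ?R ?Q ?h by (rule hom)
  have kz: "k \<subseteq> z" using k_place[OF zC] .
  have sfk: "subfield k ?R"
  proof (rule ring.subfield_iff(1)[OF cring.axioms(1)[OF cr]])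
    show "k \<subseteq> carrier ?R" using kz by simp
    have "subfield k rota" using k subfield_iff_is_subfield by blast
    then show "Ring.field (?R\<lparr>carrier := k\<rparr>)"
      using ring.subfield_iff(2)[OF ring_from_type_algebra] by simp
  qed
  have "\<one>\<^bsub>?Q\<^esub> \<noteq> \<zero>\<^bsub>?Q\<^esub>" using domain.one_not_zero[OF Ring.field.axioms(1)[OF Qf]] .
  then have sfQ: "subfield (?h ` k) ?Q" using hom.img_is_subfield[OF sfk] by blast
  have h0: "?h x = \<zero>\<^bsub>?Q\<^esub> \<longleftrightarrow> x \<in> ?M" if x: "x \<in> z" for x
  proof -
    have "\<zero>\<^bsub>?Q\<^esub> = ?M" by (simp add: FactRing_def)
    moreover have "?h x = ?M \<longleftrightarrow> x \<in> ?M"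
      using abelian_group.a_coset_join1[OF ring.is_abelian_group[OF cring.axioms(1)[OF cr]], of ?M x]
        abelian_group.a_coset_join2[OF ring.is_abelian_group[OF cring.axioms(1)[OF cr]], of x ?M]
        additive_subgroup.a_subgroup[OF ideal.axioms(1)[OF idl]] x by auto
    ultimately show ?thesis by simp
  qed
  obtain n where "codim_le k z ?M n" using residue_bounded[OF zC] by blast
  from exists_maximal_indep_family[OF k subM this]
  obtain d :: nat and f :: "nat \<Rightarrow> 'K" where f: "\<And>i. i < d \<Longrightarrow> f i \<in> z" "indep_mod k ?M f {..<d}"
    "\<And>v. v \<in> z \<Longrightarrow> \<exists>c. (\<forall>i<d. c i \<in> k) \<and> v - (\<Sum>i<d. c i * f i) \<in> ?M" by blast
  let ?F = "map f [0..<d]"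
  have Fz: "set ?F \<subseteq> carrier ?R" using f(1) by auto
  have comb: "ring.combine ?Q (map ?h Ks) (map ?h ?F) = ?h (\<Sum>i<min (length Ks) d. Ks ! i * f i)"
    if "set Ks \<subseteq> k" for Ks
  proof -
    have "ring.combine ?Q (map ?h Ks) (map ?h ?F) = ?h (ring.combine ?R Ks ?F)"
      using that kz Fz by (intro hom.combine_hom) auto
    also have "ring.combine ?R Ks ?F = (\<Sum>i<min (length Ks) d. Ks ! i * f i)"
      unfolding combine_subring_rec[OF P(1)] by (intro sum.cong) auto
    finally show ?thesis .
  qed
  have lift: "\<exists>Ks. Ls = map ?h Ks \<and> set Ks \<subseteq> k" if "set Ls \<subseteq> ?h ` k" for Ls
    using that
  proof (induction Ls)
    case (Cons L Ls)
    then obtain c Ks where "L = ?h c" "c \<in> k" "Ls = map ?h Ks" "set Ks \<subseteq> k" by auto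
    then show ?case by (intro exI[of _ "c # Ks"]) auto
  qed simp
  have sumz: "(\<Sum>i<m. c i * f i) \<in> z" if "m \<le> d" "\<And>i. i < m \<Longrightarrow> c i \<in> k" for c m
    using that f(1) kz by (intro is_subringD(8)[OF P(1)] is_subringD(4)[OF P(1)]) auto
  have indep: "ring.independent ?Q (?h ` k) (map ?h ?F)"
  proof (rule ring.trivial_combine_imp_independent[OF Qr sfQ])
    show "set (map ?h ?F) \<subseteq> carrier ?Q" using Fz hom.hom_closed by auto
    fix Ls assume Ls: "set Ls \<subseteq> ?h ` k" "ring.combine ?Q Ls (map ?h ?F) = \<zero>\<^bsub>?Q\<^esub>"
    obtain Ks where Ks: "Ls = map ?h Ks" "set Ks \<subseteq> k" using lift[OF Ls(1)] by blast
    let ?m = "min (length Ks) d"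
    have Kk: "Ks ! i \<in> k" if "i < length Ks" for i using Ks(2) that nth_mem by blast
    have "(\<Sum>i<?m. Ks ! i * f i) \<in> ?M" using comb[OF Ks(2)] Ls(2) Ks(1) h0 sumz[of ?m "\<lambda>i. Ks ! i"] Kk by simp
    moreover have "(\<Sum>i<d. (if i < ?m then Ks ! i else 0) * f i) = (\<Sum>i<?m. Ks ! i * f i)"
    proof -
      have "(\<Sum>i<d. (if i < ?m then Ks ! i else 0) * f i) = (\<Sum>i<?m. (if i < ?m then Ks ! i else 0) * f i)"
        by (rule sum.mono_neutral_right) auto
      also have "\<dots> = (\<Sum>i<?m. Ks ! i * f i)" by (rule sum.cong) auto
      finally show ?thesis .
    qed
    ultimately have "\<forall>i\<in>{..<d}. (if i < ?m then Ks ! i else 0) = 0"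
      using f(2)[unfolded indep_mod_def, rule_format, of "\<lambda>i. if i < ?m then Ks ! i else 0"]
        Kk is_subringD(1)[OF subring_k] by auto
    then have z: "Ks ! i = 0" if "i < ?m" for i using that by (metis lessThan_iff min_less_iff_conj)
    show "set (take (length (map ?h ?F)) Ls) \<subseteq> {\<zero>\<^bsub>?Q\<^esub>}"
    proof
      fix L assume "L \<in> set (take (length (map ?h ?F)) Ls)"
      then obtain i where i: "i < ?m" "L = ?h (Ks ! i)"
        unfolding Ks(1) in_set_conv_nth by auto
      then have "L = ?h 0" using z by simp
      then show "L \<in> {\<zero>\<^bsub>?Q\<^esub>}"
        using h0[of 0] is_subringD(1)[OF P(1)] vge_simps(1)[OF pl] P(6) by simp
    qed
  qed
  have "ring.Span ?Q (?h ` k) (map ?h ?F) = carrier ?Q"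
  proof
    show "ring.Span ?Q (?h ` k) (map ?h ?F) \<subseteq> carrier ?Q"
    proof (rule ring.Span_in_carrier[OF Qr])
      show "?h ` k \<subseteq> carrier ?Q" using subfieldE(3)[OF sfQ] .
      show "set (map ?h ?F) \<subseteq> carrier ?Q" using Fz hom.hom_closed by auto
    qed
    show "carrier ?Q \<subseteq> ring.Span ?Q (?h ` k) (map ?h ?F)"
    proof
      fix x assume "x \<in> carrier ?Q"
      then obtain v where v: "v \<in> z" "x = ?h v" by (auto simp: FactRing_def A_RCOSETS_def')
      obtain c where c: "\<forall>i<d. c i \<in> k" "v - (\<Sum>i<d. c i * f i) \<in> ?M" using f(3)[OF v(1)] by blast
      let ?s = "\<Sum>i<d. c i * f i"
      have sz: "?s \<in> z" using sumz[of d c] c(1) by simp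
      have "?h v = ?h ((v - ?s) \<oplus>\<^bsub>?R\<^esub> ?s)" by simp
      also have "\<dots> = ?h (v - ?s) \<oplus>\<^bsub>?Q\<^esub> ?h ?s"
        using v sz is_subringD(6)[OF P(1)] by (intro hom.hom_add) auto
      also have "?h (v - ?s) = \<zero>\<^bsub>?Q\<^esub>" using h0 c(2) v sz is_subringD(6)[OF P(1)] by blast
      also have "\<zero>\<^bsub>?Q\<^esub> \<oplus>\<^bsub>?Q\<^esub> ?h ?s = ?h ?s" using sz by (intro hom.S.l_zero hom.hom_closed) simp
      also have "\<dots> = ring.combine ?Q (map ?h (map c [0..<d])) (map ?h ?F)"
      proof -
        have "set (map c [0..<d]) \<subseteq> k" using c(1) by auto
        from comb[OF this] show ?thesis by simp
      qed
      finally have "x = ring.combine ?Q (map ?h (map c [0..<d])) (map ?h ?F)" using v by simp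
      moreover have "set (map ?h (map c [0..<d])) \<subseteq> ?h ` k" using c(1) by auto
      moreover have "set (map ?h ?F) \<subseteq> carrier ?Q" using Fz hom.hom_closed by auto
      ultimately show "x \<in> ring.Span ?Q (?h ` k) (map ?h ?F)"
        using ring.Span_eq_combine_set[OF Qr sfQ] by blast
    qed
  qed
  then have "ring.dimension ?Q d (?h ` k) (carrier ?Q)"
    using ring.dimensionI[OF Qr sfQ indep] by simp
  then have deg: "residue_degree k z = d"
    unfolding residue_degree_def using ring.dimI[OF Qr sfQ] by (simp add: over_def)
  show "codim_le k z ?M (residue_degree k z)"
    unfolding deg using codim_le_spanned[OF k subM f(3)] .
  show "codim_ge k z ?M (residue_degree k z)"
    unfolding deg codim_ge_def using f(1,2) by blast
  have "indep_mod k ?M (\<lambda>_. 1) {..<1::nat}"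
    unfolding indep_mod_def
  proof (intro allI impI)
    fix c assume c: "(\<forall>i\<in>{..<1::nat}. c i \<in> k) \<and> (\<Sum>i<1. c i * 1) \<in> ?M"
    then have "vge z 1 (c 0)" "c 0 \<in> k" using P(6) by auto
    then have "c 0 = 0" using ord_const[OF zC] by (fastforce simp: vge_def)
    then show "\<forall>i\<in>{..<1}. c i = 0" by simp
  qed
  moreover have "1 \<in> z" using is_subringD(2)[OF P(1)] .
  ultimately have "codim_ge k z ?M 1" unfolding codim_ge_def by (intro exI[of _ "\<lambda>_. 1"]) simp
  then show "residue_degree k z > 0"
    using codim_ge_le[OF _ \<open>codim_le k z ?M (residue_degree k z)\<close> is_subringD(1)[OF subring_k]] by fastforce
qed

end

(*PART P4d*)
context places
begin

lemma sections_mono: "(\<And>z. z \<in> Z \<Longrightarrow> D z \<le> D' z) \<Longrightarrow> Z \<subseteq> C \<Longrightarrow> sections Z D \<subseteq> sections Z D'"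
  unfolding sections_def by (force intro: vge_simps(6)[OF place])

lemma sections_one_point_le:
  assumes Z: "Z \<subseteq> C" "z \<in> Z"
  shows "codim_le k (sections Z D) (sections Z (D(z := D z - 1))) (residue_degree k z)"
  unfolding codim_le_def
proof (intro allI impI)
  have zC: "z \<in> C" using Z by blast
  note pl = place[OF zC] note P = discrete_placeD[OF pl]
  obtain t where t: "t \<noteq> 0" "ord_at z t = 1" using uniformizer[OF zC] by metis
  fix f :: "nat \<Rightarrow> 'K" assume f: "\<forall>i\<le>residue_degree k z. f i \<in> sections Z D"
  define s where "s = t powi (D z)"
  have s: "s \<noteq> 0" "ord_at z s = D z" using t ord_simps(7)[OF pl] by (auto simp: s_def)
  have "f i * s \<in> z" if "i \<le> residue_degree k z" for i
  proof -
    have "vge z (- D z) (f i)" using f that Z(2) unfolding sections_def by blast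
    then have "vge z (- D z + D z) (f i * s)" by (rule vge_simps(3)[OF pl]) (simp add: vge_def s)
    then show ?thesis using P(5) by simp
  qed
  then obtain c where c: "\<forall>i\<le>residue_degree k z. c i \<in> k" "\<exists>i\<le>residue_degree k z. c i \<noteq> 0"
    "(\<Sum>i\<le>residue_degree k z. c i * (f i * s)) \<in> max_ideal_at z"
    using residue_degree_codim(1)[OF zC, unfolded codim_le_def, rule_format, of "\<lambda>i. f i * s"] by blast
  let ?x = "\<Sum>i\<le>residue_degree k z. c i * f i"
  have "(\<Sum>i\<le>residue_degree k z. c i * (f i * s)) = ?x * s" by (simp add: sum_distrib_right mult.assoc)
  then have "vge z 1 (?x * s)" using c(3) P(6) by simp
  then have "vge z (1 - D z) ?x" using s P(2)[of ?x s] by (auto simp: vge_def)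
  moreover have "?x \<in> sections Z D"
    using c(1) f by (intro submodule_overD(4)[OF submodule_sections[OF Z(1)]]) auto
  ultimately have "?x \<in> sections Z (D(z := D z - 1))" unfolding sections_def by auto
  then show "\<exists>c. (\<forall>i\<le>residue_degree k z. c i \<in> k) \<and> (\<exists>i\<le>residue_degree k z. c i \<noteq> 0) \<and>
      (\<Sum>i\<le>residue_degree k z. c i * f i) \<in> sections Z (D(z := D z - 1))" using c by blast
qed

lemma sections_one_point_ge:
  assumes Z: "Z \<subseteq> C" "z \<in> Z" "finite Z"
  shows "codim_ge k (sections Z D) (sections Z (D(z := D z - 1))) (residue_degree k z)"
proof -
  have zC: "z \<in> C" using Z by blast
  note pl = place[OF zC] note P = discrete_placeD[OF pl]
  obtain t where t: "t \<noteq> 0" "ord_at z t = 1" using uniformizer[OF zC] by metis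
  obtain u :: "nat \<Rightarrow> 'K" where u: "\<forall>i<residue_degree k z. u i \<in> z"
    "indep_mod k (max_ideal_at z) u {..<residue_degree k z}"
    using residue_degree_codim(2)[OF zC] unfolding codim_ge_def by blast
  define s where "s = t powi (D z)"
  have s: "s \<noteq> 0" "ord_at z s = D z" using t ord_simps(7)[OF pl] by (auto simp: s_def)
  define N where "N = 1 + (\<Sum>l\<in>Z. \<bar>D l\<bar>)"
  have N: "N \<ge> 1 + \<bar>D l\<bar>" if "l \<in> Z" for l
    unfolding N_def using member_le_sum[of l Z "\<lambda>l. \<bar>D l\<bar>"] that Z(3) by simp
  have "\<exists>x. vge z N (x - u i / s) \<and> (\<forall>l\<in>Z - {z}. vge l N x)" for i
    by (rule weak_approximation[of "Z - {z}" z N "u i / s"]) (use Z place in auto)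
  then obtain x where x: "\<And>i. vge z N (x i - u i / s)" "\<And>i l. l \<in> Z - {z} \<Longrightarrow> vge l N (x i)" by metis
  have us: "vge z (- D z) (u i / s)" if "i < residue_degree k z" for i
  proof (cases "u i = 0")
    case False
    have "vge z 0 (u i)" using u(1) that P(5) by blast
    then show ?thesis using ord_simps(5)[OF pl False s(1)] s False by (auto simp: vge_def)
  qed (simp add: vge_def)
  have xs: "x i \<in> sections Z D" if i: "i < residue_degree k z" for i
    unfolding sections_def
  proof (intro CollectI ballI)
    fix l assume l: "l \<in> Z"
    show "vge l (- D l) (x i)"
    proof (cases "l = z")
      case True
      have "vge z (- D z) (x i - u i / s)" by (rule vge_simps(6)[OF pl x(1)]) (use N[OF Z(2)] in linarith)
      from vge_simps(2)[OF pl this us[OF i]] show ?thesis using True by simp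
    next
      case False
      have "l \<in> C" using Z l by blast
      show ?thesis by (rule vge_simps(6)[OF place[OF \<open>l \<in> C\<close>] x(2)]) (use False l N[OF l] in auto)
    qed
  qed
  have "indep_mod k (sections Z (D(z := D z - 1))) x {..<residue_degree k z}"
    unfolding indep_mod_def
  proof (intro allI impI)
    fix c assume c: "(\<forall>i\<in>{..<residue_degree k z}. c i \<in> k) \<and>
      (\<Sum>i<residue_degree k z. c i * x i) \<in> sections Z (D(z := D z - 1))"
    let ?S = "\<lambda>g. \<Sum>i<residue_degree k z. c i * g i"
    have 1: "vge z (1 - D z) (?S x)" using c Z(2) unfolding sections_def by force
    have "vge z N (\<Sum>i\<in>I. c i * (x i - u i / s))" if "I \<subseteq> {..<residue_degree k z}" for I
      using finite_subset[OF that finite_lessThan] that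
    proof (induction I rule: finite_induct)
      case (insert i I)
      then show ?case using vge_simps(2)[OF pl vge_scale[OF zC _ x(1)]] c by auto
    qed (simp add: vge_def)
    then have "vge z N (?S (\<lambda>i. x i - u i / s))" by blast
    then have 2: "vge z (1 - D z) (?S (\<lambda>i. x i - u i / s))"
      by (rule vge_simps(6)[OF pl]) (use N[OF Z(2)] in linarith)
    have "?S x - ?S (\<lambda>i. x i - u i / s) = ?S u / s"
      by (simp add: sum_subtractf[symmetric] right_diff_distrib sum_divide_distrib)
    then have "vge z (1 - D z) (?S u / s)" using vge_simps(5)[OF pl 1 2] by simp
    then have "vge z 1 (?S u)" using ord_simps(5)[OF pl _ s(1), of "?S u"] s by (auto simp: vge_def)
    then have "?S u \<in> max_ideal_at z" using P(6) by blast
    then show "\<forall>i\<in>{..<residue_degree k z}. c i = 0" using u(2) c unfolding indep_mod_def by blast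
  qed
  then show ?thesis using xs unfolding codim_ge_def by blast
qed

lemma sections_point_le:
  assumes Z: "Z \<subseteq> C" "z \<in> Z"
  shows "codim_le k (sections Z D) (sections Z (D(z := D z - int n))) (n * residue_degree k z)"
proof (induction n)
  case 0
  have "0 \<le> (0::nat)" by simp
  show ?case unfolding codim_le_def
    using is_subringD(2)[OF subring_k] by (intro allI impI exI[of _ "\<lambda>_. 1"]) auto
next
  case (Suc n)
  let ?D = "D(z := D z - int n)"
  have one: "codim_le k (sections Z ?D) (sections Z (?D(z := ?D z - 1))) (residue_degree k z)"
    using sections_one_point_le[OF Z] .
  have eq: "?D(z := ?D z - 1) = D(z := D z - int (Suc n))" by auto
  show ?case
    using codim_le_trans[OF k submodule_sections[OF Z(1)] Suc.IH one[unfolded eq]]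
    by (simp only: mult_Suc add.commute)
qed

lemma sections_point_ge:
  assumes Z: "Z \<subseteq> C" "z \<in> Z" "finite Z"
  shows "codim_ge k (sections Z D) (sections Z (D(z := D z - int n))) (n * residue_degree k z)"
proof (induction n)
  case 0
  show ?case by (auto simp: codim_ge_def indep_mod_def)
next
  case (Suc n)
  let ?D = "D(z := D z - int n)"
  have one: "codim_ge k (sections Z ?D) (sections Z (?D(z := ?D z - 1))) (residue_degree k z)"
    using sections_one_point_ge[OF Z] .
  have eq: "?D(z := ?D z - 1) = D(z := D z - int (Suc n))" by auto
  have "codim_ge k (sections Z D) (sections Z (D(z := D z - int (Suc n)))) (n * residue_degree k z + residue_degree k z)"
    using is_subringD[OF subring_k] Z
    by (intro codim_ge_add[OF _ submodule_sections[OF Z(1)] Suc.IH one[unfolded eq]] sections_mono) auto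
  then show ?case by (simp only: mult_Suc add.commute)
qed

lemma sections_le:
  assumes Z: "Z \<subseteq> C" and W: "finite W" "W \<subseteq> Z"
  shows "codim_le k (sections Z D) (sections Z (\<lambda>z. if z \<in> W then D z - int (e z) else D z))
    (\<Sum>z\<in>W. e z * residue_degree k z)"
  using W
proof (induction W rule: finite_induct)
  case empty
  show ?case unfolding codim_le_def
    using is_subringD(2)[OF subring_k] by (intro allI impI exI[of _ "\<lambda>_. 1"]) auto
next
  case (insert w W)
  let ?D = "\<lambda>z. if z \<in> W then D z - int (e z) else D z"
  have "codim_le k (sections Z ?D) (sections Z (?D(w := ?D w - int (e w)))) (e w * residue_degree k w)"
    using sections_point_le[OF Z] insert by blast
  moreover have "?D(w := ?D w - int (e w)) = (\<lambda>z. if z \<in> insert w W then D z - int (e z) else D z)"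
    using insert by auto
  ultimately have "codim_le k (sections Z D) (sections Z (\<lambda>z. if z \<in> insert w W then D z - int (e z) else D z))
      ((\<Sum>z\<in>W. e z * residue_degree k z) + e w * residue_degree k w)"
    using codim_le_trans[OF k submodule_sections[OF Z]] insert by simp
  then show ?case using insert by (simp add: add.commute)
qed

lemma sections_ge:
  assumes Z: "Z \<subseteq> C" "finite Z" and W: "W \<subseteq> Z"
  shows "codim_ge k (sections Z D) (sections Z (\<lambda>z. if z \<in> W then D z - int (e z) else D z))
    (\<Sum>z\<in>W. e z * residue_degree k z)"
  using finite_subset[OF W Z(2)] W
proof (induction W rule: finite_induct)
  case empty
  show ?case by (auto simp: codim_ge_def indep_mod_def)
next
  case (insert w W)
  let ?D = "\<lambda>z. if z \<in> W then D z - int (e z) else D z"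
  have one: "codim_ge k (sections Z ?D) (sections Z (?D(w := ?D w - int (e w)))) (e w * residue_degree k w)"
    using sections_point_ge[OF Z(1) _ Z(2)] insert by blast
  have eq: "?D(w := ?D w - int (e w)) = (\<lambda>z. if z \<in> insert w W then D z - int (e z) else D z)"
    using insert by auto
  have IH: "codim_ge k (sections Z D) (sections Z ?D) (\<Sum>z\<in>W. e z * residue_degree k z)"
    using insert by blast
  have "codim_ge k (sections Z D) (sections Z (\<lambda>z. if z \<in> insert w W then D z - int (e z) else D z))
      ((\<Sum>z\<in>W. e z * residue_degree k z) + e w * residue_degree k w)"
    using is_subringD[OF subring_k] Z
    by (intro codim_ge_add[OF _ submodule_sections[OF Z(1)] IH one[unfolded eq]] sections_mono) auto
  then show ?case using insert by (simp add: add.commute)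
qed

text \<open>The zeros of \<open>t\<close>, counted with multiplicity and residue degree, number at most
  \<open>[K\<^sub>0 : k(t)]\<close>.\<close>

lemma zeros_bound:
  assumes t: "t \<notin> k" and n: "codim_le (adjoin k t) UNIV {0} n"
    and Z: "finite Z" "Z \<subseteq> {z \<in> C. ord_at z t > 0}"
  shows "(\<Sum>z\<in>Z. nat (ord_at z t) * residue_degree k z) \<le> n"
proof -
  have ZC: "Z \<subseteq> C" using Z by blast
  have t0: "t \<noteq> 0" using t is_subringD(1)[OF subring_k] by blast
  define S where "S = sections Z (\<lambda>_. 0)"
  define U where "U = sections Z (\<lambda>z. if z \<in> Z then 0 - int (nat (ord_at z t)) else 0)"
  have memS: "x \<in> S \<longleftrightarrow> (\<forall>z\<in>Z. x \<in> z)" for x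
    using discrete_placeD(5)[OF place] ZC unfolding S_def sections_def by auto
  have Zr: "is_subring z" if "z \<in> Z" for z using discrete_placeD(1)[OF place] ZC that by blast
  have S: "is_subring S"
    unfolding is_subring_def
  proof (intro conjI ballI)
    show "0 \<in> S" "1 \<in> S" unfolding memS using is_subringD(1,2)[OF Zr] by auto
    fix x assume x: "x \<in> S"
    show "- x \<in> S" using x is_subringD(5)[OF Zr] unfolding memS by auto
    fix y assume y: "y \<in> S"
    show "x + y \<in> S" "x * y \<in> S" using x y is_subringD(3,4)[OF Zr] unfolding memS by auto
  qed
  have kS: "k \<subseteq> S" using k_place ZC memS by blast
  have tS: "t \<in> S"
    unfolding memS
  proof
    fix z assume "z \<in> Z"
    then have "z \<in> C" "ord_at z t > 0" using Z by auto
    then show "t \<in> z" unfolding discrete_placeD(5)[OF place[OF \<open>z \<in> C\<close>]] vge_def by simp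
  qed
  have U: "t * x \<in> U" if "x \<in> S" for x
    unfolding U_def sections_def
  proof (intro CollectI ballI)
    fix z assume z: "z \<in> Z"
    have zC: "z \<in> C" using z ZC by blast
    have "vge z 0 x" using that z memS discrete_placeD(5)[OF place[OF zC]] by blast
    then have "vge z (ord_at z t + 0) (t * x)"
      by (intro vge_simps(3)[OF place[OF zC]]) (auto simp: vge_def)
    moreover have "ord_at z t > 0" using z Z by blast
    ultimately show "vge z (- (if z \<in> Z then 0 - int (nat (ord_at z t)) else 0)) (t * x)"
      using z by simp
  qed
  have "codim_ge k S U (\<Sum>z\<in>Z. nat (ord_at z t) * residue_degree k z)"
    unfolding S_def U_def using sections_ge[OF ZC Z(1) order_refl] .
  then obtain f where f: "\<forall>i<(\<Sum>z\<in>Z. nat (ord_at z t) * residue_degree k z). f i \<in> S"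
    "indep_mod k U f {..<(\<Sum>z\<in>Z. nat (ord_at z t) * residue_degree k z)}" unfolding codim_ge_def by blast
  have "indep_mod (adjoin k t) {0} f {..<(\<Sum>z\<in>Z. nat (ord_at z t) * residue_degree k z)}"
    using f(1) by (intro indep_mod_lift[OF S kS tS t _ f(2) U]) auto
  then have "codim_ge (adjoin k t) UNIV {0} (\<Sum>z\<in>Z. nat (ord_at z t) * residue_degree k z)"
    unfolding codim_ge_def by blast
  then show ?thesis
    using codim_ge_le[OF _ n] is_subringD(1)[OF is_subring_adjoin[OF subring_k]] by blast
qed

lemma finite_zeros: assumes "f \<noteq> 0" shows "finite {z \<in> C. ord_at z f > 0}"
proof (cases "f \<in> k")
  case True
  then have "{z \<in> C. ord_at z f > 0} = {}" using ord_const assms by auto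
  then show ?thesis by (metis finite.emptyI)
next
  case False
  obtain n where n: "codim_le (adjoin k f) UNIV {0} n" using finite_over[OF False] by blast
  show ?thesis
  proof (rule ccontr)
    assume inf: "infinite {z \<in> C. ord_at z f > 0}"
    obtain Z where Z: "finite Z" "card Z = Suc n" "Z \<subseteq> {z \<in> C. ord_at z f > 0}"
      using infinite_arbitrarily_large[OF inf] by blast
    have "Suc n = (\<Sum>z\<in>Z. 1)" using Z by simp
    also have "\<dots> \<le> (\<Sum>z\<in>Z. nat (ord_at z f) * residue_degree k z)"
    proof (rule sum_mono)
      fix z assume "z \<in> Z"
      then have "z \<in> C" "ord_at z f > 0" using Z by auto
      then have "nat (ord_at z f) > 0" "residue_degree k z > 0" using residue_degree_codim(3) by auto
      then show "1 \<le> nat (ord_at z f) * residue_degree k z" by (simp add: Suc_leI)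
    qed
    also have "\<dots> \<le> n" using zeros_bound[OF False n Z(1,3)] .
    finally show False by simp
  qed
qed

lemma finite_support: assumes "f \<noteq> 0" shows "finite {z \<in> C. ord_at z f \<noteq> 0}"
proof -
  have "{z \<in> C. ord_at z f \<noteq> 0} \<subseteq> {z \<in> C. ord_at z f > 0} \<union> {z \<in> C. ord_at z (inverse f) > 0}"
    using ord_simps(4)[OF place assms] by auto
  then show ?thesis using finite_zeros[of f] finite_zeros[of "inverse f"] assms finite_subset by auto
qed

end

(*PART P5*)
lemma codim_geI:
  assumes "finite J" "\<And>j. j \<in> J \<Longrightarrow> f j \<in> V" "indep_mod k U f J"
  shows "codim_ge k V U (card J)"
proof -
  obtain h where h: "bij_betw h {..<card J} J"
    using ex_bij_betw_nat_finite[OF assms(1)] by (auto simp: lessThan_atLeast0)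
  define g where "g = the_inv_into {..<card J} h"
  have gh: "bij_betw g J {..<card J}" unfolding g_def using bij_betw_the_inv_into[OF h] .
  have hg: "h (g j) = j" if "j \<in> J" for j
    unfolding g_def using f_the_inv_into_f_bij_betw[OF h] that by blast
  have "indep_mod k U (\<lambda>i. f (h i)) {..<card J}"
    unfolding indep_mod_def
  proof (intro allI impI)
    fix c assume c: "(\<forall>i\<in>{..<card J}. c i \<in> k) \<and> (\<Sum>i<card J. c i * f (h i)) \<in> U"
    have "(\<Sum>j\<in>J. c (g j) * f j) = (\<Sum>j\<in>J. c (g j) * f (h (g j)))" by (intro sum.cong) (auto simp: hg)
    also have "\<dots> = (\<Sum>i<card J. c i * f (h i))"
      using sum.reindex_bij_betw[OF gh, of "\<lambda>i. c i * f (h i)"] .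
    finally have "(\<Sum>j\<in>J. c (g j) * f j) \<in> U" using c by simp
    moreover have "\<forall>j\<in>J. c (g j) \<in> k" using c gh unfolding bij_betw_def by blast
    ultimately have "\<forall>j\<in>J. c (g j) = 0"
      using assms(3)[unfolded indep_mod_def, rule_format, of "\<lambda>j. c (g j)"] by blast
    then show "\<forall>i\<in>{..<card J}. c i = 0" using gh unfolding bij_betw_def by (metis imageE)
  qed
  moreover have "\<forall>i<card J. f (h i) \<in> V" using h assms(2) unfolding bij_betw_def by blast
  ultimately show ?thesis unfolding codim_ge_def by (intro exI[of _ "\<lambda>i. f (h i)"] conjI)
qed

lemma codim_ge_mono:
  assumes "codim_ge k V U m" "m' \<le> m" "V \<subseteq> V'" "0 \<in> k"
  shows "codim_ge k V' U m'"
proof -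
  obtain f :: "nat \<Rightarrow> 'a" where f: "\<forall>i<m. f i \<in> V" "indep_mod k U f {..<m}"
    using assms(1) unfolding codim_ge_def by blast
  have "indep_mod k U f {..<m'}"
    unfolding indep_mod_def
  proof (intro allI impI)
    fix c assume c: "(\<forall>i\<in>{..<m'}. c i \<in> k) \<and> (\<Sum>i<m'. c i * f i) \<in> U"
    define e where "e i = (if i < m' then c i else 0)" for i
    have "(\<Sum>i<m. e i * f i) = (\<Sum>i<m'. e i * f i)"
      using assms(2) by (intro sum.mono_neutral_right) (auto simp: e_def)
    also have "\<dots> = (\<Sum>i<m'. c i * f i)" by (intro sum.cong) (auto simp: e_def)
    finally have "(\<Sum>i<m. e i * f i) \<in> U" using c by simp
    moreover have "\<forall>i\<in>{..<m}. e i \<in> k" using c assms(4) by (simp add: e_def)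
    ultimately have e0: "\<forall>i\<in>{..<m}. e i = 0" using f(2) unfolding indep_mod_def by blast
    show "\<forall>i\<in>{..<m'}. c i = 0"
    proof
      fix i assume i: "i \<in> {..<m'}"
      then have "e i = 0" using e0 assms(2) by auto
      then show "c i = 0" using i by (simp add: e_def)
    qed
  qed
  then show ?thesis using f assms(2,3) unfolding codim_ge_def by (intro exI[of _ f]) auto
qed

lemma codim_ge_diff:
  assumes k: "is_subfield k" and U: "submodule_over k U" and a: "codim_ge k V W a" and b: "codim_le k V U b"
  shows "codim_ge k U W (a - b)"
proof (cases "a - b")
  case 0
  then show ?thesis by (simp add: codim_ge_def indep_mod_def)
next
  case (Suc d)
  show ?thesis
  proof (rule ccontr)
    assume "\<not> ?thesis"
    then have "codim_le k U W d" using Suc codim_ge_iff_not_codim_le by metis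
    then have "codim_le k V W (b + d)" using codim_le_trans[OF k U b] by blast
    then have "a \<le> b + d" using codim_ge_le[OF a] is_subringD(1)[OF is_subfieldD(1)[OF k]] by blast
    then show False using Suc by simp
  qed
qed

lemma vge_sum:
  assumes "discrete_place z" "\<And>i. i \<in> I \<Longrightarrow> vge z n (f i)"
  shows "vge z n (sum f I)"
  using assms(2) by (induction I rule: infinite_finite_induct) (auto simp: vge_simps[OF assms(1)])

context places
begin

definition divdeg :: "('K set \<Rightarrow> int) \<Rightarrow> int" where
  "divdeg D = (\<Sum>z\<in>{z \<in> C. D z \<noteq> 0}. int (residue_degree k z) * D z)"

definition fin_div :: "('K set \<Rightarrow> int) \<Rightarrow> bool" where
  "fin_div D \<longleftrightarrow> finite {z \<in> C. D z \<noteq> 0}"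

lemma divdeg_superset:
  assumes "finite W" "W \<subseteq> C" "{z \<in> C. D z \<noteq> 0} \<subseteq> W"
  shows "divdeg D = (\<Sum>z\<in>W. int (residue_degree k z) * D z)"
  unfolding divdeg_def using assms by (intro sum.mono_neutral_left) auto

lemma divdeg_lin:
  assumes "fin_div D" "fin_div E"
  shows "fin_div (\<lambda>z. a * D z + b * E z)" "divdeg (\<lambda>z. a * D z + b * E z) = a * divdeg D + b * divdeg E"
proof -
  let ?W = "{z \<in> C. D z \<noteq> 0} \<union> {z \<in> C. E z \<noteq> 0}"
  have W: "finite ?W" "?W \<subseteq> C" using assms by (auto simp: fin_div_def)
  have sub: "{z \<in> C. a * D z + b * E z \<noteq> 0} \<subseteq> ?W" by auto
  show "fin_div (\<lambda>z. a * D z + b * E z)" unfolding fin_div_def using finite_subset[OF sub W(1)] .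
  have "divdeg (\<lambda>z. a * D z + b * E z) = (\<Sum>z\<in>?W. int (residue_degree k z) * (a * D z + b * E z))"
    using divdeg_superset[OF W sub] .
  also have "\<dots> = a * (\<Sum>z\<in>?W. int (residue_degree k z) * D z) + b * (\<Sum>z\<in>?W. int (residue_degree k z) * E z)"
    by (simp add: distrib_left sum.distrib sum_distrib_left mult.left_commute)
  also have "(\<Sum>z\<in>?W. int (residue_degree k z) * D z) = divdeg D" using divdeg_superset[OF W] by auto
  also have "(\<Sum>z\<in>?W. int (residue_degree k z) * E z) = divdeg E" using divdeg_superset[OF W] by auto
  finally show "divdeg (\<lambda>z. a * D z + b * E z) = a * divdeg D + b * divdeg E" .
qed

lemma fin_div_ord: "f \<noteq> 0 \<Longrightarrow> fin_div (\<lambda>z. ord_at z f)"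
  unfolding fin_div_def by (rule finite_support)

lemma sections_codim:
  assumes "fin_div D" "fin_div E" and le: "\<And>z. z \<in> C \<Longrightarrow> E z \<le> D z"
  shows "codim_le k (sections C D) (sections C E) (nat (divdeg D - divdeg E))"
proof -
  let ?W = "{z \<in> C. D z \<noteq> 0} \<union> {z \<in> C. E z \<noteq> 0}"
  have W: "finite ?W" "?W \<subseteq> C" using assms by (auto simp: fin_div_def)
  let ?e = "\<lambda>z. nat (D z - E z)"
  have "sections C (\<lambda>z. if z \<in> ?W then D z - int (?e z) else D z) = sections C E"
    unfolding sections_def using le by (intro Collect_cong ball_cong) auto
  moreover have "nat (divdeg D - divdeg E) = (\<Sum>z\<in>?W. ?e z * residue_degree k z)"
  proof -
    have "divdeg D - divdeg E = (\<Sum>z\<in>?W. int (residue_degree k z) * (D z - E z))"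
      using divdeg_superset[OF W, of D] divdeg_superset[OF W, of E]
      by (auto simp: sum_subtractf[symmetric] right_diff_distrib)
    also have "\<dots> = (\<Sum>z\<in>?W. int (?e z * residue_degree k z))"
      using le W(2) by (intro sum.cong) auto
    also have "\<dots> = int (\<Sum>z\<in>?W. ?e z * residue_degree k z)" by (simp only: of_nat_sum)
    finally show ?thesis by (simp only: nat_int)
  qed
  ultimately show ?thesis using sections_le[OF order_refl W, of D ?e] by simp
qed

lemma sections_shift:
  assumes g: "g \<noteq> 0"
  shows "x \<in> sections C (\<lambda>z. D z + ord_at z g) \<longleftrightarrow> x * g \<in> sections C D"
proof (cases "x = 0")
  case False
  then have "vge z (- (D z + ord_at z g)) x \<longleftrightarrow> vge z (- D z) (x * g)" if "z \<in> C" for z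
    using discrete_placeD(2)[OF place[OF that] False g] g by (auto simp: vge_def)
  then show ?thesis unfolding sections_def by blast
qed (simp add: sections_def vge_def)

lemma codim_ge_sections_shift:
  assumes g: "g \<noteq> 0" and "codim_ge k (sections C D) {0} m"
  shows "codim_ge k (sections C (\<lambda>z. D z + ord_at z g)) {0} m"
proof -
  obtain f :: "nat \<Rightarrow> 'K" where f: "\<forall>i<m. f i \<in> sections C D" "indep_mod k {0} f {..<m}"
    using assms(2) unfolding codim_ge_def by blast
  have "f i / g \<in> sections C (\<lambda>z. D z + ord_at z g)" if "i < m" for i
    using f(1) that g sections_shift[OF g, of "f i / g" D] by simp
  moreover have "indep_mod k {0} (\<lambda>i. f i / g) {..<m}"
    unfolding indep_mod_def
  proof (intro allI impI)
    fix c assume c: "(\<forall>i\<in>{..<m}. c i \<in> k) \<and> (\<Sum>i<m. c i * (f i / g)) \<in> {0}"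
    have "(\<Sum>i<m. c i * f i) = (\<Sum>i<m. c i * (f i / g)) * g" using g by (simp add: sum_distrib_right)
    then show "\<forall>i\<in>{..<m}. c i = 0" using f(2) c unfolding indep_mod_def by auto
  qed
  ultimately show ?thesis unfolding codim_ge_def by (intro exI[of _ "\<lambda>i. f i / g"] conjI) simp_all
qed

lemma adjoin_subset_place: "z \<in> C \<Longrightarrow> t \<in> z \<Longrightarrow> adjoin k t \<subseteq> z"
  using k_place discrete_placeD(1)[OF place] by (intro adjoin_least) auto

text \<open>Up to a factor in \<open>k[t]\<close> every function is integral over \<open>k[t]\<close>, so has poles only
  where \<open>t\<close> has.\<close>

lemma integral_multiple:
  assumes t: "t \<notin> k" and n: "codim_le (adjoin k t) UNIV {0} n"
  obtains a where "a \<in> adjoin k t" "a \<noteq> 0" "\<And>z. z \<in> C \<Longrightarrow> t \<in> z \<Longrightarrow> a * u \<in> z"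
proof -
  obtain c where c: "\<forall>i\<le>n. c i \<in> adjoin k t" "\<exists>i\<le>n. c i \<noteq> 0" "(\<Sum>i\<le>n. c i * u ^ i) = 0"
    using n[unfolded codim_le_def, rule_format, of "\<lambda>i. u ^ i"] by auto
  define m where "m = Max {i. i \<le> n \<and> c i \<noteq> 0}"
  have fin: "finite {i. i \<le> n \<and> c i \<noteq> 0}" by simp
  have m: "m \<le> n" "c m \<noteq> 0" using Max_in[OF fin] c(2) unfolding m_def by auto
  have above: "c i = 0" if "i \<le> n" "i > m" for i
  proof (rule ccontr)
    assume "c i \<noteq> 0"
    then have "i \<le> m" unfolding m_def using that(1) by (intro Max_ge[OF fin]) simp
    then show False using that(2) by simp
  qed
  have "(\<Sum>i\<le>m. c i * u ^ i) = (\<Sum>i\<le>n. c i * u ^ i)"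
    using m above by (intro sum.mono_neutral_left) auto
  then have rel: "(\<Sum>i\<le>m. c i * u ^ i) = 0" using c(3) by simp
  have m0: "m > 0"
  proof (rule ccontr)
    assume "\<not> m > 0"
    then show False using rel m by simp
  qed
  show ?thesis
  proof (rule that)
    show "c m \<in> adjoin k t" "c m \<noteq> 0" using c m by auto
    fix z assume z: "z \<in> C" "t \<in> z"
    note pl = place[OF z(1)] note P = discrete_placeD[OF pl]
    have cz: "vge z 0 (c i)" if "i \<le> m" for i
    proof -
      have "c i \<in> z" using adjoin_subset_place[OF z] c(1) that m(1) by auto
      then show ?thesis using P(5) by blast
    qed
    define w where "w = c m * u"
    show "c m * u \<in> z"
    proof (rule ccontr)
      assume "c m * u \<notin> z"
      then have w: "w \<noteq> 0" "ord_at z w < 0" using P(5) by (auto simp: vge_def w_def)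
      have "0 = c m ^ (m - 1) * (\<Sum>i\<le>m. c i * u ^ i)" using rel by simp
      also have "\<dots> = (\<Sum>i\<le>m. c m ^ (m - 1) * (c i * u ^ i))" by (simp add: sum_distrib_left)
      also have "\<dots> = (\<Sum>i<m. c m ^ (m - 1) * (c i * u ^ i)) + c m ^ (m - 1) * (c m * u ^ m)"
        using sum.lessThan_Suc[of "\<lambda>i. c m ^ (m - 1) * (c i * u ^ i)" m] by (simp add: lessThan_Suc_atMost)
      also have "c m ^ (m - 1) * (c m * u ^ m) = w ^ m"
        using m0 by (cases m) (simp_all add: w_def power_mult_distrib mult.assoc mult.left_commute)
      also have "(\<Sum>i<m. c m ^ (m - 1) * (c i * u ^ i)) = (\<Sum>i<m. c i * c m ^ (m - 1 - i) * w ^ i)"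
      proof (intro sum.cong refl)
        fix i assume "i \<in> {..<m}"
        then have "c m ^ (m - 1) = c m ^ (m - 1 - i) * c m ^ i" by (simp add: power_add[symmetric])
        then show "c m ^ (m - 1) * (c i * u ^ i) = c i * c m ^ (m - 1 - i) * w ^ i"
          by (simp add: w_def power_mult_distrib)
      qed
      finally have wm: "w ^ m = - (\<Sum>i<m. c i * c m ^ (m - 1 - i) * w ^ i)"
        by (metis add.commute eq_neg_iff_add_eq_0)
      have "vge z (int (m - 1) * ord_at z w) (c i * c m ^ (m - 1 - i) * w ^ i)" if i: "i < m" for i
      proof -
        have "c i * c m ^ (m - 1 - i) \<in> z"
          using cz[of i] cz[of m] i is_subringD(4,7)[OF P(1)] P(5) by simp
        then have "vge z (0 + int i * ord_at z w) (c i * c m ^ (m - 1 - i) * w ^ i)"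
          using ord_simps(6)[OF pl w(1), of i] P(5) by (intro vge_simps(3)[OF pl]) (auto simp: vge_def)
        moreover have "int (m - 1) * ord_at z w \<le> 0 + int i * ord_at z w"
          using i w(2) by (simp add: mult_right_mono_neg)
        ultimately show ?thesis by (rule vge_simps(6)[OF pl])
      qed
      then have "vge z (int (m - 1) * ord_at z w) (- (\<Sum>i<m. c i * c m ^ (m - 1 - i) * w ^ i))"
        by (intro vge_simps(4)[OF pl] vge_sum[OF pl]) auto
      then have "vge z (int (m - 1) * ord_at z w) (w ^ m)" using wm by simp
      then have "int (m - 1) * ord_at z w \<le> int m * ord_at z w"
        using ord_simps(6)[OF pl w(1), of m] w(1) by (simp add: vge_def)
      moreover obtain m' where "m = Suc m'" using m0 gr0_implies_Suc by blast
      ultimately have "0 \<le> ord_at z w" by (simp add: distrib_right)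
      then show False using w(2) by simp
    qed
  qed
qed

definition pole_div :: "'K \<Rightarrow> 'K set \<Rightarrow> int" where
  "pole_div t z = max 0 (- ord_at z t)"

lemma fin_div_pole_div: "t \<noteq> 0 \<Longrightarrow> fin_div (pole_div t)"
  unfolding fin_div_def
  by (rule finite_subset[OF _ finite_support[of t]]) (auto simp: pole_div_def)

lemma pole_div_sections_ge:
  assumes t: "t \<notin> k" and n: "codim_le (adjoin k t) UNIV {0} n" and ge: "codim_ge (adjoin k t) UNIV {0} n"
  obtains N :: nat where "\<And>r :: nat. codim_ge k (sections C (\<lambda>z. int (N + r) * pole_div t z)) {0} (n * Suc r)"
proof -
  note B = is_subringD[OF is_subring_adjoin[OF subring_k, of t]]
  have t0: "t \<noteq> 0" using t is_subringD(1)[OF subring_k] by blast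
  obtain u :: "nat \<Rightarrow> 'K" where u: "indep_mod (adjoin k t) {0} u {..<n}"
    using ge unfolding codim_ge_def by blast
  have "\<exists>a. a \<in> adjoin k t \<and> a \<noteq> 0 \<and> (\<forall>z\<in>C. t \<in> z \<longrightarrow> a * u i \<in> z)" for i
    using integral_multiple[OF t n, of "u i"] by metis
  then obtain a where a: "\<And>i. a i \<in> adjoin k t" "\<And>i. a i \<noteq> 0" "\<And>i z. z \<in> C \<Longrightarrow> t \<in> z \<Longrightarrow> a i * u i \<in> z" by metis
  define w where "w i = a i * u i" for i
  have indw: "indep_mod (adjoin k t) {0} w {..<n}"
    unfolding indep_mod_def
  proof (intro allI impI)
    fix c assume c: "(\<forall>i\<in>{..<n}. c i \<in> adjoin k t) \<and> (\<Sum>i<n. c i * w i) \<in> {0}"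
    then have "\<forall>i\<in>{..<n}. c i * a i = 0"
      using u[unfolded indep_mod_def, rule_format, of "\<lambda>i. c i * a i"] a(1) B(4)
      by (simp add: w_def mult.assoc)
    then show "\<forall>i\<in>{..<n}. c i = 0" using a(2) by simp
  qed
  let ?T = "{z \<in> C. pole_div t z \<noteq> 0}"
  have finT: "finite ?T" using fin_div_pole_div[OF t0] by (simp add: fin_div_def)
  define N where "N = (\<Sum>i<n. \<Sum>z\<in>?T. nat \<bar>ord_at z (w i)\<bar>)"
  have Nbound: "nat \<bar>ord_at z (w i)\<bar> \<le> N" if "i < n" "z \<in> ?T" for i z
  proof -
    have "nat \<bar>ord_at z (w i)\<bar> \<le> (\<Sum>z\<in>?T. nat \<bar>ord_at z (w i)\<bar>)"
      using finT that by (intro member_le_sum) auto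
    also have "\<dots> \<le> N" unfolding N_def using that
      by (intro member_le_sum[of i "{..<n}" "\<lambda>i. \<Sum>z\<in>?T. nat \<bar>ord_at z (w i)\<bar>"]) auto
    finally show ?thesis .
  qed
  have wz: "vge z (- (int N * pole_div t z)) (w i)" if i: "i < n" and z: "z \<in> C" for i z
  proof (cases "z \<in> ?T")
    case True
    have "pole_div t z \<ge> 1" using True by (auto simp: pole_div_def)
    then have "int N * 1 \<le> int N * pole_div t z" by (intro mult_left_mono) auto
    moreover have "\<bar>ord_at z (w i)\<bar> \<le> int N" using Nbound[OF i True] by linarith
    ultimately show ?thesis by (auto simp: vge_def)
  next
    case False
    then have p0: "pole_div t z = 0" using z by simp
    then have "ord_at z t \<ge> 0" by (simp add: pole_div_def)
    then have "t \<in> z" using discrete_placeD(5)[OF place[OF z]] by (simp add: vge_def)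
    then have "w i \<in> z" using a(3) z by (simp add: w_def)
    then show ?thesis using p0 discrete_placeD(5)[OF place[OF z]] by simp
  qed
  have tz: "vge z (- (int j * pole_div t z)) (t ^ j)" if z: "z \<in> C" for j z
  proof -
    have "- pole_div t z \<le> ord_at z t" by (simp add: pole_div_def)
    then have "int j * (- pole_div t z) \<le> int j * ord_at z t" by (rule mult_left_mono) simp
    then show ?thesis using ord_simps(6)[OF place[OF z] t0] by (simp add: vge_def)
  qed
  show ?thesis
  proof (rule that)
    fix r :: nat
    let ?J = "{..<n} \<times> {..r}"
    let ?f = "\<lambda>ij. w (fst ij) * t ^ snd ij"
    have "codim_ge k (sections C (\<lambda>z. int (N + r) * pole_div t z)) {0} (card ?J)"
    proof (rule codim_geI)
      fix ij assume ij: "ij \<in> ?J"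
      show "?f ij \<in> sections C (\<lambda>z. int (N + r) * pole_div t z)"
        unfolding sections_def
      proof (intro CollectI ballI)
        fix z assume z: "z \<in> C"
        have "vge z (- (int N * pole_div t z) + - (int (snd ij) * pole_div t z)) (?f ij)"
          using wz[OF _ z] tz[OF z] ij by (intro vge_simps(3)[OF place[OF z]]) auto
        moreover have "int (snd ij) * pole_div t z \<le> int r * pole_div t z"
          using ij by (intro mult_right_mono) (auto simp: pole_div_def)
        then have "- (int (N + r) * pole_div t z) \<le> - (int N * pole_div t z) + - (int (snd ij) * pole_div t z)"
          by (simp add: distrib_right)
        ultimately show "vge z (- (int (N + r) * pole_div t z)) (?f ij)"
          by (rule vge_simps(6)[OF place[OF z]])
      qed
    next
      show "indep_mod k {0} ?f ?J"
        unfolding indep_mod_def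
      proof (intro allI impI)
        fix c assume c: "(\<forall>ij\<in>?J. c ij \<in> k) \<and> (\<Sum>ij\<in>?J. c ij * ?f ij) \<in> {0}"
        define p where "p i = (\<Sum>j\<le>r. monom (c (i, j)) j)" for i
        have pk: "poly_over k (p i)" if "i < n" for i
          unfolding p_def using c that by (intro poly_over_ring(8,11)[OF subring_k]) auto
        have pt: "poly (p i) t = (\<Sum>j\<le>r. c (i, j) * t ^ j)" for i
          by (simp add: p_def poly_sum poly_monom)
        have "(\<Sum>ij\<in>?J. c ij * ?f ij) = (\<Sum>i<n. \<Sum>j\<le>r. c (i, j) * (w i * t ^ j))"
          by (subst sum.cartesian_product) (simp add: case_prod_beta)
        also have "\<dots> = (\<Sum>i<n. poly (p i) t * w i)"
          unfolding pt sum_distrib_right by (intro sum.cong refl) (simp add: algebra_simps)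
        finally have sum0: "(\<Sum>i<n. poly (p i) t * w i) \<in> {0}" using c by simp
        define e where "e i = poly (p i) t" for i
        have "\<forall>i\<in>{..<n}. e i \<in> adjoin k t" using pk unfolding adjoin_def e_def by blast
        moreover have "(\<Sum>i<n. e i * w i) \<in> {0}" using sum0 by (simp only: e_def)
        ultimately have "\<forall>i\<in>{..<n}. e i = 0" using indw unfolding indep_mod_def by blast
        then have pt0: "poly (p i) t = 0" if "i < n" for i using that by (simp add: e_def)
        have p0: "p i = 0" if "i < n" for i
          using transc[OF t] pk[OF that] pt0[OF that] unfolding transc_over_def by blast
        show "\<forall>ij\<in>?J. c ij = 0"
        proof
          fix ij assume ij: "ij \<in> ?J"
          then have "coeff (p (fst ij)) (snd ij) = c ij"
            unfolding p_def coeff_sum by (auto simp: sum.delta)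
          then show "c ij = 0" using p0[of "fst ij"] ij by auto
        qed
      qed
    qed simp
    then show "codim_ge k (sections C (\<lambda>z. int (N + r) * pole_div t z)) {0} (n * Suc r)" by simp
  qed
qed

end

(*PART P6*)
context places
begin

lemma divdeg_cong:
  assumes "\<And>z. z \<in> C \<Longrightarrow> D z = E z" shows "divdeg D = divdeg E"
proof -
  have "{z \<in> C. D z \<noteq> 0} = {z \<in> C. E z \<noteq> 0}" using assms by (metis (lifting))
  then show ?thesis unfolding divdeg_def using assms by (intro sum.cong) auto
qed

lemma divdeg_mono:
  assumes "fin_div D" "fin_div E" "\<And>z. z \<in> C \<Longrightarrow> D z \<le> E z" shows "divdeg D \<le> divdeg E"
proof -
  have "0 \<le> divdeg (\<lambda>z. 1 * E z + (-1) * D z)"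
    unfolding divdeg_def using assms(3) by (intro sum_nonneg mult_nonneg_nonneg) auto
  then show ?thesis using divdeg_lin(2)[OF assms(2,1), of 1 "-1"] by simp
qed

lemma exact_degree:
  assumes "t \<notin> k"
  obtains n where "codim_le (adjoin k t) UNIV {0} n" "codim_ge (adjoin k t) UNIV {0} n"
proof -
  define n where "n = (LEAST n. codim_le (adjoin k t) UNIV {0} n)"
  have n: "codim_le (adjoin k t) UNIV {0} n" unfolding n_def using LeastI_ex[OF finite_over[OF assms]] .
  have "codim_ge (adjoin k t) UNIV {0} n"
  proof (cases n)
    case 0
    then show ?thesis by (simp add: codim_ge_def indep_mod_def)
  next
    case (Suc m)
    then have "\<not> codim_le (adjoin k t) UNIV {0} m" unfolding n_def using not_less_Least by (metis lessI)
    then show ?thesis using Suc codim_ge_iff_not_codim_le by metis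
  qed
  then show ?thesis using n that by blast
qed

lemma divdeg_zeros_le:
  assumes t: "t \<notin> k" and n: "codim_le (adjoin k t) UNIV {0} n"
  shows "divdeg (pole_div (inverse t)) \<le> int n"
proof -
  have t0: "t \<noteq> 0" using t is_subringD(1)[OF subring_k] by blast
  let ?Z = "{z \<in> C. ord_at z t > 0}"
  have oi: "ord_at z (inverse t) = - ord_at z t" if "z \<in> C" for z using ord_simps(4)[OF place[OF that] t0] .
  have "divdeg (pole_div (inverse t)) = (\<Sum>z\<in>?Z. int (residue_degree k z) * pole_div (inverse t) z)"
    using finite_zeros[OF t0] by (intro divdeg_superset) (auto simp: pole_div_def oi max_def split: if_splits)
  also have "\<dots> = (\<Sum>z\<in>?Z. int (nat (ord_at z t) * residue_degree k z))"
    by (intro sum.cong) (auto simp: pole_div_def oi)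
  also have "\<dots> = int (\<Sum>z\<in>?Z. nat (ord_at z t) * residue_degree k z)" by (simp only: of_nat_sum)
  also have "\<dots> \<le> int n" using zeros_bound[OF t n finite_zeros[OF t0] order_refl] by (simp only: of_nat_le_iff)
  finally show ?thesis .
qed

end

text \<open>Completeness enters through the absence of nonconstant everywhere regular functions.\<close>

locale complete_places = places +
  assumes regular_const: "\<And>x. (\<And>z. z \<in> C \<Longrightarrow> x \<in> z) \<Longrightarrow> x \<in> k"
begin

lemma sections_ord_le_1:
  assumes f: "f \<noteq> 0"
  shows "codim_le k (sections C (\<lambda>z. - ord_at z f)) {0} 1"
proof (rule codim_le_spanned[OF k submodule_zero, where b = "\<lambda>_. f"])
  fix v assume v: "v \<in> sections C (\<lambda>z. - ord_at z f)"
  have "v / f \<in> k"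
  proof (rule regular_const)
    fix z assume z: "z \<in> C"
    have "vge z (ord_at z f) v" using v z unfolding sections_def by auto
    then have "vge z 0 (v / f)" using ord_simps(5)[OF place[OF z], of v f] f by (auto simp: vge_def)
    then show "v / f \<in> z" using discrete_placeD(5)[OF place[OF z]] by blast
  qed
  then show "\<exists>c. (\<forall>i<1::nat. c i \<in> k) \<and> v - (\<Sum>i<1::nat. c i * f) \<in> {0}"
    using f by (intro exI[of _ "\<lambda>_. v / f"]) simp
qed

lemma sections_upper_bound:
  assumes D: "fin_div D" and f: "f \<noteq> 0" "f \<in> sections C D"
  shows "codim_le k (sections C D) {0} (nat (divdeg D + divdeg (\<lambda>z. ord_at z f)) + 1)"
proof -
  have lin: "fin_div (\<lambda>z. - ord_at z f)" "divdeg (\<lambda>z. - ord_at z f) = - divdeg (\<lambda>z. ord_at z f)"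
    using divdeg_lin[OF fin_div_ord[OF f(1)] fin_div_ord[OF f(1)], of "-1" 0] by auto
  have "- ord_at z f \<le> D z" if "z \<in> C" for z using f that unfolding sections_def vge_def by auto
  then have "codim_le k (sections C D) (sections C (\<lambda>z. - ord_at z f)) (nat (divdeg D - divdeg (\<lambda>z. - ord_at z f)))"
    by (intro sections_codim D lin)
  then show ?thesis
    using codim_le_trans[OF k submodule_sections[OF order_refl] _ sections_ord_le_1[OF f(1)]] lin(2) by simp
qed

lemma divdeg_poles_ge:
  assumes t: "t \<notin> k" and n: "codim_le (adjoin k t) UNIV {0} n" "codim_ge (adjoin k t) UNIV {0} n"
  shows "int n \<le> divdeg (pole_div t)"
proof (rule ccontr)
  have t0: "t \<noteq> 0" using t is_subringD(1)[OF subring_k] by blast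
  note P = fin_div_pole_div[OF t0]
  obtain N :: nat where N: "\<And>r :: nat. codim_ge k (sections C (\<lambda>z. int (N + r) * pole_div t z)) {0} (n * Suc r)"
    using pole_div_sections_ge[OF t n] by blast
  define d where "d = divdeg (pole_div t)"
  have d0: "d \<ge> 0" unfolding d_def divdeg_def by (intro sum_nonneg) (auto simp: pole_div_def)
  assume "\<not> int n \<le> divdeg (pole_div t)"
  then have dn: "d \<le> int n - 1" by (simp add: d_def)
  have bound: "int (n * Suc r) \<le> int (N + r) * d + 1" for r
  proof -
    have lin: "fin_div (\<lambda>z. int (N + r) * pole_div t z)" "divdeg (\<lambda>z. int (N + r) * pole_div t z) = int (N + r) * d"
      using divdeg_lin[OF P P, of "int (N + r)" 0] by (auto simp: d_def)
    have "1 \<in> sections C (\<lambda>z. int (N + r) * pole_div t z)"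
      unfolding sections_def vge_def using ord_simps(1)[OF place] by (auto simp: pole_div_def)
    from sections_upper_bound[OF lin(1) _ this]
    have "codim_le k (sections C (\<lambda>z. int (N + r) * pole_div t z)) {0}
        (nat (int (N + r) * d + divdeg (\<lambda>z. ord_at z 1)) + 1)" using lin(2) by simp
    moreover have "divdeg (\<lambda>z. ord_at z 1) = 0"
      unfolding divdeg_def using ord_simps(1)[OF place] by (intro sum.neutral) auto
    ultimately have "n * Suc r \<le> nat (int (N + r) * d) + 1"
      using codim_ge_le[OF N] is_subringD(1)[OF subring_k] by fastforce
    moreover have "0 \<le> int (N + r) * d" using d0 by simp
    ultimately show ?thesis by linarith
  qed
  define r where "r = N * n + 1"
  have "int (N + r) * d \<le> int (N + r) * (int n - 1)" using dn by (intro mult_left_mono) auto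
  then have "int (n * Suc r) \<le> int (N + r) * (int n - 1) + 1" using bound[of r] by linarith
  then have "int n + int r \<le> int N * int n - int N + 1" by (simp add: algebra_simps)
  then show False using d0 dn by (simp add: r_def)
qed

text \<open>A function has as many zeros as poles.\<close>

lemma divdeg_ord: assumes "f \<noteq> 0" shows "divdeg (\<lambda>z. ord_at z f) = 0"
proof -
  have le: "divdeg (\<lambda>z. ord_at z f) \<le> 0" if f: "f \<noteq> 0" for f
  proof (cases "f \<in> k")
    case True
    have "{z \<in> C. ord_at z f \<noteq> 0} = {}" using ord_const[OF _ True f] by blast
    then show ?thesis by (simp only: divdeg_def sum.empty)
  next
    case False
    obtain n where n: "codim_le (adjoin k f) UNIV {0} n" "codim_ge (adjoin k f) UNIV {0} n"
      using exact_degree[OF False] .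
    have fi: "inverse f \<noteq> 0" using f by simp
    have "1 * pole_div (inverse f) z + (-1) * pole_div f z = ord_at z f" if "z \<in> C" for z
      using ord_simps(4)[OF place[OF that] f] by (auto simp: pole_div_def)
    then have "divdeg (\<lambda>z. 1 * pole_div (inverse f) z + (-1) * pole_div f z) = divdeg (\<lambda>z. ord_at z f)"
      by (rule divdeg_cong)
    then have "divdeg (\<lambda>z. ord_at z f) = divdeg (pole_div (inverse f)) - divdeg (pole_div f)"
      using divdeg_lin(2)[OF fin_div_pole_div[OF fi] fin_div_pole_div[OF f], of 1 "-1"] by simp
    then show ?thesis using divdeg_zeros_le[OF False n(1)] divdeg_poles_ge[OF False n] by simp
  qed
  have "divdeg (\<lambda>z. ord_at z (inverse f)) = divdeg (\<lambda>z. (-1) * ord_at z f + 0 * ord_at z f)"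
    using ord_simps(4)[OF place assms] by (intro divdeg_cong) auto
  also have "\<dots> = - divdeg (\<lambda>z. ord_at z f)"
    using divdeg_lin(2)[OF fin_div_ord[OF assms] fin_div_ord[OF assms], of "-1" 0] by simp
  finally show ?thesis using le[OF assms] le[of "inverse f"] assms by simp
qed

lemma nonzero_section: assumes "codim_ge k V {0} m" "m \<ge> 1" obtains f where "f \<in> V" "f \<noteq> 0"
proof -
  obtain f :: "nat \<Rightarrow> 'a" where f: "\<forall>i<m. f i \<in> V" "indep_mod k {0} f {..<m}"
    using assms(1) unfolding codim_ge_def by blast
  have "f 0 \<noteq> 0"
  proof
    assume f0: "f 0 = 0"
    define c where "c i = (if i = 0 then 1 else 0 :: 'a)" for i :: nat
    have "(\<Sum>i<m. c i * f i) = 0" using f0 by (intro sum.neutral) (auto simp: c_def)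
    moreover have "\<forall>i\<in>{..<m}. c i \<in> k" using is_subringD(1,2)[OF subring_k] by (simp add: c_def)
    ultimately have "\<forall>i\<in>{..<m}. c i = 0" using f(2) unfolding indep_mod_def by blast
    then have "c 0 = 0" using assms(2) by simp
    then show False by (simp add: c_def)
  qed
  then show ?thesis using that f(1) assms(2) by auto
qed

text \<open>Riemann's inequality: up to linear equivalence every divisor lies below a multiple of a
  fixed pole divisor, for which the sections \<open>w\<^sub>i t\<^sup>j\<close> suffice.\<close>

lemma riemann_inequality:
  obtains \<gamma> :: int where "\<gamma> \<ge> 0"
    "\<And>D m. fin_div D \<Longrightarrow> int m \<le> divdeg D - \<gamma> \<Longrightarrow> codim_ge k (sections C D) {0} m"
proof -
  obtain t where t: "t \<notin> k" using k_not_UNIV by blast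
  have t0: "t \<noteq> 0" using t is_subringD(1)[OF subring_k] by blast
  obtain n where n: "codim_le (adjoin k t) UNIV {0} n" "codim_ge (adjoin k t) UNIV {0} n"
    using exact_degree[OF t] .
  obtain N :: nat where N: "\<And>r :: nat. codim_ge k (sections C (\<lambda>z. int (N + r) * pole_div t z)) {0} (n * Suc r)"
    using pole_div_sections_ge[OF t n] by blast
  note P = fin_div_pole_div[OF t0]
  have ti: "inverse t \<noteq> 0" using t0 by simp
  have degP: "divdeg (pole_div t) = int n"
  proof -
    have "divdeg (\<lambda>z. 1 * pole_div (inverse t) z + (-1) * pole_div t z) = divdeg (\<lambda>z. ord_at z t)"
      using ord_simps(4)[OF place t0] by (intro divdeg_cong) (auto simp: pole_div_def)
    then have "divdeg (pole_div (inverse t)) = divdeg (pole_div t)"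
      using divdeg_lin(2)[OF fin_div_pole_div[OF ti] P, of 1 "-1"] divdeg_ord[OF t0] by simp
    then show ?thesis using divdeg_zeros_le[OF t n(1)] divdeg_poles_ge[OF t n] by simp
  qed
  have n0: "n > 0"
  proof (rule ccontr)
    assume "\<not> n > 0"
    then have "codim_le (adjoin k t) UNIV {0} 0" using n by simp
    from this[unfolded codim_le_def, rule_format, of "\<lambda>_. 1"] show False by auto
  qed
  define \<gamma> where "\<gamma> = int (n * N)"
  show ?thesis
  proof (rule that)
    show "\<gamma> \<ge> 0" by (simp add: \<gamma>_def)
    fix D and m :: nat assume D: "fin_div D" and m: "int m \<le> divdeg D - \<gamma>"
    define Dp where "Dp z = max 0 (D z)" for z
    have Dp: "fin_div Dp" unfolding fin_div_def
      by (rule finite_subset[OF _ D[unfolded fin_div_def]]) (auto simp: Dp_def)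
    have dp0: "divdeg Dp \<ge> 0" unfolding divdeg_def by (intro sum_nonneg) (auto simp: Dp_def)
    define r where "r = nat (divdeg Dp)"
    let ?R = "\<lambda>z. int (N + r) * pole_div t z"
    have R: "fin_div ?R" "divdeg ?R = int (N + r) * int n"
      using divdeg_lin[OF P P, of "int (N + r)" 0] degP by auto
    let ?E = "\<lambda>z. 1 * ?R z + (-1) * Dp z"
    have E: "fin_div ?E" "divdeg ?E = divdeg ?R - divdeg Dp" using divdeg_lin[OF R(1) Dp, of 1 "-1"] by auto
    have "codim_le k (sections C ?R) (sections C ?E) (nat (divdeg ?R - divdeg ?E))"
      by (intro sections_codim R E) (auto simp: Dp_def)
    then have "codim_ge k (sections C ?E) {0} (n * Suc r - r)"
      using codim_ge_diff[OF k submodule_sections[OF order_refl] N] E(2) by (simp add: r_def)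
    moreover have "n * Suc r - r \<ge> 1" using n0 by (cases n) auto
    ultimately obtain f where f: "f \<in> sections C ?E" "f \<noteq> 0" using nonzero_section by blast
    have fE: "ord_at z f + ?R z \<ge> D z" if "z \<in> C" for z
      using f that unfolding sections_def vge_def by (auto simp: Dp_def)
    let ?D' = "\<lambda>z. ?R z + ord_at z f"
    have D': "fin_div ?D'" "divdeg ?D' = divdeg ?R"
      using divdeg_lin[OF R(1) fin_div_ord[OF f(2)], of 1 1] divdeg_ord[OF f(2)] by auto
    have "codim_ge k (sections C ?D') {0} (n * Suc r)" using codim_ge_sections_shift[OF f(2) N] .
    moreover have "codim_le k (sections C ?D') (sections C D) (nat (divdeg ?R - divdeg D))"
      using sections_codim[OF D'(1) D] fE D'(2) by (simp add: add.commute)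
    ultimately have "codim_ge k (sections C D) {0} (n * Suc r - nat (divdeg ?R - divdeg D))"
      using codim_ge_diff[OF k submodule_sections[OF order_refl]] by blast
    moreover have "m \<le> n * Suc r - nat (divdeg ?R - divdeg D)"
    proof -
      have "int m + (int (N + r) * int n - divdeg D) \<le> int (n * Suc r)"
        using m n0 by (simp add: \<gamma>_def algebra_simps)
      moreover have "divdeg D \<le> divdeg ?R"
        using divdeg_mono[OF D D'(1)] fE D'(2) by (simp add: add.commute)
      ultimately have "int m + int (nat (divdeg ?R - divdeg D)) \<le> int (n * Suc r)" unfolding R(2) by linarith
      then show ?thesis by linarith
    qed
    ultimately show "codim_ge k (sections C D) {0} m"
      using codim_ge_mono is_subringD(1)[OF subring_k] by blast
  qed
qed

text \<open>Divisors of positive degree are ample: their multiples have sections vanishing as required,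
  and sections whose zero at a given point stays bounded.\<close>

lemma ample_sections:
  assumes D: "fin_div D" "divdeg D > 0" and B: "fin_div B"
  shows "\<exists>r0. \<forall>r\<ge>r0. \<exists>f\<in>sections C (\<lambda>z. int r * D z - B z). f \<noteq> 0"
proof -
  obtain \<gamma> where \<gamma>: "\<gamma> \<ge> 0" "\<And>D m. fin_div D \<Longrightarrow> int m \<le> divdeg D - \<gamma> \<Longrightarrow> codim_ge k (sections C D) {0} m"
    using riemann_inequality by blast
  show ?thesis
  proof (intro exI[of _ "nat (divdeg B + \<gamma> + 1)"] allI impI)
    fix r assume r: "nat (divdeg B + \<gamma> + 1) \<le> r"
    have lin: "fin_div (\<lambda>z. int r * D z - B z)" "divdeg (\<lambda>z. int r * D z - B z) = int r * divdeg D - divdeg B"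
      using divdeg_lin[OF D(1) B, of "int r" "-1"] by auto
    have "int r * 1 \<le> int r * divdeg D" using D(2) by (intro mult_left_mono) auto
    then have "int 1 \<le> divdeg (\<lambda>z. int r * D z - B z) - \<gamma>" using lin(2) r by linarith
    from nonzero_section[OF \<gamma>(2)[OF lin(1) this]]
    show "\<exists>f\<in>sections C (\<lambda>z. int r * D z - B z). f \<noteq> 0" by auto
  qed
qed

lemma bounded_sections:
  assumes D: "fin_div D" "divdeg D > 0" and z: "z \<in> C"
  shows "\<exists>c r0. \<forall>r\<ge>r0. \<exists>f\<in>sections C (\<lambda>z. int r * D z). f \<noteq> 0 \<and> ord_at z f + int r * D z \<le> c"
proof -
  obtain \<gamma> where \<gamma>: "\<gamma> \<ge> 0" "\<And>D m. fin_div D \<Longrightarrow> int m \<le> divdeg D - \<gamma> \<Longrightarrow> codim_ge k (sections C D) {0} m"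
    using riemann_inequality by blast
  define c where "c = \<gamma> + 1"
  show ?thesis
  proof (intro exI[of _ c] exI[of _ "nat (\<gamma> + 2)"] allI impI)
    fix r assume r: "nat (\<gamma> + 2) \<le> r"
    let ?D = "\<lambda>z. int r * D z"
    have lin: "fin_div ?D" "divdeg ?D = int r * divdeg D"
      using divdeg_lin[OF D(1) D(1), of "int r" 0] by auto
    have "int r * 1 \<le> int r * divdeg D" using D(2) by (intro mult_left_mono) auto
    then have pos: "divdeg ?D - \<gamma> \<ge> 2" using lin(2) r by linarith
    show "\<exists>f\<in>sections C ?D. f \<noteq> 0 \<and> ord_at z f + int r * D z \<le> c"
    proof (rule ccontr)
      assume neg: "\<not> ?thesis"
      let ?e = "\<lambda>y. if y = z then 1 else 0 :: int"
      have e: "fin_div ?e" "divdeg ?e = int (residue_degree k z)"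
      proof -
        have W: "{y \<in> C. ?e y \<noteq> 0} = {z}" using z by auto
        show "fin_div ?e" unfolding fin_div_def W by simp
        show "divdeg ?e = int (residue_degree k z)" unfolding divdeg_def W by simp
      qed
      let ?D' = "\<lambda>y. 1 * ?D y + (- (c + 1)) * ?e y"
      have D': "fin_div ?D'" "divdeg ?D' = divdeg ?D - (c + 1) * int (residue_degree k z)"
        using divdeg_lin[OF lin(1) e(1), of 1 "- (c + 1)"] unfolding e(2) by (simp_all only: mult_1 mult_minus_left diff_conv_add_uminus)
      have sub: "sections C ?D \<subseteq> sections C ?D'"
      proof
        fix f assume f: "f \<in> sections C ?D"
        show "f \<in> sections C ?D'"
        proof (cases "f = 0")
          case True
          then show ?thesis by (simp add: sections_def vge_def)
        next
          case False
          then have "ord_at z f + int r * D z \<ge> c + 1" using neg f by force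
          then show ?thesis using f unfolding sections_def by (auto simp: vge_def)
        qed
      qed
      define m where "m = nat (divdeg ?D - \<gamma>)"
      have m: "codim_ge k (sections C ?D) {0} m" using \<gamma>(2)[OF lin(1)] pos by (simp add: m_def)
      have "m \<ge> 1" using pos by (simp add: m_def)
      then obtain f where f: "f \<in> sections C ?D" "f \<noteq> 0" using nonzero_section[OF m] by blast
      have "codim_le k (sections C ?D') {0} (nat (divdeg ?D') + 1)"
        using sections_upper_bound[OF D'(1) f(2)] f sub divdeg_ord[OF f(2)] by auto
      moreover have "codim_ge k (sections C ?D') {0} m"
        using codim_ge_mono[OF m order_refl sub] is_subringD(1)[OF subring_k] by blast
      ultimately have "m \<le> nat (divdeg ?D') + 1"
        using codim_ge_le is_subringD(1)[OF subring_k] by blast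
      moreover have "(c + 1) * 1 \<le> (c + 1) * int (residue_degree k z)"
        using residue_degree_codim(3)[OF z] \<gamma>(1) by (intro mult_left_mono) (auto simp: c_def)
      moreover define x where "x = (c + 1) * int (residue_degree k z)"
      ultimately have mx: "m \<le> nat (divdeg ?D - x) + 1" "x \<ge> c + 1"
        unfolding x_def[symmetric] D'(2) by simp_all
      then have "int m \<le> 1 \<or> int m \<le> divdeg ?D - (c + 1) + 1" by linarith
      then show False using pos unfolding m_def c_def by linarith
    qed
  qed
qed

end

(*PART P7*)
lemma proper_ideal_in_maximal:
  assumes R: "is_subring R" and I: "is_ideal R I" "1 \<notin> I"
  shows "\<exists>m. maximalideal m (subring_rec R) \<and> I \<subseteq> m"
proof -
  note RD = is_subringD[OF R]
  let ?A = "{J. is_ideal R J \<and> I \<subseteq> J \<and> 1 \<notin> J}"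
  have "\<exists>U\<in>?A. \<forall>W\<in>c. W \<subseteq> U" if c: "c \<in> chains ?A" for c
  proof (cases "c = {}")
    case True
    then show ?thesis using I by blast
  next
    case False
    have cA: "\<And>J. J \<in> c \<Longrightarrow> is_ideal R J \<and> I \<subseteq> J \<and> 1 \<notin> J" using c unfolding chains_def by blast
    have tot: "\<And>J J'. J \<in> c \<Longrightarrow> J' \<in> c \<Longrightarrow> J \<subseteq> J' \<or> J' \<subseteq> J"
      using c unfolding chains_def chain_subset_def by blast
    have "is_ideal R (\<Union>c)"
      unfolding is_ideal_def
    proof (intro conjI ballI)
      show "\<Union>c \<subseteq> R" using cA unfolding is_ideal_def by blast
      show "0 \<in> \<Union>c" using cA False unfolding is_ideal_def by blast
      fix x assume "x \<in> \<Union>c" then obtain J where J: "J \<in> c" "x \<in> J" by blast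
      show "r * x \<in> \<Union>c" if "r \<in> R" for r using cA[OF J(1)] J that unfolding is_ideal_def by blast
      fix y assume "y \<in> \<Union>c" then obtain J' where J': "J' \<in> c" "y \<in> J'" by blast
      show "x + y \<in> \<Union>c"
      proof (cases "J \<subseteq> J'")
        case True
        then have "x \<in> J'" using J by blast
        then have "x + y \<in> J'" using cA[OF J'(1)] J'(2) unfolding is_ideal_def by blast
        then show ?thesis using J' by blast
      next
        case False
        then have "y \<in> J" using tot[OF J(1) J'(1)] J' by blast
        then have "x + y \<in> J" using cA[OF J(1)] J(2) unfolding is_ideal_def by blast
        then show ?thesis using J by blast
      qed
    qed
    moreover have "I \<subseteq> \<Union>c" using cA False by blast
    moreover have "1 \<notin> \<Union>c" using cA by blast
    ultimately show ?thesis by blast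
  qed
  then obtain m where m: "m \<in> ?A" and mmax: "\<forall>W\<in>?A. m \<subseteq> W \<longrightarrow> W = m"
    using Zorn_Lemma2[of ?A] by blast
  have "maximalideal m (subring_rec R)"
    unfolding maximalideal_iff[OF R]
  proof (intro conjI allI impI)
    show "is_ideal R m" using m by blast
    show "m \<noteq> R" using m RD(2) by blast
    fix J assume J: "is_ideal R J \<and> m \<subseteq> J"
    show "J = m \<or> J = R"
    proof (cases "1 \<in> J")
      case True
      have "x \<in> J" if "x \<in> R" for x
      proof -
        have "x * 1 \<in> J" using J True that unfolding is_ideal_def by blast
        then show ?thesis by simp
      qed
      then show ?thesis using J unfolding is_ideal_def by blast
    next
      case False
      then have "J \<in> ?A" using J m by blast
      then show ?thesis using mmax J by blast
    qed
  qed
  then show ?thesis using m by blast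
qed

lemma regular_everywhere_on_chart:
  assumes R: "is_subring R" and f: "\<And>z. z \<in> closed_points R \<Longrightarrow> f \<in> z"
  shows "f \<in> R"
proof (rule ccontr)
  assume "f \<notin> R"
  note RD = is_subringD[OF R]
  define I where "I = {r \<in> R. r * f \<in> R}"
  have "is_ideal R I"
    unfolding is_ideal_def I_def using RD by (auto simp: distrib_right mult.assoc)
  moreover have "1 \<notin> I" using \<open>f \<notin> R\<close> by (simp add: I_def)
  ultimately obtain m where m: "maximalideal m (subring_rec R)" "I \<subseteq> m"
    using proper_ideal_in_maximal[OF R] by blast
  have "f \<in> localization_at R m" using f m unfolding closed_points_def by blast
  then obtain a b where ab: "f = a / b" "a \<in> R" "b \<in> R" "b \<notin> m"
    unfolding localization_at_def by (elim CollectE exE conjE DiffE) metis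
  have "0 \<in> m" using maximal_is_prime(1)[OF R m(1)] unfolding is_ideal_def by blast
  then have "b \<noteq> 0" using ab by blast
  then have "b \<in> I" using ab by (simp add: I_def)
  then show False using m ab by blast
qed

definition monomials :: "'a::field set \<Rightarrow> nat \<Rightarrow> ('a \<Rightarrow> nat) set" where
  "monomials E n = {a. (\<forall>y. y \<notin> E \<longrightarrow> a y = 0) \<and> (\<Sum>y\<in>E. a y) = n}"

definition mon :: "'a::field set \<Rightarrow> ('a \<Rightarrow> nat) \<Rightarrow> 'a" where
  "mon E a = (\<Prod>y\<in>E. y ^ a y)"

text \<open>The span of the monomials of degree \<open>n\<close> in the homogeneous coordinates \<open>E\<close>.\<close>

definition forms :: "'a::field set \<Rightarrow> 'a set \<Rightarrow> nat \<Rightarrow> 'a set" where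
  "forms k E n = \<Inter>{U. submodule_over k U \<and> mon E ` monomials E n \<subseteq> U}"

lemma submodule_forms: "submodule_over k (forms k E n)"
  unfolding forms_def submodule_over_def by blast

lemma mon_in_forms: "a \<in> monomials E n \<Longrightarrow> mon E a \<in> forms k E n"
  unfolding forms_def by blast

lemma forms_least:
  assumes "submodule_over k U" "\<And>a. a \<in> monomials E n \<Longrightarrow> mon E a \<in> U" shows "forms k E n \<subseteq> U"
  unfolding forms_def using assms by blast

lemma forms_mult:
  assumes v: "v \<in> forms k E m" and w: "w \<in> forms k E n"
  shows "v * w \<in> forms k E (m + n)"
proof -
  note S = submodule_overD[OF submodule_forms[of k E "m + n"]]
  have 1: "mon E a * w \<in> forms k E (m + n)" if a: "a \<in> monomials E m" for a
  proof -
    have "submodule_over k {w. mon E a * w \<in> forms k E (m + n)}"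
      unfolding submodule_over_def using S(1-3) by (auto simp: distrib_left mult.left_commute)
    moreover have "mon E a * mon E b \<in> forms k E (m + n)" if b: "b \<in> monomials E n" for b
    proof -
      have "mon E a * mon E b = mon E (\<lambda>y. a y + b y)" by (simp add: mon_def power_add prod.distrib)
      moreover have "(\<lambda>y. a y + b y) \<in> monomials E (m + n)" using a b by (simp add: monomials_def sum.distrib)
      ultimately show ?thesis using mon_in_forms by metis
    qed
    ultimately have "forms k E n \<subseteq> {w. mon E a * w \<in> forms k E (m + n)}" by (intro forms_least) auto
    then show ?thesis using w by blast
  qed
  have "submodule_over k {v. v * w \<in> forms k E (m + n)}"
    unfolding submodule_over_def using S(1-3) by (auto simp: distrib_right mult.assoc)
  then have "forms k E m \<subseteq> {v. v * w \<in> forms k E (m + n)}" using 1 by (intro forms_least) auto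
  then show ?thesis using v by blast
qed

lemma single_monomial:
  assumes "finite E" "x \<in> E"
  shows "(\<lambda>y. if y = x then n else 0) \<in> monomials E n" "mon E (\<lambda>y. if y = x then n else 0) = x ^ n"
proof -
  show "(\<lambda>y. if y = x then n else 0) \<in> monomials E n" using assms by (auto simp: monomials_def)
  have "mon E (\<lambda>y. if y = x then n else 0) = (\<Prod>y\<in>E. if y = x then x ^ n else 1)"
    unfolding mon_def by (intro prod.cong) auto
  then show "mon E (\<lambda>y. if y = x then n else 0) = x ^ n" using assms by simp
qed

lemma power_in_forms: "finite E \<Longrightarrow> x \<in> E \<Longrightarrow> x ^ n \<in> forms k E n"
  using mon_in_forms[OF single_monomial(1)] single_monomial(2) by metis

lemma finite_monomials: assumes "finite E" shows "finite (monomials E n)"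
proof -
  have "monomials E n \<subseteq> {f. \<forall>y. (y \<in> E \<longrightarrow> f y \<in> {..n}) \<and> (y \<notin> E \<longrightarrow> f y = 0)}"
  proof (intro subsetI CollectI allI conjI impI)
    fix a y assume a: "a \<in> monomials E n"
    show "a y = 0" if "y \<notin> E" using a that by (simp add: monomials_def)
    show "a y \<in> {..n}" if "y \<in> E"
      using a member_le_sum[OF that, of a] assms by (auto simp: monomials_def)
  qed
  then show ?thesis using finite_set_of_finite_funs[OF assms, of "{..n}" 0] finite_subset by auto
qed

lemma forms_finite_dim:
  assumes k: "is_subfield k" and E: "finite E" shows "\<exists>d. codim_le k (forms k E n) {0} d"
proof -
  note kD = is_subringD[OF is_subfieldD(1)[OF k]]
  have fin: "finite (monomials E n)" using finite_monomials[OF E] .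
  obtain h where h: "bij_betw h {..<card (monomials E n)} (monomials E n)"
    using ex_bij_betw_nat_finite[OF fin] by (auto simp: lessThan_atLeast0)
  let ?N = "card (monomials E n)"
  define b where "b i = mon E (h i)" for i
  define U where "U = {v. \<exists>c. (\<forall>i<?N. c i \<in> k) \<and> v = (\<Sum>i<?N. c i * b i)}"
  have "submodule_over k U"
    unfolding submodule_over_def
  proof (intro conjI ballI)
    show "0 \<in> U" unfolding U_def using kD(1) by (intro CollectI exI[of _ "\<lambda>_. 0"]) simp
    fix x assume "x \<in> U" then obtain c where c: "\<forall>i<?N. c i \<in> k" "x = (\<Sum>i<?N. c i * b i)" unfolding U_def by blast
    {
      fix y assume "y \<in> U" then obtain e where e: "\<forall>i<?N. e i \<in> k" "y = (\<Sum>i<?N. e i * b i)" unfolding U_def by blast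
      show "x + y \<in> U" unfolding U_def using c e kD(3)
        by (intro CollectI exI[of _ "\<lambda>i. c i + e i"]) (simp add: distrib_right sum.distrib)
    }
  next
    fix a x assume a: "a \<in> k" and "x \<in> U"
    then obtain c where c: "\<forall>i<?N. c i \<in> k" "x = (\<Sum>i<?N. c i * b i)" unfolding U_def by blast
    show "a * x \<in> U" unfolding U_def using c a kD(4)
      by (intro CollectI exI[of _ "\<lambda>i. a * c i"]) (simp add: sum_distrib_left mult.assoc)
  qed
  moreover have "mon E a \<in> U" if "a \<in> monomials E n" for a
  proof -
    have "a \<in> h ` {..<?N}" using bij_betw_imp_surj_on[OF h] that by simp
    then obtain i where i: "i < ?N" "h i = a" by blast
    have "(\<Sum>j<?N. (if j = i then 1 else 0) * b j) = (\<Sum>j<?N. if j = i then b j else 0)"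
      by (intro sum.cong) auto
    also have "\<dots> = mon E a" using i by (simp add: b_def)
    finally show ?thesis unfolding U_def using kD(1,2)
      by (intro CollectI exI[of _ "\<lambda>j. if j = i then 1 else 0"]) simp
  qed
  ultimately have sub: "forms k E n \<subseteq> U" by (rule forms_least)
  have "codim_le k (forms k E n) {0} ?N"
  proof (rule codim_le_spanned[OF k, where b = b])
    show "submodule_over k {0}" by (simp add: submodule_over_def)
    fix v assume "v \<in> forms k E n"
    then obtain c where "\<forall>i<?N. c i \<in> k" "v = (\<Sum>i<?N. c i * b i)" using sub unfolding U_def by blast
    then show "\<exists>c. (\<forall>i<?N. c i \<in> k) \<and> v - (\<Sum>i<?N. c i * b i) \<in> {0}" by (intro exI[of _ c]) simp
  qed
  then show ?thesis by blast
qed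

lemma chart_element_denominator:
  assumes k: "is_subfield k" and E: "finite E" "x \<in> E" "x \<noteq> 0"
    and f: "f \<in> generated_algebra k {y / x | y. y \<in> E}"
  shows "\<exists>N. \<forall>n\<ge>N. f * x ^ n \<in> forms k E n"
proof -
  note kD = is_subringD[OF is_subfieldD(1)[OF k]]
  let ?S = "{g. \<exists>N. \<forall>n\<ge>N. g * x ^ n \<in> forms k E n}"
  note xn = power_in_forms[OF E(1,2)]
  have const: "c \<in> ?S" if "c \<in> k" for c
    using submodule_overD(3)[OF submodule_forms that xn] by blast
  have sub: "is_subring ?S"
    unfolding is_subring_def
  proof (intro conjI ballI)
    show "0 \<in> ?S" "1 \<in> ?S" using const kD(1,2) by blast+
    fix g assume "g \<in> ?S" then obtain N where N: "\<And>n. n \<ge> N \<Longrightarrow> g * x ^ n \<in> forms k E n" by blast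
    have "(-1) * (g * x ^ n) \<in> forms k E n" if "n \<ge> N" for n
      using submodule_overD(3)[OF submodule_forms _ N[OF that]] kD(2,5) by blast
    then show "- g \<in> ?S" by auto
    fix g' assume "g' \<in> ?S" then obtain N' where N': "\<And>n. n \<ge> N' \<Longrightarrow> g' * x ^ n \<in> forms k E n" by blast
    have "(g + g') * x ^ n \<in> forms k E n" if "n \<ge> max N N'" for n
      using submodule_overD(2)[OF submodule_forms N[of n] N'[of n]] that by (simp add: distrib_right)
    then show "g + g' \<in> ?S" by blast
    have "(g * g') * x ^ n \<in> forms k E n" if n: "n \<ge> N + N'" for n
    proof -
      have "(g * x ^ N) * (g' * x ^ (n - N)) \<in> forms k E (N + (n - N))"
        using N[of N] N'[of "n - N"] n by (intro forms_mult) auto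
      moreover have "(g * x ^ N) * (g' * x ^ (n - N)) = (g * g') * x ^ n"
        using n by (simp add: mult.commute mult.left_commute power_add[symmetric])
      ultimately show ?thesis using n by simp
    qed
    then show "g * g' \<in> ?S" by blast
  qed
  have "y / x \<in> ?S" if y: "y \<in> E" for y
  proof -
    have "y / x * x ^ n \<in> forms k E n" if n: "n \<ge> 1" for n
    proof -
      have "y ^ 1 * x ^ (n - 1) \<in> forms k E (1 + (n - 1))"
        by (rule forms_mult[OF power_in_forms[OF E(1) y] xn])
      moreover have "y / x * x ^ n = y ^ 1 * x ^ (n - 1)" using n E(3) by (cases n) auto
      ultimately show ?thesis using n by simp
    qed
    then show ?thesis by blast
  qed
  then have "k \<union> {y / x | y. y \<in> E} \<subseteq> ?S" using const by blast
  then have "generated_algebra k {y / x | y. y \<in> E} \<subseteq> ?S"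
    unfolding generated_algebra_def using sub
    by (intro ring.generate_ring_min_subring1[OF ring_from_type_algebra]) (auto simp: subring_iff_is_subring)
  then show ?thesis using f by blast
qed

text \<open>On a projective curve, multiplication by an everywhere regular function maps forms of
  large degree to forms of the same degree; as these have finite dimension, the function is
  algebraic over \<open>k\<close>.\<close>

lemma (in places) projective_complete_places:
  assumes proj: "projective_curve k C"
  shows "complete_places k C"
proof
  fix f assume f: "\<And>z. z \<in> C \<Longrightarrow> f \<in> z"
  obtain E where E: "finite E" "E \<noteq> {}" "0 \<notin> E"
    "C = (\<Union>x\<in>E. closed_points (generated_algebra k {y / x | y. y \<in> E}))"
    using proj unfolding projective_curve_def by (elim exE conjE)
  have "\<exists>N. \<forall>n\<ge>N. f * x ^ n \<in> forms k E n" if x: "x \<in> E" for x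
  proof -
    let ?R = "generated_algebra k {y / x | y. y \<in> E}"
    have "subring ?R rota"
      unfolding generated_algebra_def by (rule ring.generate_ring_is_subring[OF ring_from_type_algebra]) simp
    then have R: "is_subring ?R" using subring_iff_is_subring by blast
    have "z \<in> C" if "z \<in> closed_points ?R" for z unfolding E(4) using x that by blast
    then have fR: "f \<in> ?R" using f by (intro regular_everywhere_on_chart[OF R]) blast
    have "x \<noteq> 0" using x E(3) by blast
    then show ?thesis by (rule chart_element_denominator[OF k E(1) x _ fR])
  qed
  then obtain N where N: "\<And>x n. x \<in> E \<Longrightarrow> n \<ge> N x \<Longrightarrow> f * x ^ n \<in> forms k E n" by metis
  define n where "n = Suc (\<Sum>x\<in>E. N x)"
  have n: "f * x ^ n \<in> forms k E n" if "x \<in> E" for x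
  proof (rule N[OF that])
    show "n \<ge> N x" unfolding n_def using member_le_sum[of x E N] that E(1) by auto
  qed
  define M where "M = card E * n"
  have stable: "f * v \<in> forms k E M" if v: "v \<in> forms k E M" for v
  proof -
    note S = submodule_overD[OF submodule_forms[of k E M]]
    have "submodule_over k {v. f * v \<in> forms k E M}"
      unfolding submodule_over_def using S(1-3) by (auto simp: distrib_left mult.left_commute)
    moreover have "f * mon E a \<in> forms k E M" if a: "a \<in> monomials E M" for a
    proof -
      have "\<exists>x\<in>E. a x \<ge> n"
      proof (rule ccontr)
        assume "\<not> (\<exists>x\<in>E. a x \<ge> n)"
        then have lt: "\<And>x. x \<in> E \<Longrightarrow> a x < n" by (meson not_le)
        have "(\<Sum>x\<in>E. a x) < (\<Sum>x\<in>E. n)" by (rule sum_strict_mono[OF E(1,2) lt])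
        also have "\<dots> = M" by (simp add: M_def)
        also have "M = (\<Sum>x\<in>E. a x)" using a unfolding monomials_def by blast
        finally show False by simp
      qed
      then obtain x where x: "x \<in> E" "a x \<ge> n" by blast
      define a' where "a' = a(x := a x - n)"
      have sa: "sum a E = a x + sum a (E - {x})" "sum a' E = a' x + sum a' (E - {x})"
        using sum.remove[OF E(1) x(1)] by blast+
      have "sum a' (E - {x}) = sum a (E - {x})" by (intro sum.cong) (auto simp: a'_def)
      then have a': "a' \<in> monomials E (M - n)" "M \<ge> n"
        using a x sa by (auto simp: monomials_def a'_def)
      have "mon E a = x ^ a x * (\<Prod>y\<in>E - {x}. y ^ a y)" unfolding mon_def by (rule prod.remove[OF E(1) x(1)])
      also have "x ^ a x = x ^ n * x ^ a' x" using x by (simp add: a'_def power_add[symmetric])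
      also have "(\<Prod>y\<in>E - {x}. y ^ a y) = (\<Prod>y\<in>E - {x}. y ^ a' y)" by (intro prod.cong) (auto simp: a'_def)
      also have "x ^ n * x ^ a' x * (\<Prod>y\<in>E - {x}. y ^ a' y) = x ^ n * mon E a'"
        unfolding mon_def by (simp add: prod.remove[OF E(1) x(1), of "\<lambda>y. y ^ a' y"] mult.assoc)
      finally have eq: "f * mon E a = (f * x ^ n) * mon E a'" by (simp add: mult.assoc)
      show ?thesis unfolding eq using forms_mult[OF n[OF x(1)] mon_in_forms[OF a'(1)]] a'(2) by simp
    qed
    ultimately have "forms k E M \<subseteq> {v. f * v \<in> forms k E M}" by (intro forms_least) auto
    then show ?thesis using v by blast
  qed
  obtain x where x: "x \<in> E" using E(2) by blast
  have pow: "f ^ i * x ^ M \<in> forms k E M" for i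
    by (induction i) (use power_in_forms[OF E(1) x] stable in \<open>auto simp: mult.assoc\<close>)
  obtain d where d: "codim_le k (forms k E M) {0} d" using forms_finite_dim[OF k E(1)] by blast
  obtain c where c: "\<forall>i\<le>d. c i \<in> k" "\<exists>i\<le>d. c i \<noteq> 0" "(\<Sum>i\<le>d. c i * (f ^ i * x ^ M)) = 0"
    using d[unfolded codim_le_def, rule_format, of "\<lambda>i. f ^ i * x ^ M"] pow by auto
  define p where "p = (\<Sum>i\<le>d. monom (c i) i)"
  have "(\<Sum>i\<le>d. c i * (f ^ i * x ^ M)) = poly p f * x ^ M"
    by (simp add: p_def poly_sum poly_monom sum_distrib_right mult.assoc)
  then have "poly p f = 0" using c(3) x E(3) by auto
  moreover have "poly_over k p" unfolding p_def using c(1) by (intro poly_over_ring(8,11)[OF subring_k]) auto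
  moreover have "p \<noteq> 0"
  proof
    assume p0: "p = 0"
    have "coeff p i = c i" if "i \<le> d" for i unfolding p_def coeff_sum using that by (simp add: sum.delta)
    then show False using c(2) p0 by auto
  qed
  ultimately show "f \<in> k" using transc[of f] unfolding transc_over_def by blast
qed

(*PART P7b*)
context places
begin

lemma affine_functions:
  assumes R: "affine_curve_ring k R" and C: "C = closed_points R"
  shows "\<And>x z. x \<in> R \<Longrightarrow> z \<in> C \<Longrightarrow> x \<noteq> 0 \<Longrightarrow> ord_at z x \<ge> 0"
    "\<And>y. y \<in> C \<Longrightarrow> \<exists>x\<in>R. x \<noteq> 0 \<and> ord_at y x \<ge> 1"
    "\<And>y z. y \<in> C \<Longrightarrow> z \<in> C \<Longrightarrow> y \<noteq> z \<Longrightarrow> \<exists>x\<in>R. x \<noteq> 0 \<and> ord_at y x \<ge> 1 \<and> ord_at z x = 0"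
    "is_subring R"
proof -
  note RR = affine_curve_ringD[OF k R]
  show sub: "is_subring R" by (rule RR(2))
  have loc: "\<exists>m. maximalideal m (subring_rec R) \<and> z = localization_at R m \<and> R \<subseteq> z \<and> R \<inter> max_ideal_at z = m"
    if zC: "z \<in> C" for z
  proof -
    obtain m where m: "z = localization_at R m" "maximalideal m (subring_rec R)"
      using zC unfolding C closed_points_def by blast
    then show ?thesis using localization_props(2,4)[OF sub m(2,1)] by blast
  qed
  show nn: "ord_at z x \<ge> 0" if "x \<in> R" "z \<in> C" "x \<noteq> 0" for x z
  proof -
    have "x \<in> z" using loc[OF that(2)] that(1) by blast
    then show ?thesis using discrete_placeD(5)[OF place[OF that(2)]] that(3) by (simp add: vge_def)
  qed
  have pos: "x \<noteq> 0 \<Longrightarrow> ord_at z x \<ge> 1" if "x \<in> max_ideal_at z" "z \<in> C" for x z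
    using that discrete_placeD(6)[OF place[OF that(2)]] by (simp add: vge_def)
  show "\<exists>x\<in>R. x \<noteq> 0 \<and> ord_at y x \<ge> 1" if y: "y \<in> C" for y
  proof -
    obtain m where m: "maximalideal m (subring_rec R)" "R \<inter> max_ideal_at y = m" using loc[OF y] by blast
    have "m \<noteq> {0}" using m(1) RR(6) by metis
    moreover have "0 \<in> m" using maximal_is_prime(1)[OF sub m(1)] unfolding is_ideal_def by blast
    ultimately obtain x where "x \<in> m" "x \<noteq> 0" by blast
    then show ?thesis using m(2) pos[OF _ y] by blast
  qed
  show "\<exists>x\<in>R. x \<noteq> 0 \<and> ord_at y x \<ge> 1 \<and> ord_at z x = 0" if y: "y \<in> C" and z: "z \<in> C" and ne: "y \<noteq> z" for y z
  proof -
    obtain m where m: "maximalideal m (subring_rec R)" "y = localization_at R m" "R \<inter> max_ideal_at y = m"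
      using loc[OF y] by blast
    obtain n where n: "maximalideal n (subring_rec R)" "z = localization_at R n" "R \<inter> max_ideal_at z = n"
      using loc[OF z] by blast
    have "\<not> m \<subseteq> n"
    proof
      assume "m \<subseteq> n"
      then have "n = m" using m(1) n(1) unfolding maximalideal_iff[OF sub] by metis
      then show False using m n ne by simp
    qed
    then obtain x where x: "x \<in> m" "x \<notin> n" by blast
    have xR: "x \<in> R" using x m by blast
    have "0 \<in> n" using maximal_is_prime(1)[OF sub n(1)] unfolding is_ideal_def by blast
    then have x0: "x \<noteq> 0" using x by blast
    have "x \<notin> max_ideal_at z" using x xR n by blast
    then have "\<not> ord_at z x \<ge> 1" using discrete_placeD(6)[OF place[OF z]] x0 by (simp add: vge_def)
    then have "ord_at z x = 0" using nn[OF xR z x0] by simp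
    moreover have "ord_at y x \<ge> 1" using pos[OF _ y x0] x m by blast
    ultimately show ?thesis using xR x0 by blast
  qed
qed

lemma affine_high_order:
  assumes R: "affine_curve_ring k R" and C: "C = closed_points R" and Y: "finite Y" "Y \<subseteq> C"
    and g: "\<And>y. y \<in> Y \<Longrightarrow> g y \<in> R \<and> g y \<noteq> 0 \<and> ord_at y (g y) \<ge> 1"
  shows "\<exists>f\<in>R. f \<noteq> 0 \<and> (\<forall>y\<in>Y. ord_at y f \<ge> int N) \<and>
    (\<forall>z\<in>C. (\<forall>y\<in>Y. ord_at z (g y) = 0) \<longrightarrow> ord_at z f = 0)"
proof -
  note A = affine_functions[OF R C] and RD = is_subringD[OF affine_functions(4)[OF R C]]
  have prod: "ord_at z (\<Prod>y\<in>Y'. g y ^ N) = (\<Sum>y\<in>Y'. int N * ord_at z (g y))"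
    if z: "z \<in> C" and sub: "Y' \<subseteq> Y" for z Y'
    using finite_subset[OF sub Y(1)] sub
  proof (induction Y' rule: finite_induct)
    case empty
    show ?case using ord_simps(1)[OF place[OF z]] by simp
  next
    case (insert y Y')
    have gy: "g y \<noteq> 0" "(\<Prod>y\<in>Y'. g y ^ N) \<noteq> 0" using g insert by auto
    then show ?case
      using discrete_placeD(2)[OF place[OF z], of "g y ^ N"] ord_simps(6)[OF place[OF z] gy(1)] insert by simp
  qed
  show ?thesis
  proof (intro bexI[of _ "\<Prod>y\<in>Y. g y ^ N"] conjI ballI impI)
    show "(\<Prod>y\<in>Y. g y ^ N) \<in> R" using g by (intro RD(9) RD(7)) blast
    show "(\<Prod>y\<in>Y. g y ^ N) \<noteq> 0" using g Y by simp
    fix y assume y: "y \<in> Y"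
    have yC: "y \<in> C" using y Y by blast
    have nonneg: "0 \<le> int N * ord_at y (g y')" if "y' \<in> Y" for y'
      using A(1)[OF _ yC, of "g y'"] g[OF that] by simp
    have "int N * 1 \<le> int N * ord_at y (g y)" using g[OF y] by (intro mult_left_mono) auto
    also have "\<dots> \<le> (\<Sum>y'\<in>Y. int N * ord_at y (g y'))"
      using nonneg Y(1) y by (intro member_le_sum) auto
    finally show "ord_at y (\<Prod>y\<in>Y. g y ^ N) \<ge> int N" using prod[OF yC order_refl] by simp
  next
    fix z assume "z \<in> C" "\<forall>y\<in>Y. ord_at z (g y) = 0"
    then show "ord_at z (\<Prod>y\<in>Y. g y ^ N) = 0" using prod[OF _ order_refl] by simp
  qed
qed

lemma affine_ample_sections:
  assumes aff: "affine_curve k C" and D: "fin_div D"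
  shows "\<exists>f. f \<noteq> 0 \<and> (\<forall>z\<in>C. ord_at z f + D z \<ge> 0)"
proof -
  obtain R where R: "affine_curve_ring k R" "C = closed_points R" using aff unfolding affine_curve_def by blast
  note A = affine_functions[OF R]
  let ?Y = "{z \<in> C. D z \<noteq> 0}"
  have Y: "finite ?Y" using D by (simp add: fin_div_def)
  have "\<forall>y\<in>?Y. \<exists>x. x \<in> R \<and> x \<noteq> 0 \<and> ord_at y x \<ge> 1" using A(2) by auto
  then obtain g where g: "\<And>y. y \<in> ?Y \<Longrightarrow> g y \<in> R \<and> g y \<noteq> 0 \<and> ord_at y (g y) \<ge> 1"
    by (subst (asm) bchoice_iff) blast
  define N where "N = (\<Sum>y\<in>?Y. nat \<bar>D y\<bar>)"
  have N: "int N \<ge> \<bar>D y\<bar>" if "y \<in> ?Y" for y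
    using member_le_sum[OF that, of "\<lambda>y. nat \<bar>D y\<bar>"] Y unfolding N_def by linarith
  have YC: "?Y \<subseteq> C" by blast
  obtain f where f: "f \<in> R" "f \<noteq> 0" "\<And>y. y \<in> ?Y \<Longrightarrow> ord_at y f \<ge> int N"
    using affine_high_order[OF R Y YC g, of N] by blast
  have "ord_at z f + D z \<ge> 0" if z: "z \<in> C" for z
  proof (cases "D z = 0")
    case True
    then show ?thesis using A(1)[OF f(1) z f(2)] by simp
  next
    case False
    then have "z \<in> ?Y" using z by simp
    then show ?thesis using f(3)[of z] N[of z] by linarith
  qed
  then show ?thesis using f(2) by blast
qed

lemma affine_bounded_sections:
  assumes aff: "affine_curve k C" and D: "fin_div D" and z: "z \<in> C"
  shows "\<exists>f. f \<noteq> 0 \<and> (\<forall>y\<in>C. ord_at y f + D y \<ge> 0) \<and> ord_at z f + D z = 0"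
proof -
  obtain R where R: "affine_curve_ring k R" "C = closed_points R" using aff unfolding affine_curve_def by blast
  note A = affine_functions[OF R]
  obtain t where t: "t \<noteq> 0" "ord_at z t = 1" using uniformizer[OF z] by metis
  define s where "s = t powi (- D z)"
  have s: "s \<noteq> 0" "ord_at z s = - D z" using t ord_simps(7)[OF place[OF z] t(1), of "- D z"] by (auto simp: s_def)
  let ?Y = "({y \<in> C. D y \<noteq> 0} \<union> {y \<in> C. ord_at y s \<noteq> 0}) - {z}"
  have Y: "finite ?Y" using D finite_support[OF s(1)] by (simp add: fin_div_def)
  have "\<forall>y\<in>?Y. \<exists>x. x \<in> R \<and> x \<noteq> 0 \<and> ord_at y x \<ge> 1 \<and> ord_at z x = 0" using A(3)[OF _ z] by auto
  from bchoice[OF this] obtain g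
    where g0: "\<forall>y\<in>?Y. g y \<in> R \<and> g y \<noteq> 0 \<and> ord_at y (g y) \<ge> 1 \<and> ord_at z (g y) = 0" by (elim exE)
  note g = bspec[OF g0]
  define N where "N = (\<Sum>y\<in>?Y. nat \<bar>D y\<bar> + nat \<bar>ord_at y s\<bar>)"
  have N: "int N \<ge> \<bar>D y\<bar> + \<bar>ord_at y s\<bar>" if "y \<in> ?Y" for y
    using member_le_sum[OF that, of "\<lambda>y. nat \<bar>D y\<bar> + nat \<bar>ord_at y s\<bar>"] Y unfolding N_def by linarith
  have YC: "?Y \<subseteq> C" by blast
  have gR: "g y \<in> R \<and> g y \<noteq> 0 \<and> 1 \<le> ord_at y (g y)" if "y \<in> ?Y" for y using g[OF that] by blast
  have "\<exists>f\<in>R. f \<noteq> 0 \<and> (\<forall>y\<in>?Y. ord_at y f \<ge> int N) \<and>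
      (\<forall>z\<in>C. (\<forall>y\<in>?Y. ord_at z (g y) = 0) \<longrightarrow> ord_at z f = 0)"
    by (rule affine_high_order[OF R Y YC]) (rule gR)
  then obtain f where f: "f \<in> R" "f \<noteq> 0" "\<forall>y\<in>?Y. ord_at y f \<ge> int N"
    "\<forall>z\<in>C. (\<forall>y\<in>?Y. ord_at z (g y) = 0) \<longrightarrow> ord_at z f = 0"
    by (elim bexE conjE)
  have fz: "ord_at z f = 0" using bspec[OF f(4) z] g by blast
  have sf: "ord_at y (s * f) = ord_at y s + ord_at y f" if "y \<in> C" for y
    using discrete_placeD(2)[OF place[OF that] s(1) f(2)] .
  have "ord_at y (s * f) + D y \<ge> 0" if y: "y \<in> C" for y
  proof (cases "y \<in> ?Y")
    case True
    then show ?thesis using bspec[OF f(3) True] N[OF True] sf[OF y] by linarith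
  next
    case False
    then consider "y = z" | "D y = 0" "ord_at y s = 0" using y by blast
    then show ?thesis
    proof cases
      case 1
      then show ?thesis using sf[OF z] fz s by simp
    next
      case 2
      then show ?thesis using sf[OF y] A(1)[OF f(1) y f(2)] by simp
    qed
  qed
  moreover have "ord_at z (s * f) + D z = 0" using sf[OF z] fz s by simp
  ultimately show ?thesis using s f by (intro exI[of _ "s * f"]) auto
qed

text \<open>The two cases of properness together.\<close>

lemma curve_ample_sections:
  assumes "affine_curve k C \<or> (projective_curve k C \<and> divdeg D > 0)" and D: "fin_div D" and B: "fin_div B"
  shows "\<exists>r0. \<forall>r\<ge>r0. \<exists>f. f \<noteq> 0 \<and> (\<forall>z\<in>C. ord_at z f + int r * D z \<ge> B z)"
  using assms(1)
proof
  assume aff: "affine_curve k C"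
  have "\<exists>f. f \<noteq> 0 \<and> (\<forall>z\<in>C. ord_at z f + int r * D z \<ge> B z)" for r
    using affine_ample_sections[OF aff divdeg_lin(1)[OF D B, of "int r" "-1"]] by force
  then show ?thesis by blast
next
  assume p: "projective_curve k C \<and> divdeg D > 0"
  interpret complete_places k C using projective_complete_places p by blast
  obtain r0 where r0: "\<And>r. r \<ge> r0 \<Longrightarrow> \<exists>f\<in>sections C (\<lambda>z. int r * D z - B z). f \<noteq> 0"
    using ample_sections[OF D _ B] p by blast
  have "\<exists>f. f \<noteq> 0 \<and> (\<forall>z\<in>C. ord_at z f + int r * D z \<ge> B z)" if "r \<ge> r0" for r
    using r0[OF that] unfolding sections_def vge_def by fastforce
  then show ?thesis by blast
qed

lemma curve_bounded_sections:
  assumes "affine_curve k C \<or> (projective_curve k C \<and> divdeg D > 0)" and D: "fin_div D" and z: "z \<in> C"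
  shows "\<exists>c r0. \<forall>r\<ge>r0. \<exists>f. f \<noteq> 0 \<and> (\<forall>y\<in>C. ord_at y f + int r * D y \<ge> 0) \<and> ord_at z f + int r * D z \<le> c"
  using assms(1)
proof
  assume aff: "affine_curve k C"
  have "\<exists>f. f \<noteq> 0 \<and> (\<forall>y\<in>C. ord_at y f + int r * D y \<ge> 0) \<and> ord_at z f + int r * D z \<le> 0" for r
    using affine_bounded_sections[OF aff divdeg_lin(1)[OF D D, of "int r" 0] z] by auto
  then show ?thesis by - (rule exI[of _ 0], rule exI[of _ 0], intro allI impI)
next
  assume p: "projective_curve k C \<and> divdeg D > 0"
  interpret complete_places k C using projective_complete_places p by blast
  obtain c r0 where r0: "\<And>r. r \<ge> r0 \<Longrightarrow> \<exists>f\<in>sections C (\<lambda>z. int r * D z). f \<noteq> 0 \<and> ord_at z f + int r * D z \<le> c"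
    using bounded_sections[OF D _ z] p by blast
  have "\<exists>f. f \<noteq> 0 \<and> (\<forall>y\<in>C. ord_at y f + int r * D y \<ge> 0) \<and> ord_at z f + int r * D z \<le> c" if "r \<ge> r0" for r
    using r0[OF that] unfolding sections_def vge_def by fastforce
  then show ?thesis by - (rule exI[of _ c], rule exI[of _ r0], intro allI impI)
qed

end

(*PART P8a*)
lemma convex_coneI:
  assumes "0 \<in> S" "\<And>x y. x \<in> S \<Longrightarrow> y \<in> S \<Longrightarrow> x + y \<in> S" "\<And>x c. x \<in> S \<Longrightarrow> 0 \<le> c \<Longrightarrow> c *\<^sub>R x \<in> S"
  shows "convex_cone S"
  using assms unfolding convex_cone_iff by blast

lemma convex_coneD:
  assumes "convex_cone S"
  shows "0 \<in> S" "\<And>x y. x \<in> S \<Longrightarrow> y \<in> S \<Longrightarrow> x + y \<in> S" "\<And>x c. x \<in> S \<Longrightarrow> 0 \<le> c \<Longrightarrow> c *\<^sub>R x \<in> S"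
  using assms unfolding convex_cone_iff by blast+

lemma separate_from_cone:
  fixes \<sigma> :: "(real ^ 'n::finite) set"
  assumes \<sigma>: "convex_cone \<sigma>" "closed \<sigma>" and x: "x \<notin> \<sigma>"
  obtains a where "\<And>v. v \<in> \<sigma> \<Longrightarrow> a \<bullet> v \<ge> 0" "a \<bullet> x < 0"
proof -
  note S = convex_coneD[OF \<sigma>(1)]
  have "convex \<sigma>" using \<sigma>(1) unfolding convex_cone_def by blast
  then obtain a b where ab: "a \<bullet> x < b" "\<And>v. v \<in> \<sigma> \<Longrightarrow> b < a \<bullet> v"
    using separating_hyperplane_closed_point[OF _ \<sigma>(2) x] by blast
  have b: "b < 0" using ab(2)[OF S(1)] by simp
  show ?thesis
  proof (rule that)
    show "a \<bullet> x < 0" using ab(1) b by simp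
    fix v assume v: "v \<in> \<sigma>"
    show "a \<bullet> v \<ge> 0"
    proof (rule ccontr)
      assume n: "\<not> a \<bullet> v \<ge> 0"
      then have "b / (a \<bullet> v) \<ge> 0" using b by (simp add: divide_nonpos_neg)
      then have "b < a \<bullet> ((b / (a \<bullet> v)) *\<^sub>R v)" using ab(2) S(3)[OF v] by blast
      then show False using n by simp
    qed
  qed
qed

definition lattice_point :: "('n::finite \<Rightarrow> int) \<Rightarrow> 'n dual_lattice" where
  "lattice_point f = Abs_poly_mapping f"

lemma lookup_lattice_point [simp]: "Poly_Mapping.lookup (lattice_point f) i = f i"
  unfolding lattice_point_def by simp

lemma pairing_inner: "pairing m v = (\<chi> i. real_of_int (Poly_Mapping.lookup m i)) \<bullet> v"
  by (simp add: pairing_def inner_vec_def)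

lemma pairing_real_simps:
  fixes v w :: "real ^ 'n::finite"
  shows "pairing m (v + w) = pairing m v + pairing m w" "pairing m (c *\<^sub>R v) = c * pairing m v"
    "pairing m 0 = (0::real)" "pairing m (v - w) = pairing m v - pairing m w" "pairing m (- v) = - pairing m v"
  by (simp_all add: pairing_inner inner_add_right inner_diff_right)

lemma pairing_add: "pairing (m + m') v = pairing m v + pairing m' (v :: 'a::comm_ring_1 ^ 'n::finite)"
  by (simp add: pairing_def lookup_add distrib_right sum.distrib)

lemma pairing_cmul: "pairing (frag_cmul c m) v = of_int c * pairing m (v :: 'a::comm_ring_1 ^ 'n::finite)"
  by (simp add: pairing_def sum_distrib_left mult.assoc)

lemma pairing_zero: "pairing 0 (v :: 'a::comm_ring_1 ^ 'n::finite) = 0" by (simp add: pairing_def)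

lemma pairing_lattice_vec: "pairing m (lattice_vec \<rho>) = real_of_int (pairing m \<rho>)"
  by (simp add: pairing_def lattice_vec_def)

lemma floor_approximation:
  fixes a v :: "real ^ 'n::finite"
  shows "\<bar>pairing (lattice_point (\<lambda>i. \<lfloor>r * a $ i\<rfloor>)) v - r * (a \<bullet> v)\<bar> \<le> (\<Sum>i\<in>UNIV. \<bar>v $ i\<bar>)"
proof -
  have "pairing (lattice_point (\<lambda>i. \<lfloor>r * a $ i\<rfloor>)) v - r * (a \<bullet> v) = (\<Sum>i\<in>UNIV. (of_int \<lfloor>r * a $ i\<rfloor> - r * a $ i) * v $ i)"
    by (simp add: pairing_def inner_vec_def sum_distrib_left sum_subtractf[symmetric] left_diff_distrib mult.assoc)
  also have "\<bar>\<dots>\<bar> \<le> (\<Sum>i\<in>UNIV. \<bar>(of_int \<lfloor>r * a $ i\<rfloor> - r * a $ i) * v $ i\<bar>)" by (rule sum_abs)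
  also have "\<dots> \<le> (\<Sum>i\<in>UNIV. \<bar>v $ i\<bar>)"
  proof (rule sum_mono)
    fix i
    have "\<bar>of_int \<lfloor>r * a $ i\<rfloor> - r * a $ i\<bar> \<le> 1" by linarith
    then show "\<bar>(of_int \<lfloor>r * a $ i\<rfloor> - r * a $ i) * v $ i\<bar> \<le> \<bar>v $ i\<bar>"
      unfolding abs_mult by (intro mult_left_le_one_le) auto
  qed
  finally show ?thesis .
qed

lemma finite_bound:
  assumes "finite V" "\<And>v. v \<in> V \<Longrightarrow> 0 < f v"
  obtains r :: real where "r \<ge> 0" "\<And>v. v \<in> V \<Longrightarrow> r * f v > g v"
proof -
  define r where "r = (\<Sum>v\<in>V. (\<bar>g v\<bar> + 1) / f v)"
  show ?thesis
  proof (rule that)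
    show "r \<ge> 0" unfolding r_def using assms(2) by (intro sum_nonneg divide_nonneg_nonneg) (auto intro: less_imp_le)
    fix v assume v: "v \<in> V"
    have "(\<bar>g v\<bar> + 1) / f v \<le> r" unfolding r_def using assms v
      by (intro member_le_sum) (auto intro!: divide_nonneg_nonneg intro: less_imp_le)
    then have "\<bar>g v\<bar> + 1 \<le> r * f v" using assms(2)[OF v] by (simp add: divide_le_eq)
    then show "r * f v > g v" by linarith
  qed
qed

text \<open>Strict linear inequalities that have a real solution have one in the lattice.\<close>

lemma lattice_solution:
  fixes V :: "(real ^ 'n::finite) set"
  assumes "finite V" "\<And>v. v \<in> V \<Longrightarrow> a \<bullet> v > 0"
  obtains m where "\<And>v. v \<in> V \<Longrightarrow> pairing m v > 0"
proof -
  obtain r :: real where r: "r \<ge> 0" "\<And>v. v \<in> V \<Longrightarrow> r * (a \<bullet> v) > (\<Sum>i\<in>UNIV. \<bar>v $ i\<bar>)"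
    using finite_bound[of V "\<lambda>v. a \<bullet> v" "\<lambda>v :: real ^ 'n. \<Sum>i\<in>UNIV. \<bar>v $ i\<bar>"] assms by blast
  show ?thesis
  proof (rule that)
    fix v assume "v \<in> V"
    then show "pairing (lattice_point (\<lambda>i. \<lfloor>r * a $ i\<rfloor>)) v > 0"
      using floor_approximation[of r a v] r(2)[of v] by linarith
  qed
qed

lemma perturbed_lattice_solution:
  fixes V W :: "(real ^ 'n::finite) set"
  assumes V: "finite V" "\<And>v. v \<in> V \<Longrightarrow> a \<bullet> v > 0"
    and W: "finite W" "\<And>v. v \<in> W \<Longrightarrow> a \<bullet> v \<ge> 0" "\<And>v. v \<in> W \<Longrightarrow> c \<bullet> v > 0"
  obtains m where "\<And>v. v \<in> V \<union> W \<Longrightarrow> pairing m v > 0"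
proof -
  obtain r :: real where r: "r \<ge> 0" "\<And>v. v \<in> V \<Longrightarrow> r * (a \<bullet> v) > - (c \<bullet> v)"
    using finite_bound[of V "\<lambda>v. a \<bullet> v" "\<lambda>v. - (c \<bullet> v)"] V by blast
  have "(r *\<^sub>R a + c) \<bullet> v > 0" if "v \<in> V \<union> W" for v
  proof (cases "v \<in> V")
    case True
    then show ?thesis using r(2)[OF True] by (simp add: inner_add_left)
  next
    case False
    then have "v \<in> W" using that by blast
    then have "r * (a \<bullet> v) \<ge> 0" "c \<bullet> v > 0" using W r(1) by auto
    then show ?thesis by (simp add: inner_add_left)
  qed
  then show ?thesis using lattice_solution[of "V \<union> W" "r *\<^sub>R a + c"] V(1) W(1) that by blast
qed

lemma lattice_vec_scale: "lattice_vec (d *s w) = real_of_int d *\<^sub>R lattice_vec w"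
  by (simp add: lattice_vec_def vec_eq_iff)

lemma lattice_vec_eq_iff [simp]: "lattice_vec v = lattice_vec w \<longleftrightarrow> v = w"
  by (simp add: lattice_vec_def vec_eq_iff)

lemma lattice_vec_zero [simp]: "lattice_vec v = 0 \<longleftrightarrow> v = 0"
  by (simp add: lattice_vec_def vec_eq_iff)

lemma primitive_nonzero: "primitive \<rho> \<Longrightarrow> \<rho> \<noteq> 0"
proof
  assume "primitive \<rho>" "\<rho> = 0"
  then have "(0 :: int ^ 'a) = 0 *s 0 \<longrightarrow> is_unit (0::int)" unfolding primitive_def by blast
  then show False by simp
qed

lemma primitive_part:
  fixes s :: "int ^ 'n::finite"
  assumes "s \<noteq> 0"
  obtains d \<rho> where "primitive \<rho>" "d > 0" "s = d *s \<rho>"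
proof -
  define d where "d = Gcd (range (\<lambda>i. s $ i))"
  have dvd: "d dvd s $ i" for i unfolding d_def by (intro Gcd_dvd) auto
  have "d \<noteq> 0" using assms dvd by (metis dvd_0_left_iff vec_eq_iff zero_index)
  then have d: "d > 0" unfolding d_def by (metis Gcd_int_greater_eq_0 order_le_less)
  define \<rho> where "\<rho> = (\<chi> i. s $ i div d)"
  have s: "s = d *s \<rho>" using dvd by (simp add: \<rho>_def vec_eq_iff)
  have "primitive \<rho>"
    unfolding primitive_def
  proof (intro allI impI)
    fix e w assume e: "\<rho> = e *s w"
    have "d * e dvd s $ i" for i using s e by (simp add: mult.assoc)
    then have "d * e dvd d" unfolding d_def by (intro Gcd_greatest) auto
    then show "is_unit e" using \<open>d \<noteq> 0\<close> by (metis dvd_mult_cancel_left mult.right_neutral)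
  qed
  then show ?thesis using that d s by blast
qed

lemma primitive_unique:
  fixes \<rho> \<rho>' :: "int ^ 'n::finite"
  assumes p: "primitive \<rho>" and p': "primitive \<rho>'" and c: "lattice_vec \<rho> = c *\<^sub>R lattice_vec \<rho>'" "c > 0"
  shows "\<rho> = \<rho>'"
proof -
  obtain i where i: "\<rho>' $ i \<noteq> 0" using primitive_nonzero[OF p'] by (metis vec_eq_iff zero_index)
  have comp: "real_of_int (\<rho> $ j) = c * real_of_int (\<rho>' $ j)" for j
    using arg_cong[OF c(1), of "\<lambda>v. v $ j"] by (simp add: lattice_vec_def)
  have cross: "\<rho> $ j * \<rho>' $ i = \<rho> $ i * \<rho>' $ j" for j
  proof -
    have "real_of_int (\<rho> $ j * \<rho>' $ i) = real_of_int (\<rho> $ i * \<rho>' $ j)" by (simp add: comp)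
    then show ?thesis by (simp only: of_int_eq_iff)
  qed
  define g where "g = gcd (\<rho> $ i) (\<rho>' $ i)"
  have g0: "g \<noteq> 0" using i by (simp add: g_def)
  obtain p q where pq: "\<rho> $ i = p * g" "\<rho>' $ i = q * g" "coprime p q"
    using gcd_coprime_exists[of "\<rho> $ i" "\<rho>' $ i"] g0 unfolding g_def by metis
  have pq': "\<rho> $ j * q = p * \<rho>' $ j" for j
  proof -
    have "(\<rho> $ j * q) * g = (p * \<rho>' $ j) * g" using cross[of j] pq by (simp add: algebra_simps)
    then show ?thesis using g0 by simp
  qed
  have "p dvd \<rho> $ j" for j using pq'[of j] pq(3) by (metis coprime_dvd_mult_left_iff dvd_triv_left)
  then have "\<rho> = p *s (\<chi> j. \<rho> $ j div p)" by (simp add: vec_eq_iff)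
  then have up: "is_unit p" using p unfolding primitive_def by blast
  have "q dvd \<rho>' $ j" for j using pq'[of j] pq(3) by (metis coprime_commute coprime_dvd_mult_right_iff dvd_triv_right)
  then have "\<rho>' = q *s (\<chi> j. \<rho>' $ j div q)" by (simp add: vec_eq_iff)
  then have uq: "is_unit q" using p' unfolding primitive_def by blast
  have "real_of_int p * g = c * (real_of_int q * g)" using comp[of i] pq by simp
  then have "real_of_int p = c * real_of_int q" using g0 by simp
  moreover have "\<bar>p\<bar> = 1" "\<bar>q\<bar> = 1" using up uq by auto
  ultimately have "c = 1 \<or> c = -1" by (auto simp: abs_if split: if_splits)
  then show ?thesis using c by simp
qed

lemma primitive_dual_vector:
  fixes \<rho> :: "int ^ 'n::finite"
  assumes "primitive \<rho>"
  obtains e :: "'n dual_lattice" where "pairing e \<rho> = -1"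
proof -
  let ?G = "range (\<lambda>e :: 'n dual_lattice. pairing e \<rho>)"
  have comb: "a * x + b * y \<in> ?G" if xy: "x \<in> ?G" "y \<in> ?G" for a b x y
  proof -
    obtain e f where "x = pairing e \<rho>" "y = pairing f \<rho>" using xy by auto
    then have "a * x + b * y = pairing (frag_cmul a e + frag_cmul b f) \<rho>" by (simp add: pairing_add pairing_cmul)
    then show ?thesis by blast
  qed
  have comp: "\<rho> $ i \<in> ?G" for i
  proof -
    have "pairing (lattice_point (\<lambda>j. if j = i then 1 else 0)) \<rho> = (\<Sum>j\<in>UNIV. if j = i then \<rho> $ j else 0)"
      unfolding pairing_def by (intro sum.cong) auto
    then have "pairing (lattice_point (\<lambda>j. if j = i then 1 else 0)) \<rho> = \<rho> $ i" by simp
    then show ?thesis by (metis rangeI)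
  qed
  obtain i where i: "\<rho> $ i \<noteq> 0" using primitive_nonzero[OF assms] by (metis vec_eq_iff zero_index)
  have "\<bar>\<rho> $ i\<bar> \<in> ?G"
    using comb[OF comp[of i] comp[of i], of "sgn (\<rho> $ i)" 0] by (simp add: abs_sgn mult.commute)
  then have ex: "\<exists>n::nat. n > 0 \<and> int n \<in> ?G" using i by (intro exI[of _ "nat \<bar>\<rho> $ i\<bar>"]) auto
  define d where "d = (LEAST n::nat. n > 0 \<and> int n \<in> ?G)"
  have d: "d > 0" "int d \<in> ?G" using LeastI_ex[OF ex] unfolding d_def by auto
  have "int d dvd x" if x: "x \<in> ?G" for x
  proof (rule ccontr)
    assume "\<not> int d dvd x"
    then have pos: "x mod int d \<noteq> 0" by (simp add: dvd_eq_mod_eq_0)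
    have m: "0 \<le> x mod int d" "x mod int d < int d" using d(1) by auto
    have "x mod int d = 1 * x + (- (x div int d)) * int d" by (simp add: minus_div_mult_eq_mod[symmetric])
    then have "x mod int d \<in> ?G" using comb[OF x d(2)] by metis
    then have "nat (x mod int d) > 0 \<and> int (nat (x mod int d)) \<in> ?G" using m pos by simp
    then have "d \<le> nat (x mod int d)" unfolding d_def by (rule Least_le)
    then show False using m by linarith
  qed
  then have "\<rho> = int d *s (\<chi> i. \<rho> $ i div int d)" using comp by (simp add: vec_eq_iff)
  then have "is_unit (int d)" using assms unfolding primitive_def by blast
  then have "(-1) * int d + 0 * int d = -1" by simp
  then have "-1 \<in> ?G" using comb[OF d(2) d(2), of "-1" 0] by simp
  then show ?thesis using that by (metis imageE)
qed

(*PART P8b*)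
locale rational_cone =
  fixes \<sigma> :: "(real ^ 'n::finite) set" and S :: "(int ^ 'n) set"
  assumes S: "finite S" and \<sigma>: "\<sigma> = convex_cone hull (lattice_vec ` S)"
    and strong: "\<And>v. v \<in> \<sigma> \<Longrightarrow> - v \<in> \<sigma> \<Longrightarrow> v = 0"
begin

abbreviation ray :: "int ^ 'n \<Rightarrow> (real ^ 'n) set" where
  "ray \<rho> \<equiv> {t *\<^sub>R lattice_vec \<rho> | t. t \<ge> 0}"

lemma cone: "convex_cone \<sigma>" unfolding \<sigma> by (rule convex_cone_convex_cone_hull)

lemmas cone_props = convex_coneD[OF cone]

lemma closed_cone: "closed \<sigma>"
  unfolding \<sigma> using S by (intro polyhedron_imp_closed polyhedron_convex_cone_hull) simp

lemma generator_in: "s \<in> S \<Longrightarrow> lattice_vec s \<in> \<sigma>"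
  unfolding \<sigma> by (intro hull_inc) simp

lemma cone_least:
  assumes "convex_cone W" "\<And>s. s \<in> S \<Longrightarrow> lattice_vec s \<in> W" shows "\<sigma> \<subseteq> W"
  unfolding \<sigma> using assms by (intro hull_minimal) auto

lemma ray_in: "\<rho> \<in> extremal_rays \<sigma> \<Longrightarrow> lattice_vec \<rho> \<in> \<sigma>"
proof -
  assume "\<rho> \<in> extremal_rays \<sigma>"
  then have "ray \<rho> \<subseteq> \<sigma>" unfolding extremal_rays_def face_of_def by blast
  moreover have "lattice_vec \<rho> \<in> ray \<rho>" by (intro CollectI exI[of _ 1]) simp
  ultimately show ?thesis by blast
qed

lemma ray_summands:
  assumes \<rho>: "\<rho> \<in> extremal_rays \<sigma>" and xy: "x \<in> \<sigma>" "y \<in> \<sigma>" "x + y \<in> ray \<rho>"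
  shows "x \<in> ray \<rho>"
proof (cases "x = y")
  case True
  obtain t where t: "x + y = t *\<^sub>R lattice_vec \<rho>" "t \<ge> 0" using xy(3) by blast
  then have "2 *\<^sub>R x = t *\<^sub>R lattice_vec \<rho>" using True by (simp add: scaleR_2)
  then have "(1/2) *\<^sub>R (2 *\<^sub>R x) = (1/2) *\<^sub>R (t *\<^sub>R lattice_vec \<rho>)" by simp
  then have "x = (t / 2) *\<^sub>R lattice_vec \<rho>" by simp
  then show ?thesis using t(2) by (intro CollectI exI[of _ "t / 2"]) simp
next
  case False
  have face: "ray \<rho> face_of \<sigma>" using \<rho> unfolding extremal_rays_def by blast
  have "x + y \<in> open_segment (2 *\<^sub>R x) (2 *\<^sub>R y)"
    unfolding in_segment using False by (intro conjI exI[of _ "1/2"]) simp_all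
  then have "2 *\<^sub>R x \<in> ray \<rho>"
    using face_ofD[OF face _ _ _ xy(3)] cone_props(3)[OF xy(1), of 2] cone_props(3)[OF xy(2), of 2] by simp
  then obtain t where t: "2 *\<^sub>R x = t *\<^sub>R lattice_vec \<rho>" "t \<ge> 0" by blast
  then have "(1/2) *\<^sub>R (2 *\<^sub>R x) = (1/2) *\<^sub>R (t *\<^sub>R lattice_vec \<rho>)" by simp
  then have "x = (t / 2) *\<^sub>R lattice_vec \<rho>" by simp
  then show ?thesis using t(2) by (intro CollectI exI[of _ "t / 2"]) simp
qed

text \<open>An interior point of the dual cone: sum separating functionals for the vectors \<open>- s\<close>, which
  lie outside \<open>\<sigma>\<close> by strong convexity.\<close>

lemma interior_functional:
  obtains a where "\<And>v. v \<in> \<sigma> \<Longrightarrow> v \<noteq> 0 \<Longrightarrow> a \<bullet> v > 0"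
proof -
  have "\<exists>a. (\<forall>v\<in>\<sigma>. a \<bullet> v \<ge> 0) \<and> (lattice_vec s \<noteq> 0 \<longrightarrow> a \<bullet> lattice_vec s > 0)" if s: "s \<in> S" for s
  proof (cases "lattice_vec s = 0")
    case True
    then show ?thesis by (intro exI[of _ 0]) simp
  next
    case False
    then have "- lattice_vec s \<notin> \<sigma>" using strong generator_in[OF s] by blast
    then obtain a where "\<And>v. v \<in> \<sigma> \<Longrightarrow> a \<bullet> v \<ge> 0" "a \<bullet> (- lattice_vec s) < 0"
      using separate_from_cone[OF cone closed_cone] by blast
    then show ?thesis by (intro exI[of _ a]) simp
  qed
  then have "\<forall>s\<in>S. \<exists>a. (\<forall>v\<in>\<sigma>. a \<bullet> v \<ge> 0) \<and> (lattice_vec s \<noteq> 0 \<longrightarrow> a \<bullet> lattice_vec s > 0)" by blast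
  from bchoice[OF this] obtain a
    where a: "\<forall>s\<in>S. (\<forall>v\<in>\<sigma>. a s \<bullet> v \<ge> 0) \<and> (lattice_vec s \<noteq> 0 \<longrightarrow> a s \<bullet> lattice_vec s > 0)" by (elim exE)
  let ?b = "\<Sum>s\<in>S. a s"
  have pos: "?b \<bullet> lattice_vec s > 0" if s: "s \<in> S" "lattice_vec s \<noteq> 0" for s
  proof -
    have "0 < a s \<bullet> lattice_vec s" using a s by blast
    also have "\<dots> \<le> (\<Sum>r\<in>S. a r \<bullet> lattice_vec s)"
      using S s a generator_in by (intro member_le_sum) auto
    finally show ?thesis by (simp add: inner_sum_left)
  qed
  have "\<sigma> \<subseteq> {v. v = 0 \<or> ?b \<bullet> v > 0}"
  proof (rule cone_least)
    show "convex_cone {v. v = 0 \<or> ?b \<bullet> v > 0}"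
    proof (rule convex_coneI)
      show "c *\<^sub>R x \<in> {v. v = 0 \<or> ?b \<bullet> v > 0}" if "x \<in> {v. v = 0 \<or> ?b \<bullet> v > 0}" "0 \<le> c" for x c
        using that by (cases "c = 0") auto
    qed (auto simp: inner_add_right intro: add_pos_pos)
    show "lattice_vec s \<in> {v. v = 0 \<or> ?b \<bullet> v > 0}" if "s \<in> S" for s using pos[OF that] by blast
  qed
  then show ?thesis using that[of ?b] by blast
qed

definition nonzero_gens :: "(real ^ 'n) set" where "nonzero_gens = lattice_vec ` S - {0}"

lemma finite_nonzero_gens: "finite nonzero_gens" using S by (simp add: nonzero_gens_def)

lemma nonzero_gens_in: "v \<in> nonzero_gens \<Longrightarrow> v \<in> \<sigma> \<and> v \<noteq> 0"
  using generator_in by (auto simp: nonzero_gens_def)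

lemma positive_on_cone:
  assumes m: "\<And>v. v \<in> nonzero_gens \<Longrightarrow> pairing m v > (0::real)" and v: "v \<in> \<sigma>" "v \<noteq> 0"
  shows "pairing m v > 0"
proof -
  have "\<sigma> \<subseteq> {v. v = 0 \<or> pairing m v > 0}"
  proof (rule cone_least)
    show "convex_cone {v. v = 0 \<or> pairing m v > (0::real)}"
    proof (rule convex_coneI)
      show "c *\<^sub>R x \<in> {v. v = 0 \<or> pairing m v > 0}" if "x \<in> {v. v = 0 \<or> pairing m v > (0::real)}" "0 \<le> c" for x c
        using that by (cases "c = 0") (auto simp: pairing_real_simps)
    qed (auto simp: pairing_real_simps intro: add_pos_pos)
    show "lattice_vec s \<in> {v. v = 0 \<or> pairing m v > 0}" if "s \<in> S" for s
      using m[of "lattice_vec s"] that by (auto simp: nonzero_gens_def)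
  qed
  then show ?thesis using v by blast
qed

definition interior_dual :: "'n dual_lattice set" where
  "interior_dual = {m. \<forall>v\<in>\<sigma>. v \<noteq> 0 \<longrightarrow> pairing m v > (0::real)}"

lemma interior_dual_subset: "interior_dual \<subseteq> dual_cone_lattice \<sigma>"
proof
  fix m assume m: "m \<in> interior_dual"
  have "pairing m v \<ge> (0::real)" if "v \<in> \<sigma>" for v
    using m that by (cases "v = 0") (auto simp: interior_dual_def pairing_real_simps intro: less_imp_le)
  then show "m \<in> dual_cone_lattice \<sigma>" by (simp add: dual_cone_lattice_def)
qed

lemma interior_dual_nonempty: obtains m where "m \<in> interior_dual"
proof -
  obtain a where a: "\<And>v. v \<in> \<sigma> \<Longrightarrow> v \<noteq> 0 \<Longrightarrow> a \<bullet> v > 0" using interior_functional by blast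
  obtain m where "\<And>v. v \<in> nonzero_gens \<Longrightarrow> pairing m v > (0::real)"
    using lattice_solution[of nonzero_gens a] finite_nonzero_gens a nonzero_gens_in by blast
  then have "m \<in> interior_dual" unfolding interior_dual_def using positive_on_cone by blast
  then show ?thesis using that by blast
qed

text \<open>Perturbing into the interior.\<close>

lemma interior_dual_strict:
  assumes V: "finite V" "\<And>v. v \<in> V \<Longrightarrow> a \<bullet> v > 0" and a: "\<And>v. v \<in> \<sigma> \<Longrightarrow> a \<bullet> v \<ge> 0"
  obtains m where "m \<in> interior_dual" "\<And>v. v \<in> V \<Longrightarrow> pairing m v > (0::real)"
proof -
  obtain c where c: "\<And>v. v \<in> \<sigma> \<Longrightarrow> v \<noteq> 0 \<Longrightarrow> c \<bullet> v > 0" using interior_functional by blast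
  obtain m where m: "\<And>v. v \<in> V \<union> nonzero_gens \<Longrightarrow> pairing m v > (0::real)"
    using perturbed_lattice_solution[OF V finite_nonzero_gens, of c] a c nonzero_gens_in by blast
  then have "m \<in> interior_dual" unfolding interior_dual_def using positive_on_cone by blast
  then show ?thesis using that m by blast
qed

lemma bidual:
  assumes "\<And>m. m \<in> interior_dual \<Longrightarrow> pairing m x \<ge> (0::real)" shows "x \<in> \<sigma>"
proof (rule ccontr)
  assume "x \<notin> \<sigma>"
  then obtain a where a: "\<And>v. v \<in> \<sigma> \<Longrightarrow> a \<bullet> v \<ge> 0" "a \<bullet> x < 0"
    using separate_from_cone[OF cone closed_cone] by blast
  obtain m where "m \<in> interior_dual" "pairing m (- x) > (0::real)"
    using interior_dual_strict[of "{- x}" a] a by auto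
  then show False using assms[of m] by (simp add: pairing_real_simps)
qed

text \<open>A minimal set of generators spans extremal rays.\<close>

lemma cone_generated_by_rays:
  assumes W: "convex_cone W" "\<And>\<rho>. \<rho> \<in> extremal_rays \<sigma> \<Longrightarrow> lattice_vec \<rho> \<in> W" shows "\<sigma> \<subseteq> W"
proof -
  let ?P = "\<lambda>T. T \<subseteq> S \<and> \<sigma> = convex_cone hull (lattice_vec ` T)"
  obtain T where T: "?P T" and Tmin: "\<And>T'. ?P T' \<Longrightarrow> card T \<le> card T'"
    using ex_has_least_nat[of ?P S card] \<sigma> by blast
  have finT: "finite T" using T S finite_subset by blast
  have "lattice_vec s \<in> W" if s: "s \<in> T" for s
  proof -
    let ?c = "convex_cone hull (lattice_vec ` (T - {s}))"
    have c_sub: "?c \<subseteq> \<sigma>" using T by (metis Diff_subset hull_mono image_mono)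
    note C = convex_coneD[OF convex_cone_convex_cone_hull[of "lattice_vec ` (T - {s})"]]
    have notin: "lattice_vec s \<notin> ?c"
    proof
      assume "lattice_vec s \<in> ?c"
      then have "lattice_vec ` T \<subseteq> ?c" using hull_inc[of _ "lattice_vec ` (T - {s})" convex_cone] by blast
      then have "convex_cone hull (lattice_vec ` T) \<subseteq> ?c" by (intro hull_minimal convex_cone_convex_cone_hull)
      then have "?P (T - {s})" using T c_sub by blast
      then have "card T \<le> card (T - {s})" by (rule Tmin)
      then show False using s finT by (metis card_Diff1_less leD)
    qed
    have s0: "s \<noteq> 0"
    proof
      assume "s = 0"
      then have "lattice_vec s = 0" by (simp add: lattice_vec_def vec_eq_iff)
      then show False using notin C(1) by metis
    qed
    have sin: "lattice_vec s \<in> \<sigma>" using T s by (metis hull_inc imageI)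
    obtain d \<rho> where \<rho>: "primitive \<rho>" "d > 0" "s = d *s \<rho>" using primitive_part[OF s0] .
    have split: "\<exists>\<alpha> w. v = \<alpha> *\<^sub>R lattice_vec s + w \<and> \<alpha> \<ge> 0 \<and> w \<in> ?c" if "v \<in> \<sigma>" for v
    proof -
      let ?E = "{v. \<exists>\<alpha> w. v = \<alpha> *\<^sub>R lattice_vec s + w \<and> \<alpha> \<ge> 0 \<and> w \<in> ?c}"
      have "convex_cone ?E"
      proof (rule convex_coneI)
        show "0 \<in> ?E" using C(1) by (intro CollectI exI[of _ 0]) simp
        fix x assume "x \<in> ?E"
        then obtain \<alpha> w where x: "x = \<alpha> *\<^sub>R lattice_vec s + w" "\<alpha> \<ge> 0" "w \<in> ?c" by (elim CollectE exE conjE)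
        {
          fix y assume "y \<in> ?E"
          then obtain \<beta> u where y: "y = \<beta> *\<^sub>R lattice_vec s + u" "\<beta> \<ge> 0" "u \<in> ?c" by (elim CollectE exE conjE)
          show "x + y \<in> ?E" using x y C(2)
            by (intro CollectI exI[of _ "\<alpha> + \<beta>"] exI[of _ "w + u"]) (simp add: algebra_simps)
        }
        fix c :: real assume "0 \<le> c"
        then show "c *\<^sub>R x \<in> ?E" using x C(3)
          by (intro CollectI exI[of _ "c * \<alpha>"] exI[of _ "c *\<^sub>R w"]) (simp add: algebra_simps)
      qed
      moreover have "lattice_vec r \<in> ?E" if "r \<in> T" for r
      proof (cases "r = s")
        case True
        then show ?thesis using C(1) by (intro CollectI exI[of _ 1] exI[of _ 0]) simp
      next
        case False
        then have "lattice_vec r \<in> ?c" using that by (intro hull_inc) auto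
        then show ?thesis by (intro CollectI exI[of _ 0] exI[of _ "lattice_vec r"]) simp
      qed
      ultimately have "convex_cone hull (lattice_vec ` T) \<subseteq> ?E" by (intro hull_minimal) auto
      then show ?thesis using T \<open>v \<in> \<sigma>\<close> by blast
    qed
    have rs: "ray \<rho> = {t *\<^sub>R lattice_vec s | t. t \<ge> 0}"
    proof (intro equalityI subsetI)
      fix x assume "x \<in> ray \<rho>" then obtain t where t: "x = t *\<^sub>R lattice_vec \<rho>" "t \<ge> 0" by blast
      then have "x = (t / d) *\<^sub>R lattice_vec s" using \<rho> by (simp add: lattice_vec_scale)
      then show "x \<in> {t *\<^sub>R lattice_vec s | t. t \<ge> 0}" using t(2) \<rho>(2) by (intro CollectI exI[of _ "t / d"]) simp
    next
      fix x assume "x \<in> {t *\<^sub>R lattice_vec s | t. t \<ge> 0}" then obtain t where t: "x = t *\<^sub>R lattice_vec s" "t \<ge> 0" by blast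
      then show "x \<in> ray \<rho>" using \<rho> by (intro CollectI exI[of _ "t * d"]) (simp add: lattice_vec_scale)
    qed
    have "{t *\<^sub>R lattice_vec s | t. t \<ge> 0} face_of \<sigma>"
      unfolding face_of_def
    proof (intro conjI ballI impI)
      show "{t *\<^sub>R lattice_vec s | t. t \<ge> 0} \<subseteq> \<sigma>" using cone_props(3)[OF sin] by auto
      show "convex {t *\<^sub>R lattice_vec s | t. t \<ge> 0}"
      proof (rule convexI)
        fix x y and u v :: real
        assume "x \<in> {t *\<^sub>R lattice_vec s | t. t \<ge> 0}" "y \<in> {t *\<^sub>R lattice_vec s | t. t \<ge> 0}" and uv: "0 \<le> u" "0 \<le> v"
        then obtain p q where "x = p *\<^sub>R lattice_vec s" "p \<ge> 0" "y = q *\<^sub>R lattice_vec s" "q \<ge> 0" by blast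
        then show "u *\<^sub>R x + v *\<^sub>R y \<in> {t *\<^sub>R lattice_vec s | t. t \<ge> 0}"
          using uv by (intro CollectI exI[of _ "u * p + v * q"]) (simp add: scaleR_add_left)
      qed
    next
      fix a b x assume ab: "a \<in> \<sigma>" "b \<in> \<sigma>" and x: "x \<in> {t *\<^sub>R lattice_vec s | t. t \<ge> 0}" "x \<in> open_segment a b"
      obtain t where t: "x = t *\<^sub>R lattice_vec s" "t \<ge> 0" using x(1) by blast
      obtain u where u: "0 < u" "u < 1" "x = (1 - u) *\<^sub>R a + u *\<^sub>R b" using x(2) unfolding in_segment by blast
      obtain \<alpha> w where a: "a = \<alpha> *\<^sub>R lattice_vec s + w" "\<alpha> \<ge> 0" "w \<in> ?c" using split[OF ab(1)] by (elim exE conjE)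
      obtain \<beta> w' where b: "b = \<beta> *\<^sub>R lattice_vec s + w'" "\<beta> \<ge> 0" "w' \<in> ?c" using split[OF ab(2)] by (elim exE conjE)
      define \<gamma> where "\<gamma> = (1 - u) * \<alpha> + u * \<beta>"
      define w'' where "w'' = (1 - u) *\<^sub>R w + u *\<^sub>R w'"
      have w'': "w'' \<in> ?c" unfolding w''_def using u a b by (intro C(2) C(3)) auto
      have eq: "(t - \<gamma>) *\<^sub>R lattice_vec s = w''"
        using u(3) t(1) a(1) b(1) unfolding \<gamma>_def w''_def by (simp add: algebra_simps)
      have "\<not> t > \<gamma>"
      proof
        assume g: "t > \<gamma>"
        have "(1 / (t - \<gamma>)) *\<^sub>R w'' \<in> ?c" using g w'' by (intro C(3)) auto
        moreover have "(1 / (t - \<gamma>)) *\<^sub>R w'' = lattice_vec s" using g eq[symmetric] by simp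
        ultimately show False using notin by simp
      qed
      then have "(\<gamma> - t) *\<^sub>R lattice_vec s \<in> \<sigma>" using cone_props(3)[OF sin] by simp
      moreover have "(\<gamma> - t) *\<^sub>R lattice_vec s = - w''" using eq by (simp add: algebra_simps)
      ultimately have "w'' = 0" using strong[of w''] w'' c_sub by auto
      then have e: "(1 - u) *\<^sub>R w = - (u *\<^sub>R w')" unfolding w''_def by (simp add: eq_neg_iff_add_eq_0)
      have "(1 - u) *\<^sub>R w \<in> \<sigma>" "u *\<^sub>R w' \<in> \<sigma>" using u a b c_sub cone_props(3) by auto
      then have "u *\<^sub>R w' = 0" using strong[of "u *\<^sub>R w'"] e by simp
      then have "w' = 0" "w = 0" using e u by auto
      then show "a \<in> {t *\<^sub>R lattice_vec s | t. t \<ge> 0}" "b \<in> {t *\<^sub>R lattice_vec s | t. t \<ge> 0}" using a b by auto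
    qed
    then have "\<rho> \<in> extremal_rays \<sigma>" using \<rho>(1) rs unfolding extremal_rays_def by simp
    then have "lattice_vec \<rho> \<in> W" by (rule W(2))
    then show ?thesis using \<rho> convex_coneD(3)[OF W(1)] by (simp add: lattice_vec_scale)
  qed
  then have "convex_cone hull (lattice_vec ` T) \<subseteq> W" using W(1) by (intro hull_minimal) auto
  then show ?thesis using T by simp
qed

end

(*PART P8c*)
context rational_cone
begin

lemma primitive_in_ray:
  assumes "primitive \<rho>" "primitive \<rho>'" "lattice_vec \<rho>' \<in> ray \<rho>" shows "\<rho>' = \<rho>"
proof -
  obtain t where t: "lattice_vec \<rho>' = t *\<^sub>R lattice_vec \<rho>" "t \<ge> 0" using assms(3) by blast
  have "t \<noteq> 0" using t(1) primitive_nonzero[OF assms(2)] by auto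
  then show ?thesis using primitive_unique[OF assms(2,1) t(1)] t(2) by simp
qed

lemma extremal_primitive: "\<rho> \<in> extremal_rays \<sigma> \<Longrightarrow> primitive \<rho>"
  unfolding extremal_rays_def by blast

lemma off_ray_cone: assumes "\<rho> \<in> extremal_rays \<sigma>"
  shows "convex_cone {v \<in> \<sigma>. v \<in> ray \<rho> \<longrightarrow> v = 0}"
proof (rule convex_coneI)
  show "0 \<in> {v \<in> \<sigma>. v \<in> ray \<rho> \<longrightarrow> v = 0}" using cone_props(1) by blast
  fix x assume x: "x \<in> {v \<in> \<sigma>. v \<in> ray \<rho> \<longrightarrow> v = 0}"
  show "x + y \<in> {v \<in> \<sigma>. v \<in> ray \<rho> \<longrightarrow> v = 0}" if y: "y \<in> {v \<in> \<sigma>. v \<in> ray \<rho> \<longrightarrow> v = 0}" for y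
  proof -
    have "x + y = 0" if r: "x + y \<in> ray \<rho>"
    proof -
      have "x \<in> ray \<rho>" by (rule ray_summands[OF assms _ _ r]) (use x y in auto)
      moreover have "y \<in> ray \<rho>"
        by (rule ray_summands[OF assms, of y x]) (use x y r in \<open>auto simp: add.commute\<close>)
      ultimately show ?thesis using x y by simp
    qed
    then show ?thesis using x y cone_props(2) by blast
  qed
  fix c :: real assume c: "0 \<le> c"
  have "c *\<^sub>R x = 0" if "c *\<^sub>R x \<in> ray \<rho>"
  proof (cases "c = 0")
    case False
    obtain t where t: "c *\<^sub>R x = t *\<^sub>R lattice_vec \<rho>" "t \<ge> 0" using \<open>c *\<^sub>R x \<in> ray \<rho>\<close> by (elim CollectE exE conjE)
    have "x = (t / c) *\<^sub>R lattice_vec \<rho>" using arg_cong[OF t(1), of "\<lambda>v. (1 / c) *\<^sub>R v"] False by simp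
    then have "x \<in> ray \<rho>" using t(2) c by (intro CollectI exI[of _ "t / c"]) simp
    then show ?thesis using x by simp
  qed simp
  then show "c *\<^sub>R x \<in> {v \<in> \<sigma>. v \<in> ray \<rho> \<longrightarrow> v = 0}" using x cone_props(3) c by blast
qed

lemma ray_has_generator:
  assumes \<rho>: "\<rho> \<in> extremal_rays \<sigma>"
  obtains s t where "s \<in> S" "lattice_vec s = t *\<^sub>R lattice_vec \<rho>" "t > 0"
proof -
  have "\<exists>s\<in>S. lattice_vec s \<in> ray \<rho> \<and> lattice_vec s \<noteq> 0"
  proof (rule ccontr)
    assume "\<not> ?thesis"
    then have "\<sigma> \<subseteq> {v \<in> \<sigma>. v \<in> ray \<rho> \<longrightarrow> v = 0}"
      using generator_in by (intro cone_least off_ray_cone[OF \<rho>]) blast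
    moreover have "lattice_vec \<rho> \<in> ray \<rho>" by (intro CollectI exI[of _ 1]) simp
    ultimately have "lattice_vec \<rho> = 0" using ray_in[OF \<rho>] by blast
    then show False using primitive_nonzero[OF extremal_primitive[OF \<rho>]] by simp
  qed
  then obtain s t where s: "s \<in> S" "lattice_vec s = t *\<^sub>R lattice_vec \<rho>" "t \<ge> 0" "lattice_vec s \<noteq> 0" by blast
  then have "t > 0" by (cases "t = 0") auto
  then show ?thesis using that s by blast
qed

definition off_ray_gens :: "int ^ 'n \<Rightarrow> (int ^ 'n) set" where
  "off_ray_gens \<rho> = {s \<in> S. lattice_vec s \<notin> ray \<rho>}"

lemma expose_ray:
  assumes \<rho>: "\<rho> \<in> extremal_rays \<sigma>"
  obtains a where "a \<bullet> lattice_vec \<rho> = 0" "\<And>s. s \<in> off_ray_gens \<rho> \<Longrightarrow> a \<bullet> lattice_vec s > 0"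
proof -
  let ?c = "convex_cone hull (lattice_vec ` off_ray_gens \<rho>)"
  have "?c \<subseteq> {v \<in> \<sigma>. v \<in> ray \<rho> \<longrightarrow> v = 0}"
    using off_ray_cone[OF \<rho>] generator_in by (intro hull_minimal) (auto simp: off_ray_gens_def)
  moreover have "lattice_vec \<rho> \<in> ray \<rho>" by (intro CollectI exI[of _ 1]) simp
  moreover have \<rho>0: "lattice_vec \<rho> \<noteq> 0" using primitive_nonzero[OF extremal_primitive[OF \<rho>]] by simp
  ultimately have notin: "lattice_vec \<rho> \<notin> ?c" by blast
  have "closed ?c" using S by (intro polyhedron_imp_closed polyhedron_convex_cone_hull) (simp add: off_ray_gens_def)
  then obtain a1 where a1: "\<And>v. v \<in> ?c \<Longrightarrow> a1 \<bullet> v \<ge> 0" "a1 \<bullet> lattice_vec \<rho> < 0"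
    using separate_from_cone[OF convex_cone_convex_cone_hull _ notin] by blast
  obtain b where b: "\<And>v. v \<in> \<sigma> \<Longrightarrow> v \<noteq> 0 \<Longrightarrow> b \<bullet> v > 0" using interior_functional by blast
  have bp: "b \<bullet> lattice_vec \<rho> > 0" using b ray_in[OF \<rho>] \<rho>0 by blast
  define c where "c = - (a1 \<bullet> lattice_vec \<rho>) / (b \<bullet> lattice_vec \<rho>)"
  have c: "c > 0" using a1(2) bp by (simp add: c_def divide_neg_pos)
  show ?thesis
  proof (rule that)
    show "(a1 + c *\<^sub>R b) \<bullet> lattice_vec \<rho> = 0" using bp by (simp add: inner_add_left inner_diff_left c_def)
    fix s assume s: "s \<in> off_ray_gens \<rho>"
    have "lattice_vec s \<noteq> 0"
    proof
      assume "lattice_vec s = 0"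
      then have "lattice_vec s \<in> ray \<rho>" by (intro CollectI exI[of _ 0]) simp
      then show False using s unfolding off_ray_gens_def by blast
    qed
    then have "b \<bullet> lattice_vec s > 0" using b generator_in s by (auto simp: off_ray_gens_def)
    then have "c * (b \<bullet> lattice_vec s) > 0" using c by simp
    moreover have "a1 \<bullet> lattice_vec s \<ge> 0" using a1(1) s by (intro a1(1) hull_inc) simp
    ultimately show "(a1 + c *\<^sub>R b) \<bullet> lattice_vec s > 0" by (simp add: inner_add_left)
  qed
qed

lemma expose_ray_lattice:
  assumes \<rho>: "\<rho> \<in> extremal_rays \<sigma>" and e: "pairing e \<rho> = -1"
  obtains m where "pairing m \<rho> = 0" "\<And>s. s \<in> off_ray_gens \<rho> \<Longrightarrow> pairing m s > 0"
proof -
  obtain a where a: "a \<bullet> lattice_vec \<rho> = 0" "\<And>s. s \<in> off_ray_gens \<rho> \<Longrightarrow> a \<bullet> lattice_vec s > 0"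
    using expose_ray[OF \<rho>] by blast
  let ?l = "\<lambda>v :: real ^ 'n. \<Sum>i\<in>UNIV. \<bar>v $ i\<bar>"
  have fin: "finite (off_ray_gens \<rho>)" using S by (simp add: off_ray_gens_def)
  obtain r :: real where r: "r \<ge> 0" "\<And>s. s \<in> off_ray_gens \<rho> \<Longrightarrow>
      r * (a \<bullet> lattice_vec s) > ?l (lattice_vec s) + ?l (lattice_vec \<rho>) * \<bar>real_of_int (pairing e s)\<bar>"
    using fin a(2) finite_bound[of "off_ray_gens \<rho>" "\<lambda>s. a \<bullet> lattice_vec s" "\<lambda>s. ?l (lattice_vec s) + ?l (lattice_vec \<rho>) * \<bar>real_of_int (pairing e s)\<bar>"] by blast
  define m1 where "m1 = lattice_point (\<lambda>i. \<lfloor>r * a $ i\<rfloor>)"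
  define c where "c = pairing m1 \<rho>"
  have cb: "\<bar>real_of_int c\<bar> \<le> ?l (lattice_vec \<rho>)"
    using floor_approximation[of r a "lattice_vec \<rho>"] a(1) unfolding m1_def[symmetric] pairing_lattice_vec by (simp add: c_def)
  show ?thesis
  proof (rule that)
    show "pairing (m1 + frag_cmul c e) \<rho> = 0" by (simp add: pairing_add pairing_cmul e c_def)
    fix s assume s: "s \<in> off_ray_gens \<rho>"
    have "real_of_int (pairing m1 s) \<ge> r * (a \<bullet> lattice_vec s) - ?l (lattice_vec s)"
      using floor_approximation[of r a "lattice_vec s"] unfolding m1_def[symmetric] pairing_lattice_vec by linarith
    moreover have "\<bar>real_of_int (c * pairing e s)\<bar> \<le> ?l (lattice_vec \<rho>) * \<bar>real_of_int (pairing e s)\<bar>"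
      using cb by (simp add: abs_mult mult_right_mono)
    ultimately have "real_of_int (pairing m1 s) + real_of_int (c * pairing e s) > 0" using r(2)[OF s] by linarith
    then show "pairing (m1 + frag_cmul c e) s > 0" by (simp add: pairing_add pairing_cmul del: of_int_mult flip: of_int_add)
  qed
qed

lemma off_ray_pos:
  assumes m: "pairing m \<rho> = (0::int)" "\<And>s. s \<in> off_ray_gens \<rho> \<Longrightarrow> pairing m s > (0::int)"
    and v: "v \<in> \<sigma>" "v \<notin> ray \<rho>"
  shows "pairing m v > (0::real)"
proof -
  have "\<sigma> \<subseteq> {v. v \<in> ray \<rho> \<or> pairing m v > (0::real)}"
  proof (rule cone_least)
    have r0: "pairing m x = (0::real)" if "x \<in> ray \<rho>" for x
      using that m(1) by (auto simp: pairing_real_simps pairing_lattice_vec)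
    show "convex_cone {v. v \<in> ray \<rho> \<or> pairing m v > (0::real)}"
    proof (rule convex_coneI)
      have "0 \<in> ray \<rho>" by (intro CollectI exI[of _ 0]) simp
      then show "0 \<in> {v. v \<in> ray \<rho> \<or> pairing m v > (0::real)}" by blast
      fix x assume x: "x \<in> {v. v \<in> ray \<rho> \<or> pairing m v > (0::real)}"
      show "x + y \<in> {v. v \<in> ray \<rho> \<or> pairing m v > (0::real)}" if y: "y \<in> {v. v \<in> ray \<rho> \<or> pairing m v > (0::real)}" for y
      proof (cases "x \<in> ray \<rho> \<and> y \<in> ray \<rho>")
        case True
        then obtain t u where "x = t *\<^sub>R lattice_vec \<rho>" "t \<ge> 0" "y = u *\<^sub>R lattice_vec \<rho>" "u \<ge> 0" by blast
        then have "x + y \<in> ray \<rho>" by (intro CollectI exI[of _ "t + u"]) (simp add: scaleR_add_left)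
        then show ?thesis by blast
      next
        case False
        then have "pairing m x + pairing m y > (0::real)" using x y r0[of x] r0[of y] by fastforce
        then show ?thesis by (simp add: pairing_real_simps)
      qed
      fix c :: real assume c: "0 \<le> c"
      show "c *\<^sub>R x \<in> {v. v \<in> ray \<rho> \<or> pairing m v > (0::real)}"
      proof (cases "c = 0 \<or> x \<in> ray \<rho>")
        case True
        then have "c *\<^sub>R x \<in> ray \<rho>"
        proof
          assume "c = 0" then show ?thesis by (intro CollectI exI[of _ 0]) simp
        next
          assume "x \<in> ray \<rho>"
          then obtain t where "x = t *\<^sub>R lattice_vec \<rho>" "t \<ge> 0" by blast
          then show ?thesis using c by (intro CollectI exI[of _ "c * t"]) simp
        qed
        then show ?thesis by blast
      next
        case False
        then show ?thesis using x c by (auto simp: pairing_real_simps)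
      qed
    qed
    show "lattice_vec s \<in> {v. v \<in> ray \<rho> \<or> pairing m v > (0::real)}" if "s \<in> S" for s
      using m(2)[of s] that by (auto simp: off_ray_gens_def pairing_lattice_vec)
  qed
  then show ?thesis using v by blast
qed

lemma demazure_root_exists:
  assumes "\<sigma> \<noteq> {0}" obtains e \<rho> where "demazure_root \<sigma> e \<rho>"
proof -
  have "extremal_rays \<sigma> \<noteq> {}"
  proof
    assume "extremal_rays \<sigma> = {}"
    then have "\<sigma> \<subseteq> {0}" by (intro cone_generated_by_rays convex_coneI) auto
    then show False using assms cone_props(1) by blast
  qed
  then obtain \<rho> where \<rho>: "\<rho> \<in> extremal_rays \<sigma>" by blast
  obtain e0 :: "'n dual_lattice" where e0: "pairing e0 \<rho> = -1" using primitive_dual_vector[OF extremal_primitive[OF \<rho>]] .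
  obtain m where m: "pairing m \<rho> = 0" "\<And>s. s \<in> off_ray_gens \<rho> \<Longrightarrow> pairing m s > 0"
    using expose_ray_lattice[OF \<rho> e0] by blast
  have fin: "finite (off_ray_gens \<rho>)" using S by (simp add: off_ray_gens_def)
  define N where "N = (\<Sum>s\<in>off_ray_gens \<rho>. \<bar>pairing e0 s\<bar>)"
  have N: "\<bar>pairing e0 s\<bar> \<le> N" if "s \<in> off_ray_gens \<rho>" for s
    unfolding N_def using fin that by (intro member_le_sum) auto
  define e where "e = e0 + frag_cmul N m"
  have es: "pairing e s \<ge> 0" if s: "s \<in> off_ray_gens \<rho>" for s
  proof -
    have "N * 1 \<le> N * pairing m s" using m(2)[OF s] N[OF s] by (intro mult_left_mono) auto
    then show ?thesis using N[OF s] by (simp add: e_def pairing_add pairing_cmul)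
  qed
  have "demazure_root \<sigma> e \<rho>"
    unfolding demazure_root_def
  proof (intro conjI ballI \<rho>)
    show "pairing e \<rho> = -1" by (simp add: e_def pairing_add pairing_cmul m(1) e0)
    fix \<rho>' assume \<rho>': "\<rho>' \<in> extremal_rays \<sigma> - {\<rho>}"
    obtain s t where s: "s \<in> S" "lattice_vec s = t *\<^sub>R lattice_vec \<rho>'" "t > 0" using ray_has_generator \<rho>' by blast
    have "lattice_vec s \<notin> ray \<rho>"
    proof
      assume "lattice_vec s \<in> ray \<rho>"
      then obtain u where u: "lattice_vec s = u *\<^sub>R lattice_vec \<rho>" "u \<ge> 0" by blast
      have "lattice_vec \<rho>' = (1 / t) *\<^sub>R lattice_vec s" using s by simp
      also have "\<dots> = (u / t) *\<^sub>R lattice_vec \<rho>" using u by simp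
      finally have "lattice_vec \<rho>' \<in> ray \<rho>" using s(3) u(2) by (intro CollectI exI[of _ "u / t"]) simp
      then show False using primitive_in_ray[OF extremal_primitive[OF \<rho>] extremal_primitive] \<rho>' by blast
    qed
    then have "pairing e s \<ge> 0" using s(1) by (intro es) (simp add: off_ray_gens_def)
    moreover have "real_of_int (pairing e s) = t * real_of_int (pairing e \<rho>')"
      using arg_cong[OF s(2), of "pairing e"] by (simp add: pairing_lattice_vec pairing_real_simps)
    ultimately have "t * real_of_int (pairing e \<rho>') \<ge> 0" by (metis of_int_0_le_iff)
    then show "pairing e \<rho>' \<ge> 0" using s(3) by (simp add: zero_le_mult_iff)
  qed
  then show ?thesis using that by blast
qed

text \<open>\<open>m + d e\<close> stays in the dual cone when \<open>d \<le> \<langle>m, \<rho>\<rangle>\<close>.\<close>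

lemma demazure_translate:
  assumes e: "demazure_root \<sigma> e \<rho>" and m: "m \<in> dual_cone_lattice \<sigma>" and i: "int i \<le> pairing m \<rho>"
  shows "m + frag_cmul (int i) e \<in> dual_cone_lattice \<sigma>"
proof -
  have "\<sigma> \<subseteq> {v. pairing (m + frag_cmul (int i) e) v \<ge> (0::real)}"
  proof (rule cone_generated_by_rays)
    show "convex_cone {v. pairing (m + frag_cmul (int i) e) v \<ge> (0::real)}"
      by (rule convex_coneI) (auto simp: pairing_real_simps)
    fix \<rho>' assume \<rho>': "\<rho>' \<in> extremal_rays \<sigma>"
    have "pairing (m + frag_cmul (int i) e) \<rho>' \<ge> 0"
    proof (cases "\<rho>' = \<rho>")
      case True
      then show ?thesis using i e by (simp add: pairing_add pairing_cmul demazure_root_def)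
    next
      case False
      then have "pairing e \<rho>' \<ge> 0" using e \<rho>' by (simp add: demazure_root_def)
      moreover have "pairing m (lattice_vec \<rho>') \<ge> (0::real)" using m ray_in[OF \<rho>'] by (simp add: dual_cone_lattice_def)
      then have "pairing m \<rho>' \<ge> 0" by (simp add: pairing_lattice_vec)
      ultimately show ?thesis by (simp add: pairing_add pairing_cmul)
    qed
    then show "lattice_vec \<rho>' \<in> {v. pairing (m + frag_cmul (int i) e) v \<ge> (0::real)}"
      by (simp add: pairing_lattice_vec)
  qed
  then show ?thesis by (auto simp: dual_cone_lattice_def)
qed

text \<open>A primitive vector \<open>\<rho>\<close> of \<open>\<sigma>\<close> with \<open>\<langle>e, \<rho>\<rangle> = -1\<close> is a distinguished ray as soon as
  the translations \<open>m \<mapsto> m + \<langle>m, \<rho>\<rangle> e\<close> preserve the dual cone, at least for multiples of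
  interior points: otherwise choose \<open>m\<close> close to the facet on which \<open>e\<close> is negative.\<close>

lemma demazure_rootI:
  assumes \<rho>: "lattice_vec \<rho> \<in> \<sigma>" "pairing e \<rho> = -1"
    and tr: "\<And>m. m \<in> interior_dual \<Longrightarrow> \<exists>r>0. frag_cmul (int r) m + frag_cmul (int r * pairing m \<rho>) e \<in> dual_cone_lattice \<sigma>"
  shows "demazure_root \<sigma> e \<rho>"
proof -
  have prim: "primitive \<rho>"
    unfolding primitive_def
  proof (intro allI impI)
    fix d w assume "\<rho> = d *s w"
    then have "pairing e \<rho> = d * pairing e w" by (simp add: pairing_def sum_distrib_left mult.left_commute)
    then show "is_unit d" using \<rho>(2) by (metis dvd_minus_iff dvd_triv_left)
  qed
  have nonneg: "pairing e \<rho>' \<ge> 0" if \<rho>': "\<rho>' \<in> extremal_rays \<sigma>" "\<rho>' \<noteq> \<rho>" for \<rho>'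
  proof (rule ccontr)
    assume neg: "\<not> pairing e \<rho>' \<ge> 0"
    obtain e0 :: "'n dual_lattice" where e0: "pairing e0 \<rho>' = -1"
      using primitive_dual_vector[OF extremal_primitive[OF \<rho>'(1)]] .
    obtain m where m: "pairing m \<rho>' = 0" "\<And>s. s \<in> off_ray_gens \<rho>' \<Longrightarrow> pairing m s > 0"
      using expose_ray_lattice[OF \<rho>'(1) e0] by blast
    have "lattice_vec \<rho> \<notin> ray \<rho>'" using primitive_in_ray[OF extremal_primitive[OF \<rho>'(1)] prim] \<rho>'(2) by blast
    then have "pairing m (lattice_vec \<rho>) > (0::real)" using off_ray_pos[OF m \<rho>(1)] by blast
    then have mp: "pairing m \<rho> \<ge> 1" by (simp add: pairing_lattice_vec)
    obtain m0 where m0: "m0 \<in> interior_dual" using interior_dual_nonempty by blast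
    define N where "N = \<bar>pairing m0 \<rho>'\<bar> + 1"
    define m1 where "m1 = frag_cmul N m + m0"
    have "pairing m1 v > (0::real)" if "v \<in> \<sigma>" "v \<noteq> 0" for v
    proof -
      have "pairing m v \<ge> (0::real)"
      proof (cases "v \<in> ray \<rho>'")
        case True
        then show ?thesis using m(1) by (auto simp: pairing_real_simps pairing_lattice_vec)
      next
        case False
        then show ?thesis using off_ray_pos[OF m that(1)] by simp
      qed
      then have "real_of_int N * pairing m v \<ge> (0::real)" by (simp add: N_def)
      moreover have "pairing m0 v > (0::real)" using m0 that by (simp add: interior_dual_def)
      ultimately show ?thesis by (simp add: m1_def pairing_add pairing_cmul)
    qed
    then have m1: "m1 \<in> interior_dual" by (simp add: interior_dual_def)
    obtain r where r: "r > 0" "frag_cmul (int r) m1 + frag_cmul (int r * pairing m1 \<rho>) e \<in> dual_cone_lattice \<sigma>"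
      using tr[OF m1] by blast
    have "pairing (frag_cmul (int r) m1 + frag_cmul (int r * pairing m1 \<rho>) e) (lattice_vec \<rho>') \<ge> (0::real)"
      using r(2) ray_in[OF \<rho>'(1)] unfolding dual_cone_lattice_def by blast
    then have "int r * pairing m1 \<rho>' + int r * pairing m1 \<rho> * pairing e \<rho>' \<ge> 0"
      by (simp only: pairing_lattice_vec of_int_0_le_iff pairing_add pairing_cmul of_int_of_nat_eq of_int_eq_id id_apply)
    then have "int r * (pairing m1 \<rho>' + pairing m1 \<rho> * pairing e \<rho>') \<ge> 0" by (simp add: distrib_left mult.assoc)
    then have ge: "pairing m1 \<rho>' + pairing m1 \<rho> * pairing e \<rho>' \<ge> 0" using r(1) by (simp add: zero_le_mult_iff)
    have "pairing m0 (lattice_vec \<rho>) > (0::real)" using m0 \<rho>(1) primitive_nonzero[OF prim] by (simp add: interior_dual_def)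
    then have m0p: "pairing m0 \<rho> > 0" by (simp add: pairing_lattice_vec)
    have "N * 1 \<le> N * pairing m \<rho>" using mp by (intro mult_left_mono) (auto simp: N_def)
    then have "pairing m1 \<rho> \<ge> N" using m0p by (simp add: m1_def pairing_add pairing_cmul)
    moreover have "pairing e \<rho>' \<le> -1" using neg by simp
    ultimately have "pairing m1 \<rho> * pairing e \<rho>' \<le> pairing m1 \<rho> * (-1)"
      by (intro mult_left_mono) (auto simp: N_def)
    moreover have "pairing m1 \<rho>' = pairing m0 \<rho>'" by (simp add: m1_def pairing_add pairing_cmul m(1))
    ultimately have "pairing m0 \<rho>' - pairing m1 \<rho> \<ge> 0" using ge by linarith
    then show False using \<open>pairing m1 \<rho> \<ge> N\<close> by (simp add: N_def)
  qed
  have "\<rho> \<in> extremal_rays \<sigma>"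
  proof (rule ccontr)
    assume n: "\<rho> \<notin> extremal_rays \<sigma>"
    have "\<sigma> \<subseteq> {v. pairing e v \<ge> (0::real)}"
    proof (rule cone_generated_by_rays)
      show "convex_cone {v. pairing e v \<ge> (0::real)}" by (rule convex_coneI) (auto simp: pairing_real_simps)
      show "lattice_vec \<rho>' \<in> {v. pairing e v \<ge> (0::real)}" if "\<rho>' \<in> extremal_rays \<sigma>" for \<rho>'
      proof -
        have "\<rho>' \<noteq> \<rho>" using that n by blast
        then show ?thesis using nonneg[OF that] by (simp add: pairing_lattice_vec)
      qed
    qed
    then have "pairing e (lattice_vec \<rho>) \<ge> (0::real)" using \<rho>(1) by blast
    then show False using \<rho>(2) by (simp add: pairing_lattice_vec)
  qed
  then show ?thesis unfolding demazure_root_def using \<rho>(2) nonneg by blast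
qed

end

(*PART P8d*)
abbreviation vertices :: "(real ^ 'n::finite) set \<Rightarrow> (real ^ 'n) set" where
  "vertices P \<equiv> {v. v extreme_point_of P}"

context rational_cone
begin

lemma not_between: "v extreme_point_of P \<Longrightarrow> v - w \<in> P \<Longrightarrow> v + w \<in> P \<Longrightarrow> w = 0"
proof (rule ccontr)
  assume v: "v extreme_point_of P" "v - w \<in> P" "v + w \<in> P" and w: "w \<noteq> 0"
  have "v \<in> open_segment (v - w) (v + w)"
    unfolding in_segment
  proof (intro conjI exI[of _ "1/2"])
    show "v - w \<noteq> v + w"
    proof
      assume "v - w = v + w"
      then have "2 *\<^sub>R w = 0" by (simp add: scaleR_2 algebra_simps)
      then show False using w by simp
    qed
    show "v = (1 - 1/2) *\<^sub>R (v - w) + (1/2) *\<^sub>R (v + w)"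
      by (simp add: scaleR_add_right scaleR_diff_right flip: scaleR_add_left)
  qed auto
  then show False using v by (auto simp: extreme_point_of_def)
qed

lemma vertices_cone: "vertices \<sigma> \<subseteq> {0}"
proof
  fix v assume "v \<in> vertices \<sigma>"
  then have v: "v extreme_point_of \<sigma>" by simp
  then have "v \<in> \<sigma>" by (simp add: extreme_point_of_def)
  then have "v + v \<in> \<sigma>" by (intro cone_props(2))
  moreover have "v - v \<in> \<sigma>" using cone_props(1) by simp
  ultimately show "v \<in> {0}" using not_between[OF v, of v] by simp
qed

text \<open>A vertex of \<open>Q + \<sigma>\<close> lies in \<open>Q\<close>, as adding elements of \<open>\<sigma>\<close> gives inner points of segments.
  Vertices exist: a functional positive on \<open>\<sigma>\<close> attains its minimum over \<open>Q + \<sigma>\<close> exactly on a face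
  of \<open>Q\<close>.\<close>

lemma Pol_vertices:
  assumes "P \<in> Pol \<sigma>"
  shows "finite (vertices P)" "vertices P \<noteq> {}" "\<And>v. v \<in> vertices P \<Longrightarrow> rational_vec v"
    "vertices P \<subseteq> P" "convex P" "\<And>p s. p \<in> P \<Longrightarrow> s \<in> \<sigma> \<Longrightarrow> p + s \<in> P"
proof -
  obtain Q where Q: "P = Q + \<sigma>" "polytope Q" "Q \<noteq> {}" "\<forall>v. v extreme_point_of Q \<longrightarrow> rational_vec v"
    using assms unfolding Pol_def by (elim CollectE exE conjE)
  have convQ: "convex Q" and compQ: "compact Q" using Q(2) by (auto intro: polytope_imp_convex polytope_imp_compact)
  have conv\<sigma>: "convex \<sigma>" using cone by (simp add: convex_cone_def)
  show conv: "convex P"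
    unfolding Q(1) by (rule convex_set_plus[OF convQ conv\<sigma>])
  show add: "p + s \<in> P" if ps: "p \<in> P" "s \<in> \<sigma>" for p s
  proof -
    obtain q t where "p = q + t" "q \<in> Q" "t \<in> \<sigma>" using ps(1) unfolding Q(1) by (rule set_plus_elim)
    then show ?thesis unfolding Q(1) using cone_props(2)[OF _ ps(2)] by (metis add.assoc set_plus_intro)
  qed
  have QP: "Q \<subseteq> P" unfolding Q(1) using set_plus_intro[OF _ cone_props(1)] by fastforce
  have sub: "v extreme_point_of Q" if v: "v extreme_point_of P" for v
  proof -
    have "v \<in> P" using v by (simp add: extreme_point_of_def)
    then obtain q s where qs: "v = q + s" "q \<in> Q" "s \<in> \<sigma>" unfolding Q(1) by (rule set_plus_elim)
    have "v - s \<in> P" "v + s \<in> P" using qs QP add[OF \<open>v \<in> P\<close> qs(3)] by auto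
    then have "s = 0" by (rule not_between[OF v])
    then show ?thesis using qs v QP by (auto simp: extreme_point_of_def)
  qed
  have "finite (vertices Q)" by (rule finite_polyhedron_extreme_points[OF polytope_imp_polyhedron[OF Q(2)]])
  then show "finite (vertices P)" by (rule rev_finite_subset) (use sub in auto)
  show "rational_vec v" if "v \<in> vertices P" for v using sub Q(4) that by blast
  show "vertices P \<subseteq> P" by (auto simp: extreme_point_of_def)
  obtain a where a: "\<And>v. v \<in> \<sigma> \<Longrightarrow> v \<noteq> 0 \<Longrightarrow> a \<bullet> v > 0" using interior_functional by blast
  have "continuous_on Q (\<lambda>x. a \<bullet> x)" by (intro continuous_intros)
  then obtain q where q: "q \<in> Q" "\<And>x. x \<in> Q \<Longrightarrow> a \<bullet> q \<le> a \<bullet> x"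
    using continuous_attains_inf[OF compQ Q(3)] by blast
  have a0: "a \<bullet> v \<ge> 0" if "v \<in> \<sigma>" for v using a[OF that] by (cases "v = 0") auto
  let ?F = "P \<inter> {x. a \<bullet> x = a \<bullet> q}"
  have face: "?F face_of P"
  proof (rule face_of_Int_supporting_hyperplane_ge[OF conv])
    fix x assume "x \<in> P"
    then obtain p s where "x = p + s" "p \<in> Q" "s \<in> \<sigma>" unfolding Q(1) by (rule set_plus_elim)
    then show "a \<bullet> x \<ge> a \<bullet> q" using q(2) a0 by (simp add: inner_add_right add_increasing2)
  qed
  have FQ: "?F = Q \<inter> {x. a \<bullet> x = a \<bullet> q}"
  proof (intro equalityI subsetI)
    fix x assume x: "x \<in> ?F"
    then have "x \<in> P" by blast
    then obtain p s where ps: "x = p + s" "p \<in> Q" "s \<in> \<sigma>" unfolding Q(1) by (rule set_plus_elim)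
    have "a \<bullet> p + a \<bullet> s = a \<bullet> q" using x ps(1) by (simp add: inner_add_right)
    then have "\<not> a \<bullet> s > 0" using q(2)[OF ps(2)] by linarith
    then have "s = 0" using a[OF ps(3)] by blast
    then show "x \<in> Q \<inter> {x. a \<bullet> x = a \<bullet> q}" using ps x by simp
  qed (use QP in auto)
  have "compact (Q \<inter> {x. a \<bullet> x = a \<bullet> q})" "convex (Q \<inter> {x. a \<bullet> x = a \<bullet> q})"
    using compQ convQ by (auto intro: compact_Int_closed closed_hyperplane convex_Int convex_hyperplane)
  then obtain v where v: "v extreme_point_of (Q \<inter> {x. a \<bullet> x = a \<bullet> q})"
    using extreme_point_exists_convex[of "Q \<inter> {x. a \<bullet> x = a \<bullet> q}"] q(1) by blast
  have "v extreme_point_of P" using v extreme_point_of_face[OF face, of v] unfolding FQ by simp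
  then show "vertices P \<noteq> {}" by blast
qed

text \<open>Every vertex is exposed by a lattice functional in the interior of the dual cone: it lies
  outside the closed convex set spanned by the other vertices and \<open>\<sigma>\<close>.\<close>

lemma vertex_exposed:
  assumes P: "P \<in> Pol \<sigma>" and v: "v \<in> vertices P"
  obtains m where "m \<in> interior_dual" "\<And>u. u \<in> vertices P \<Longrightarrow> pairing m v \<le> (pairing m u :: real)"
proof -
  note pv = Pol_vertices[OF P]
  let ?V = "vertices P - {v}"
  have "\<exists>a :: real ^ 'n. (\<forall>u\<in>?V. a \<bullet> (u - v) > 0) \<and> (\<forall>s\<in>\<sigma>. a \<bullet> s \<ge> 0)"
  proof (cases "?V = {}")
    case True
    show ?thesis unfolding True by (intro exI[of _ 0]) simp
  next
    case False
    let ?W = "\<Union>x\<in>convex hull ?V. \<Union>y\<in>\<sigma>. {x + y}"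
    have v': "v extreme_point_of P" using v by simp
    have hullP: "convex hull ?V \<subseteq> P - {v}"
      using v' pv(4) extreme_point_of_stillconvex[OF pv(5), of v] by (intro hull_minimal) auto
    have "v \<notin> ?W"
    proof
      assume "v \<in> ?W"
      then obtain x y where xy: "v = x + y" "x \<in> convex hull ?V" "y \<in> \<sigma>" by blast
      have x: "x \<in> P" "x \<noteq> v" using xy(2) hullP by auto
      have "v \<in> P" using v pv(4) by blast
      then have "v + y \<in> P" by (rule pv(6)[OF _ xy(3)])
      moreover have "v - y \<in> P" using x xy(1) by simp
      ultimately have "y = 0" using not_between[OF v', of y] by simp
      then show False using x xy(1) by simp
    qed
    moreover have "closed ?W"
      using pv(1) by (intro compact_closed_sums finite_imp_compact_convex_hull closed_cone) simp
    moreover have "convex ?W"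
      using cone by (intro convex_sums convex_convex_hull) (simp add: convex_cone_def)
    ultimately obtain a b where ab: "a \<bullet> v < b" "\<forall>x\<in>?W. a \<bullet> x > b"
      using separating_hyperplane_closed_point[of ?W v] by blast
    have pos: "a \<bullet> s \<ge> 0" if s: "s \<in> \<sigma>" for s
    proof (rule ccontr)
      assume n: "\<not> a \<bullet> s \<ge> 0"
      obtain u where u: "u \<in> ?V" using False by blast
      define c where "c = (a \<bullet> u - b) / (- (a \<bullet> s))"
      have "u + 0 \<in> ?W" using hull_inc[OF u] cone_props(1) by blast
      then have "a \<bullet> u > b" using ab(2) by auto
      then have "c \<ge> 0" unfolding c_def using n by (intro divide_nonneg_nonneg) auto
      then have "u + c *\<^sub>R s \<in> ?W" using hull_inc[OF u] cone_props(3)[OF s] by blast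
      then have "a \<bullet> (u + c *\<^sub>R s) > b" using ab(2) by (rule bspec[rotated])
      then have "a \<bullet> u + c * (a \<bullet> s) > b" by (simp add: inner_add_right)
      moreover have "c * (a \<bullet> s) = - (a \<bullet> u - b)" using n by (simp add: c_def)
      ultimately show False by linarith
    qed
    have "a \<bullet> (u - v) > 0" if u: "u \<in> ?V" for u
    proof -
      have "u + 0 \<in> ?W" using hull_inc[OF u] cone_props(1) by blast
      then have "a \<bullet> u > b" using ab(2) by auto
      then show ?thesis using ab(1) by (simp add: inner_diff_right)
    qed
    then show ?thesis using pos by blast
  qed
  then obtain a :: "real ^ 'n" where a: "\<And>u. u \<in> ?V \<Longrightarrow> a \<bullet> (u - v) > 0" "\<And>s. s \<in> \<sigma> \<Longrightarrow> a \<bullet> s \<ge> 0" by blast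
  obtain m where m: "m \<in> interior_dual" "\<And>w. w \<in> (\<lambda>u. u - v) ` ?V \<Longrightarrow> pairing m w > (0::real)"
    using interior_dual_strict[of "(\<lambda>u. u - v) ` ?V" a] a pv(1) by blast
  have "pairing m v \<le> (pairing m u :: real)" if u: "u \<in> vertices P" for u
  proof (cases "u = v")
    case False
    then have "pairing m (u - v) > (0::real)" using m(2) u by blast
    moreover have "(pairing m u :: real) = pairing m (u - v) + pairing m v"
      using pairing_real_simps(1)[of m "u - v" v] by simp
    ultimately show ?thesis by linarith
  qed simp
  then show ?thesis using that m(1) by blast
qed

end

lemma Min_pairing:
  fixes V :: "(real ^ 'n::finite) set"
  assumes V: "finite V" "V \<noteq> {}"
  shows Min_pairing_le: "v \<in> V \<Longrightarrow> Min (pairing m ` V) \<le> (pairing m v :: real)"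
    and Min_pairing_attained: "\<exists>v\<in>V. Min (pairing m ` V) = (pairing m v :: real)"
    and Min_pairing_add: "Min (pairing m ` V) + Min (pairing m' ` V) \<le> (Min (pairing (m + m') ` V) :: real)"
    and Min_pairing_scale: "Min (pairing (frag_cmul (int r) m) ` V) = real r * (Min (pairing m ` V) :: real)"
proof -
  show le: "Min (pairing m ` V) \<le> (pairing m v :: real)" if "v \<in> V" for v m using V that by simp
  show at: "\<exists>v\<in>V. Min (pairing m ` V) = (pairing m v :: real)" for m
    using Min_in[of "pairing m ` V"] V by (metis empty_is_image finite_imageI imageE)
  obtain v where v: "v \<in> V" "Min (pairing (m + m') ` V) = (pairing (m + m') v :: real)" using at by blast
  show "Min (pairing m ` V) + Min (pairing m' ` V) \<le> (Min (pairing (m + m') ` V) :: real)"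
    using le[OF v(1), of m] le[OF v(1), of m'] by (simp only: v(2) pairing_add)
  obtain v where v: "v \<in> V" "Min (pairing m ` V) = (pairing m v :: real)" using at by blast
  show "Min (pairing (frag_cmul (int r) m) ` V) = real r * (Min (pairing m ` V) :: real)"
  proof (rule Min_eqI)
    show "finite (pairing (frag_cmul (int r) m) ` V :: real set)" using V by simp
    show "real r * Min (pairing m ` V) \<in> pairing (frag_cmul (int r) m) ` V"
      using v by (auto simp: pairing_cmul intro!: image_eqI[of _ _ v])
    fix y :: real assume "y \<in> pairing (frag_cmul (int r) m) ` V"
    then obtain u where u: "u \<in> V" "y = pairing (frag_cmul (int r) m) u" by blast
    have "real r * Min (pairing m ` V) \<le> real r * pairing m u" using le[OF u(1)] by (intro mult_left_mono) auto
    then show "y \<ge> real r * Min (pairing m ` V)" by (simp add: u(2) pairing_cmul)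
  qed
qed

(*PART P8e*)
lemma common_denominator:
  assumes "finite Y" "Y \<subseteq> \<rat>"
  obtains R :: nat where "R > 0" "\<And>x :: real. x \<in> Y \<Longrightarrow> real R * x \<in> \<int>"
proof -
  have "\<exists>R::nat. R > 0 \<and> (\<forall>x\<in>Y. real R * x \<in> \<int>)" using assms
  proof (induction Y rule: finite_induct)
    case empty
    show ?case by (intro exI[of _ 1]) simp
  next
    case (insert x Y)
    then obtain R :: nat where R: "R > 0" "\<forall>x\<in>Y. real R * x \<in> \<int>" by auto
    have "x \<in> \<rat>" using insert by simp
    then obtain p q :: int where pq: "q > 0" "x = of_int p / of_int q" by (rule Rats_cases')
    have qn: "real (nat q) = of_int q" using pq(1) by simp
    have "real (R * nat q) * y \<in> \<int>" if "y \<in> insert x Y" for y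
    proof (cases "y = x")
      case True
      have "real (R * nat q) * y = of_int (int R * p)" using pq True qn by simp
      then show ?thesis by (metis Ints_of_int)
    next
      case False
      then have "real R * y \<in> \<int>" using R(2) that by blast
      then have "(real R * y) * of_int q \<in> \<int>" by (rule Ints_mult[OF _ Ints_of_int])
      moreover have "real (R * nat q) * y = (real R * y) * of_int q" using qn by simp
      ultimately show ?thesis by metis
    qed
    moreover have "R * nat q > 0" using R(1) pq(1) by simp
    ultimately show ?case by blast
  qed
  then show ?thesis using that by blast
qed

lemma pairing_rational: assumes "rational_vec v" shows "(pairing m v :: real) \<in> \<rat>"
proof -
  have "(\<Sum>i\<in>I. of_int (Poly_Mapping.lookup m i) * v $ i) \<in> \<rat>" if "finite I" for I
    using that assms by (induction rule: finite_induct) (auto simp: rational_vec_def)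
  then show ?thesis unfolding pairing_def by simp
qed

locale poly_divisor = places k C + rational_cone \<sigma> S
  for k :: "'K::field set" and C and \<sigma> :: "(real ^ 'l::{finite,linorder}) set" and S +
  fixes \<DD> :: "'K set \<Rightarrow> (real ^ 'l::{finite,linorder}) set"
  assumes pdiv: "polyhedral_divisor C \<sigma> \<DD>" and proper: "proper_pdiv k C \<sigma> \<DD>"
begin

abbreviation h :: "'l dual_lattice \<Rightarrow> 'K set \<Rightarrow> real" where "h m z \<equiv> pdiv_eval \<DD> m z"
abbreviation piece :: "'l dual_lattice \<Rightarrow> 'K set" where "piece \<equiv> pdiv_piece C \<sigma> \<DD>"

lemma Pol_at: "z \<in> C \<Longrightarrow> \<DD> z \<in> Pol \<sigma>"
  using pdiv unfolding polyhedral_divisor_def by blast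

lemma finite_nontrivial: "finite {z \<in> C. \<DD> z \<noteq> \<sigma>}"
  using pdiv unfolding polyhedral_divisor_def by blast

lemma h_le: "z \<in> C \<Longrightarrow> v \<in> vertices (\<DD> z) \<Longrightarrow> h m z \<le> pairing m v"
  unfolding pdiv_eval_def by (rule Min_pairing_le[OF Pol_vertices(1,2)[OF Pol_at]])

lemma h_attained: "z \<in> C \<Longrightarrow> \<exists>v\<in>vertices (\<DD> z). h m z = pairing m v"
  unfolding pdiv_eval_def by (rule Min_pairing_attained[OF Pol_vertices(1,2)[OF Pol_at]])

lemma h_add: "z \<in> C \<Longrightarrow> h m z + h m' z \<le> h (m + m') z"
  unfolding pdiv_eval_def by (rule Min_pairing_add[OF Pol_vertices(1,2)[OF Pol_at]])

lemma h_scale: "z \<in> C \<Longrightarrow> h (frag_cmul (int r) m) z = real r * h m z"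
  unfolding pdiv_eval_def by (rule Min_pairing_scale[OF Pol_vertices(1,2)[OF Pol_at]])

lemma h_trivial: assumes "z \<in> C" "\<DD> z = \<sigma>" shows "h m z = 0"
proof -
  obtain v where v: "v \<in> vertices (\<DD> z)" "h m z = pairing m v" using h_attained[OF assms(1)] by blast
  then have "v = 0" using vertices_cone assms(2) by auto
  then show ?thesis using v(2) by (simp add: pairing_def)
qed

lemma h_rational: assumes "z \<in> C" shows "h m z \<in> \<rat>"
proof -
  obtain v where v: "v \<in> vertices (\<DD> z)" "h m z = pairing m v" using h_attained[OF assms(1)] by blast
  then show ?thesis using pairing_rational[OF Pol_vertices(3)[OF Pol_at[OF assms] v(1)]] by simp
qed

lemma fin_div_h: assumes "\<And>z. z \<in> C \<Longrightarrow> h m z = 0 \<Longrightarrow> D z = 0" shows "fin_div D"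
  unfolding fin_div_def
  by (rule finite_subset[OF _ finite_nontrivial]) (use assms h_trivial in auto)

text \<open>The degree of \<open>\<DD>(m)\<close> is the value of \<open>m\<close> at a point of \<open>deg \<DD> \<subseteq> \<sigma>\<close>, and this point is
  not the origin, as otherwise \<open>deg \<DD>\<close> would contain all of \<open>\<sigma>\<close>.\<close>

lemma integral_multiple_ample:
  assumes m: "m \<in> interior_dual"
  obtains R D where "R > 0" "fin_div D" "\<And>z. z \<in> C \<Longrightarrow> real_of_int (D z) = real R * h m z"
    "affine_curve k C \<or> (projective_curve k C \<and> divdeg D > 0)"
proof -
  let ?Z = "{z \<in> C. \<DD> z \<noteq> \<sigma>}"
  obtain R :: nat where R: "R > 0" "\<And>x. x \<in> h m ` ?Z \<Longrightarrow> real R * x \<in> \<int>"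
    using common_denominator[of "h m ` ?Z"] finite_nontrivial h_rational by blast
  define D where "D z = \<lfloor>real R * h m z\<rfloor>" for z
  have D: "real_of_int (D z) = real R * h m z" if z: "z \<in> C" for z
  proof (cases "\<DD> z = \<sigma>")
    case True
    then show ?thesis using h_trivial[OF z] by (simp add: D_def)
  next
    case False
    then have "real R * h m z \<in> \<int>" using R(2) z by blast
    then obtain n where "real R * h m z = of_int n" by (rule Ints_cases)
    then show ?thesis by (simp add: D_def)
  qed
  have fin: "fin_div D" by (rule fin_div_h[of m]) (simp add: D_def)
  have "affine_curve k C \<or> (projective_curve k C \<and> divdeg D > 0)"
  proof (cases "affine_curve k C")
    case False
    then have pr: "projective_curve k C" "pdiv_degree k C \<sigma> \<DD> \<subset> \<sigma>"
      using proper unfolding proper_pdiv_def by blast+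
    have "\<exists>v. v \<in> vertices (\<DD> z) \<and> h m z = pairing m v" if "z \<in> ?Z" for z using h_attained that by blast
    then obtain v where v: "\<And>z. z \<in> ?Z \<Longrightarrow> v z \<in> vertices (\<DD> z) \<and> h m z = pairing m (v z)" by metis
    define w where "w = (\<Sum>z\<in>?Z. real (residue_degree k z) *\<^sub>R v z)"
    have wsum: "w \<in> (\<Sum>z\<in>?Z. (\<lambda>v. real (residue_degree k z) *\<^sub>R v) ` \<DD> z)"
      unfolding set_sum_alt[OF finite_nontrivial]
    proof (intro CollectI exI[of _ "\<lambda>z. real (residue_degree k z) *\<^sub>R v z"] conjI ballI)
      show "real (residue_degree k z) *\<^sub>R v z \<in> (\<lambda>v. real (residue_degree k z) *\<^sub>R v) ` \<DD> z" if "z \<in> ?Z" for z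
        using v[OF that] Pol_vertices(4)[OF Pol_at, of z] that by blast
    qed (simp add: w_def)
    have wdeg: "s + w \<in> pdiv_degree k C \<sigma> \<DD>" if "s \<in> \<sigma>" for s
      unfolding pdiv_degree_def using that wsum by (rule set_plus_intro)
    have "w \<in> \<sigma>" using wdeg[OF cone_props(1)] pr(2) by auto
    moreover have "w \<noteq> 0"
    proof
      assume "w = 0"
      then have "\<sigma> \<subseteq> pdiv_degree k C \<sigma> \<DD>" using wdeg by auto
      then show False using pr(2) by blast
    qed
    ultimately have pos: "pairing m w > (0::real)" using m by (simp add: interior_dual_def)
    have lin: "pairing m (\<Sum>z\<in>I. real (residue_degree k z) *\<^sub>R v z) = (\<Sum>z\<in>I. real (residue_degree k z) * pairing m (v z))"
      if "finite I" for I
      using that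
    proof (induction rule: finite_induct)
      case empty
      show ?case by (simp add: pairing_def)
    next
      case (insert x F)
      then show ?case by (simp add: pairing_real_simps)
    qed
    have "real_of_int (divdeg D) = (\<Sum>z\<in>?Z. real_of_int (int (residue_degree k z) * D z))"
      using divdeg_superset[OF finite_nontrivial, of D] h_trivial by (force simp: D_def)
    also have "\<dots> = (\<Sum>z\<in>?Z. real R * (real (residue_degree k z) * pairing m (v z)))"
    proof (rule sum.cong[OF refl])
      fix z assume z: "z \<in> ?Z"
      then show "real_of_int (int (residue_degree k z) * D z) = real R * (real (residue_degree k z) * pairing m (v z))"
        using D[of z] v[OF z] by simp
    qed
    also have "\<dots> = real R * pairing m w" unfolding w_def lin[OF finite_nontrivial] by (simp add: sum_distrib_left)
    finally have "real_of_int (divdeg D) > 0" using pos R(1) by simp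
    then show ?thesis using pr(1) by simp
  qed simp
  then show ?thesis using that[OF R(1) fin D] by blast
qed

lemma piece_iff:
  "f \<noteq> 0 \<Longrightarrow> f \<in> piece m \<longleftrightarrow> m \<in> dual_cone_lattice \<sigma> \<and> (\<forall>z\<in>C. of_int (ord_at z f) + h m z \<ge> 0)"
  by (auto simp: pdiv_piece_def H0_def)

lemma piece_zero [simp]: "0 \<in> piece m"
  by (simp add: pdiv_piece_def H0_def)

lemma piece_add: assumes "f \<in> piece m" "g \<in> piece m" shows "f + g \<in> piece m"
proof (cases "f = 0 \<or> g = 0 \<or> f + g = 0")
  case False
  have "of_int (ord_at z (f + g)) + h m z \<ge> 0" if z: "z \<in> C" for z
  proof -
    have "vge z (min (ord_at z f) (ord_at z g)) (f + g)"
      using discrete_placeD(3)[OF place[OF z], of f g] False by (auto simp: vge_def)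
    then have "ord_at z (f + g) \<ge> min (ord_at z f) (ord_at z g)" using False by (simp add: vge_def)
    then show ?thesis using assms piece_iff[of f m] piece_iff[of g m] False z by fastforce
  qed
  then show ?thesis using assms False by (simp add: piece_iff)
qed (use assms in auto)

lemma dual_cone_add: "m \<in> dual_cone_lattice \<sigma> \<Longrightarrow> m' \<in> dual_cone_lattice \<sigma> \<Longrightarrow> m + m' \<in> dual_cone_lattice \<sigma>"
  by (simp add: dual_cone_lattice_def pairing_add)

lemma piece_mult: assumes "f \<in> piece m" "g \<in> piece m'" shows "f * g \<in> piece (m + m')"
proof (cases "f = 0 \<or> g = 0")
  case False
  have "of_int (ord_at z (f * g)) + h (m + m') z \<ge> 0" if z: "z \<in> C" for z
    using discrete_placeD(2)[OF place[OF z], of f g] assms piece_iff[of f m] piece_iff[of g m'] False z h_add[OF z, of m m']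
    by fastforce
  then show ?thesis using assms False dual_cone_add by (simp add: piece_iff)
qed auto

lemma k_subset_piece: assumes "c \<in> k" shows "c \<in> piece 0"
proof (cases "c = 0")
  case False
  have "of_int (ord_at z c) + h 0 z \<ge> 0" if z: "z \<in> C" for z
  proof -
    obtain v :: "real ^ 'l::{finite,linorder}" where "h 0 z = pairing 0 v" using h_attained[OF z, of 0] by blast
    then show ?thesis using ord_const[OF z assms False] by (simp add: pairing_zero)
  qed
  then show ?thesis using False by (simp add: piece_iff dual_cone_lattice_def pairing_zero)
qed simp

lemma ample_pieces:
  assumes m: "m \<in> interior_dual" and B: "fin_div B"
  obtains R r0 where "R > 0" "\<And>r. r \<ge> r0 \<Longrightarrow>
    \<exists>f. f \<noteq> 0 \<and> (\<forall>z\<in>C. of_int (ord_at z f) + h (frag_cmul (int (r * R)) m) z \<ge> of_int (B z))"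
proof -
  obtain R D where R: "R > 0" "fin_div D" "\<And>z. z \<in> C \<Longrightarrow> real_of_int (D z) = real R * h m z"
    "affine_curve k C \<or> (projective_curve k C \<and> divdeg D > 0)" using integral_multiple_ample[OF m] by metis
  obtain r0 where r0: "\<forall>r\<ge>r0. \<exists>f. f \<noteq> 0 \<and> (\<forall>z\<in>C. ord_at z f + int r * D z \<ge> B z)"
    using curve_ample_sections[OF R(4,2) B] by (elim exE)
  have "\<exists>f. f \<noteq> 0 \<and> (\<forall>z\<in>C. of_int (ord_at z f) + h (frag_cmul (int (r * R)) m) z \<ge> of_int (B z))" if "r \<ge> r0" for r
  proof -
    obtain f where f: "f \<noteq> 0" "\<forall>z\<in>C. ord_at z f + int r * D z \<ge> B z" using r0 \<open>r \<ge> r0\<close> by (metis (no_types))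
    have "of_int (ord_at z f) + h (frag_cmul (int (r * R)) m) z \<ge> of_int (B z)" if z: "z \<in> C" for z
    proof -
      have "real_of_int (ord_at z f + int r * D z) \<ge> of_int (B z)" using f(2) z by (simp only: of_int_le_iff)
      then show ?thesis using R(3)[OF z] by (simp only: h_scale[OF z]) (simp add: mult.assoc)
    qed
    then show ?thesis using f(1) by blast
  qed
  then show ?thesis by (rule that[OF R(1)])
qed

lemma bounded_pieces:
  assumes m: "m \<in> interior_dual" and z: "z \<in> C"
  obtains R r0 c where "R > 0" "\<And>r. r \<ge> r0 \<Longrightarrow>
    \<exists>f. f \<noteq> 0 \<and> f \<in> piece (frag_cmul (int (r * R)) m) \<and> of_int (ord_at z f) + h (frag_cmul (int (r * R)) m) z \<le> of_int c"
proof -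
  obtain R D where R: "R > 0" "fin_div D" "\<And>z. z \<in> C \<Longrightarrow> real_of_int (D z) = real R * h m z"
    "affine_curve k C \<or> (projective_curve k C \<and> divdeg D > 0)" using integral_multiple_ample[OF m] by metis
  obtain c r0 where r0: "\<forall>r\<ge>r0. \<exists>f. f \<noteq> 0 \<and> (\<forall>y\<in>C. ord_at y f + int r * D y \<ge> 0) \<and> ord_at z f + int r * D z \<le> c"
    using curve_bounded_sections[OF R(4,2) z] by (elim exE)
  have "\<exists>f. f \<noteq> 0 \<and> f \<in> piece (frag_cmul (int (r * R)) m) \<and> of_int (ord_at z f) + h (frag_cmul (int (r * R)) m) z \<le> of_int c"
    if "r \<ge> r0" for r
  proof -
    obtain f where f: "f \<noteq> 0" "\<forall>y\<in>C. ord_at y f + int r * D y \<ge> 0" "ord_at z f + int r * D z \<le> c"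
      using r0 \<open>r \<ge> r0\<close> by (metis (no_types))
    have eq: "real_of_int (ord_at y f + int r * D y) = of_int (ord_at y f) + h (frag_cmul (int (r * R)) m) y" if y: "y \<in> C" for y
      using R(3)[OF y] by (simp only: h_scale[OF y]) (simp add: mult.assoc)
    have "of_int (ord_at y f) + h (frag_cmul (int (r * R)) m) y \<ge> 0" if y: "y \<in> C" for y
      unfolding eq[OF y, symmetric] using f(2) y by (simp only: of_int_0_le_iff)
    moreover have "m \<in> dual_cone_lattice \<sigma>" using m interior_dual_subset by blast
    then have "frag_cmul (int (r * R)) m \<in> dual_cone_lattice \<sigma>"
      by (simp add: dual_cone_lattice_def pairing_cmul)
    ultimately have "f \<in> piece (frag_cmul (int (r * R)) m)" using f(1) by (simp add: piece_iff)
    moreover have "of_int (ord_at z f) + h (frag_cmul (int (r * R)) m) z \<le> of_int c"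
      unfolding eq[OF z, symmetric] using f(3) by (simp only: of_int_le_iff)
    ultimately show ?thesis using f(1) by blast
  qed
  then show ?thesis by (rule that[OF R(1)])
qed

lemma multiple_of_interior:
  assumes m: "m \<in> interior_dual"
  obtains r0 :: nat where "\<And>r. r \<ge> r0 \<Longrightarrow> e + frag_cmul (int r) m \<in> dual_cone_lattice \<sigma>"
proof -
  have "0 < (pairing m v :: real)" if "v \<in> nonzero_gens" for v
    using m nonzero_gens_in[OF that] by (simp add: interior_dual_def)
  then obtain x :: real where x: "x \<ge> 0" "\<And>v. v \<in> nonzero_gens \<Longrightarrow> x * pairing m v > \<bar>pairing e v\<bar>"
    using finite_bound[of nonzero_gens "pairing m" "\<lambda>v. \<bar>pairing e v\<bar>"] finite_nonzero_gens by blast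
  have "e + frag_cmul (int r) m \<in> dual_cone_lattice \<sigma>" if r: "r \<ge> nat \<lceil>x\<rceil>" for r
  proof -
    have "pairing (e + frag_cmul (int r) m) v > (0::real)" if v: "v \<in> nonzero_gens" for v
    proof -
      have "real r \<ge> x" using r by linarith
      moreover have "pairing m v > (0::real)" using m nonzero_gens_in[OF v] by (simp add: interior_dual_def)
      ultimately have "x * pairing m v \<le> real r * pairing m v" by simp
      then have "real r * pairing m v + pairing e v > 0" using x(2)[OF v] by linarith
      then show ?thesis by (simp add: pairing_add pairing_cmul)
    qed
    then have "e + frag_cmul (int r) m \<in> interior_dual" unfolding interior_dual_def using positive_on_cone by blast
    then show ?thesis using interior_dual_subset by blast
  qed
  then show ?thesis using that by blast
qed

text \<open>The weights of \<open>A\<close> generate the lattice \<open>M\<close>.\<close>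

lemma common_piece:
  obtains s f where "f \<noteq> 0" "f \<in> piece s" "f \<in> piece (e + s)"
proof -
  obtain m where m: "m \<in> interior_dual" using interior_dual_nonempty by blast
  define B where "B z = \<lceil>max 0 (- h e z)\<rceil>" for z
  have "fin_div B" by (rule fin_div_h[of e]) (simp add: B_def)
  then obtain R r1 where R: "R > 0" "\<And>r. r \<ge> r1 \<Longrightarrow>
    \<exists>f. f \<noteq> 0 \<and> (\<forall>z\<in>C. of_int (ord_at z f) + h (frag_cmul (int (r * R)) m) z \<ge> of_int (B z))"
    using ample_pieces[OF m] by metis
  obtain r2 where r2: "\<And>r. r \<ge> r2 \<Longrightarrow> e + frag_cmul (int r) m \<in> dual_cone_lattice \<sigma>"
    using multiple_of_interior[OF m, of e] by metis
  define s where "s = frag_cmul (int (max r1 r2 * R)) m"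
  obtain f where f: "f \<noteq> 0" "\<forall>z\<in>C. of_int (ord_at z f) + h s z \<ge> of_int (B z)"
    using R(2)[of "max r1 r2"] unfolding s_def by auto
  have "max r1 r2 * 1 \<le> max r1 r2 * R" using R(1) by (intro mult_le_mono2) simp
  then have "max r1 r2 * R \<ge> r2" by simp
  then have es: "e + s \<in> dual_cone_lattice \<sigma>" unfolding s_def by (rule r2)
  have "m \<in> dual_cone_lattice \<sigma>" using m interior_dual_subset by blast
  then have s: "s \<in> dual_cone_lattice \<sigma>" by (simp add: s_def dual_cone_lattice_def pairing_cmul)
  have ge: "of_int (ord_at z f) + h s z \<ge> 0 \<and> of_int (ord_at z f) + h (e + s) z \<ge> 0" if z: "z \<in> C" for z
  proof -
    have "real_of_int (B z) \<ge> max 0 (- h e z)" unfolding B_def by linarith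
    moreover have "of_int (ord_at z f) + h s z \<ge> of_int (B z)" using f(2) z by blast
    ultimately show ?thesis using h_add[OF z, of e s] by linarith
  qed
  have "f \<in> piece s" "f \<in> piece (e + s)" using f(1) ge s es by (simp_all add: piece_iff)
  then show ?thesis by (rule that[OF f(1)])
qed

end

(*PART P9a*)
lemma frac_embed_simps:
  "frac_embed (a + b) = frac_embed a + frac_embed b" "frac_embed (a * b) = frac_embed a * frac_embed b"
  "frac_embed 0 = 0" "frac_embed 1 = 1" "frac_embed (- a) = - frac_embed a"
  "frac_embed a = frac_embed b \<longleftrightarrow> a = b" "frac_embed a = 0 \<longleftrightarrow> a = 0"
  by (simp_all add: frac_embed_def eq_fract Zero_fract_def One_fract_def)

lemma Fract_frac_embed: "b \<noteq> 0 \<Longrightarrow> Fract a b = frac_embed a / frac_embed b"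
  by (simp add: frac_embed_def)

lemma frac_embed_sum: "frac_embed (sum f I) = (\<Sum>i\<in>I. frac_embed (f i))"
  by (induction I rule: infinite_finite_induct) (simp_all add: frac_embed_simps)

lemma frac_embed_of_nat: "frac_embed (of_nat n) = of_nat n"
  by (induction n) (simp_all add: frac_embed_simps)

text \<open>The double series of \<open>\<partial>\<^sup>(\<^sup>i\<^sup>+\<^sup>j\<^sup>)\<close> weighted by binomial coefficients, that is \<open>x \<mapsto> \<Sum> \<partial>\<^sup>(\<^sup>n\<^sup>)(x) (s + t)\<^sup>n\<close>.\<close>

definition shift_series :: "'a::comm_ring_1 fps \<Rightarrow> 'a fps fps" where
  "shift_series F = Abs_fps (\<lambda>j. Abs_fps (\<lambda>i. of_nat ((i + j) choose j) * fps_nth F (i + j)))"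

lemma shift_series_mult: "shift_series (F * G) = shift_series F * shift_series G"
proof (rule fps_ext, rule fps_ext)
  fix j i
  let ?w = "\<lambda>p n. of_nat ((n choose p) * ((i + j - n) choose (j - p))) * (fps_nth F n * fps_nth G (i + j - n))"
  have inner: "(\<Sum>q=0..i. fps_nth (fps_nth (shift_series F) p) q * fps_nth (fps_nth (shift_series G) (j - p)) (i - q)) = (\<Sum>n\<in>{0..i+j}. ?w p n)"
    if p: "p \<le> j" for p
  proof -
    have "(\<Sum>n\<in>{0..i+j}. ?w p n) = (\<Sum>n\<in>{p..p+i}. ?w p n)"
      using p by (intro sum.mono_neutral_right) (auto simp: not_le binomial_eq_0)
    also have "\<dots> = (\<Sum>q=0..i. ?w p (q + p))"
      by (rule sum.reindex_bij_witness[of _ "\<lambda>q. q + p" "\<lambda>n. n - p"]) auto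
    also have "\<dots> = (\<Sum>q=0..i. fps_nth (fps_nth (shift_series F) p) q * fps_nth (fps_nth (shift_series G) (j - p)) (i - q))"
    proof (rule sum.cong[OF refl])
      fix q assume "q \<in> {0..i}"
      then have "i - q + (j - p) = i + j - (q + p)" using p by simp
      then show "?w p (q + p) = fps_nth (fps_nth (shift_series F) p) q * fps_nth (fps_nth (shift_series G) (j - p)) (i - q)"
        by (simp add: shift_series_def mult_ac)
    qed
    finally show ?thesis by simp
  qed
  have "fps_nth (fps_nth (shift_series F * shift_series G) j) i =
      (\<Sum>p=0..j. \<Sum>q=0..i. fps_nth (fps_nth (shift_series F) p) q * fps_nth (fps_nth (shift_series G) (j - p)) (i - q))"
    by (simp add: fps_mult_nth fps_sum_nth)
  also have "\<dots> = (\<Sum>p=0..j. \<Sum>n\<in>{0..i+j}. ?w p n)" by (rule sum.cong[OF refl], rule inner) simp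
  also have "\<dots> = (\<Sum>n\<in>{0..i+j}. \<Sum>p=0..j. ?w p n)" by (rule sum.swap)
  also have "\<dots> = (\<Sum>n\<in>{0..i+j}. of_nat ((i + j) choose j) * (fps_nth F n * fps_nth G (i + j - n)))"
  proof (rule sum.cong[OF refl])
    fix n assume "n \<in> {0..i+j}"
    then have v: "(\<Sum>p=0..j. (n choose p) * ((i + j - n) choose (j - p))) = (i + j) choose j"
      using vandermonde[of n "i + j - n" j] by (simp add: atLeast0AtMost)
    show "(\<Sum>p=0..j. ?w p n) = of_nat ((i + j) choose j) * (fps_nth F n * fps_nth G (i + j - n))"
      by (simp only: sum_distrib_right[symmetric] of_nat_sum[symmetric] v)
  qed
  also have "\<dots> = fps_nth (fps_nth (shift_series (F * G)) j) i"
    by (simp add: shift_series_def fps_mult_nth sum_distrib_left)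
  finally show "fps_nth (fps_nth (shift_series (F * G)) j) i = fps_nth (fps_nth (shift_series F * shift_series G) j) i" by simp
qed

locale higher_derivation =
  fixes S B :: "'r::idom set" and \<delta> :: "nat \<Rightarrow> 'r \<Rightarrow> 'r"
  assumes one: "1 \<in> B" and neg: "\<And>a. a \<in> B \<Longrightarrow> - a \<in> B"
    and add: "\<And>a b. a \<in> B \<Longrightarrow> b \<in> B \<Longrightarrow> a + b \<in> B" and mult: "\<And>a b. a \<in> B \<Longrightarrow> b \<in> B \<Longrightarrow> a * b \<in> B"
    and S: "S \<subseteq> B" and hd: "iterative_hd S B \<delta>"
begin

lemma \<delta>_in: "a \<in> B \<Longrightarrow> \<delta> i a \<in> B" using hd unfolding iterative_hd_def by blast
lemma \<delta>_add: "a \<in> B \<Longrightarrow> b \<in> B \<Longrightarrow> \<delta> i (a + b) = \<delta> i a + \<delta> i b" using hd unfolding iterative_hd_def by blast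
lemma \<delta>_scale: "s \<in> S \<Longrightarrow> b \<in> B \<Longrightarrow> \<delta> i (s * b) = s * \<delta> i b" using hd unfolding iterative_hd_def by blast
lemma \<delta>_0: "a \<in> B \<Longrightarrow> \<delta> 0 a = a" using hd unfolding iterative_hd_def by blast
lemma \<delta>_mult: "a \<in> B \<Longrightarrow> b \<in> B \<Longrightarrow> \<delta> i (a * b) = (\<Sum>j\<le>i. \<delta> j a * \<delta> (i - j) b)" using hd unfolding iterative_hd_def by blast
lemma \<delta>_comp: "a \<in> B \<Longrightarrow> \<delta> i (\<delta> j a) = of_nat ((i + j) choose i) * \<delta> (i + j) a" using hd unfolding iterative_hd_def by blast

lemma zero: "0 \<in> B" using add[OF one neg[OF one]] by simp

definition F :: "'r fract set" where "F = fraction_subfield B"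

lemma FE: assumes "x \<in> F" obtains a b where "a \<in> B" "b \<in> B" "b \<noteq> 0" "x = frac_embed a / frac_embed b"
  using assms Fract_frac_embed unfolding F_def fraction_subfield_def by blast

lemma FI: "a \<in> B \<Longrightarrow> b \<in> B \<Longrightarrow> b \<noteq> 0 \<Longrightarrow> frac_embed a / frac_embed b \<in> F"
  using Fract_frac_embed[of b a] unfolding F_def fraction_subfield_def by (metis (mono_tags, lifting) mem_Collect_eq)

lemma F_embed: "a \<in> B \<Longrightarrow> frac_embed a \<in> F"
  using FI[of a 1] one by (simp add: frac_embed_simps)

lemma F_add: assumes "x \<in> F" "y \<in> F" shows "x + y \<in> F"
proof -
  obtain a b where x: "a \<in> B" "b \<in> B" "b \<noteq> 0" "x = frac_embed a / frac_embed b" using assms(1) by (rule FE)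
  obtain c d where y: "c \<in> B" "d \<in> B" "d \<noteq> 0" "y = frac_embed c / frac_embed d" using assms(2) by (rule FE)
  have "x + y = frac_embed (a * d + c * b) / frac_embed (b * d)"
    using x y by (simp add: frac_embed_simps add_frac_eq)
  then show ?thesis using FI[of "a * d + c * b" "b * d"] x y add mult by simp
qed

lemma F_mult: assumes "x \<in> F" "y \<in> F" shows "x * y \<in> F"
proof -
  obtain a b where x: "a \<in> B" "b \<in> B" "b \<noteq> 0" "x = frac_embed a / frac_embed b" using assms(1) by (rule FE)
  obtain c d where y: "c \<in> B" "d \<in> B" "d \<noteq> 0" "y = frac_embed c / frac_embed d" using assms(2) by (rule FE)
  have "x * y = frac_embed (a * c) / frac_embed (b * d)" using x y by (simp add: frac_embed_simps)
  then show ?thesis using FI[of "a * c" "b * d"] x y mult by simp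
qed

lemma F_neg: "x \<in> F \<Longrightarrow> - x \<in> F"
  using F_mult[OF F_embed[OF neg[OF one]], of x] by (simp add: frac_embed_simps)

lemma F_inverse: assumes "x \<in> F" shows "inverse x \<in> F"
proof -
  obtain a b where x: "a \<in> B" "b \<in> B" "b \<noteq> 0" "x = frac_embed a / frac_embed b" using assms by (rule FE)
  show ?thesis
  proof (cases "a = 0")
    case True
    then show ?thesis using x F_embed[OF zero] by (simp add: frac_embed_simps)
  next
    case False
    then show ?thesis using FI[OF x(2,1)] x(4) by simp
  qed
qed

lemma F_sum: "(\<And>i. i \<in> I \<Longrightarrow> f i \<in> F) \<Longrightarrow> sum f I \<in> F"
  using F_embed[OF zero] by (induction I rule: infinite_finite_induct) (auto intro: F_add simp: frac_embed_simps)

text \<open>The higher derivation as the ring homomorphism \<open>a \<mapsto> \<Sum> \<partial>\<^sup>(\<^sup>i\<^sup>)(a) t\<^sup>i\<close>.\<close>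

definition \<Theta> :: "'r \<Rightarrow> 'r fract fps" where "\<Theta> a = Abs_fps (\<lambda>i. frac_embed (\<delta> i a))"

lemma \<Theta>_nth: "fps_nth (\<Theta> a) i = frac_embed (\<delta> i a)" by (simp add: \<Theta>_def)

lemma \<Theta>_add: "a \<in> B \<Longrightarrow> b \<in> B \<Longrightarrow> \<Theta> (a + b) = \<Theta> a + \<Theta> b"
  by (rule fps_ext) (simp add: \<Theta>_nth \<delta>_add frac_embed_simps)

lemma \<Theta>_mult: "a \<in> B \<Longrightarrow> b \<in> B \<Longrightarrow> \<Theta> (a * b) = \<Theta> a * \<Theta> b"
  by (rule fps_ext) (simp add: \<Theta>_nth \<delta>_mult frac_embed_simps frac_embed_sum fps_mult_nth atLeast0AtMost)

lemma \<Theta>_unit: "b \<in> B \<Longrightarrow> b \<noteq> 0 \<Longrightarrow> fps_nth (\<Theta> b) 0 \<noteq> 0" "b \<in> B \<Longrightarrow> b \<noteq> 0 \<Longrightarrow> \<Theta> b \<noteq> 0"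
proof -
  show *: "fps_nth (\<Theta> b) 0 \<noteq> 0" if "b \<in> B" "b \<noteq> 0" using that by (simp add: \<Theta>_nth \<delta>_0 frac_embed_simps)
  show "\<Theta> b \<noteq> 0" if "b \<in> B" "b \<noteq> 0" using *[OF that] by auto
qed

lemma \<Theta>_one: "\<Theta> 1 = 1"
  using \<Theta>_mult[OF one one] \<Theta>_unit(2)[OF one] by simp

lemma \<delta>_const: assumes "s \<in> S" shows "\<Theta> s = fps_const (frac_embed s)"
proof (rule fps_ext)
  fix n
  have "\<delta> n s = s * \<delta> n 1" using \<delta>_scale[OF assms one, of n] by simp
  moreover have "frac_embed (\<delta> n 1) = (if n = 0 then 1 else 0)" using arg_cong[OF \<Theta>_one, of "\<lambda>f. fps_nth f n"] by (simp add: \<Theta>_nth)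
  ultimately show "fps_nth (\<Theta> s) n = fps_nth (fps_const (frac_embed s)) n" by (simp add: \<Theta>_nth frac_embed_simps)
qed

definition \<Psi> :: "'r fract \<Rightarrow> 'r fract fps" where
  "\<Psi> x = (SOME f. \<exists>a\<in>B. \<exists>b\<in>B. b \<noteq> 0 \<and> x = frac_embed a / frac_embed b \<and> f * \<Theta> b = \<Theta> a)"

lemma \<Psi>_eq:
  assumes "a \<in> B" "b \<in> B" "b \<noteq> 0" "x = frac_embed a / frac_embed b" shows "\<Psi> x * \<Theta> b = \<Theta> a"
proof -
  have "\<Theta> a * inverse (\<Theta> b) * \<Theta> b = \<Theta> a"
    using inverse_mult_eq_1[OF \<Theta>_unit(1)[OF assms(2,3)]] by (simp add: mult.assoc)
  then have "\<exists>f. \<exists>a\<in>B. \<exists>b\<in>B. b \<noteq> 0 \<and> x = frac_embed a / frac_embed b \<and> f * \<Theta> b = \<Theta> a" using assms by blast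
  then have "\<exists>a\<in>B. \<exists>b\<in>B. b \<noteq> 0 \<and> x = frac_embed a / frac_embed b \<and> \<Psi> x * \<Theta> b = \<Theta> a" unfolding \<Psi>_def by (rule someI_ex)
  then obtain c d where cd: "c \<in> B" "d \<in> B" "d \<noteq> 0" "x = frac_embed c / frac_embed d" "\<Psi> x * \<Theta> d = \<Theta> c" by blast
  have "frac_embed a * frac_embed d = frac_embed c * frac_embed b"
    using assms(3,4) cd(3,4) by (simp add: frac_eq_eq frac_embed_simps)
  then have "frac_embed (a * d) = frac_embed (c * b)" by (simp only: frac_embed_simps)
  then have "a * d = c * b" using frac_embed_simps(6) by blast
  then have "\<Theta> a * \<Theta> d = \<Theta> c * \<Theta> b" using \<Theta>_mult assms cd by metis
  then have "(\<Psi> x * \<Theta> b) * \<Theta> d = \<Theta> a * \<Theta> d" using cd(5) by (simp add: mult_ac)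
  then show ?thesis using \<Theta>_unit(2)[OF cd(2,3)] by simp
qed

lemma \<Psi>_embed: "a \<in> B \<Longrightarrow> \<Psi> (frac_embed a) = \<Theta> a"
  using \<Psi>_eq[of a 1] one by (simp add: frac_embed_simps \<Theta>_one)

lemma \<Psi>_mult: assumes "x \<in> F" "y \<in> F" shows "\<Psi> (x * y) = \<Psi> x * \<Psi> y"
proof -
  obtain a b where x: "a \<in> B" "b \<in> B" "b \<noteq> 0" "x = frac_embed a / frac_embed b" using assms(1) by (rule FE)
  obtain c d where y: "c \<in> B" "d \<in> B" "d \<noteq> 0" "y = frac_embed c / frac_embed d" using assms(2) by (rule FE)
  have "\<Psi> (x * y) * \<Theta> (b * d) = \<Theta> (a * c)"
    by (rule \<Psi>_eq) (use x y mult in \<open>simp_all add: frac_embed_simps\<close>)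
  also have "\<dots> = (\<Psi> x * \<Theta> b) * (\<Psi> y * \<Theta> d)" using \<Psi>_eq[OF x] \<Psi>_eq[OF y] \<Theta>_mult x y by simp
  also have "\<dots> = (\<Psi> x * \<Psi> y) * \<Theta> (b * d)" using \<Theta>_mult x y by (simp add: mult_ac)
  finally show ?thesis using \<Theta>_unit(2)[of "b * d"] x y mult by simp
qed

lemma \<Psi>_add: assumes "x \<in> F" "y \<in> F" shows "\<Psi> (x + y) = \<Psi> x + \<Psi> y"
proof -
  obtain a b where x: "a \<in> B" "b \<in> B" "b \<noteq> 0" "x = frac_embed a / frac_embed b" using assms(1) by (rule FE)
  obtain c d where y: "c \<in> B" "d \<in> B" "d \<noteq> 0" "y = frac_embed c / frac_embed d" using assms(2) by (rule FE)
  have "\<Psi> (x + y) * \<Theta> (b * d) = \<Theta> (a * d + c * b)"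
    by (rule \<Psi>_eq) (use x y mult add in \<open>simp_all add: frac_embed_simps add_frac_eq\<close>)
  also have "\<dots> = (\<Psi> x * \<Theta> b) * \<Theta> d + (\<Psi> y * \<Theta> d) * \<Theta> b"
    using \<Psi>_eq[OF x] \<Psi>_eq[OF y] \<Theta>_mult \<Theta>_add mult x y by simp
  also have "\<dots> = (\<Psi> x + \<Psi> y) * \<Theta> (b * d)" using \<Theta>_mult x y by (simp add: algebra_simps)
  finally show ?thesis using \<Theta>_unit(2)[of "b * d"] x y mult by simp
qed

lemma \<Psi>_0: assumes "x \<in> F" shows "fps_nth (\<Psi> x) 0 = x"
proof -
  obtain a b where x: "a \<in> B" "b \<in> B" "b \<noteq> 0" "x = frac_embed a / frac_embed b" using assms by (rule FE)
  have "fps_nth (\<Psi> x) 0 * frac_embed b = frac_embed a"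
    using arg_cong[OF \<Psi>_eq[OF x], of "\<lambda>f. fps_nth f 0"] x by (simp add: \<Theta>_nth \<delta>_0)
  moreover have "x * frac_embed b = frac_embed a" "frac_embed b \<noteq> 0" using x(3,4) by (simp_all add: frac_embed_simps)
  ultimately show ?thesis by (metis mult_right_cancel)
qed

lemma \<Psi>_in: assumes "x \<in> F" shows "fps_nth (\<Psi> x) n \<in> F"
proof -
  obtain a b where x: "a \<in> B" "b \<in> B" "b \<noteq> 0" "x = frac_embed a / frac_embed b" using assms by (rule FE)
  have b0: "frac_embed b \<noteq> 0" using x(3) by (simp add: frac_embed_simps)
  show ?thesis
  proof (induction n rule: less_induct)
    case (less n)
    let ?s = "\<Sum>i\<in>{..<n}. fps_nth (\<Psi> x) i * frac_embed (\<delta> (n - i) b)"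
    have "frac_embed (\<delta> n a) = (\<Sum>i\<le>n. fps_nth (\<Psi> x) i * frac_embed (\<delta> (n - i) b))"
      using arg_cong[OF \<Psi>_eq[OF x], of "\<lambda>f. fps_nth f n"] by (simp add: fps_mult_nth \<Theta>_nth atLeast0AtMost)
    also have "\<dots> = ?s + fps_nth (\<Psi> x) n * frac_embed b"
      using \<delta>_0[OF x(2)] by (simp add: lessThan_Suc_atMost[symmetric])
    finally have "fps_nth (\<Psi> x) n * frac_embed b = frac_embed (\<delta> n a) + - ?s" by simp
    then have "fps_nth (\<Psi> x) n = (frac_embed (\<delta> n a) + - ?s) * inverse (frac_embed b)"
      using b0 by (metis divide_inverse nonzero_mult_div_cancel_right)
    moreover have "?s \<in> F" using less.IH \<delta>_in x by (intro F_sum F_mult F_embed) auto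
    ultimately show ?case using \<delta>_in x by (simp only:) (intro F_mult F_add F_neg F_inverse F_embed)
  qed
qed

text \<open>Iterativity says that two ring homomorphisms into double power series agree, and they agree on
  fractions because they agree on \<open>B\<close>.\<close>

lemma \<Psi>_comp: assumes x: "x \<in> F"
  shows "fps_nth (\<Psi> (fps_nth (\<Psi> x) j)) i = of_nat ((i + j) choose i) * fps_nth (\<Psi> x) (i + j)"
proof -
  define \<Phi> where "\<Phi> y = Abs_fps (\<lambda>j. \<Psi> (fps_nth (\<Psi> y) j))" for y
  have \<Psi>_sum: "\<Psi> (\<Sum>i\<in>I. f i) = (\<Sum>i\<in>I. \<Psi> (f i))" if fin: "finite I" and f: "\<And>i. i \<in> I \<Longrightarrow> f i \<in> F" for I and f :: "nat \<Rightarrow> 'r fract"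
    using fin f
  proof (induction I rule: finite_induct)
    case empty
    have "\<Psi> 0 = \<Psi> 0 + \<Psi> 0" using \<Psi>_add[OF F_embed[OF zero] F_embed[OF zero]] by (simp only: frac_embed_simps add_0)
    then have "\<Psi> 0 = 0" by (metis add_cancel_right_right)
    then show ?case by (simp add: frac_embed_simps)
  next
    case (insert i I)
    then show ?case using \<Psi>_add[of "f i" "sum f I"] F_sum[of I f] by simp
  qed
  have \<Phi>_mult: "\<Phi> (y * y') = \<Phi> y * \<Phi> y'" if y: "y \<in> F" "y' \<in> F" for y y'
    using y by (intro fps_ext) (simp add: \<Phi>_def \<Psi>_mult fps_mult_nth \<Psi>_sum F_mult \<Psi>_in)
  have agree: "\<Phi> (frac_embed a) = shift_series (\<Psi> (frac_embed a))" if a: "a \<in> B" for a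
    by (intro fps_ext) (simp add: \<Phi>_def shift_series_def \<Psi>_embed a \<Theta>_nth \<delta>_in \<delta>_comp frac_embed_simps frac_embed_of_nat
        binomial_symmetric[of i "i + j" for i j])
  obtain a b where ab: "a \<in> B" "b \<in> B" "b \<noteq> 0" "x = frac_embed a / frac_embed b" using x by (rule FE)
  have xb: "x * frac_embed b = frac_embed a" using ab by (simp add: frac_embed_simps)
  have "\<Phi> x * \<Phi> (frac_embed b) = \<Phi> (frac_embed a)" using \<Phi>_mult[OF x F_embed[OF ab(2)]] xb by simp
  also have "\<dots> = shift_series (\<Psi> (x * frac_embed b))" using agree[OF ab(1)] xb by simp
  also have "\<dots> = shift_series (\<Psi> x) * \<Phi> (frac_embed b)"
    using \<Psi>_mult[OF x F_embed[OF ab(2)]] shift_series_mult agree[OF ab(2)] by simp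
  finally have eq: "\<Phi> x * \<Phi> (frac_embed b) = shift_series (\<Psi> x) * \<Phi> (frac_embed b)" .
  have "fps_nth (fps_nth (\<Phi> (frac_embed b)) 0) 0 = frac_embed b"
    by (simp add: \<Phi>_def \<Psi>_0 F_embed ab(2))
  then have "\<Phi> (frac_embed b) \<noteq> 0" using ab(3) by (auto simp: frac_embed_simps)
  then have "\<Phi> x = shift_series (\<Psi> x)" using eq by simp
  then have "fps_nth (fps_nth (\<Phi> x) j) i = fps_nth (fps_nth (shift_series (\<Psi> x)) j) i" by simp
  then show ?thesis by (simp add: \<Phi>_def shift_series_def binomial_symmetric[of i "i + j"])
qed

lemma extension_to_fractions:
  "\<exists>\<delta>'. iterative_hd (frac_embed ` S) (fraction_subfield B) \<delta>' \<and>
     (\<forall>i. \<forall>a\<in>B. \<delta>' i (frac_embed a) = frac_embed (\<delta> i a)) \<and> (\<forall>i x. x \<notin> fraction_subfield B \<longrightarrow> \<delta>' i x = 0)"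
proof -
  define \<delta>' where "\<delta>' i x = (if x \<in> F then fps_nth (\<Psi> x) i else 0)" for i x
  have "iterative_hd (frac_embed ` S) F \<delta>'"
    unfolding iterative_hd_def
  proof (intro conjI allI ballI)
    show "\<delta>' i f \<in> F" if "f \<in> F" for i f using that \<Psi>_in by (simp add: \<delta>'_def)
    show "\<delta>' i (f + g) = \<delta>' i f + \<delta>' i g" if "f \<in> F" "g \<in> F" for i f g using that by (simp add: \<delta>'_def \<Psi>_add F_add)
    show "\<delta>' 0 f = f" if "f \<in> F" for f using that \<Psi>_0 by (simp add: \<delta>'_def)
    show "\<delta>' i (f * g) = (\<Sum>j\<le>i. \<delta>' j f * \<delta>' (i - j) g)" if "f \<in> F" "g \<in> F" for i f g
      using that by (simp add: \<delta>'_def \<Psi>_mult F_mult fps_mult_nth atLeast0AtMost)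
    show "\<delta>' i (\<delta>' j f) = of_nat ((i + j) choose i) * \<delta>' (i + j) f" if "f \<in> F" for i j f
      using that \<Psi>_in \<Psi>_comp by (simp add: \<delta>'_def)
    fix i s f assume s: "s \<in> frac_embed ` S" and f: "f \<in> F"
    then obtain c where c: "c \<in> S" "s = frac_embed c" by blast
    then have "\<Psi> (s * f) = fps_const s * \<Psi> f" using \<Psi>_mult[OF F_embed f, of c] \<Psi>_embed[of c] \<delta>_const[of c] S by auto
    moreover have "s * f \<in> F" using c S f by (auto intro: F_mult F_embed)
    ultimately show "\<delta>' i (s * f) = s * \<delta>' i f" using f by (simp add: \<delta>'_def)
  qed
  moreover have "\<delta>' i (frac_embed a) = frac_embed (\<delta> i a)" if "a \<in> B" for i a
    using that by (simp add: \<delta>'_def F_embed \<Psi>_embed \<Theta>_nth)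
  ultimately show ?thesis unfolding F_def[symmetric] by (intro exI[of _ \<delta>']) (simp add: \<delta>'_def)
qed

end

(*PART P9b*)
lemma sum_of_monomials: "a = (\<Sum>m\<in>Poly_Mapping.keys a. Poly_Mapping.single m (Poly_Mapping.lookup a m))"
  by (rule poly_mapping_eqI) (simp add: lookup_sum lookup_single when_def in_keys_iff)

lemma const_mult_single: "const c * Poly_Mapping.single m x = Poly_Mapping.single m (c * x)"
  by (simp add: const_def mult_single)

lemma root_section_hd_superset:
  assumes "finite I" "Poly_Mapping.keys a \<subseteq> I"
  shows "root_section_hd e \<rho> \<phi> i a = (\<Sum>m\<in>I. Poly_Mapping.single (m + frag_cmul (int i) e)
    (\<phi> ^ i * (of_nat (nat (pairing m \<rho>) choose i) * Poly_Mapping.lookup a m)))"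
proof -
  have "root_section_hd e \<rho> \<phi> i a = (\<Sum>m\<in>Poly_Mapping.keys a. Poly_Mapping.single (m + frag_cmul (int i) e)
    (\<phi> ^ i * (of_nat (nat (pairing m \<rho>) choose i) * Poly_Mapping.lookup a m)))"
    by (simp add: root_section_hd_def root_hd_def sum_distrib_left const_mult_single)
  also have "\<dots> = (\<Sum>m\<in>I. Poly_Mapping.single (m + frag_cmul (int i) e)
    (\<phi> ^ i * (of_nat (nat (pairing m \<rho>) choose i) * Poly_Mapping.lookup a m)))"
    using assms by (intro sum.mono_neutral_left) (auto simp: in_keys_iff)
  finally show ?thesis .
qed

lemma root_section_hd_single:
  "root_section_hd e \<rho> \<phi> i (Poly_Mapping.single m c) =
    Poly_Mapping.single (m + frag_cmul (int i) e) (\<phi> ^ i * (of_nat (nat (pairing m \<rho>) choose i) * c))"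
  by (subst root_section_hd_superset[of "{m}"]) (auto simp: in_keys_iff lookup_single when_def)

lemma root_section_hd_add:
  "root_section_hd e \<rho> \<phi> i (a + b) = root_section_hd e \<rho> \<phi> i a + root_section_hd e \<rho> \<phi> i b"
proof -
  let ?I = "Poly_Mapping.keys a \<union> Poly_Mapping.keys b"
  have "Poly_Mapping.keys (a + b) \<subseteq> ?I" by (rule keys_add)
  then show ?thesis
    by (simp add: root_section_hd_superset[of ?I] lookup_add distrib_left single_add sum.distrib)
qed

lemma root_section_hd_sum:
  "root_section_hd e \<rho> \<phi> i (\<Sum>x\<in>I. f x) = (\<Sum>x\<in>I. root_section_hd e \<rho> \<phi> i (f x))"
proof (induction I rule: infinite_finite_induct)
  case (insert x I)
  then show ?case by (simp add: root_section_hd_add)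
qed (simp_all add: root_section_hd_superset[of "{}"])

lemma root_section_hd_const:
  "root_section_hd e \<rho> \<phi> i (const c * a) = const c * root_section_hd e \<rho> \<phi> i a"
proof -
  have "root_section_hd e \<rho> \<phi> i (const c * (\<Sum>m\<in>Poly_Mapping.keys a. Poly_Mapping.single m (Poly_Mapping.lookup a m))) =
    const c * root_section_hd e \<rho> \<phi> i (\<Sum>m\<in>Poly_Mapping.keys a. Poly_Mapping.single m (Poly_Mapping.lookup a m))"
    by (simp add: sum_distrib_left root_section_hd_sum const_mult_single root_section_hd_single mult_ac)
  then show ?thesis by (simp only: sum_of_monomials[symmetric])
qed

context poly_divisor
begin

abbreviation A :: "('l, 'K) group_algebra set" where "A \<equiv> pdiv_algebra C \<sigma> \<DD>"

lemma single_in_A: "Poly_Mapping.single m f \<in> A \<longleftrightarrow> f \<in> piece m"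
  by (auto simp: pdiv_algebra_def lookup_single when_def)

lemma A_lookup: "a \<in> A \<Longrightarrow> Poly_Mapping.lookup a m \<in> piece m"
  by (simp add: pdiv_algebra_def)

lemma A_add: "a \<in> A \<Longrightarrow> b \<in> A \<Longrightarrow> a + b \<in> A"
  using piece_add by (simp add: pdiv_algebra_def lookup_add)

lemma A_zero: "0 \<in> A"
  by (simp add: pdiv_algebra_def)

lemma A_sum: "(\<And>i. i \<in> I \<Longrightarrow> f i \<in> A) \<Longrightarrow> sum f I \<in> A"
  by (induction I rule: infinite_finite_induct) (auto intro: A_add simp: A_zero)

lemma A_mult: assumes "a \<in> A" "b \<in> A" shows "a * b \<in> A"
proof -
  have "(\<Sum>m\<in>Poly_Mapping.keys a. Poly_Mapping.single m (Poly_Mapping.lookup a m)) *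
    (\<Sum>m\<in>Poly_Mapping.keys b. Poly_Mapping.single m (Poly_Mapping.lookup b m)) \<in> A"
    unfolding sum_product using assms by (intro A_sum) (simp add: mult_single single_in_A piece_mult A_lookup)
  then show ?thesis by (simp only: sum_of_monomials[symmetric])
qed

lemma k_in_A: "const ` k \<subseteq> A"
  using k_subset_piece by (auto simp: const_def single_in_A)

lemma piece_dual: "f \<in> piece m \<Longrightarrow> f \<noteq> 0 \<Longrightarrow> m \<in> dual_cone_lattice \<sigma>"
  by (simp add: piece_iff)

lemma A_keys: "a \<in> A \<Longrightarrow> m \<in> Poly_Mapping.keys a \<Longrightarrow> m \<in> dual_cone_lattice \<sigma>"
  using A_lookup[of a m] piece_dual[of "Poly_Mapping.lookup a m" m] by (simp add: in_keys_iff)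

lemma k_of_nat: "of_nat n \<in> k" and k_minus_one: "- 1 \<in> k" and k_one: "1 \<in> k"
proof -
  have sr: "is_subring k" using k by (rule is_subfieldD)
  show one: "1 \<in> k" using is_subringD[OF sr] by blast
  show "- 1 \<in> k" using is_subringD[OF sr] one by blast
  show "of_nat n \<in> k" using is_subringD[OF sr] one by (induction n) (auto simp: add.commute)
qed

lemma A_higher_derivation:
  assumes "iterative_hd (const ` k) A \<delta>" shows "higher_derivation (const ` k) A \<delta>"
proof
  have c: "const 1 \<in> A" "const (- 1) \<in> A" using k_in_A k_one k_minus_one by auto
  show "1 \<in> A" using c(1) by (simp add: const_def)
  show "- a \<in> A" if "a \<in> A" for a
    using A_mult[OF c(2) that] by (simp add: const_def single_uminus)
qed (use assms k_in_A A_add A_mult in auto)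

lemma vertical_if_linear:
  assumes hd: "iterative_hd (const ` k) A \<delta>" and lin: "\<And>i c a. \<delta> i (const c * a) = const c * \<delta> i a"
  shows "vertical_hd k A \<delta>"
proof -
  obtain \<delta>' where \<delta>': "iterative_hd (frac_embed ` const ` k) (fraction_subfield A) \<delta>'"
    "\<forall>i. \<forall>a\<in>A. \<delta>' i (frac_embed a) = frac_embed (\<delta> i a)" "\<forall>i x. x \<notin> fraction_subfield A \<longrightarrow> \<delta>' i x = 0"
    using higher_derivation.extension_to_fractions[OF A_higher_derivation[OF hd]] by (elim exE conjE)
  interpret higher_derivation "const ` k" A \<delta> by (rule A_higher_derivation[OF hd])
  have "\<delta>' i (frac_embed (const c)) = 0" if "i > 0" for i c
  proof (cases "frac_embed (const c) \<in> fraction_subfield A")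
    case True
    then obtain a b where ab: "a \<in> A" "b \<in> A" "b \<noteq> 0" "frac_embed (const c) = frac_embed a / frac_embed b"
      using FE unfolding F_def by blast
    have "frac_embed (const c * b) = frac_embed a" using ab(3,4) by (simp add: frac_embed_simps)
    then have a: "a = const c * b" using frac_embed_simps(6) by metis
    have leib: "\<delta>' i (x * y) = (\<Sum>j\<le>i. \<delta>' j x * \<delta>' (i - j) y)" if "x \<in> fraction_subfield A" "y \<in> fraction_subfield A" for x y i
      using \<delta>'(1) that unfolding iterative_hd_def by blast
    have id: "\<delta>' 0 x = x" if "x \<in> fraction_subfield A" for x
      using \<delta>'(1) that unfolding iterative_hd_def by blast
    have b: "frac_embed b \<in> fraction_subfield A" using F_embed[OF ab(2)] by (simp add: F_def)
    show ?thesis using \<open>i > 0\<close>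
    proof (induction i rule: less_induct)
      case (less i)
      have "frac_embed (const c) * frac_embed (\<delta> i b) = \<delta>' i (frac_embed (const c) * frac_embed b)"
        using \<delta>'(2) ab(1) lin[of i c b] a by (simp flip: frac_embed_simps(2))
      also have "\<dots> = (\<Sum>j\<le>i. \<delta>' j (frac_embed (const c)) * \<delta>' (i - j) (frac_embed b))" by (rule leib[OF True b])
      also have "\<dots> = (\<Sum>j\<in>{0, i}. \<delta>' j (frac_embed (const c)) * \<delta>' (i - j) (frac_embed b))"
      proof (rule sum.mono_neutral_right)
        show "\<forall>j\<in>{..i} - {0, i}. \<delta>' j (frac_embed (const c)) * \<delta>' (i - j) (frac_embed b) = 0"
        proof
          fix j assume "j \<in> {..i} - {0, i}"
          then have "\<delta>' j (frac_embed (const c)) = 0" using less.IH[of j] by simp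
          then show "\<delta>' j (frac_embed (const c)) * \<delta>' (i - j) (frac_embed b) = 0" by simp
        qed
      qed auto
      also have "\<dots> = frac_embed (const c) * frac_embed (\<delta> i b) + \<delta>' i (frac_embed (const c)) * frac_embed b"
        using less.prems \<delta>'(2) ab(2) id[OF True] id[OF b] by simp
      finally have "\<delta>' i (frac_embed (const c)) * frac_embed b = 0" by simp
      then show ?case using ab(3) by (simp add: frac_embed_simps)
    qed
  qed (use \<delta>'(3) in simp)
  then show ?thesis unfolding vertical_hd_def image_comp[symmetric] using \<delta>'(1,2) by blast
qed

context
  fixes e :: "'l dual_lattice" and \<rho> :: "int ^ 'l::{finite,linorder}" and \<phi> :: 'K
  assumes e: "demazure_root \<sigma> e \<rho>" and \<phi>: "\<phi> \<in> H0 C (h e)"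
begin

abbreviation D :: "nat \<Rightarrow> ('l, 'K) group_algebra \<Rightarrow> ('l, 'K) group_algebra" where "D \<equiv> root_section_hd e \<rho> \<phi>"

lemma pairing_ray_nonneg: assumes "m \<in> dual_cone_lattice \<sigma>" shows "pairing m \<rho> \<ge> 0"
proof -
  have "\<rho> \<in> extremal_rays \<sigma>" using e by (simp add: demazure_root_def)
  then have "pairing m (lattice_vec \<rho>) \<ge> (0::real)" using assms ray_in by (simp add: dual_cone_lattice_def)
  then show ?thesis by (simp add: pairing_lattice_vec)
qed

text \<open>The image of \<open>f \<chi>\<^sup>m\<close> under the \<open>i\<close>-th operator has no worse poles than \<open>\<DD>(m + i e)\<close> allows,
  because \<open>\<DD>(m) + i \<DD>(e) \<le> \<DD>(m + i e)\<close>.\<close>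

lemma D_piece:
  assumes f: "f \<in> piece m"
  shows "\<phi> ^ i * (of_nat (nat (pairing m \<rho>) choose i) * f) \<in> piece (m + frag_cmul (int i) e)"
proof (cases "\<phi> ^ i * (of_nat (nat (pairing m \<rho>) choose i) * f) = 0")
  case False
  let ?c = "of_nat (nat (pairing m \<rho>) choose i) :: 'K"
  have nz: "\<phi> ^ i \<noteq> 0" "?c \<noteq> 0" "f \<noteq> 0" using False by auto
  have m: "m \<in> dual_cone_lattice \<sigma>" using piece_dual[OF f nz(3)] .
  have "i \<le> nat (pairing m \<rho>)" using nz(2) by (metis binomial_eq_0 not_le of_nat_0)
  then have "int i \<le> pairing m \<rho>" using pairing_ray_nonneg[OF m] by linarith
  then have "m + frag_cmul (int i) e \<in> dual_cone_lattice \<sigma>" using demazure_translate[OF e m] by blast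
  moreover have "of_int (ord_at z (\<phi> ^ i * (?c * f))) + h (m + frag_cmul (int i) e) z \<ge> 0" if z: "z \<in> C" for z
  proof -
    note pl = place[OF z]
    have "i = 0 \<or> \<phi> \<noteq> 0" using nz(1) by (cases "i = 0") auto
    then have "of_int (ord_at z (\<phi> ^ i)) + real i * h e z \<ge> 0"
    proof
      assume "\<phi> \<noteq> 0"
      then have "of_int (ord_at z \<phi>) + h e z \<ge> 0" using \<phi> z by (simp add: H0_def)
      then have "real i * (of_int (ord_at z \<phi>) + h e z) \<ge> 0" by (intro mult_nonneg_nonneg) auto
      then show ?thesis using ord_simps(6)[OF pl \<open>\<phi> \<noteq> 0\<close>, of i] by (simp add: distrib_left)
    qed (simp add: ord_simps(1)[OF pl])
    moreover have "of_int (ord_at z f) + h m z \<ge> 0" using f nz(3) z by (simp add: piece_iff)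
    moreover have "ord_at z (\<phi> ^ i * (?c * f)) = ord_at z (\<phi> ^ i) + ord_at z f"
      using discrete_placeD(2)[OF pl, of "\<phi> ^ i" "?c * f"] discrete_placeD(2)[OF pl nz(2,3)]
        ord_const[OF z k_of_nat nz(2)] nz by simp
    ultimately show ?thesis using h_add[OF z, of m "frag_cmul (int i) e"] h_scale[OF z, of i e] by simp
  qed
  ultimately show ?thesis using piece_iff[OF False] by blast
next
  case True
  show ?thesis by (simp only: True piece_zero)
qed

lemma D_single_mult:
  assumes m: "m \<in> dual_cone_lattice \<sigma>" and n: "n \<in> dual_cone_lattice \<sigma>"
  shows "D i (Poly_Mapping.single m x * Poly_Mapping.single n y) =
    (\<Sum>j\<le>i. D j (Poly_Mapping.single m x) * D (i - j) (Poly_Mapping.single n y))"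
proof -
  let ?a = "nat (pairing m \<rho>)" and ?b = "nat (pairing n \<rho>)"
  have ab: "nat (pairing (m + n) \<rho>) = ?a + ?b"
    using pairing_ray_nonneg[OF m] pairing_ray_nonneg[OF n] by (simp add: pairing_add nat_add_distrib)
  have "(\<Sum>j\<le>i. D j (Poly_Mapping.single m x) * D (i - j) (Poly_Mapping.single n y)) =
    (\<Sum>j\<le>i. Poly_Mapping.single (m + n + frag_cmul (int i) e) (of_nat ((?a choose j) * (?b choose (i - j))) * (\<phi> ^ i * (x * y))))"
  proof (rule sum.cong[OF refl])
    fix j assume j: "j \<in> {..i}"
    have "frag_cmul (int j) e + frag_cmul (int (i - j)) e = frag_cmul (int i) e" using j by (simp flip: frag_cmul_distrib)
    then have "(m + frag_cmul (int j) e) + (n + frag_cmul (int (i - j)) e) = m + n + frag_cmul (int i) e"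
      by (metis (no_types, lifting) add.assoc add.left_commute)
    moreover have "\<phi> ^ j * \<phi> ^ (i - j) = \<phi> ^ i" using j by (simp flip: power_add)
    then have "\<phi> ^ j * (of_nat (?a choose j) * x) * (\<phi> ^ (i - j) * (of_nat (?b choose (i - j)) * y)) =
        of_nat ((?a choose j) * (?b choose (i - j))) * (\<phi> ^ i * (x * y))"
      by (metis (no_types, lifting) mult.assoc mult.left_commute of_nat_mult)
    ultimately show "D j (Poly_Mapping.single m x) * D (i - j) (Poly_Mapping.single n y) =
      Poly_Mapping.single (m + n + frag_cmul (int i) e) (of_nat ((?a choose j) * (?b choose (i - j))) * (\<phi> ^ i * (x * y)))"
      by (simp only: root_section_hd_single mult_single)
  qed
  also have "\<dots> = Poly_Mapping.single (m + n + frag_cmul (int i) e) ((\<Sum>j\<le>i. of_nat ((?a choose j) * (?b choose (i - j)))) * (\<phi> ^ i * (x * y)))"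
    unfolding sum_distrib_right by (rule poly_mapping_eqI) (simp add: lookup_sum lookup_single when_def)
  also have "(\<Sum>j\<le>i. of_nat ((?a choose j) * (?b choose (i - j)))) = (of_nat ((?a + ?b) choose i) :: 'K)"
    by (simp only: of_nat_sum[symmetric] vandermonde)
  finally show ?thesis by (simp add: mult_single root_section_hd_single ab mult_ac)
qed

lemma D_mult: assumes "a \<in> A" "b \<in> A" shows "D i (a * b) = (\<Sum>j\<le>i. D j a * D (i - j) b)"
proof -
  let ?s = "\<lambda>a m. Poly_Mapping.single m (Poly_Mapping.lookup a m) :: ('l, 'K) group_algebra"
  let ?I = "Poly_Mapping.keys a" and ?J = "Poly_Mapping.keys b"
  have "D i ((\<Sum>m\<in>?I. ?s a m) * (\<Sum>n\<in>?J. ?s b n)) = (\<Sum>m\<in>?I. \<Sum>n\<in>?J. \<Sum>j\<le>i. D j (?s a m) * D (i - j) (?s b n))"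
    unfolding sum_product root_section_hd_sum using A_keys assms by (intro sum.cong refl D_single_mult) auto
  also have "\<dots> = (\<Sum>m\<in>?I. \<Sum>j\<le>i. \<Sum>n\<in>?J. D j (?s a m) * D (i - j) (?s b n))"
    by (intro sum.cong refl sum.swap)
  also have "\<dots> = (\<Sum>j\<le>i. \<Sum>m\<in>?I. \<Sum>n\<in>?J. D j (?s a m) * D (i - j) (?s b n))" by (rule sum.swap)
  also have "\<dots> = (\<Sum>j\<le>i. D j (\<Sum>m\<in>?I. ?s a m) * D (i - j) (\<Sum>n\<in>?J. ?s b n))"
    unfolding root_section_hd_sum sum_product ..
  finally show ?thesis by (simp only: sum_of_monomials[symmetric])
qed

lemma D_comp_single:
  assumes m: "m \<in> dual_cone_lattice \<sigma>"
  shows "D i (D j (Poly_Mapping.single m x)) = of_nat ((i + j) choose i) * D (i + j) (Poly_Mapping.single m x)"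
proof -
  let ?a = "nat (pairing m \<rho>)"
  have p: "pairing (m + frag_cmul (int j) e) \<rho> = pairing m \<rho> - int j"
    using e by (simp add: pairing_add pairing_cmul demazure_root_def)
  have pm: "pairing m \<rho> = int ?a" using pairing_ray_nonneg[OF m] by simp
  have binom: "(nat (pairing m \<rho> - int j) choose i) * (?a choose j) = ((i + j) choose i) * (?a choose (i + j))"
  proof (cases "i + j \<le> ?a")
    case True
    have "nat (pairing m \<rho> - int j) = ?a - j" using pm by linarith
    then show ?thesis using choose_mult[of j "i + j" ?a] True binomial_symmetric[of i "i + j"] by (simp add: mult.commute)
  next
    case False
    show ?thesis
    proof (cases "j \<le> ?a")
      case True
      then have "nat (pairing m \<rho> - int j) < i" using False pm by linarith
      then show ?thesis using False by (simp add: binomial_eq_0)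
    qed (use False in \<open>simp add: binomial_eq_0\<close>)
  qed
  have frag: "m + frag_cmul (int j) e + frag_cmul (int i) e = m + frag_cmul (int (i + j)) e"
    by (simp add: frag_cmul_distrib add_ac)
  have nat_single: "of_nat n * Poly_Mapping.single l y = Poly_Mapping.single l (of_nat n * y)" for n :: nat and l :: "'l dual_lattice" and y :: 'K
    by (induction n) (simp_all add: distrib_right single_add)
  have "\<phi> ^ i * (of_nat (nat (pairing m \<rho> - int j) choose i) * (\<phi> ^ j * (of_nat (?a choose j) * x))) =
    \<phi> ^ (i + j) * x * of_nat ((nat (pairing m \<rho> - int j) choose i) * (?a choose j))"
    by (simp add: power_add mult_ac)
  also have "\<dots> = of_nat ((i + j) choose i) * (\<phi> ^ (i + j) * (of_nat (?a choose (i + j)) * x))"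
    unfolding binom by (simp add: mult_ac)
  finally have eq: "\<phi> ^ i * (of_nat (nat (pairing m \<rho> - int j) choose i) * (\<phi> ^ j * (of_nat (?a choose j) * x))) =
    of_nat ((i + j) choose i) * (\<phi> ^ (i + j) * (of_nat (?a choose (i + j)) * x))" .
  show ?thesis unfolding root_section_hd_single p nat_single frag by (rule arg_cong[OF eq])
qed

lemma root_section_hd_lfihd: "lfihd (const ` k) A D"
  unfolding lfihd_def iterative_hd_def
proof (intro conjI allI ballI)
  show "D i f \<in> A" if "f \<in> A" for i f
    unfolding root_section_hd_superset[OF finite_keys subset_refl]
    using that by (intro A_sum) (simp add: single_in_A D_piece A_lookup)
  show "D i (f + g) = D i f + D i g" for i f g by (rule root_section_hd_add)
  show "D i (s * f) = s * D i f" if "s \<in> const ` k" for i s f using that root_section_hd_const by auto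
  show "D 0 f = f" for f
    unfolding root_section_hd_superset[OF finite_keys subset_refl] using sum_of_monomials[of f] by simp
  show "D i (f * g) = (\<Sum>j\<le>i. D j f * D (i - j) g)" if "f \<in> A" "g \<in> A" for i f g using that by (rule D_mult)
  show "D i (D j f) = of_nat (i + j choose i) * D (i + j) f" if f: "f \<in> A" for i j f
  proof -
    let ?s = "\<lambda>m. Poly_Mapping.single m (Poly_Mapping.lookup f m) :: ('l, 'K) group_algebra"
    have "D i (D j (\<Sum>m\<in>Poly_Mapping.keys f. ?s m)) = of_nat (i + j choose i) * D (i + j) (\<Sum>m\<in>Poly_Mapping.keys f. ?s m)"
      unfolding root_section_hd_sum sum_distrib_left using A_keys[OF f] by (intro sum.cong refl D_comp_single)
    then show ?thesis by (simp only: sum_of_monomials[symmetric])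
  qed
  fix f :: "('l, 'K) group_algebra" assume "f \<in> A"
  define N where "N = (\<Sum>m\<in>Poly_Mapping.keys f. nat (pairing m \<rho>)) + 1"
  have "D i f = 0" if i: "i \<ge> N" for i
    unfolding root_section_hd_superset[OF finite_keys subset_refl]
  proof (intro sum.neutral ballI)
    fix m assume m: "m \<in> Poly_Mapping.keys f"
    have "nat (pairing m \<rho>) \<le> (\<Sum>m\<in>Poly_Mapping.keys f. nat (pairing m \<rho>))" using m by (intro member_le_sum) auto
    then have "nat (pairing m \<rho>) < i" using i by (simp add: N_def)
    then show "Poly_Mapping.single (m + frag_cmul (int i) e)
          (\<phi> ^ i * (of_nat (nat (pairing m \<rho>) choose i) * Poly_Mapping.lookup f m)) = 0" by (simp add: binomial_eq_0)
  qed
  then show "\<exists>n. \<forall>i\<ge>n. D i f = 0" by blast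
qed

lemma root_section_hd_homogeneous: "homogeneous_hd piece D"
  unfolding homogeneous_hd_def using D_piece by (intro exI[of _ e]) (auto simp: root_section_hd_single)

lemma root_section_hd_vertical: "vertical_hd k A D"
  using root_section_hd_lfihd root_section_hd_const by (intro vertical_if_linear) (simp_all add: lfihd_def)

end

end

(*PART P10*)
lemma poly_bezout:
  fixes p q :: "'a::field poly"
  shows "\<exists>g a b. g dvd p \<and> g dvd q \<and> g = a * p + b * q"
proof (induction "if q = 0 then 0 else Suc (degree q)" arbitrary: p q rule: less_induct)
  case less
  show ?case
  proof (cases "q = 0")
    case True
    then show ?thesis by (intro exI[of _ p] exI[of _ 1] exI[of _ 0]) simp
  next
    case False
    have "(if p mod q = 0 then 0 else Suc (degree (p mod q))) < (if q = 0 then 0 else Suc (degree q))"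
      using False degree_mod_less[of q p] by auto
    from less[OF this, of q] obtain g a b where g: "g dvd q" "g dvd p mod q" "g = a * q + b * (p mod q)" by (elim exE conjE)
    have p: "p = (p div q) * q + p mod q" by simp
    have "g dvd p" by (subst p) (intro dvd_add dvd_mult g(1,2))
    moreover have "g = b * p + (a - b * (p div q)) * q"
    proof -
      have "b * p = b * ((p div q) * q + p mod q)" using p by simp
      then show ?thesis using g(3) by (simp only: distrib_left left_diff_distrib mult.assoc) simp
    qed
    ultimately show ?thesis using g(1) by blast
  qed
qed

lemma poly_power_dvd_cancel:
  fixes p q :: "'a::field poly"
  assumes "p ^ d dvd q ^ d" "d > 0" shows "p dvd q"
proof (cases "p = 0")
  case True
  then show ?thesis using assms by (auto simp: power_0_left)
next
  case False
  obtain g a b where g: "g dvd p" "g dvd q" "g = a * p + b * q" using poly_bezout[of p q] by (elim exE conjE)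
  obtain p' where p': "p = g * p'" using g(1) by (elim dvdE)
  obtain q' where q': "q = g * q'" using g(2) by (elim dvdE)
  have g0: "g \<noteq> 0" using False p' by auto
  have "g * (a * p' + b * q') = g * 1" using g(3) p' q' by (simp add: algebra_simps)
  then have one: "a * p' + b * q' = 1" using g0 by (simp only: mult_cancel_left) simp
  have "g ^ d * p' ^ d dvd g ^ d * q' ^ d" using assms(1) by (simp only: p' q' power_mult_distrib)
  then have "p' ^ d dvd q' ^ d" using g0 by (metis dvd_times_left_cancel_iff power_not_zero)
  moreover have "p' dvd p' ^ d" using assms(2) by (intro dvd_power) simp
  ultimately have "p' dvd q' ^ d" by (rule dvd_trans[rotated])
  have "p' dvd (b * q') ^ d" unfolding power_mult_distrib using \<open>p' dvd q' ^ d\<close> by (rule dvd_mult)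
  moreover have "b * q' = 1 - a * p'" using one by (simp add: algebra_simps)
  moreover have "p' dvd (1 - a * p') ^ n - 1" for n
  proof (induction n)
    case (Suc n)
    have "(1 - a * p') ^ Suc n - 1 = (1 - a * p') * ((1 - a * p') ^ n - 1) - a * p'" by (simp add: algebra_simps)
    moreover have "p' dvd (1 - a * p') * ((1 - a * p') ^ n - 1) - a * p'"
      by (rule dvd_diff[OF dvd_mult[OF Suc] dvd_triv_right])
    ultimately show ?case by (simp only:)
  qed simp
  ultimately have "p' dvd (1 - a * p') ^ d - ((1 - a * p') ^ d - 1)" by (metis dvd_diff)
  then have "p' dvd 1" by simp
  then obtain u where "1 = p' * u" by (elim dvdE)
  then have "q = p * (u * q')" using p' q' by (metis mult.assoc mult.commute mult.right_neutral)
  then show ?thesis by simp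
qed

locale vertical_lfihd = poly_divisor k C \<sigma> S \<DD>
  for k :: "'K::field set" and C and \<sigma> :: "(real ^ 'l::{finite,linorder}) set" and S and \<DD> +
  fixes \<delta> :: "nat \<Rightarrow> ('l, 'K) group_algebra \<Rightarrow> ('l, 'K) group_algebra" and e :: "'l dual_lattice"
  assumes lf: "lfihd (const ` k) A \<delta>" and vert: "vertical_hd k A \<delta>"
    and hom: "\<And>i m. \<delta> i ` (Poly_Mapping.single m ` piece m) \<subseteq>
       Poly_Mapping.single (m + frag_cmul (int i) e) ` piece (m + frag_cmul (int i) e)"
begin

sublocale hd: higher_derivation "const ` k" A \<delta>
  using A_higher_derivation lf by (simp add: lfihd_def)

text \<open>Since the extension of \<open>\<delta>\<close> to fractions kills the constants \<open>g / f \<in> Frac A\<close>, the operators are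
  linear over them.\<close>

lemma \<delta>_proportional:
  assumes f: "f \<in> piece m" "f \<noteq> 0" and g: "g \<in> piece m"
  shows "\<delta> i (Poly_Mapping.single m g) = const (g / f) * \<delta> i (Poly_Mapping.single m f)"
proof -
  obtain \<delta>' where \<delta>': "iterative_hd ((frac_embed \<circ> const) ` k) (fraction_subfield A) \<delta>'"
    "\<forall>i. \<forall>a\<in>A. \<delta>' i (frac_embed a) = frac_embed (\<delta> i a)" "\<forall>i>0. \<forall>c. \<delta>' i (frac_embed (const c)) = 0"
    using vert unfolding vertical_hd_def by (elim exE conjE)
  let ?f = "Poly_Mapping.single m f" and ?g = "Poly_Mapping.single m g" and ?c = "frac_embed (const (g / f))"
  have A: "?f \<in> A" "?g \<in> A" using f g by (simp_all add: single_in_A)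
  have f0: "?f \<noteq> 0" using f(2) by (metis lookup_single_eq lookup_zero)
  have cf: "const (g / f) * ?f = ?g" using f(2) by (simp add: const_mult_single)
  then have "?c * frac_embed ?f = frac_embed ?g" by (metis frac_embed_simps(2))
  then have "?c = frac_embed ?g / frac_embed ?f" using f0 by (simp add: frac_embed_simps(7) eq_divide_eq)
  then have c: "?c \<in> fraction_subfield A" using hd.FI[OF A(2,1) f0] by (simp add: hd.F_def)
  have ff: "frac_embed ?f \<in> fraction_subfield A" using hd.F_embed[OF A(1)] by (simp add: hd.F_def)
  have id: "\<delta>' 0 ?c = ?c" using \<delta>'(1) c unfolding iterative_hd_def by blast
  have "frac_embed (\<delta> i ?g) = \<delta>' i (?c * frac_embed ?f)"
    using \<delta>'(2) A(2) cf by (metis frac_embed_simps(2))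
  also have "\<dots> = (\<Sum>j\<le>i. \<delta>' j ?c * \<delta>' (i - j) (frac_embed ?f))"
    using \<delta>'(1) c ff unfolding iterative_hd_def by blast
  also have "\<dots> = (\<Sum>j\<in>{0}. \<delta>' j ?c * \<delta>' (i - j) (frac_embed ?f))"
    using \<delta>'(3) by (intro sum.mono_neutral_right) auto
  also have "\<dots> = frac_embed (const (g / f) * \<delta> i ?f)" using id \<delta>'(2) A(1) by (simp add: frac_embed_simps(2))
  finally show ?thesis by (simp only: frac_embed_simps(6))
qed

definition weights :: "'l dual_lattice set" where "weights = {m. \<exists>f\<in>piece m. f \<noteq> 0}"

definition gen :: "'l dual_lattice \<Rightarrow> 'K" where "gen m = (SOME f. f \<in> piece m \<and> f \<noteq> 0)"

lemma gen: "m \<in> weights \<Longrightarrow> gen m \<in> piece m \<and> gen m \<noteq> 0"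
  unfolding gen_def weights_def by (rule someI_ex) blast

lemma weightsI: "f \<in> piece m \<Longrightarrow> f \<noteq> 0 \<Longrightarrow> m \<in> weights" unfolding weights_def by blast

lemma weights_dual: "m \<in> weights \<Longrightarrow> m \<in> dual_cone_lattice \<sigma>"
  using gen piece_dual by blast

lemma weights_add: "m \<in> weights \<Longrightarrow> n \<in> weights \<Longrightarrow> m + n \<in> weights"
  using gen[of m] gen[of n] piece_mult[of "gen m" m "gen n" n] by (intro weightsI[of "gen m * gen n"]) auto

definition lam :: "'l dual_lattice \<Rightarrow> nat \<Rightarrow> 'K" where
  "lam m i = Poly_Mapping.lookup (\<delta> i (Poly_Mapping.single m (gen m))) (m + frag_cmul (int i) e) / gen m"

lemma \<delta>_single:
  assumes f: "f \<in> piece m" "f \<noteq> 0"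
  shows "\<delta> i (Poly_Mapping.single m f) = Poly_Mapping.single (m + frag_cmul (int i) e) (f * lam m i)"
    and \<delta>_single_in: "f * lam m i \<in> piece (m + frag_cmul (int i) e)"
proof -
  have m: "m \<in> weights" using f by (rule weightsI)
  note g = gen[OF m]
  have "\<delta> i (Poly_Mapping.single m (gen m)) \<in> Poly_Mapping.single (m + frag_cmul (int i) e) ` piece (m + frag_cmul (int i) e)"
    using hom[of i m] g by blast
  then obtain x where x: "\<delta> i (Poly_Mapping.single m (gen m)) = Poly_Mapping.single (m + frag_cmul (int i) e) x" by blast
  then have "lam m i = x / gen m" by (simp add: lam_def)
  then show eq: "\<delta> i (Poly_Mapping.single m f) = Poly_Mapping.single (m + frag_cmul (int i) e) (f * lam m i)"
    using \<delta>_proportional[of "gen m" m f i] g f(1) x by (simp add: const_mult_single)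
  have "Poly_Mapping.single m f \<in> A" using f by (simp add: single_in_A)
  then have "\<delta> i (Poly_Mapping.single m f) \<in> A" by (rule hd.\<delta>_in)
  then show "f * lam m i \<in> piece (m + frag_cmul (int i) e)" by (simp add: eq single_in_A)
qed

lemma lam_weight: "m \<in> weights \<Longrightarrow> lam m i \<noteq> 0 \<Longrightarrow> m + frag_cmul (int i) e \<in> weights"
  using gen[of m] \<delta>_single_in[of "gen m" m i] by (intro weightsI[of "gen m * lam m i"]) auto

lemma lam_zero: "m \<in> weights \<Longrightarrow> lam m 0 = 1"
  using gen[of m] hd.\<delta>_0[of "Poly_Mapping.single m (gen m)"] by (simp add: lam_def single_in_A)

lemma lam_finite: assumes "m \<in> weights" shows "\<forall>\<^sub>\<infinity>i. lam m i = 0"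
proof -
  have "Poly_Mapping.single m (gen m) \<in> A" using gen[OF assms] by (simp add: single_in_A)
  then obtain n where "\<forall>i\<ge>n. \<delta> i (Poly_Mapping.single m (gen m)) = 0" using lf unfolding lfihd_def by blast
  then have "\<forall>i\<ge>n. lam m i = 0" by (simp add: lam_def)
  then show ?thesis unfolding MOST_nat_le by blast
qed

lemma lam_mult: assumes m: "m \<in> weights" and n: "n \<in> weights"
  shows "lam (m + n) i = (\<Sum>j\<le>i. lam m j * lam n (i - j))"
proof -
  note gm = gen[OF m] note gn = gen[OF n]
  let ?f = "gen m" and ?g = "gen n" and ?N = "m + n + frag_cmul (int i) e"
  have fg: "?f * ?g \<in> piece (m + n)" "?f * ?g \<noteq> 0" using gm gn piece_mult by auto
  have "Poly_Mapping.single ?N (?f * ?g * lam (m + n) i) = \<delta> i (Poly_Mapping.single m ?f * Poly_Mapping.single n ?g)"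
    using \<delta>_single[OF fg] by (simp add: mult_single)
  also have "\<dots> = (\<Sum>j\<le>i. \<delta> j (Poly_Mapping.single m ?f) * \<delta> (i - j) (Poly_Mapping.single n ?g))"
    using gm gn by (intro hd.\<delta>_mult) (simp_all add: single_in_A)
  also have "\<dots> = (\<Sum>j\<le>i. Poly_Mapping.single ?N (?f * ?g * (lam m j * lam n (i - j))))"
  proof (rule sum.cong[OF refl])
    fix j assume j: "j \<in> {..i}"
    have "frag_cmul (int j) e + frag_cmul (int (i - j)) e = frag_cmul (int i) e" using j by (simp flip: frag_cmul_distrib)
    then have "(m + frag_cmul (int j) e) + (n + frag_cmul (int (i - j)) e) = ?N"
      by (metis (no_types, lifting) add.assoc add.left_commute)
    moreover have "\<delta> j (Poly_Mapping.single m ?f) = Poly_Mapping.single (m + frag_cmul (int j) e) (?f * lam m j)"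
      using gm by (intro \<delta>_single) auto
    moreover have "\<delta> (i - j) (Poly_Mapping.single n ?g) = Poly_Mapping.single (n + frag_cmul (int (i - j)) e) (?g * lam n (i - j))"
      using gn by (intro \<delta>_single) auto
    ultimately show "\<delta> j (Poly_Mapping.single m ?f) * \<delta> (i - j) (Poly_Mapping.single n ?g) =
      Poly_Mapping.single ?N (?f * ?g * (lam m j * lam n (i - j)))" by (simp only: mult_single) (simp only: mult_ac)
  qed
  finally have "Poly_Mapping.lookup (Poly_Mapping.single ?N (?f * ?g * lam (m + n) i)) ?N =
    Poly_Mapping.lookup (\<Sum>j\<le>i. Poly_Mapping.single ?N (?f * ?g * (lam m j * lam n (i - j)))) ?N" by (rule arg_cong)
  then have "?f * ?g * lam (m + n) i = ?f * ?g * (\<Sum>j\<le>i. lam m j * lam n (i - j))"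
    by (simp only: lookup_sum lookup_single_eq sum_distrib_left)
  then show ?thesis by (rule mult_left_cancel[OF fg(2), THEN iffD1])
qed

lemma lam_comp: assumes m: "m \<in> weights" and j: "lam m j \<noteq> 0"
  shows "lam m j * lam (m + frag_cmul (int j) e) i = of_nat ((i + j) choose i) * lam m (i + j)"
proof -
  note gm = gen[OF m]
  let ?f = "gen m" and ?N = "m + frag_cmul (int (i + j)) e"
  have fg: "?f * lam m j \<in> piece (m + frag_cmul (int j) e)" "?f * lam m j \<noteq> 0" using gm j \<delta>_single_in by auto
  have frag: "m + frag_cmul (int j) e + frag_cmul (int i) e = ?N"
    by (simp add: frag_cmul_distrib add_ac)
  have nat_single: "of_nat n * Poly_Mapping.single l y = Poly_Mapping.single l (of_nat n * y)" for n :: nat and l :: "'l dual_lattice" and y :: 'K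
    by (induction n) (simp_all add: distrib_right single_add)
  have \<delta>f: "\<delta> n (Poly_Mapping.single m ?f) = Poly_Mapping.single (m + frag_cmul (int n) e) (?f * lam m n)" for n
    using gm by (intro \<delta>_single) auto
  have "Poly_Mapping.single ?N (?f * lam m j * lam (m + frag_cmul (int j) e) i) = \<delta> i (\<delta> j (Poly_Mapping.single m ?f))"
    by (simp only: \<delta>f \<delta>_single[OF fg] frag)
  also have "\<dots> = of_nat ((i + j) choose i) * \<delta> (i + j) (Poly_Mapping.single m ?f)"
    using gm by (intro hd.\<delta>_comp) (simp add: single_in_A)
  also have "\<dots> = Poly_Mapping.single ?N (of_nat ((i + j) choose i) * (?f * lam m (i + j)))"
    by (simp only: \<delta>f nat_single)
  finally have "Poly_Mapping.lookup (Poly_Mapping.single ?N (?f * lam m j * lam (m + frag_cmul (int j) e) i)) ?N =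
    Poly_Mapping.lookup (Poly_Mapping.single ?N (of_nat ((i + j) choose i) * (?f * lam m (i + j)))) ?N" by (rule arg_cong)
  then have "?f * (lam m j * lam (m + frag_cmul (int j) e) i) = ?f * (of_nat ((i + j) choose i) * lam m (i + j))"
    by (simp only: lookup_single_eq mult_ac)
  then show ?thesis by (rule mult_left_cancel[OF conjunct2[OF gm], THEN iffD1])
qed

definition \<Lambda> :: "'l dual_lattice \<Rightarrow> 'K poly" where "\<Lambda> m = Abs_poly (lam m)"

lemma coeff_\<Lambda>: "m \<in> weights \<Longrightarrow> coeff (\<Lambda> m) i = lam m i"
  unfolding \<Lambda>_def using lam_finite by (simp add: Abs_poly_inverse)

lemma \<Lambda>_add: "m \<in> weights \<Longrightarrow> n \<in> weights \<Longrightarrow> \<Lambda> (m + n) = \<Lambda> m * \<Lambda> n"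
  by (rule poly_eqI) (simp add: coeff_\<Lambda> weights_add coeff_mult lam_mult)

lemma \<Lambda>_const: "m \<in> weights \<Longrightarrow> coeff (\<Lambda> m) 0 = 1"
  by (simp add: coeff_\<Lambda> lam_zero)

lemma \<Lambda>_nonzero: "m \<in> weights \<Longrightarrow> \<Lambda> m \<noteq> 0"
  using \<Lambda>_const[of m] by auto

lemma \<Lambda>_one_iff: "m \<in> weights \<Longrightarrow> degree (\<Lambda> m) = 0 \<longleftrightarrow> \<Lambda> m = 1"
  using \<Lambda>_const[of m] by (auto elim!: degree_eq_zeroE simp: one_pCons)

abbreviation L :: "'l dual_lattice \<Rightarrow> nat" where "L m \<equiv> degree (\<Lambda> m)"

lemma L_add: "m \<in> weights \<Longrightarrow> n \<in> weights \<Longrightarrow> L (m + n) = L m + L n"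
  by (simp add: \<Lambda>_add degree_mult_eq \<Lambda>_nonzero)

lemma weights_zero: "0 \<in> weights"
  using k_subset_piece[OF k_one] by (rule weightsI) simp

lemma \<Lambda>_zero: "\<Lambda> 0 = 1"
  using \<Lambda>_add[OF weights_zero weights_zero] \<Lambda>_nonzero[OF weights_zero] by simp

lemma weights_multiple: assumes "m \<in> weights"
  shows "frag_cmul (int d) m \<in> weights" "\<Lambda> (frag_cmul (int d) m) = \<Lambda> m ^ d"
proof (induction d)
  case (Suc d)
  have eq: "frag_cmul (int (Suc d)) m = m + frag_cmul (int d) m" by (simp add: frag_cmul_distrib)
  case 1 show ?case unfolding eq using Suc assms by (intro weights_add)
  case 2 show ?case unfolding eq using Suc assms by (simp add: \<Lambda>_add)
qed (simp_all add: weights_zero \<Lambda>_zero)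

text \<open>The top coefficient of \<open>\<Lambda>(m)\<close> carries \<open>A\<^sub>m\<close> to the kernel of \<open>\<delta>\<close>.\<close>

lemma \<Lambda>_translate: assumes m: "m \<in> weights"
  shows "m + frag_cmul (int (L m)) e \<in> weights" "\<Lambda> (m + frag_cmul (int (L m)) e) = 1"
proof -
  have top: "lam m (L m) \<noteq> 0" using \<Lambda>_nonzero[OF m] coeff_\<Lambda>[OF m, of "L m"] by (metis leading_coeff_0_iff)
  show w: "m + frag_cmul (int (L m)) e \<in> weights" by (rule lam_weight[OF m top])
  show "\<Lambda> (m + frag_cmul (int (L m)) e) = 1"
  proof (rule poly_eqI)
    fix i
    show "coeff (\<Lambda> (m + frag_cmul (int (L m)) e)) i = coeff 1 i"
    proof (cases "i = 0")
      case False
      then have "lam m (i + L m) = 0" using coeff_\<Lambda>[OF m, of "i + L m"] coeff_eq_0[of "\<Lambda> m" "i + L m"] by simp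
      then have "lam m (L m) * lam (m + frag_cmul (int (L m)) e) i = 0" using lam_comp[OF m top, of i] by simp
      then show ?thesis using top False by (simp add: coeff_\<Lambda>[OF w] coeff_1)
    qed (simp add: \<Lambda>_const[OF w])
  qed
qed

end

(*PART P10b*)
lemma coeff_one_plus_power:
  "coeff ([:1, \<phi>:] ^ d) i = of_nat (d choose i) * (\<phi> :: 'a::comm_ring_1) ^ i"
proof (induction d arbitrary: i)
  case 0
  then show ?case by (cases i) (simp_all add: coeff_1)
next
  case (Suc d)
  have "[:1, \<phi>:] ^ Suc d = [:1, \<phi>:] ^ d + smult \<phi> (pCons 0 ([:1, \<phi>:] ^ d))" by simp
  then show ?case by (cases i) (simp_all only: coeff_add coeff_smult coeff_pCons_0 coeff_pCons_Suc Suc, simp_all add: algebra_simps)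
qed

context vertical_lfihd
begin

text \<open>The weights generate \<open>M\<close>, so the degree \<open>L\<close> extends to a linear form on \<open>M\<close>, that is a vector of \<open>N\<close>.\<close>

definition base :: "'l dual_lattice \<Rightarrow> 'l dual_lattice" where
  "base m = (SOME s. s \<in> weights \<and> m + s \<in> weights)"

lemma base: "base m \<in> weights" "m + base m \<in> weights"
proof -
  obtain s f where f: "f \<noteq> 0" "f \<in> piece s" "f \<in> piece (m + s)" using common_piece[of m] .
  have "\<exists>s. s \<in> weights \<and> m + s \<in> weights" using weightsI[OF f(2,1)] weightsI[OF f(3,1)] by blast
  then have "base m \<in> weights \<and> m + base m \<in> weights" unfolding base_def by (rule someI_ex)
  then show "base m \<in> weights" "m + base m \<in> weights" by blast+
qed

definition lin :: "'l dual_lattice \<Rightarrow> int" where "lin m = int (L (m + base m)) - int (L (base m))"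

lemma lin_eq: assumes "s \<in> weights" "m + s \<in> weights" shows "lin m = int (L (m + s)) - int (L s)"
proof -
  have "L (m + s) + L (base m) = L ((m + s) + base m)" using assms base by (intro L_add[symmetric])
  also have "(m + s) + base m = (m + base m) + s" by (simp only: add_ac)
  also have "L \<dots> = L (m + base m) + L s" using assms base by (intro L_add)
  finally show ?thesis by (simp add: lin_def)
qed

lemma lin_weight: "m \<in> weights \<Longrightarrow> lin m = int (L m)"
  using lin_eq[of 0 m] weights_zero \<Lambda>_zero by simp

lemma lin_add: "lin (m + n) = lin m + lin n"
proof -
  have w: "base m + base n \<in> weights" "(m + n) + (base m + base n) \<in> weights"
  proof -
    have "(m + n) + (base m + base n) = (m + base m) + (n + base n)" by (simp only: add_ac)
    then show "(m + n) + (base m + base n) \<in> weights" using weights_add[OF base(2)[of m] base(2)[of n]] by (simp only:)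
  qed (intro weights_add base)
  have "(m + n) + (base m + base n) = (m + base m) + (n + base n)" by (simp only: add_ac)
  then have "L ((m + n) + (base m + base n)) = L (m + base m) + L (n + base n)"
    using L_add[OF base(2)[of m] base(2)[of n]] by (simp only:)
  moreover have "L (base m + base n) = L (base m) + L (base n)" by (intro L_add base)
  ultimately show ?thesis using lin_eq[OF w] by (simp add: lin_def)
qed

lemma lin_zero: "lin 0 = 0"
  using lin_add[of 0 0] by simp

lemma lin_cmul: "lin (frag_cmul c m) = c * lin m"
proof -
  have nat: "lin (frag_cmul (int n) m) = int n * lin m" for n
  proof (induction n)
    case (Suc n)
    have "frag_cmul (int (Suc n)) m = m + frag_cmul (int n) m" by (simp add: frag_cmul_distrib)
    then show ?case using Suc by (simp only: lin_add) (simp add: distrib_right)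
  qed (simp add: lin_zero)
  show ?thesis
  proof (cases "c \<ge> 0")
    case True
    then show ?thesis using nat[of "nat c"] by simp
  next
    case False
    have "frag_cmul c m + frag_cmul (int (nat (- c))) m = 0" using False by (simp flip: frag_cmul_distrib)
    then have "lin (frag_cmul c m) + lin (frag_cmul (int (nat (- c))) m) = 0" using lin_add lin_zero by metis
    then show ?thesis using nat[of "nat (- c)"] False by simp
  qed
qed

definition \<rho> :: "int ^ 'l::{finite,linorder}" where "\<rho> = (\<chi> i. lin (Poly_Mapping.single i 1))"

lemma lin_pairing: "lin m = pairing m \<rho>"
proof -
  have sum: "lin (\<Sum>i\<in>I. f i) = (\<Sum>i\<in>I. lin (f i))" for I and f :: "'l \<Rightarrow> 'l dual_lattice"
    by (induction I rule: infinite_finite_induct) (simp_all add: lin_zero lin_add)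
  have "m = (\<Sum>i\<in>UNIV. frag_cmul (Poly_Mapping.lookup m i) (Poly_Mapping.single i 1))"
    by (rule poly_mapping_eqI) (simp add: lookup_sum lookup_single when_def if_distrib[of "\<lambda>y. _ * y"] cong: if_cong)
  then have "lin m = lin (\<Sum>i\<in>UNIV. frag_cmul (Poly_Mapping.lookup m i) (Poly_Mapping.single i 1))" by (rule arg_cong)
  also have "\<dots> = pairing m \<rho>" by (simp add: sum lin_cmul pairing_def \<rho>_def)
  finally show ?thesis .
qed

lemma L_pairing: "m \<in> weights \<Longrightarrow> int (L m) = pairing m \<rho>"
  using lin_weight lin_pairing by simp

lemma interior_weight:
  assumes m: "m \<in> interior_dual" obtains N :: nat where "N > 0" "frag_cmul (int N) m \<in> weights"
proof -
  have "fin_div (\<lambda>z. 0)" by (simp add: fin_div_def)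
  then obtain R r0 where R: "R > 0" "\<And>r. r \<ge> r0 \<Longrightarrow>
    \<exists>f. f \<noteq> 0 \<and> (\<forall>z\<in>C. of_int (ord_at z f) + h (frag_cmul (int (r * R)) m) z \<ge> of_int 0)"
    using ample_pieces[OF m] by metis
  obtain f where f: "f \<noteq> 0" "\<forall>z\<in>C. of_int (ord_at z f) + h (frag_cmul (int (Suc r0 * R)) m) z \<ge> 0"
    using R(2)[of "Suc r0"] by auto
  have "m \<in> dual_cone_lattice \<sigma>" using m interior_dual_subset by blast
  then have "frag_cmul (int (Suc r0 * R)) m \<in> dual_cone_lattice \<sigma>" by (simp add: dual_cone_lattice_def pairing_cmul)
  then have "f \<in> piece (frag_cmul (int (Suc r0 * R)) m)" using piece_iff[OF f(1)] f(2) by blast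
  then have "frag_cmul (int (Suc r0 * R)) m \<in> weights" using f(1) by (rule weightsI)
  moreover have "Suc r0 * R > 0" using R(1) by simp
  ultimately show ?thesis using that by blast
qed

lemma \<rho>_in_cone: "lattice_vec \<rho> \<in> \<sigma>"
proof (rule bidual)
  fix m assume "m \<in> interior_dual"
  then obtain N :: nat where N: "N > 0" "frag_cmul (int N) m \<in> weights" by (rule interior_weight)
  have "int N * pairing m \<rho> \<ge> 0" using L_pairing[OF N(2)] by (simp add: pairing_cmul)
  then have "pairing m \<rho> \<ge> 0" using N(1) by (simp add: zero_le_mult_iff)
  then show "pairing m (lattice_vec \<rho>) \<ge> (0::real)" by (simp add: pairing_lattice_vec)
qed

context
  assumes nontrivial: "\<exists>m\<in>weights. \<Lambda> m \<noteq> 1"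
begin

lemma translate_relation:
  assumes m: "m \<in> weights"
  shows "\<Lambda> (base e) ^ L m = \<Lambda> m * \<Lambda> (e + base e) ^ L m"
proof -
  let ?d = "L m"
  have "m + frag_cmul (int ?d) (e + base e) = (m + frag_cmul (int ?d) e) + frag_cmul (int ?d) (base e)"
    by (simp add: frag_cmul_distrib2 add_ac)
  then have "\<Lambda> (m + frag_cmul (int ?d) (e + base e)) = \<Lambda> ((m + frag_cmul (int ?d) e) + frag_cmul (int ?d) (base e))" by (simp only:)
  then show ?thesis
    using \<Lambda>_add[OF m weights_multiple(1)[OF base(2)[of e]], of ?d] weights_multiple(2)[OF base(2)[of e], of ?d]
      \<Lambda>_add[OF \<Lambda>_translate(1)[OF m] weights_multiple(1)[OF base(1)[of e]], of ?d] weights_multiple(2)[OF base(1)[of e], of ?d]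
      \<Lambda>_translate(2)[OF m] by (simp only: mult_1_left)
qed

lemma pairing_e: "pairing e \<rho> = -1"
proof -
  obtain m where m: "m \<in> weights" "L m > 0" using nontrivial \<Lambda>_one_iff by blast
  have "degree (\<Lambda> (base e) ^ L m) = degree (\<Lambda> m * \<Lambda> (e + base e) ^ L m)" using translate_relation[OF m(1)] by simp
  then have "L m * L (base e) = L m + L m * L (e + base e)"
    using \<Lambda>_nonzero base m(1) by (simp add: degree_power_eq degree_mult_eq)
  then have "L m * L (base e) = L m * (1 + L (e + base e))" by (simp add: distrib_left)
  then have "L (base e) = 1 + L (e + base e)" using m(2) by (simp only: mult_cancel1) simp
  then have "lin e = -1" by (simp add: lin_def)
  then show ?thesis by (simp add: lin_pairing)
qed

lemma \<Lambda>_power: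
  obtains \<phi> where "\<phi> \<noteq> 0" "\<And>m. m \<in> weights \<Longrightarrow> \<Lambda> m = [:1, \<phi>:] ^ L m"
proof -
  obtain m where m: "m \<in> weights" "L m > 0" using nontrivial \<Lambda>_one_iff by blast
  have "\<Lambda> (e + base e) ^ L m dvd \<Lambda> (base e) ^ L m" using translate_relation[OF m(1)] by simp
  then have "\<Lambda> (e + base e) dvd \<Lambda> (base e)" by (rule poly_power_dvd_cancel[OF _ m(2)])
  then obtain P where P: "\<Lambda> (base e) = \<Lambda> (e + base e) * P" by (elim dvdE)
  have P0: "P \<noteq> 0" using P \<Lambda>_nonzero[OF base(1)[of e]] by auto
  have "L (base e) = L (e + base e) + degree P" using P degree_mult_eq[OF \<Lambda>_nonzero[OF base(2)[of e]] P0] by simp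
  moreover have "int (L (e + base e)) - int (L (base e)) = -1" using pairing_e lin_pairing[of e] by (simp add: lin_def)
  ultimately have deg: "degree P = 1" by linarith
  have "coeff (\<Lambda> (base e)) 0 = coeff (\<Lambda> (e + base e)) 0 * coeff P 0" using P by (simp add: coeff_mult)
  then have c0: "coeff P 0 = 1" using \<Lambda>_const base by simp
  have Peq: "P = [:1, coeff P 1:]"
  proof (rule poly_eqI)
    fix i :: nat
    consider "i = 0" | "i = 1" | "i \<ge> 2" by linarith
    then show "coeff P i = coeff [:1, coeff P 1:] i"
    proof cases
      case 3
      then have "coeff P i = 0" using deg by (intro coeff_eq_0) simp
      moreover obtain j where "i = Suc (Suc j)" using 3 by (metis add_2_eq_Suc le_Suc_ex)
      ultimately show ?thesis by simp
    qed (use c0 in simp_all)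
  qed
  have "coeff P 1 \<noteq> 0" using deg by (metis leading_coeff_0_iff P0)
  moreover have "\<Lambda> n = [:1, coeff P 1:] ^ L n" if n: "n \<in> weights" for n
  proof -
    have "\<Lambda> n * \<Lambda> (e + base e) ^ L n = P ^ L n * \<Lambda> (e + base e) ^ L n"
      using translate_relation[OF n] unfolding P power_mult_distrib by (metis mult.commute)
    then have "\<Lambda> n = P ^ L n" using \<Lambda>_nonzero[OF base(2)[of e]] by simp
    then show ?thesis using Peq by metis
  qed
  ultimately show ?thesis using that by blast
qed

lemma root: "demazure_root \<sigma> e \<rho>"
proof (rule demazure_rootI[OF \<rho>_in_cone pairing_e])
  fix m assume "m \<in> interior_dual"
  then obtain N :: nat where N: "N > 0" "frag_cmul (int N) m \<in> weights" by (rule interior_weight)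
  have "frag_cmul (int N) m + frag_cmul (int (L (frag_cmul (int N) m))) e \<in> dual_cone_lattice \<sigma>"
    by (rule weights_dual[OF \<Lambda>_translate(1)[OF N(2)]])
  then show "\<exists>r>0. frag_cmul (int r) m + frag_cmul (int r * pairing m \<rho>) e \<in> dual_cone_lattice \<sigma>"
    using N L_pairing[OF N(2)] by (intro exI[of _ N]) (simp add: pairing_cmul)
qed

lemma \<phi>_section:
  assumes \<phi>: "\<phi> \<noteq> 0" "\<And>m. m \<in> weights \<Longrightarrow> \<Lambda> m = [:1, \<phi>:] ^ L m"
  shows "\<phi> \<in> H0 C (h e)"
proof -
  have "of_int (ord_at z \<phi>) + h e z \<ge> 0" if z: "z \<in> C" for z
  proof (rule ccontr)
    assume neg: "\<not> of_int (ord_at z \<phi>) + h e z \<ge> 0"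
    define x where "x = - (of_int (ord_at z \<phi>) + h e z)"
    have x: "x > 0" using neg by (simp add: x_def)
    obtain v where v: "v \<in> vertices (\<DD> z)" "h e z = pairing e v" using h_attained[OF z] by blast
    obtain m where m: "m \<in> interior_dual" "\<And>u. u \<in> vertices (\<DD> z) \<Longrightarrow> pairing m v \<le> (pairing m u :: real)"
      using vertex_exposed[OF Pol_at[OF z] v(1)] by blast
    have hm: "h m z = pairing m v"
    proof -
      obtain u where "u \<in> vertices (\<DD> z)" "h m z = pairing m u" using h_attained[OF z] by blast
      then show ?thesis using m(2)[of u] h_le[OF z v(1), of m] by linarith
    qed
    obtain R r0 c where R: "R > 0" "\<And>r. r \<ge> r0 \<Longrightarrow> \<exists>f. f \<noteq> 0 \<and> f \<in> piece (frag_cmul (int (r * R)) m) \<and>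
        of_int (ord_at z f) + h (frag_cmul (int (r * R)) m) z \<le> of_int c" using bounded_pieces[OF m(1) z] by metis
    have "\<rho> \<noteq> 0"
    proof
      assume "\<rho> = 0"
      then show False using pairing_e by (simp add: pairing_def)
    qed
    then have "pairing m (lattice_vec \<rho>) > (0::real)" using m(1) \<rho>_in_cone by (simp add: interior_dual_def)
    then have q: "pairing m \<rho> \<ge> 1" by (simp add: pairing_lattice_vec)
    define r where "r = max r0 (nat \<lceil>\<bar>of_int c\<bar> / x\<rceil> + 1)"
    define n where "n = frag_cmul (int (r * R)) m"
    obtain f where f: "f \<noteq> 0" "f \<in> piece n" "of_int (ord_at z f) + h n z \<le> of_int c"
      using R(2)[of r] unfolding n_def r_def by auto
    have n: "n \<in> weights" using weightsI f by blast
    have Ln: "int (L n) = int (r * R) * pairing m \<rho>" using L_pairing[OF n] by (simp add: n_def pairing_cmul)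
    have "int r * 1 \<le> int r * (int R * pairing m \<rho>)"
    proof (intro mult_left_mono)
      have "int R * pairing m \<rho> \<ge> 1 * 1" using R(1) q by (intro mult_mono) auto
      then show "1 \<le> int R * pairing m \<rho>" by simp
    qed simp
    then have Lr: "L n \<ge> r" using Ln by (simp add: mult.assoc)
    have "lam n (L n) = \<phi> ^ L n" using coeff_\<Lambda>[OF n, of "L n"] \<phi>(2)[OF n] coeff_one_plus_power[of \<phi> "L n" "L n"] by simp
    then have "f * \<phi> ^ L n \<in> piece (n + frag_cmul (int (L n)) e)" using \<delta>_single_in[OF f(2,1), of "L n"] by simp
    moreover have "f * \<phi> ^ L n \<noteq> 0" using f(1) \<phi>(1) by simp
    ultimately have "of_int (ord_at z (f * \<phi> ^ L n)) + h (n + frag_cmul (int (L n)) e) z \<ge> 0"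
      using piece_iff z by blast
    moreover have "ord_at z (f * \<phi> ^ L n) = ord_at z f + int (L n) * ord_at z \<phi>"
      using discrete_placeD(2)[OF place[OF z], of f "\<phi> ^ L n"] ord_simps(6)[OF place[OF z] \<phi>(1)] f(1) \<phi>(1) by simp
    moreover have "h (n + frag_cmul (int (L n)) e) z \<le> h n z + real (L n) * h e z"
      using h_le[OF z v(1), of "n + frag_cmul (int (L n)) e"] v(2) hm h_scale[OF z, of "r * R" m]
      by (simp add: pairing_add pairing_cmul n_def)
    ultimately have "of_int c - real (L n) * x \<ge> 0" using f(3) by (simp add: x_def algebra_simps)
    moreover have "real (L n) * x \<ge> real r * x" using Lr x by simp
    moreover have "real r > \<bar>of_int c\<bar> / x" unfolding r_def by linarith
    then have "real r * x > \<bar>of_int c\<bar>" using x by (simp add: divide_less_eq)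
    ultimately show False by linarith
  qed
  then show ?thesis using \<phi>(1) by (simp add: H0_def)
qed

end

lemma \<delta>_eqI:
  assumes "e' = e \<or> \<phi> = 0"
    and lam: "\<And>m i. m \<in> weights \<Longrightarrow> lam m i = \<phi> ^ i * of_nat (nat (pairing m \<eta>) choose i)" and a: "a \<in> A"
  shows "\<delta> i a = root_section_hd e' \<eta> \<phi> i a"
proof -
  have "\<delta> i 0 = \<delta> i 0 + \<delta> i 0" using hd.\<delta>_add[OF A_zero A_zero, of i] by (simp only: add_0)
  then have zero: "\<delta> i 0 = 0" by (metis add_cancel_right_right)
  have single: "\<delta> i (Poly_Mapping.single m f) = root_section_hd e' \<eta> \<phi> i (Poly_Mapping.single m f)" if f: "f \<in> piece m" for m f
  proof (cases "f = 0")
    case True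
    then show ?thesis using zero by (simp add: root_section_hd_superset[of "{}"])
  next
    case False
    have lam_m: "lam m i = \<phi> ^ i * of_nat (nat (pairing m \<eta>) choose i)" by (rule lam[OF weightsI[OF f False]])
    have "e' = e \<or> lam m i = 0 \<or> i = 0" using assms(1) lam_m by (cases i) auto
    then have eq: "Poly_Mapping.single (m + frag_cmul (int i) e) (f * lam m i) = Poly_Mapping.single (m + frag_cmul (int i) e') (f * lam m i)"
      by (elim disjE) simp_all
    have "f * lam m i = \<phi> ^ i * (of_nat (nat (pairing m \<eta>) choose i) * f)" unfolding lam_m by (simp only: mult_ac)
    then show ?thesis using eq by (simp only: \<delta>_single[OF f False] root_section_hd_single)
  qed
  have sum: "\<delta> i (\<Sum>m\<in>I. Poly_Mapping.single m (Poly_Mapping.lookup a m)) = (\<Sum>m\<in>I. \<delta> i (Poly_Mapping.single m (Poly_Mapping.lookup a m)))" for I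
  proof (induction I rule: infinite_finite_induct)
    case (insert m I)
    have "Poly_Mapping.single m (Poly_Mapping.lookup a m) \<in> A" for m using A_lookup[OF a] by (simp add: single_in_A)
    then show ?case using insert hd.\<delta>_add[of "Poly_Mapping.single m (Poly_Mapping.lookup a m)"
      "\<Sum>m\<in>I. Poly_Mapping.single m (Poly_Mapping.lookup a m)" i] A_sum[of I] by simp
  qed (simp_all add: zero)
  have "\<delta> i (\<Sum>m\<in>Poly_Mapping.keys a. Poly_Mapping.single m (Poly_Mapping.lookup a m)) =
    root_section_hd e' \<eta> \<phi> i (\<Sum>m\<in>Poly_Mapping.keys a. Poly_Mapping.single m (Poly_Mapping.lookup a m))"
    unfolding sum root_section_hd_sum using single A_lookup[OF a] by (intro sum.cong refl) blast
  then show ?thesis by (simp only: sum_of_monomials[symmetric])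
qed

theorem vertical_lfihd_root:
  assumes "\<sigma> \<noteq> {0}"
  shows "\<exists>e \<rho> \<phi>. demazure_root \<sigma> e \<rho> \<and> \<phi> \<in> H0 C (h e) \<and> (\<forall>i. \<forall>a\<in>A. \<delta> i a = root_section_hd e \<rho> \<phi> i a)"
proof (cases "\<exists>m\<in>weights. \<Lambda> m \<noteq> 1")
  case True
  obtain \<phi> where \<phi>: "\<phi> \<noteq> 0" "\<And>m. m \<in> weights \<Longrightarrow> \<Lambda> m = [:1, \<phi>:] ^ L m" using \<Lambda>_power[OF True] by blast
  have "lam m i = \<phi> ^ i * of_nat (nat (pairing m \<rho>) choose i)" if m: "m \<in> weights" for m i
  proof -
    have "lam m i = coeff ([:1, \<phi>:] ^ L m) i" using coeff_\<Lambda>[OF m] \<phi>(2)[OF m] by simp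
    moreover have "L m = nat (pairing m \<rho>)" using L_pairing[OF m] by linarith
    ultimately show ?thesis unfolding coeff_one_plus_power by (simp only: mult.commute)
  qed
  then have "\<forall>i. \<forall>a\<in>A. \<delta> i a = root_section_hd e \<rho> \<phi> i a" using \<delta>_eqI by blast
  then show ?thesis using root[OF True] \<phi>_section[OF True \<phi>] by blast
next
  case False
  obtain e' \<eta> where root: "demazure_root \<sigma> e' \<eta>" using demazure_root_exists[OF assms] .
  have "lam m i = 0 ^ i * of_nat (nat (pairing m \<eta>) choose i)" if m: "m \<in> weights" for m i
  proof -
    have "lam m i = coeff 1 i" using coeff_\<Lambda>[OF m] False m by auto
    then show ?thesis by (cases i) (simp_all add: coeff_1)
  qed
  then have "\<forall>i. \<forall>a\<in>A. \<delta> i a = root_section_hd e' \<eta> 0 i a" using \<delta>_eqI by blast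
  moreover have "0 \<in> H0 C (h e')" by (simp add: H0_def)
  ultimately show ?thesis using root by blast
qed

end

theorem theorem4p4:
  fixes k :: "'K::field set"
    and C :: "'K set set"
    and \<sigma> :: "(real ^ 'n::{finite,linorder}) set"
    and \<DD> :: "'K set \<Rightarrow> (real ^ 'n::{finite,linorder}) set"
    and A :: "('n::{finite,linorder}, 'K) group_algebra set"
  assumes "regular_curve k C"
    and "alg_closed_in_type k"
    and "strongly_convex_rational_cone \<sigma>"
    and "\<sigma> \<noteq> {0}"
    and "polyhedral_divisor C \<sigma> \<DD>"
    and "proper_pdiv k C \<sigma> \<DD>"
    and "A = pdiv_algebra C \<sigma> \<DD>"
  shows "(\<forall>e \<rho> \<phi>. demazure_root \<sigma> e \<rho> \<and> \<phi> \<in> H0 C (pdiv_eval \<DD> e) \<longrightarrow>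
            lfihd (const ` k) A (root_section_hd e \<rho> \<phi>) \<and>
            homogeneous_hd (pdiv_piece C \<sigma> \<DD>) (root_section_hd e \<rho> \<phi>) \<and>
            vertical_hd k A (root_section_hd e \<rho> \<phi>)) \<and>
         (\<forall>\<delta>. lfihd (const ` k) A \<delta> \<and> homogeneous_hd (pdiv_piece C \<sigma> \<DD>) \<delta> \<and> vertical_hd k A \<delta> \<longrightarrow>
            (\<exists>e \<rho> \<phi>. demazure_root \<sigma> e \<rho> \<and> \<phi> \<in> H0 C (pdiv_eval \<DD> e) \<and>
               (\<forall>i. \<forall>a\<in>A. \<delta> i a = root_section_hd e \<rho> \<phi> i a)))"
proof -
  obtain S where S: "finite S" "\<sigma> = convex_cone hull (lattice_vec ` S)" "\<And>v. v \<in> \<sigma> \<Longrightarrow> - v \<in> \<sigma> \<Longrightarrow> v = 0"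
    using assms(3) unfolding strongly_convex_rational_cone_def by blast
  interpret pl: places k C by (rule regular_curve_places[OF assms(1,2)])
  interpret poly_divisor k C \<sigma> S \<DD> by unfold_locales (use S assms in auto)
  show ?thesis
    unfolding assms(7)
  proof (intro conjI allI impI; (elim conjE)?)
    fix e \<rho> \<phi> assume e: "demazure_root \<sigma> e \<rho>" "\<phi> \<in> H0 C (pdiv_eval \<DD> e)"
    show "lfihd (const ` k) (pdiv_algebra C \<sigma> \<DD>) (root_section_hd e \<rho> \<phi>)" by (rule root_section_hd_lfihd[OF e])
    show "homogeneous_hd (pdiv_piece C \<sigma> \<DD>) (root_section_hd e \<rho> \<phi>)" by (rule root_section_hd_homogeneous[OF e])
    show "vertical_hd k (pdiv_algebra C \<sigma> \<DD>) (root_section_hd e \<rho> \<phi>)" by (rule root_section_hd_vertical[OF e])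
  next
    fix \<delta> assume \<delta>: "lfihd (const ` k) (pdiv_algebra C \<sigma> \<DD>) \<delta>" "homogeneous_hd (pdiv_piece C \<sigma> \<DD>) \<delta>"
      "vertical_hd k (pdiv_algebra C \<sigma> \<DD>) \<delta>"
    obtain e where e: "\<forall>i m. \<delta> i ` (Poly_Mapping.single m ` pdiv_piece C \<sigma> \<DD> m) \<subseteq>
       Poly_Mapping.single (m + frag_cmul (int i) e) ` pdiv_piece C \<sigma> \<DD> (m + frag_cmul (int i) e)"
      using \<delta>(2) unfolding homogeneous_hd_def by (elim exE)
    have "vertical_lfihd k C \<sigma> S \<DD> \<delta> e" by unfold_locales (use \<delta>(1,3) e in blast)+
    then show "\<exists>e \<rho> \<phi>. demazure_root \<sigma> e \<rho> \<and> \<phi> \<in> H0 C (pdiv_eval \<DD> e) \<and>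
               (\<forall>i. \<forall>a\<in>pdiv_algebra C \<sigma> \<DD>. \<delta> i a = root_section_hd e \<rho> \<phi> i a)"
      using assms(4) by (rule vertical_lfihd.vertical_lfihd_root)
  qed
qed

end
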